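(* (a) For given integer parameters $c$ and $E$, there are constants $c_1=c_1(c,E)$, $r=r(c,E)$, and $t=t(c,E)$, such that the following holds. Let $f\in\mathbb{C}[x,y,z]$ be a complex irreducible polynomial of degree $D\gg E$, and let $\mathcal{C}_0\subset\mathcal{C}_{3,E}$ be a constructible set of complexity at most $c$. If there exist at least $c_1D^2$ curves of $\mathcal{C}_0$, such that each of them is contained in $Z(f)$ and contains at least $c_1D$ points on $Z(f)$ that are $(t,\mathcal{C}_0,r)$-flecnodes, then $Z(f)$ is infinitely ruled by curves from $\mathcal{C}_0$. (b) In particular, if $Z(f)$ is not infinitely ruled by curves from $\mathcal{C}_0$ then, except for at most $c_1D^2$ exceptional curves, every curve in $\mathcal{C}_0$ that is fully contained in $Z(f)$ is incident to at most $c_1D$ $t$-rich points, namely points that are incident to at least $t$ curves in $\mathcal{C}_0$ that are also fully contained in $Z(f)$.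
   Context: Everything is over $\mathbb{C}$. $Z(f)$ is the zero set of $f$ in $\mathbb{C}^3$. The condition $D\gg E$ means that $D$ is larger than a sufficiently large constant depending on $c$ and $E$ ($E$ and $r$ are treated as constants compared with $D$). $\mathcal{C}_{3,E}$ is the family of all irreducible algebraic curves of degree at most $E$ in complex 3-space; it is (parametrized by) a constructible set of constant complexity depending only on $E$ (Guth and Zahl), and subfamilies of curves are identified with the sets of points representing them in the parameter space. Constructible sets: for $z\in\mathbb{C}$ put $v(0)=0$ and $v(z)=1$ for $z\neq 0$. A set $Y\subseteq\mathbb{C}^d$ ($d$ a constant) is constructible if there are an integer $J_Y$, polynomials $f_j:\mathbb{C}^d\to\mathbb{C}$ for $j=1,\dots,J_Y$, and a subset $B_Y\subset\{0,1\}^{J_Y}$ such that $x\in Y$ if and only if $(v(f_1(x)),\dots,v(f_{J_Y}(x)))\in B_Y$. The complexity of $Y$ is the minimum of $\deg f_1+\cdots+\deg f_{J_Y}$ over all such representations. A point $p\in Z(f)$ is a $(t,\mathcal{C}_0,r)$-flecnode if there are at least $t$ curves $\gamma_1,\dots,\gamma_t\in\mathcal{C}_0$ such that, for each $i=1,\dots,t$, (i) $\gamma_i$ is incident to $p$, (ii) $p$ is a non-singular point of $\gamma_i$, and (iii) $\gamma_i$ osculates to $Z(f)$ to order $r$ at $p$. Osculation to order $r$ means that the Taylor expansion of $f$ at $p$ along $\gamma_i$ vanishes through order $r$: if $\varphi$ is a local analytic parametrization of $\gamma_i$ near $p$ with $\varphi(0)=p$ and $\varphi'(0)\neq 0$,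 then the derivatives of $f\circ\varphi$ of orders $0,1,\dots,r$ vanish at $0$. A surface $V$ is infinitely ruled by a family $\Gamma$ of curves if every generic point $p\in V$ (every point outside some proper Zariski-closed subset of $V$) is incident to infinitely many curves of $\Gamma$ that are fully contained in $V$. *)

theory Defs
  imports
    "HOL-Complex_Analysis.Complex_Analysis"
    "HOL-Computational_Algebra.Computational_Algebra"
    "HOL-Library.Poly_Mapping"
    "HOL-Library.Numeral_Type"
begin

subsection \<open>Polynomials and Zariski-closed sets\<close>

text \<open>
  Polynomials over the complex numbers in variables indexed by \<open>'i\<close>, as finitely supported maps
  from exponent vectors to coefficients; the ring structure is that of \<open>Poly_Mapping\<close>.  Points
  are functions \<open>'i \<Rightarrow> complex\<close>, so complex 3-space is the type \<open>3 \<Rightarrow> complex\<close>.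
\<close>

type_synonym 'i monom = "'i \<Rightarrow>\<^sub>0 nat"
type_synonym 'i cpoly = "'i monom \<Rightarrow>\<^sub>0 complex"
type_synonym space3 = "3 \<Rightarrow> complex"

definition monom_degree :: "'i monom \<Rightarrow> nat" where
  "monom_degree m = (\<Sum>i\<in>Poly_Mapping.keys m. Poly_Mapping.lookup m i)"

text \<open>The zero polynomial gets degree 0.\<close>

definition total_degree :: "'i cpoly \<Rightarrow> nat" where
  "total_degree f = Max (insert 0 (monom_degree ` Poly_Mapping.keys f))"

definition poly_vars :: "'i cpoly \<Rightarrow> 'i set" where
  "poly_vars f = (\<Union>m\<in>Poly_Mapping.keys f. Poly_Mapping.keys m)"

definition poly_eval :: "'i cpoly \<Rightarrow> ('i \<Rightarrow> complex) \<Rightarrow> complex" where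
  "poly_eval f x = (\<Sum>m\<in>Poly_Mapping.keys f.
     Poly_Mapping.lookup f m * (\<Prod>i\<in>Poly_Mapping.keys m. x i ^ Poly_Mapping.lookup m i))"

definition zero_set :: "'i cpoly \<Rightarrow> ('i \<Rightarrow> complex) set" where
  "zero_set f = {x. poly_eval f x = 0}"

definition vanishing_ideal :: "('i \<Rightarrow> complex) set \<Rightarrow> 'i cpoly set" where
  "vanishing_ideal X = {g. \<forall>x\<in>X. poly_eval g x = 0}"

definition zariski_closed :: "('i \<Rightarrow> complex) set \<Rightarrow> bool" where
  "zariski_closed X \<longleftrightarrow> (\<exists>G. X = (\<Inter>g\<in>G. zero_set g))"

definition zariski_closure :: "('i \<Rightarrow> complex) set \<Rightarrow> ('i \<Rightarrow> complex) set" where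
  "zariski_closure X = (\<Inter>g\<in>vanishing_ideal X. zero_set g)"

definition irreducible_variety :: "('i \<Rightarrow> complex) set \<Rightarrow> bool" where
  "irreducible_variety X \<longleftrightarrow> zariski_closed X \<and> X \<noteq> {} \<and>
     (\<forall>A B. zariski_closed A \<and> zariski_closed B \<and> X = A \<union> B \<longrightarrow> X = A \<or> X = B)"

definition irreducible_chain :: "('i \<Rightarrow> complex) set \<Rightarrow> nat \<Rightarrow> bool" where
  "irreducible_chain X n \<longleftrightarrow> (\<exists>Z :: nat \<Rightarrow> ('i \<Rightarrow> complex) set.
     (\<forall>i\<le>n. irreducible_variety (Z i) \<and> Z i \<subseteq> X) \<and> (\<forall>i<n. Z i \<subset> Z (Suc i)))"

definition has_dimension :: "('i \<Rightarrow> complex) set \<Rightarrow> nat \<Rightarrow> bool" where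
  "has_dimension X n \<longleftrightarrow> irreducible_chain X n \<and> (\<forall>m. irreducible_chain X m \<longrightarrow> m \<le> n)"


subsection \<open>Constructible sets\<close>

text \<open>
  The ambient affine space is \<open>\<complex>\<^sup>I\<close> for a finite set \<open>I\<close> of coordinates, realised as the functions
  vanishing outside \<open>I\<close>; only polynomials in the variables from \<open>I\<close> are admitted.  The map
  \<open>\<lambda>z. of_bool (z \<noteq> 0)\<close> is the indicator \<open>v\<close> with \<open>v(0) = 0\<close> and \<open>v(z) = 1\<close> for \<open>z \<noteq> 0\<close>.
\<close>

definition constructible_rep ::
    "'i set \<Rightarrow> ('i \<Rightarrow> complex) set \<Rightarrow> 'i cpoly list \<Rightarrow> nat list set \<Rightarrow> bool" where
  "constructible_rep I Y fs B \<longleftrightarrow>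
     (\<forall>f\<in>set fs. poly_vars f \<subseteq> I) \<and>
     B \<subseteq> {bs. length bs = length fs \<and> set bs \<subseteq> {0, 1}} \<and>
     Y = {x. (\<forall>i. i \<notin> I \<longrightarrow> x i = 0) \<and> map (\<lambda>f. of_bool (poly_eval f x \<noteq> 0)) fs \<in> B}"

definition constructible :: "'i set \<Rightarrow> ('i \<Rightarrow> complex) set \<Rightarrow> bool" where
  "constructible I Y \<longleftrightarrow> (\<exists>fs B. constructible_rep I Y fs B)"

definition constructible_complexity :: "'i set \<Rightarrow> ('i \<Rightarrow> complex) set \<Rightarrow> nat" where
  "constructible_complexity I Y =
     (LEAST n. \<exists>fs B. constructible_rep I Y fs B \<and> n = (\<Sum>f\<leftarrow>fs. total_degree f))"


subsection \<open>The family of irreducible space curves of bounded degree\<close>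

text \<open>
  The plane with homogeneous coefficients \<open>u\<close>: index \<open>None\<close> carries the constant term.
\<close>

definition plane :: "(3 option \<Rightarrow> complex) \<Rightarrow> space3 set" where
  "plane u = {p. u None + (\<Sum>i\<in>UNIV. u (Some i) * p i) = 0}"

definition irreducible_curve :: "space3 set \<Rightarrow> bool" where
  "irreducible_curve \<gamma> \<longleftrightarrow> irreducible_variety \<gamma> \<and> has_dimension \<gamma> 1"

text \<open>
  The degree is the number of intersection points with a generic plane; generic means that the
  coefficient vector lies outside the zero set of some nonzero polynomial.
\<close>

definition has_curve_degree :: "space3 set \<Rightarrow> nat \<Rightarrow> bool" where
  "has_curve_degree \<gamma> d \<longleftrightarrow> (\<exists>q :: 3 option cpoly. q \<noteq> 0 \<and>
     (\<forall>u. poly_eval q u \<noteq> 0 \<longrightarrow> finite (\<gamma> \<inter> plane u) \<and> card (\<gamma> \<inter> plane u) = d))"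

definition curves3 :: "nat \<Rightarrow> space3 set set" where
  "curves3 E = {\<gamma>. irreducible_curve \<gamma> \<and> (\<exists>d\<le>E. has_curve_degree \<gamma> d)}"

text \<open>
  The parameter space is that of Chow coordinates.  The Chow form of an irreducible curve of
  degree \<open>d\<close> is the irreducible polynomial, unique up to a scalar and of degree \<open>d\<close> in each of the
  coefficient vectors \<open>u\<close>, \<open>v\<close> of two planes, that cuts out the closure of the set of pairs of
  planes meeting in a point of the curve.  (Since the affine curve is dense in its projective
  closure, taking common points in affine space gives the same closure.)
\<close>

definition chow_form :: "space3 set \<Rightarrow> (3 option + 3 option) cpoly \<Rightarrow> bool" where
  "chow_form \<gamma> F \<longleftrightarrow> irreducible F \<and>
     zero_set F = zariski_closure {case_sum u v | u v. \<gamma> \<inter> plane u \<inter> plane v \<noteq> {}}"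

text \<open>
  Curves of degree at most \<open>E\<close> have Chow forms of total degree at most \<open>2 * E\<close>, so their
  coefficient vectors lie in the affine space indexed by the monomials of degree at most \<open>2 * E\<close>.
  As Chow coordinates are only determined up to a nonzero scalar, a family of curves is
  represented by all coefficient vectors of the Chow forms of its members, i.e. by the (punctured)
  affine cone over the corresponding set of points of projective space.
\<close>

definition chow_index :: "nat \<Rightarrow> (3 option + 3 option) monom set" where
  "chow_index E = {m. monom_degree m \<le> 2 * E}"

definition chow_points ::
    "space3 set set \<Rightarrow> ((3 option + 3 option) monom \<Rightarrow> complex) set" where
  "chow_points C = {Poly_Mapping.lookup F | F. \<exists>\<gamma>\<in>C. chow_form \<gamma> F}"

definition constructible_family :: "nat \<Rightarrow> nat \<Rightarrow> space3 set set \<Rightarrow> bool" where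
  "constructible_family E c C \<longleftrightarrow> C \<subseteq> curves3 E \<and>
     constructible (chow_index E) (chow_points C) \<and>
     constructible_complexity (chow_index E) (chow_points C) \<le> c"


subsection \<open>Flecnodes, rich points and infinitely ruled surfaces\<close>

definition at_least :: "real \<Rightarrow> 'a set \<Rightarrow> bool" where
  "at_least x A \<longleftrightarrow> infinite A \<or> x \<le> real (card A)"

definition at_most :: "real \<Rightarrow> 'a set \<Rightarrow> bool" where
  "at_most x A \<longleftrightarrow> finite A \<and> real (card A) \<le> x"

definition tangent_space :: "space3 set \<Rightarrow> space3 \<Rightarrow> space3 set" where
  "tangent_space \<gamma> p =
     {w. \<forall>g\<in>vanishing_ideal \<gamma>. deriv (\<lambda>s. poly_eval g (\<lambda>i. p i + s * w i)) 0 = 0}"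

text \<open>A point of a curve is non-singular iff its Zariski tangent space there is a line.\<close>

definition nonsingular_point :: "space3 set \<Rightarrow> space3 \<Rightarrow> bool" where
  "nonsingular_point \<gamma> p \<longleftrightarrow>
     p \<in> \<gamma> \<and> (\<exists>w. w \<noteq> (\<lambda>i. 0) \<and> tangent_space \<gamma> p = range (\<lambda>a i. a * w i))"

text \<open>
  The image of a parametrization is required to be a neighbourhood of \<open>p\<close> in the curve, in the
  Euclidean topology of complex 3-space.
\<close>

definition local_parametrization ::
    "space3 set \<Rightarrow> space3 \<Rightarrow> (complex \<Rightarrow> space3) \<Rightarrow> bool" where
  "local_parametrization \<gamma> p \<phi> \<longleftrightarrow> (\<exists>e>0.
     (\<forall>i. (\<lambda>s. \<phi> s i) holomorphic_on ball 0 e) \<and>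
     \<phi> 0 = p \<and> (\<exists>i. deriv (\<lambda>s. \<phi> s i) 0 \<noteq> 0) \<and>
     openin (top_of_set \<gamma>) (\<phi> ` ball 0 e))"

text \<open>
  At a non-singular point local parametrizations exist and differ by a biholomorphic change of
  the parameter, so the choice of \<open>\<phi>\<close> is immaterial.
\<close>

definition osculates :: "space3 set \<Rightarrow> 3 cpoly \<Rightarrow> nat \<Rightarrow> space3 \<Rightarrow> bool" where
  "osculates \<gamma> f r p \<longleftrightarrow> (\<exists>\<phi>. local_parametrization \<gamma> p \<phi> \<and>
     (\<forall>k\<le>r. (deriv ^^ k) (\<lambda>s. poly_eval f (\<phi> s)) 0 = 0))"

definition flecnode :: "3 cpoly \<Rightarrow> nat \<Rightarrow> space3 set set \<Rightarrow> nat \<Rightarrow> space3 \<Rightarrow> bool" where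
  "flecnode f t C r p \<longleftrightarrow> p \<in> zero_set f \<and>
     at_least (real t) {\<gamma>\<in>C. p \<in> \<gamma> \<and> nonsingular_point \<gamma> p \<and> osculates \<gamma> f r p}"

definition rich_point :: "3 cpoly \<Rightarrow> nat \<Rightarrow> space3 set set \<Rightarrow> space3 \<Rightarrow> bool" where
  "rich_point f t C p \<longleftrightarrow> at_least (real t) {\<gamma>\<in>C. p \<in> \<gamma> \<and> \<gamma> \<subseteq> zero_set f}"

definition infinitely_ruled :: "space3 set \<Rightarrow> space3 set set \<Rightarrow> bool" where
  "infinitely_ruled V C \<longleftrightarrow> (\<exists>W. zariski_closed W \<and> W \<subset> V \<and>
     (\<forall>p\<in>V - W. infinite {\<gamma>\<in>C. p \<in> \<gamma> \<and> \<gamma> \<subseteq> V}))"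

end

theory Submission
  imports Defs "HOL-Computational_Algebra.Field_as_Ring"
begin

text \<open>
  Let \<open>f\<close> be irreducible of degree \<open>D\<close>.  A curve through a point \<open>p\<close> is encoded by its Chow form \<open>F\<close>;
  the cylinders over two plane projections of the curve, whose equations are read off \<open>F\<close>, have
  gradients whose cross product is a vector field \<open>X\<close> tangent to the curve, and osculation of order
  \<open>r\<close> at \<open>p\<close> says that \<open>f, X f, \<dots>, X\<^sup>r f\<close> vanish at \<open>p\<close>.  Hence the set of Chow forms in the family
  osculating at \<open>p\<close> is definable from \<open>p\<close> and the derivatives of \<open>f\<close> at \<open>p\<close>.

  Quantifier elimination, applied to the ratio of two Chow coordinates, yields a polynomial \<open>u\<close> of
  degree \<open>O(D)\<close>, not divisible by \<open>f\<close>, such that one of two things happens uniformly at the points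
  of \<open>Z(f)\<close> outside \<open>Z(u)\<close>.  Either infinitely many curves osculate at each of them.  By an effective
  ascending chain condition for the ideals generated by the \<open>X\<^sup>k f\<close> with the Chow form as parameter, a
  bounded order of contact generically implies infinite order, so these curves are contained in
  \<open>Z(f)\<close>, which is infinitely ruled.  Or the number of osculating curves is bounded by a constant.
  Then flecnodes of higher multiplicity lie on \<open>Z(u)\<close>.  So do rich points: a curve contained in
  \<open>Z(f)\<close> osculates at almost all of its points, so its Chow ratios are roots of the exceptional
  polynomials there and, by continuity, at the given point.  A curve with more than a multiple of \<open>D\<close>
  such points is contained in \<open>Z(u)\<close> by Bezout, and at most \<open>D deg u = O(D\<^sup>2)\<close> curves are contained
  in \<open>Z(f)\<close> and \<open>Z(u)\<close>.
\<close>

subsection \<open>Evaluation of polynomials\<close>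

text \<open>The obstacle is degree: every construction has to produce polynomials in the point of
  degree O(D), with a constant independent of \<open>f\<close> and of the family. The derivatives of
  \<open>f\<close> at the point and the coefficients of the polynomials describing the family are
  therefore variables of the formulas. Finitely many quantifier eliminations, done before
  \<open>f\<close> is known, serve for all surfaces and families, and substituting the actual values
  costs only a factor D.

  A Chow form is determined up to a scalar, whereas the ratio of two of its coordinates is a single
  number. Infinitely many values of one ratio mean infinitely many curves, while boundedly many
  values of all ratios bound the number of curves.

  No intersection theory is presupposed. Degrees of curves are replaced by a bound on the Hilbert
  function read off the Chow form, and both bounds of Bezout type are dimension counts. That the
  Chow form determines the curve, and that a nonsingular point is a simple root for generic
  projections, is shown by limits of points of the curve.\<close>

definition mono_eval :: "'i monom \<Rightarrow> ('i \<Rightarrow> complex) \<Rightarrow> complex" where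
  "mono_eval m x = (\<Prod>i\<in>Poly_Mapping.keys m. x i ^ Poly_Mapping.lookup m i)"

lemma mono_eval_superset:
  assumes "finite A" "Poly_Mapping.keys m \<subseteq> A"
  shows "mono_eval m x = (\<Prod>i\<in>A. x i ^ Poly_Mapping.lookup m i)"
  unfolding mono_eval_def
  by (rule prod.mono_neutral_left) (use assms in \<open>auto simp: in_keys_iff\<close>)

lemma mono_eval_0 [simp]: "mono_eval 0 x = 1"
  by (simp add: mono_eval_def)

lemma mono_eval_single [simp]: "mono_eval (Poly_Mapping.single i n) x = x i ^ n"
  by (cases "n = 0") (simp_all add: mono_eval_def)

lemma mono_eval_add: "mono_eval (m + m') x = mono_eval m x * mono_eval m' x"
proof -
  let ?A = "Poly_Mapping.keys m \<union> Poly_Mapping.keys m'"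
  have "mono_eval (m + m') x = (\<Prod>i\<in>?A. x i ^ Poly_Mapping.lookup (m + m') i)"
    by (rule mono_eval_superset) (use keys_add[of m m'] in auto)
  also have "\<dots> = (\<Prod>i\<in>?A. x i ^ Poly_Mapping.lookup m i) * (\<Prod>i\<in>?A. x i ^ Poly_Mapping.lookup m' i)"
    by (simp add: lookup_add power_add prod.distrib)
  also have "\<dots> = mono_eval m x * mono_eval m' x"
    by (subst (1 2) mono_eval_superset[where A = ?A]) auto
  finally show ?thesis .
qed

lemma poly_eval_mono: "poly_eval f x = (\<Sum>m\<in>Poly_Mapping.keys f. Poly_Mapping.lookup f m * mono_eval m x)"
  by (simp add: poly_eval_def mono_eval_def)

lemma poly_eval_superset:
  assumes "finite A" "Poly_Mapping.keys f \<subseteq> A"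
  shows "poly_eval f x = (\<Sum>m\<in>A. Poly_Mapping.lookup f m * mono_eval m x)"
  unfolding poly_eval_mono
  by (rule sum.mono_neutral_left) (use assms in \<open>auto simp: in_keys_iff\<close>)

lemma poly_eval_single [simp]: "poly_eval (Poly_Mapping.single m c) x = c * mono_eval m x"
  by (cases "c = 0") (simp_all add: poly_eval_mono)

lemma poly_eval_0 [simp]: "poly_eval 0 x = 0"
  by (simp add: poly_eval_mono)

lemma poly_eval_1 [simp]: "poly_eval 1 x = 1"
  using poly_eval_single[of 0 1 x] by simp

lemma poly_eval_add [simp]: "poly_eval (f + g) x = poly_eval f x + poly_eval g x"
proof -
  let ?A = "Poly_Mapping.keys f \<union> Poly_Mapping.keys g"
  have "poly_eval (f + g) x = (\<Sum>m\<in>?A. Poly_Mapping.lookup (f + g) m * mono_eval m x)"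
    by (rule poly_eval_superset) (use keys_add[of f g] in auto)
  also have "\<dots> = (\<Sum>m\<in>?A. Poly_Mapping.lookup f m * mono_eval m x) + (\<Sum>m\<in>?A. Poly_Mapping.lookup g m * mono_eval m x)"
    by (simp add: lookup_add distrib_right sum.distrib)
  also have "\<dots> = poly_eval f x + poly_eval g x"
    by (subst (1 2) poly_eval_superset[where A = ?A]) auto
  finally show ?thesis .
qed

lemma poly_eval_uminus [simp]: "poly_eval (- f) x = - poly_eval f x"
  using poly_eval_add[of f "- f" x] by (simp add: eq_neg_iff_add_eq_0 add.commute)

lemma poly_eval_diff [simp]: "poly_eval (f - g) x = poly_eval f x - poly_eval g x"
  using poly_eval_add[of f "- g" x] by simp

lemma poly_eval_sum [simp]: "poly_eval (sum f A) x = (\<Sum>a\<in>A. poly_eval (f a) x)"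
  by (induction A rule: infinite_finite_induct) auto

lemma poly_mapping_sum_single:
  "p = (\<Sum>m\<in>Poly_Mapping.keys p. Poly_Mapping.single m (Poly_Mapping.lookup p m))"
  by (rule poly_mapping_eqI)
     (auto simp: lookup_sum lookup_single when_def in_keys_iff sum.delta')

lemma poly_mapping_add_induct [case_names zero single add]:
  assumes "P 0" "\<And>m c. P (Poly_Mapping.single m c)" "\<And>p q. P p \<Longrightarrow> P q \<Longrightarrow> P (p + q)"
  shows "P (p :: 'a \<Rightarrow>\<^sub>0 'b :: comm_monoid_add)"
proof -
  have "P (\<Sum>m\<in>A. Poly_Mapping.single m (Poly_Mapping.lookup p m))" if "finite A" for A
    using that by induction (auto intro: assms)
  from this[OF finite_keys, of p] show ?thesis
    using poly_mapping_sum_single[of p] by simp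
qed

lemma poly_eval_mult [simp]: "poly_eval (f * g) x = poly_eval f x * poly_eval g x"
proof (induction f rule: poly_mapping_add_induct)
  case (single m c)
  show ?case
    by (induction g rule: poly_mapping_add_induct)
       (auto simp: mult_single mono_eval_add algebra_simps)
qed (auto simp: algebra_simps)

lemma poly_eval_power [simp]: "poly_eval (f ^ n) x = poly_eval f x ^ n"
  by (induction n) auto

lemma poly_eval_prod [simp]: "poly_eval (prod f A) x = (\<Prod>a\<in>A. poly_eval (f a) x)"
  by (induction A rule: infinite_finite_induct) auto

definition Cst :: "complex \<Rightarrow> 'i cpoly" where
  "Cst c = Poly_Mapping.single 0 c"

definition Var :: "'i \<Rightarrow> 'i cpoly" where
  "Var i = Poly_Mapping.single (Poly_Mapping.single i 1) 1"

lemma poly_eval_Cst [simp]: "poly_eval (Cst c) x = c"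
  by (simp add: Cst_def)

lemma poly_eval_Var [simp]: "poly_eval (Var i) x = x i"
  by (simp add: Var_def)

lemma Cst_0 [simp]: "Cst 0 = 0" and Cst_1 [simp]: "Cst 1 = 1"
  by (simp_all add: Cst_def)

lemma Cst_add: "Cst (a + b) = Cst a + Cst b"
  by (simp add: Cst_def single_add)

lemma Cst_mult: "Cst (a * b) = Cst a * Cst b"
  by (simp add: Cst_def mult_single)

lemma Var_power: "Var i ^ n = Poly_Mapping.single (Poly_Mapping.single i n) 1"
proof (induction n)
  case (Suc n)
  then show ?case
    by (simp add: Var_def mult_single flip: single_add)
qed auto

lemma single_mono_eq: "Poly_Mapping.single m c =
    Cst c * (\<Prod>i\<in>Poly_Mapping.keys m. Var i ^ Poly_Mapping.lookup m i)"
proof -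
  have "(\<Prod>i\<in>A. Var i ^ Poly_Mapping.lookup m i) =
      Poly_Mapping.single (\<Sum>i\<in>A. Poly_Mapping.single i (Poly_Mapping.lookup m i)) 1"
    if "finite A" for A
    using that by induction (auto simp: Var_power mult_single)
  from this[OF finite_keys, of m] show ?thesis
    by (simp add: Cst_def mult_single flip: poly_mapping_sum_single)
qed

lemma cpoly_induct [case_names Cst Var add mult]:
  assumes "\<And>c. P (Cst c)" "\<And>i. P (Var i)"
    and add: "\<And>p q. P p \<Longrightarrow> P q \<Longrightarrow> P (p + q)" and mult: "\<And>p q. P p \<Longrightarrow> P q \<Longrightarrow> P (p * q)"
  shows "P (p :: 'i cpoly)"
proof (induction p rule: poly_mapping_add_induct)
  case zero
  show ?case using assms(1)[of 0] by simp
next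
  case (single m c)
  have pow: "P (Var i ^ n)" for i n
    using assms(1)[of 1] by (induction n) (auto intro: assms)
  have "P (\<Prod>i\<in>A. Var i ^ Poly_Mapping.lookup m i)" if "finite A" for A
    using that assms(1)[of 1] by induction (auto intro: assms pow)
  then show ?case unfolding single_mono_eq by (intro mult assms(1)) auto
qed (rule add)

subsection \<open>Total degree\<close>

lemma monom_degree_superset:
  assumes "finite A" "Poly_Mapping.keys m \<subseteq> A"
  shows "monom_degree m = (\<Sum>i\<in>A. Poly_Mapping.lookup m i)"
  unfolding monom_degree_def
  by (rule sum.mono_neutral_left) (use assms in \<open>auto simp: in_keys_iff\<close>)

lemma monom_degree_0 [simp]: "monom_degree 0 = 0"
  by (simp add: monom_degree_def)

lemma monom_degree_single [simp]: "monom_degree (Poly_Mapping.single i n) = n"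
  by (cases "n = 0") (simp_all add: monom_degree_def)

lemma monom_degree_add [simp]: "monom_degree (m + m') = monom_degree m + monom_degree m'"
proof -
  let ?A = "Poly_Mapping.keys m \<union> Poly_Mapping.keys m'"
  have "monom_degree (m + m') = (\<Sum>i\<in>?A. Poly_Mapping.lookup (m + m') i)"
    by (rule monom_degree_superset) (use keys_add[of m m'] in auto)
  then show ?thesis
    by (subst (2 3) monom_degree_superset[where A = ?A]) (auto simp: lookup_add sum.distrib)
qed

lemma total_degree_le_iff:
  "total_degree f \<le> n \<longleftrightarrow> (\<forall>m\<in>Poly_Mapping.keys f. monom_degree m \<le> n)"
  by (simp add: total_degree_def)

lemma total_degree_leI:
  "(\<And>m. m \<in> Poly_Mapping.keys f \<Longrightarrow> monom_degree m \<le> n) \<Longrightarrow> total_degree f \<le> n"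
  by (simp add: total_degree_le_iff)

lemma monom_degree_le_total_degree: "m \<in> Poly_Mapping.keys f \<Longrightarrow> monom_degree m \<le> total_degree f"
  using total_degree_le_iff by blast

lemma total_degree_0 [simp]: "total_degree 0 = 0"
  by (simp add: total_degree_def)

lemma total_degree_Cst [simp]: "total_degree (Cst c) = 0"
  by (cases "c = 0") (simp_all add: total_degree_def Cst_def)

lemma total_degree_Var [simp]: "total_degree (Var i) = 1"
  by (simp add: total_degree_def Var_def)

lemma total_degree_add_le: "total_degree f \<le> n \<Longrightarrow> total_degree g \<le> n \<Longrightarrow> total_degree (f + g) \<le> n"
  using keys_add[of f g] by (auto simp: total_degree_le_iff)

lemma total_degree_uminus [simp]: "total_degree (- f) = total_degree f"
  by (simp add: total_degree_def)

lemma total_degree_diff_le: "total_degree f \<le> n \<Longrightarrow> total_degree g \<le> n \<Longrightarrow> total_degree (f - g) \<le> n"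
  using total_degree_add_le[of f n "- g"] by simp

lemma total_degree_mult_le: "total_degree (f * g) \<le> total_degree f + total_degree g"
proof (rule total_degree_leI)
  fix m assume "m \<in> Poly_Mapping.keys (f * g)"
  then obtain a b where "a \<in> Poly_Mapping.keys f" "b \<in> Poly_Mapping.keys g" "m = a + b"
    using keys_mult[of f g] by blast
  then show "monom_degree m \<le> total_degree f + total_degree g"
    by (auto intro!: add_mono monom_degree_le_total_degree)
qed

lemma total_degree_sum_le: "(\<And>a. a \<in> A \<Longrightarrow> total_degree (f a) \<le> n) \<Longrightarrow> total_degree (sum f A) \<le> n"
  by (induction A rule: infinite_finite_induct) (auto intro: total_degree_add_le)

lemma total_degree_prod_le: "total_degree (prod f A) \<le> (\<Sum>a\<in>A. total_degree (f a))"
proof (induction A rule: infinite_finite_induct)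
  case (insert x A)
  then show ?case using total_degree_mult_le[of "f x" "prod f A"] by simp
qed (simp_all flip: Cst_1)

lemma total_degree_power_le: "total_degree (f ^ n) \<le> n * total_degree f"
proof (induction n)
  case (Suc n)
  then show ?case using total_degree_mult_le[of f "f ^ n"] by simp
qed (simp flip: Cst_1)

text \<open>Polynomials are handled as functions with a degree bound, so that substitution is
  composition of functions. The bound need not be attained, which makes it monotone; the index type
  is arbitrary, so that auxiliary choices of directions can be packed into one argument.\<close>

definition pfun :: "nat \<Rightarrow> (('i \<Rightarrow> complex) \<Rightarrow> complex) \<Rightarrow> bool" where
  "pfun n P \<longleftrightarrow> (\<exists>g. total_degree g \<le> n \<and> P = poly_eval g)"

lemma pfunI: "total_degree g \<le> n \<Longrightarrow> (\<And>x. P x = poly_eval g x) \<Longrightarrow> pfun n P"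
  by (auto simp: pfun_def)

lemma pfunE: assumes "pfun n P" obtains g where "total_degree g \<le> n" "\<And>x. P x = poly_eval g x"
  using assms by (auto simp: pfun_def)

lemma pfun_poly_eval: "total_degree g \<le> n \<Longrightarrow> pfun n (poly_eval g)"
  by (auto intro: pfunI)

lemma pfun_mono: "pfun n P \<Longrightarrow> n \<le> m \<Longrightarrow> pfun m P"
  by (elim pfunE, rule pfunI) auto

lemma pfun_const: "pfun n (\<lambda>x. c)"
  by (rule pfunI[of "Cst c"]) auto

lemma pfun_var: "1 \<le> n \<Longrightarrow> pfun n (\<lambda>x. x i)"
  by (rule pfunI[of "Var i"]) auto

lemma pfun_add: "pfun n P \<Longrightarrow> pfun n Q \<Longrightarrow> pfun n (\<lambda>x. P x + Q x)"
  by (elim pfunE, rule pfunI, erule (1) total_degree_add_le) simp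

lemma pfun_diff: "pfun n P \<Longrightarrow> pfun n Q \<Longrightarrow> pfun n (\<lambda>x. P x - Q x)"
  by (elim pfunE, rule pfunI, erule (1) total_degree_diff_le) simp

lemma pfun_mult: "pfun n P \<Longrightarrow> pfun m Q \<Longrightarrow> n + m \<le> k \<Longrightarrow> pfun k (\<lambda>x. P x * Q x)"
  by (elim pfunE, rule pfunI, rule order_trans[OF total_degree_mult_le]) auto

lemma pfun_sum: "(\<And>a. a \<in> A \<Longrightarrow> pfun n (P a)) \<Longrightarrow> pfun n (\<lambda>x. \<Sum>a\<in>A. P a x)"
  by (induction A rule: infinite_finite_induct) (auto intro: pfun_const pfun_add)

lemma pfun_prod:
  "(\<And>a. a \<in> A \<Longrightarrow> pfun (n a) (P a)) \<Longrightarrow> pfun (sum n A) (\<lambda>x. \<Prod>a\<in>A. P a x)"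
proof (induction A rule: infinite_finite_induct)
  case (insert x F)
  then show ?case by (auto intro!: pfun_mult[of "n x" _ "sum n F"])
qed (auto intro: pfun_const)

lemma pfun_power: "pfun n P \<Longrightarrow> pfun (k * n) (\<lambda>x. P x ^ k)"
  by (induction k) (auto intro: pfun_const pfun_mult)

lemma pfun_compose:
  assumes "pfun n P" "\<And>i. pfun d (\<lambda>y. \<sigma> y i)"
  shows "pfun (n * d) (\<lambda>y. P (\<sigma> y))"
proof -
  obtain g where g: "total_degree g \<le> n" "P = poly_eval g" using assms(1) by (auto simp: pfun_def)
  have "pfun (n * d) (\<lambda>y. Poly_Mapping.lookup g m * mono_eval m (\<sigma> y))" if "m \<in> Poly_Mapping.keys g" for m
  proof -
    have "pfun (\<Sum>i\<in>Poly_Mapping.keys m. Poly_Mapping.lookup m i * d)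
        (\<lambda>y. \<Prod>i\<in>Poly_Mapping.keys m. \<sigma> y i ^ Poly_Mapping.lookup m i)"
      by (intro pfun_prod pfun_power assms)
    then have "pfun (monom_degree m * d) (\<lambda>y. mono_eval m (\<sigma> y))"
      by (simp add: mono_eval_def monom_degree_def sum_distrib_right)
    moreover have "monom_degree m * d \<le> n * d"
      using g(1) that by (intro mult_right_mono) (auto simp: total_degree_le_iff)
    ultimately show ?thesis by (intro pfun_mult[OF pfun_const[of 0]]) auto
  qed
  then show ?thesis by (simp add: g(2) poly_eval_mono pfun_sum)
qed

lemma pfun_on_line:
  assumes "pfun n P"
  shows "\<exists>q. degree q \<le> n \<and> (\<forall>t. poly q t = P (\<lambda>i. x i + t * y i))"
proof -
  obtain g where g: "total_degree g \<le> n" "\<And>x. P x = poly_eval g x" using assms by (auto simp: pfun_def)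
  define q where "q m = smult (Poly_Mapping.lookup g m)
      (\<Prod>i\<in>Poly_Mapping.keys m. [:x i, y i:] ^ Poly_Mapping.lookup m i)" for m
  have "degree (q m) \<le> n" if "m \<in> Poly_Mapping.keys g" for m
  proof -
    have "degree (q m) \<le> degree (\<Prod>i\<in>Poly_Mapping.keys m. [:x i, y i:] ^ Poly_Mapping.lookup m i)"
      unfolding q_def by (rule degree_smult_le)
    also have "\<dots> \<le> (\<Sum>i\<in>Poly_Mapping.keys m. degree ([:x i, y i:] ^ Poly_Mapping.lookup m i))"
      using degree_prod_sum_le[OF finite_keys, of "\<lambda>i. [:x i, y i:] ^ Poly_Mapping.lookup m i" m]
      by (simp add: comp_def)
    also have "\<dots> \<le> (\<Sum>i\<in>Poly_Mapping.keys m. Poly_Mapping.lookup m i)"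
      by (intro sum_mono order_trans[OF degree_power_le]) auto
    also have "\<dots> \<le> n"
      using g(1) that by (auto simp: total_degree_le_iff monom_degree_def)
    finally show ?thesis .
  qed
  then have "degree (\<Sum>m\<in>Poly_Mapping.keys g. q m) \<le> n"
    by (intro degree_sum_le) auto
  moreover have "poly (\<Sum>m\<in>Poly_Mapping.keys g. q m) t = P (\<lambda>i. x i + t * y i)" for t
    by (simp add: g(2) poly_sum q_def poly_prod poly_power poly_eval_mono mono_eval_def)
  ultimately show ?thesis by blast
qed

text \<open>Both functions restrict to nonzero univariate polynomials on the line through the two
  points, and the product of these has a nonroot. Most generic choices below come from here.\<close>

lemma pfun_common_nonzero:
  assumes "pfun n P" "P x \<noteq> 0" "pfun m Q" "Q y \<noteq> 0"
  shows "\<exists>z. P z \<noteq> 0 \<and> Q z \<noteq> 0"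
proof -
  obtain p where p: "\<And>t. poly p t = P (\<lambda>i. x i + t * (y i - x i))"
    using pfun_on_line[OF assms(1), of x "\<lambda>i. y i - x i"] by blast
  obtain q where q: "\<And>t. poly q t = Q (\<lambda>i. x i + t * (y i - x i))"
    using pfun_on_line[OF assms(3), of x "\<lambda>i. y i - x i"] by blast
  have "poly p 0 \<noteq> 0" "poly q 1 \<noteq> 0" using p[of 0] q[of 1] assms by auto
  then have "p * q \<noteq> 0" by auto
  then obtain t where "poly (p * q) t \<noteq> 0" using poly_all_0_iff_0 by blast
  then show ?thesis using p q by (intro exI[of _ "\<lambda>i. x i + t * (y i - x i)"]) auto
qed

lemma pfun_finite_common_nonzero:
  assumes "finite A" "\<And>a. a \<in> A \<Longrightarrow> pfun (n a) (P a)" "\<And>a. a \<in> A \<Longrightarrow> \<exists>x. P a x \<noteq> 0"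
  shows "\<exists>z. \<forall>a\<in>A. P a z \<noteq> 0"
proof -
  have "\<exists>z. (\<Prod>a\<in>A. P a z) \<noteq> 0"
    using assms
  proof (induction)
    case (insert a A)
    obtain x where x: "P a x \<noteq> 0" using insert.prems by blast
    obtain z where z: "(\<Prod>a\<in>A. P a z) \<noteq> 0" using insert by blast
    have "pfun (sum n A) (\<lambda>z. \<Prod>a\<in>A. P a z)" using insert.prems by (intro pfun_prod) auto
    then have "\<exists>w. P a w \<noteq> 0 \<and> (\<Prod>a\<in>A. P a w) \<noteq> 0"
      using x z insert.prems(1)
      by (intro pfun_common_nonzero[where n = "n a" and P = "P a" and x = x and m = "sum n A"
            and Q = "\<lambda>z. \<Prod>a\<in>A. P a z" and y = z]) auto
    then show ?case using insert.hyps by simp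
  qed auto
  then show ?thesis using assms(1) by auto
qed

subsection \<open>Partial derivatives\<close>

text \<open>The truncated subtraction in the exponent is harmless: where \<open>i\<close> does not
  occur in \<open>m\<close>, the coefficient carries the factor 0.\<close>

definition pd :: "'i \<Rightarrow> 'i cpoly \<Rightarrow> 'i cpoly" where
  "pd i f = (\<Sum>m\<in>Poly_Mapping.keys f. Poly_Mapping.single (m - Poly_Mapping.single i 1)
     (Poly_Mapping.lookup f m * of_nat (Poly_Mapping.lookup m i)))"

lemma pd_superset:
  assumes "finite A" "Poly_Mapping.keys f \<subseteq> A"
  shows "pd i f = (\<Sum>m\<in>A. Poly_Mapping.single (m - Poly_Mapping.single i 1)
     (Poly_Mapping.lookup f m * of_nat (Poly_Mapping.lookup m i)))"
  unfolding pd_def by (rule sum.mono_neutral_left) (use assms in \<open>auto simp: in_keys_iff\<close>)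

lemma pd_0 [simp]: "pd i 0 = 0"
  by (simp add: pd_def)

lemma pd_single: "pd i (Poly_Mapping.single m c) =
    Poly_Mapping.single (m - Poly_Mapping.single i 1) (c * of_nat (Poly_Mapping.lookup m i))"
  by (cases "c = 0") (simp_all add: pd_def)

lemma pd_add: "pd i (f + g) = pd i f + pd i g"
proof -
  let ?A = "Poly_Mapping.keys f \<union> Poly_Mapping.keys g"
  have "pd i (f + g) = (\<Sum>m\<in>?A. Poly_Mapping.single (m - Poly_Mapping.single i 1)
      (Poly_Mapping.lookup (f + g) m * of_nat (Poly_Mapping.lookup m i)))"
    by (rule pd_superset) (use keys_add[of f g] in auto)
  also have "\<dots> = pd i f + pd i g"
    by (subst (1 2) pd_superset[where A = ?A])
       (auto simp: lookup_add distrib_right sum.distrib single_add)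
  finally show ?thesis .
qed

lemma monom_minus_single_add:
  "Poly_Mapping.lookup a i \<noteq> 0 \<Longrightarrow> a + b - Poly_Mapping.single i 1 = (a - Poly_Mapping.single i (1::nat)) + b"
  by (rule poly_mapping_eqI) (auto simp: lookup_add lookup_minus lookup_single when_def)

lemma pd_mult: "pd i (f * g) = pd i f * g + f * pd i g"
proof (induction f rule: poly_mapping_add_induct)
  case (single a c)
  show ?case
  proof (induction g rule: poly_mapping_add_induct)
    case (single b d)
    show ?case
    proof (cases "Poly_Mapping.lookup a i = 0")
      case True
      have "a + b - Poly_Mapping.single i 1 = a + (b - Poly_Mapping.single i 1)" if "Poly_Mapping.lookup b i \<noteq> 0"
        using monom_minus_single_add[OF that, of a] by (simp add: add.commute)
      with True show ?thesis
        by (cases "Poly_Mapping.lookup b i = 0")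
          (simp_all add: mult_single pd_single lookup_add mult.assoc)
    next
      case False
      show ?thesis
      proof (cases "Poly_Mapping.lookup b i = 0")
        case True
        then show ?thesis using False
          by (simp add: mult_single pd_single lookup_add monom_minus_single_add[of a i b, simplified] algebra_simps)
      next
        case F: False
        have "a + (b - Poly_Mapping.single i 1) = a + b - Poly_Mapping.single i 1"
          using monom_minus_single_add[OF F, of a] by (simp add: add.commute)
        moreover have "(a - Poly_Mapping.single i 1) + b = a + b - Poly_Mapping.single i 1"
          using monom_minus_single_add[OF False, of b] by simp
        ultimately show ?thesis
          unfolding mult_single pd_single lookup_add
          by (simp add: distrib_left distrib_right mult_ac flip: single_add)
      qed
    qed
  qed (auto simp: pd_add algebra_simps)
qed (auto simp: pd_add algebra_simps)

lemma pd_Cst [simp]: "pd i (Cst c) = 0"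
  by (simp add: Cst_def pd_single)

lemma pd_Var: "pd i (Var j) = (if i = j then 1 else 0)"
  by (auto simp: Var_def pd_single lookup_single)

lemma pd_1 [simp]: "pd i 1 = 0"
  using pd_Cst[of i 1] by simp

lemma total_degree_pd_le: "total_degree (pd i f) \<le> total_degree f"
  unfolding pd_def
proof (rule total_degree_sum_le)
  fix m assume m: "m \<in> Poly_Mapping.keys f"
  have "Poly_Mapping.keys (m - Poly_Mapping.single i 1) \<subseteq> Poly_Mapping.keys m"
    by (auto simp: in_keys_iff lookup_minus)
  then have "monom_degree (m - Poly_Mapping.single i 1) \<le> monom_degree m"
    by (subst monom_degree_superset[where A = "Poly_Mapping.keys m"])
      (auto simp: monom_degree_def lookup_minus intro: sum_mono)
  also have "\<dots> \<le> total_degree f" by (rule monom_degree_le_total_degree[OF m])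
  finally show "total_degree (Poly_Mapping.single (m - Poly_Mapping.single i 1)
     (Poly_Mapping.lookup f m * of_nat (Poly_Mapping.lookup m i))) \<le> total_degree f"
    by (intro total_degree_leI) (auto split: if_splits)
qed

lemma has_field_derivative_poly_eval:
  fixes \<phi> :: "complex \<Rightarrow> 'i::finite \<Rightarrow> complex"
  assumes "\<And>i. ((\<lambda>s. \<phi> s i) has_field_derivative \<phi>' i) (at s within S)"
  shows "((\<lambda>s. poly_eval f (\<phi> s)) has_field_derivative
      (\<Sum>i\<in>UNIV. poly_eval (pd i f) (\<phi> s) * \<phi>' i)) (at s within S)"
proof (induction f rule: cpoly_induct)
  case (Var j)
  have "(\<Sum>i\<in>UNIV. poly_eval (pd i (Var j)) (\<phi> s) * \<phi>' i) = (\<Sum>i\<in>UNIV. if i = j then \<phi>' i else 0)"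
    by (intro sum.cong) (auto simp: pd_Var)
  then show ?case using assms by simp
next
  case (add p q)
  from DERIV_add[OF this] show ?case
    by (simp add: pd_add distrib_right sum.distrib)
next
  case (mult p q)
  have "(\<Sum>i\<in>UNIV. poly_eval (pd i (p * q)) (\<phi> s) * \<phi>' i) =
      (\<Sum>i\<in>UNIV. poly_eval (pd i p) (\<phi> s) * \<phi>' i) * poly_eval q (\<phi> s) +
      (\<Sum>i\<in>UNIV. poly_eval (pd i q) (\<phi> s) * \<phi>' i) * poly_eval p (\<phi> s)"
    unfolding sum_distrib_right sum.distrib[symmetric] by (intro sum.cong) (auto simp: pd_mult algebra_simps)
  with DERIV_mult[OF mult] show ?case by simp
qed auto

subsection \<open>Polynomial rings as iterated univariate polynomial rings\<close>

lemma poly_vars_add: "poly_vars (f + g) \<subseteq> poly_vars f \<union> poly_vars g"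
  using keys_add[of f g] by (auto simp: poly_vars_def)

lemma poly_vars_mult: "poly_vars (f * g) \<subseteq> poly_vars f \<union> poly_vars g"
proof
  fix i assume "i \<in> poly_vars (f * g)"
  then obtain m where m: "m \<in> Poly_Mapping.keys (f * g)" "i \<in> Poly_Mapping.keys m"
    by (auto simp: poly_vars_def)
  then obtain a b where "a \<in> Poly_Mapping.keys f" "b \<in> Poly_Mapping.keys g" "m = a + b"
    using keys_mult[of f g] by blast
  with m(2) keys_add[of a b] show "i \<in> poly_vars f \<union> poly_vars g"
    by (auto simp: poly_vars_def)
qed

lemma poly_vars_Cst [simp]: "poly_vars (Cst c) = {}"
  by (cases "c = 0") (simp_all add: poly_vars_def Cst_def)

lemma poly_vars_0 [simp]: "poly_vars 0 = {}"
  by (simp add: poly_vars_def)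

lemma poly_vars_Var [simp]: "poly_vars (Var i) = {i}"
  by (simp add: poly_vars_def Var_def)

lemma mono_eval_cong:
  "(\<And>i. i \<in> Poly_Mapping.keys m \<Longrightarrow> x i = y i) \<Longrightarrow> mono_eval m x = mono_eval m y"
  by (simp add: mono_eval_def)

lemma poly_eval_cong:
  assumes "\<And>i. i \<in> poly_vars f \<Longrightarrow> x i = y i"
  shows "poly_eval f x = poly_eval f y"
  unfolding poly_eval_mono
  by (intro sum.cong refl arg_cong2[where f = "(*)"] mono_eval_cong assms) (auto simp: poly_vars_def)

lemma cpoly_vars_induct [consumes 1, case_names Cst Var add mult]:
  assumes "poly_vars (p :: 'i cpoly) \<subseteq> I"
  assumes "\<And>c. P (Cst c)" "\<And>i. i \<in> I \<Longrightarrow> P (Var i)"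
    and add: "\<And>p q. P p \<Longrightarrow> P q \<Longrightarrow> P (p + q)" and mult: "\<And>p q. P p \<Longrightarrow> P q \<Longrightarrow> P (p * q)"
  shows "P p"
proof -
  have P01: "P 0" "P 1" using assms(2)[of 0] assms(2)[of 1] by auto
  have pow: "P (Var i ^ n)" if "i \<in> I" for i n
    using P01 that by (induction n) (auto intro: assms)
  have prd: "P (\<Prod>i\<in>A. Var i ^ Poly_Mapping.lookup m i)" if "finite A" "A \<subseteq> I" for A m
    using that P01 by induction (auto intro: assms pow)
  have sng: "P (Poly_Mapping.single m c)" if "m \<in> Poly_Mapping.keys p" for m c
    unfolding single_mono_eq using assms(1) that
    by (intro mult assms(2) prd) (auto simp: poly_vars_def)
  have "P (\<Sum>m\<in>A. Poly_Mapping.single m (Poly_Mapping.lookup p m))" if "finite A" "A \<subseteq> Poly_Mapping.keys p" for A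
    using that P01 by induction (auto intro: add sng)
  from this[OF finite_keys, of p] show ?thesis
    using poly_mapping_sum_single[of p] by simp
qed

text \<open>Iterated univariate polynomial rings over the complex numbers are factorial; such a map
  identifies one of them with the polynomials in the variables \<open>I\<close> and transports
  factorization. The last clause yields injectivity and also that a polynomial vanishing at every
  point is zero.\<close>

definition iso_vars :: "('a::comm_ring_1 \<Rightarrow> 'i cpoly) \<Rightarrow> 'i set \<Rightarrow> bool" where
  "iso_vars \<phi> I \<longleftrightarrow> (\<forall>x y. \<phi> (x + y) = \<phi> x + \<phi> y) \<and> (\<forall>x y. \<phi> (x * y) = \<phi> x * \<phi> y) \<and> \<phi> 1 = 1 \<and>
     range \<phi> = {p. poly_vars p \<subseteq> I} \<and> (\<forall>q. (\<forall>x. poly_eval (\<phi> q) x = 0) \<longrightarrow> q = 0)"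

definition iso_ext :: "('a::comm_ring_1 \<Rightarrow> 'i cpoly) \<Rightarrow> 'i \<Rightarrow> 'a poly \<Rightarrow> 'i cpoly" where
  "iso_ext \<phi> i q = fold_coeffs (\<lambda>a p. \<phi> a + Var i * p) q 0"

context
  fixes \<phi> :: "'a::comm_ring_1 \<Rightarrow> 'i cpoly" and I
  assumes iso: "iso_vars \<phi> I"
begin

lemma iso_add: "\<phi> (x + y) = \<phi> x + \<phi> y" and iso_mult: "\<phi> (x * y) = \<phi> x * \<phi> y"
  and iso_1: "\<phi> 1 = 1" and iso_range: "range \<phi> = {p. poly_vars p \<subseteq> I}"
  and iso_eval: "(\<And>x. poly_eval (\<phi> q) x = 0) \<Longrightarrow> q = 0"
  using iso by (auto simp: iso_vars_def)

lemma iso_0: "\<phi> 0 = 0"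
  using iso_add[of 0 0] by simp

lemma iso_uminus: "\<phi> (- x) = - \<phi> x"
  using iso_add[of x "- x"] iso_0 by (simp add: eq_neg_iff_add_eq_0 add.commute)

lemma iso_inj: "\<phi> x = \<phi> y \<Longrightarrow> x = y"
  using iso_eval[of "x - y"] iso_add[of x "- y"] iso_uminus by simp

lemma iso_eq_0_iff: "\<phi> x = 0 \<longleftrightarrow> x = 0"
  using iso_inj[of x 0] iso_0 by auto

lemma iso_surj: "poly_vars p \<subseteq> I \<Longrightarrow> \<exists>x. p = \<phi> x"
  using iso_range by blast

lemma iso_dvd_iff:
  assumes "I = UNIV"
  shows "\<phi> x dvd \<phi> y \<longleftrightarrow> x dvd y"
proof
  assume "\<phi> x dvd \<phi> y"
  then obtain k where k: "\<phi> y = \<phi> x * k" by (elim dvdE)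
  obtain z where "k = \<phi> z" using iso_surj assms by blast
  then have "y = x * z" using k iso_inj by (simp flip: iso_mult)
  then show "x dvd y" by simp
qed (auto simp: iso_mult elim!: dvdE)

lemma iso_ext_0: "iso_ext \<phi> i 0 = 0"
  by (simp add: iso_ext_def)

lemma iso_ext_pCons: "iso_ext \<phi> i (pCons a q) = \<phi> a + Var i * iso_ext \<phi> i q"
proof (cases "a = 0 \<and> q = 0")
  case True
  then show ?thesis by (simp add: iso_ext_0 iso_0)
next
  case False
  then show ?thesis by (cases "q = 0") (auto simp: iso_ext_def)
qed

lemma iso_ext_add: "iso_ext \<phi> i (p + q) = iso_ext \<phi> i p + iso_ext \<phi> i q"
  by (induction p q rule: poly_induct2) (auto simp: iso_ext_pCons iso_ext_0 iso_add algebra_simps)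

lemma iso_ext_smult: "iso_ext \<phi> i (smult a q) = \<phi> a * iso_ext \<phi> i q"
  by (induction q) (auto simp: iso_ext_pCons iso_ext_0 iso_mult algebra_simps)

lemma iso_ext_mult: "iso_ext \<phi> i (p * q) = iso_ext \<phi> i p * iso_ext \<phi> i q"
  by (induction p) (auto simp: iso_ext_pCons iso_ext_0 iso_ext_add iso_ext_smult iso_0 algebra_simps)

lemma iso_ext_const: "iso_ext \<phi> i [:a:] = \<phi> a"
  by (simp add: iso_ext_pCons iso_ext_0)

lemma iso_ext_eval:
  assumes "i \<notin> I"
  shows "poly_eval (iso_ext \<phi> i q) (x(i := t)) = poly (map_poly (\<lambda>a. poly_eval (\<phi> a) x) q) t"
proof (induction q)
  case (pCons a q)
  have "poly_vars (\<phi> a) \<subseteq> I" using iso_range by blast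
  then have "poly_eval (\<phi> a) (x(i := t)) = poly_eval (\<phi> a) x"
    using assms by (intro poly_eval_cong) auto
  with pCons show ?case
    by (simp add: iso_ext_pCons map_poly_pCons iso_0 del: fun_upd_apply) simp
qed (simp add: iso_ext_0)

lemma iso_vars_ext:
  assumes "i \<notin> I"
  shows "iso_vars (iso_ext \<phi> i) (insert i I)"
  unfolding iso_vars_def
proof (intro conjI allI impI)
  show "iso_ext \<phi> i 1 = 1" by (simp add: one_pCons iso_ext_const iso_1)
  show "range (iso_ext \<phi> i) = {p. poly_vars p \<subseteq> insert i I}"
  proof (intro equalityI subsetI)
    fix p assume "p \<in> range (iso_ext \<phi> i)"
    then obtain q where q: "p = iso_ext \<phi> i q" by auto
    have "poly_vars (iso_ext \<phi> i q) \<subseteq> insert i I"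
    proof (induction q)
      case (pCons a q)
      have "poly_vars (\<phi> a) \<subseteq> I" using iso_range by blast
      then show ?case using poly_vars_add[of "\<phi> a" "Var i * iso_ext \<phi> i q"]
          poly_vars_mult[of "Var i" "iso_ext \<phi> i q"] pCons by (auto simp: iso_ext_pCons)
    qed (simp add: iso_ext_0)
    with q show "p \<in> {p. poly_vars p \<subseteq> insert i I}" by simp
  next
    fix p :: "'i cpoly" assume "p \<in> {p. poly_vars p \<subseteq> insert i I}"
    then have "poly_vars p \<subseteq> insert i I" by simp
    then show "p \<in> range (iso_ext \<phi> i)"
    proof (induction rule: cpoly_vars_induct)
      case (Cst c)
      have "Cst c \<in> range \<phi>" using iso_range by auto
      then obtain a where "Cst c = \<phi> a" by blast
      then show ?case using iso_ext_const[of i a] by (metis rangeI)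
    next
      case (Var j)
      show ?case
      proof (cases "j = i")
        case True
        have "Var i = iso_ext \<phi> i [:0, 1:]" by (simp add: iso_ext_pCons iso_ext_0 iso_0 iso_1)
        then show ?thesis using True by simp
      next
        case False
        then have "Var j \<in> range \<phi>" using iso_range Var by auto
        then obtain a where "Var j = \<phi> a" by blast
        then show ?thesis using iso_ext_const[of i a] by (metis rangeI)
      qed
    next
      case (add p q)
      then obtain a b where "p = iso_ext \<phi> i a" "q = iso_ext \<phi> i b" by blast
      then show ?case using iso_ext_add[of i a b] by (metis rangeI)
    next
      case (mult p q)
      then obtain a b where "p = iso_ext \<phi> i a" "q = iso_ext \<phi> i b" by blast
      then show ?case using iso_ext_mult[of i a b] by (metis rangeI)
    qed
  qed
next
  fix q assume q: "\<forall>x. poly_eval (iso_ext \<phi> i q) x = 0"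
  have "coeff q k = 0" for k
  proof (rule iso_eval)
    fix x
    have "map_poly (\<lambda>a. poly_eval (\<phi> a) x) q = 0"
      using q iso_ext_eval[OF assms, of q x] by (simp flip: poly_all_0_iff_0 del: fun_upd_apply)
    then have "coeff (map_poly (\<lambda>a. poly_eval (\<phi> a) x) q) k = 0" by simp
    then show "poly_eval (\<phi> (coeff q k)) x = 0" by (simp add: coeff_map_poly iso_0)
  qed
  then show "q = 0" by (intro poly_eqI) auto
qed (simp_all add: iso_ext_add iso_ext_mult)

end

lemma iso_vars_Cst: "iso_vars (Cst :: complex \<Rightarrow> 'i cpoly) {}"
  unfolding iso_vars_def
proof (intro conjI)
  show "range Cst = {p :: 'i cpoly. poly_vars p \<subseteq> {}}"
  proof (intro equalityI subsetI)
    fix p :: "'i cpoly" assume "p \<in> {p. poly_vars p \<subseteq> {}}"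
    then have "poly_vars p \<subseteq> {}" by simp
    then show "p \<in> range Cst"
    proof (induction rule: cpoly_vars_induct)
      case (add p q)
      then obtain a b where "p = Cst a" "q = Cst b" by blast
      then show ?case by (simp flip: Cst_add)
    next
      case (mult p q)
      then obtain a b where "p = Cst a" "q = Cst b" by blast
      then show ?case by (simp flip: Cst_mult)
    qed auto
  qed auto
qed (auto simp: Cst_add Cst_mult)

lemma iso_vars_irreducible_prime:
  fixes \<phi> :: "'a::{factorial_ring_gcd, semiring_gcd_mult_normalize} \<Rightarrow> 'i cpoly"
    and F :: "'i cpoly"
  assumes iso: "iso_vars \<phi> UNIV" and F: "irreducible F" and dvd: "F dvd a * b"
  shows "F dvd a \<or> F dvd b"
proof -
  have surj: "\<exists>x. p = \<phi> x" for p using iso_surj[OF iso] by blast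
  obtain F' where "F = \<phi> F'" using surj by blast
  obtain a' where "a = \<phi> a'" using surj by blast
  obtain b' where "b = \<phi> b'" using surj by blast
  note eq = \<open>F = \<phi> F'\<close> \<open>a = \<phi> a'\<close> \<open>b = \<phi> b'\<close>
  note dvd_iff = iso_dvd_iff[OF iso refl]
  have "irreducible F'"
  proof (rule irreducibleI)
    show "F' \<noteq> 0" using F iso_0[OF iso] eq by (auto simp: irreducible_def)
    show "\<not> F' dvd 1" using F eq dvd_iff[of F' 1] iso_1[OF iso] by (auto simp: irreducible_def)
    fix x y assume "F' = x * y"
    then have "\<phi> x dvd 1 \<or> \<phi> y dvd 1" using F eq iso_mult[OF iso] by (auto simp: irreducible_def)
    then show "x dvd 1 \<or> y dvd 1" using dvd_iff[of _ 1] iso_1[OF iso] by auto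
  qed
  then have "prime_elem F'" by (rule irreducible_imp_prime_elem)
  moreover have "F' dvd a' * b'" using dvd dvd_iff[of F' "a' * b'"] eq iso_mult[OF iso] by simp
  ultimately have "F' dvd a' \<or> F' dvd b'" by (rule prime_elem_dvd_multD)
  then show ?thesis using dvd_iff eq by auto
qed

text \<open>A resultant without determinants. A nonzero combination \<open>H\<close> of least degree
  divides constant multiples of both \<open>F\<close> and \<open>G\<close>, by pseudo-division. If
  its degree were positive, primality of \<open>F\<close> in \<open>smult c F = H * Q\<close> would
  leave two cases: \<open>F\<close> divides \<open>H\<close>, hence \<open>G\<close>, or
  \<open>F\<close> divides \<open>Q\<close>, so that \<open>H\<close> divides a constant.\<close>

lemma prime_elem_elimination:
  fixes F G :: "'a::idom poly"
  assumes prime: "\<And>a b. F dvd a * b \<Longrightarrow> F dvd a \<or> F dvd b" and deg: "degree F > 0" and ndvd: "\<not> F dvd G"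
  shows "\<exists>A B h. A * F + B * G = [:h:] \<and> h \<noteq> 0"
proof -
  define J where "J = {A * F + B * G | A B. A * F + B * G \<noteq> 0}"
  have "F = 1 * F + 0 * G" by simp
  moreover have "F \<noteq> 0" using deg by auto
  ultimately have FJ: "F \<in> J" unfolding J_def by (metis (mono_tags, lifting) mem_Collect_eq)
  define H where "H = (ARG_MIN degree H. H \<in> J)"
  have HJ: "H \<in> J"
    unfolding H_def using FJ by (rule arg_min_natI)
  have Hmin: "degree H \<le> degree K" if "K \<in> J" for K
    unfolding H_def using that by (rule arg_min_nat_le)
  obtain A B where AB: "H = A * F + B * G" "H \<noteq> 0" using HJ by (auto simp: J_def)
  have red: "\<exists>c Q. c \<noteq> 0 \<and> smult c (C * F + D * G) = H * Q" for C D
  proof -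
    obtain q r where qr: "pseudo_divmod (C * F + D * G) H = (q, r)" by fastforce
    define c where "c = coeff H (degree H) ^ (Suc (degree (C * F + D * G)) - degree H)"
    have eq: "smult c (C * F + D * G) = H * q + r" and r: "r = 0 \<or> degree r < degree H"
      using pseudo_divmod[OF AB(2) qr] by (auto simp: c_def)
    have "r = (smult c C - q * A) * F + (smult c D - q * B) * G"
      using eq AB(1) by (simp add: algebra_simps smult_add_right)
    then have "r = 0 \<or> r \<in> J" unfolding J_def by blast
    then have "r = 0" using r Hmin by force
    moreover have "c \<noteq> 0" using AB(2) by (simp add: c_def)
    ultimately show ?thesis using eq by auto
  qed
  have "degree H = 0"
  proof (rule ccontr)
    assume pos: "degree H \<noteq> 0"
    obtain c Q where c: "c \<noteq> 0" "smult c F = H * Q" using red[of 1 0] by auto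
    have ndc: "\<not> F dvd [:d:]" if "d \<noteq> 0" for d
      using that deg dvd_imp_degree_le[of F "[:d:]"] by auto
    have "F dvd H * Q" using c(2) by (metis dvd_smult dvd_refl)
    then consider "F dvd H" | "F dvd Q" using prime by blast
    then show False
    proof cases
      case 1
      obtain d R where d: "d \<noteq> 0" "smult d G = H * R" using red[of 0 1] by auto
      then have "F dvd [:d:] * G" using 1 by simp
      then show False using prime ndc[OF d(1)] ndvd by blast
    next
      case 2
      then obtain R where "Q = F * R" by blast
      then have "F * (smult 1 [:c:] - H * R) = 0" using c(2) by (simp add: algebra_simps)
      then have "smult 1 [:c:] - H * R = 0" using deg by (metis degree_0 less_irrefl mult_eq_0_iff)
      then have "[:c:] = H * R" by simp
      then have "H dvd [:c:]" by simp
      then show False using dvd_imp_degree_le[of H "[:c:]"] c(1) pos by auto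
    qed
  qed
  then obtain h where "H = [:h:]" by (rule degree_eq_zeroE)
  then show ?thesis using AB by auto
qed

lemma iso_vars_elimination:
  fixes \<phi> :: "'a::{factorial_ring_gcd, semiring_gcd_mult_normalize} \<Rightarrow> 'i cpoly"
  assumes iso: "iso_vars \<phi> I" and i: "i \<notin> I" "insert i I = UNIV"
    and F: "irreducible F" "i \<in> poly_vars F" "\<not> F dvd G"
  shows "\<exists>A B H. A * F + B * G = H \<and> H \<noteq> 0 \<and> i \<notin> poly_vars H"
proof -
  let ?\<psi> = "iso_ext \<phi> i"
  have iso': "iso_vars ?\<psi> UNIV" using iso_vars_ext[OF iso i(1)] i(2) by simp
  obtain F' where "F = ?\<psi> F'" using iso_surj[OF iso'] by blast
  obtain G' where "G = ?\<psi> G'" using iso_surj[OF iso'] by blast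
  note eq = \<open>F = ?\<psi> F'\<close> \<open>G = ?\<psi> G'\<close>
  note dvd_iff = iso_dvd_iff[OF iso' refl]
  have prime: "F' dvd a \<or> F' dvd b" if "F' dvd a * b" for a b
    using iso_vars_irreducible_prime[OF iso' F(1), of "?\<psi> a" "?\<psi> b"] that
    unfolding eq by (simp add: dvd_iff flip: iso_mult[OF iso'])
  have free: "i \<notin> poly_vars (?\<psi> [:h:])" for h
    using iso_ext_const[OF iso, of i h] iso_range[OF iso] i(1) by auto
  have "degree F' > 0"
    using F(2) free degree_eq_zeroE[of F'] unfolding eq by (cases "degree F' = 0") auto
  from prime_elem_elimination[OF prime this] F(3) obtain A B h where h: "A * F' + B * G' = [:h:]" "h \<noteq> 0"
    unfolding eq dvd_iff by blast
  have "?\<psi> A * F + ?\<psi> B * G = ?\<psi> [:h:]"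
    unfolding eq h(1)[symmetric] by (simp add: iso_add[OF iso'] iso_mult[OF iso'])
  moreover have "?\<psi> [:h:] \<noteq> 0" using iso_eq_0_iff[OF iso', of "[:h:]"] h(2) by simp
  ultimately show ?thesis using free[of h] by blast
qed

lemma iso_vars_3:
  fixes i :: 3
  shows "\<exists>(\<phi> :: complex poly poly \<Rightarrow> 3 cpoly) I. iso_vars \<phi> I \<and> i \<notin> I \<and> insert i I = UNIV"
proof -
  obtain j k where jk: "{i, j, k} = UNIV" "j \<noteq> i" "k \<noteq> i" "j \<noteq> k"
  proof -
    have "i = 1 \<or> i = 2 \<or> i = 3" by (rule exhaust_3)
    then show ?thesis
      using that[of 2 3] that[of 1 3] that[of 1 2] unfolding UNIV_3 by (elim disjE) (simp_all add: insert_commute)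
  qed
  have "iso_vars (iso_ext (iso_ext Cst j) k :: complex poly poly \<Rightarrow> 3 cpoly) {k, j}"
    by (intro iso_vars_ext iso_vars_Cst) (use jk in auto)
  moreover have "i \<notin> {k, j}" "insert i {k, j} = UNIV" using jk by auto
  ultimately show ?thesis
    by (intro exI[of _ "iso_ext (iso_ext Cst j) k"] exI[of _ "{k, j}"] conjI)
qed

text \<open>The variables are the coefficients of two planes. \<open>Inr None\<close>, the constant
  term of the second plane, is kept outermost because it is the variable that is eliminated from
  Chow forms.\<close>

lemma iso_vars_8:
  "\<exists>(\<phi> :: complex poly poly poly poly poly poly poly \<Rightarrow> (3 option + 3 option) cpoly) I.
     iso_vars \<phi> I \<and> Inr None \<notin> I \<and> insert (Inr None) I = UNIV"
proof -
  let ?\<phi> = "iso_ext (iso_ext (iso_ext (iso_ext (iso_ext (iso_ext (iso_ext Cst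
     (Inl None)) (Inl (Some 1))) (Inl (Some 2))) (Inl (Some 3))) (Inr (Some 1))) (Inr (Some 2))) (Inr (Some 3))
     :: complex poly poly poly poly poly poly poly \<Rightarrow> (3 option + 3 option) cpoly"
  let ?I = "{Inr (Some 3), Inr (Some 2), Inr (Some 1), Inl (Some 3), Inl (Some 2), Inl (Some 1), Inl None}
     :: (3 option + 3 option) set"
  have iso: "iso_vars ?\<phi> ?I"
    by (intro iso_vars_ext iso_vars_Cst) auto
  have "x \<in> insert (Inr None) ?I" for x :: "3 option + 3 option"
  proof -
    have *: "y = None \<or> y = Some 1 \<or> y = Some 2 \<or> y = Some 3" for y :: "3 option"
    proof (cases y)
      case (Some z) then show ?thesis using exhaust_3[of z] by blast
    qed blast
    show ?thesis
    proof (cases x)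
      case (Inl y) then show ?thesis using *[of y] by blast
    next
      case (Inr y) then show ?thesis using *[of y] by blast
    qed
  qed
  then have un: "insert (Inr None) ?I = UNIV" by (intro UNIV_eq_I[symmetric])
  have "Inr None \<notin> ?I" by simp
  show ?thesis
    by (rule exI[of _ ?\<phi>], rule exI[of _ ?I], intro conjI iso un) simp
qed

text \<open>\<open>l\<close> is the leading coefficient with respect to the variable
  \<open>i\<close>: where it does not vanish, the specialized polynomial keeps its positive degree
  and has a root.\<close>

lemma iso_vars_root:
  fixes \<phi> :: "'a::{factorial_ring_gcd, semiring_gcd_mult_normalize} \<Rightarrow> 'i cpoly"
  assumes iso: "iso_vars \<phi> I" and i: "i \<notin> I" "insert i I = UNIV" and f: "i \<in> poly_vars f"
  shows "\<exists>l. l \<noteq> 0 \<and> (\<forall>x. poly_eval l x \<noteq> 0 \<longrightarrow> (\<exists>t. poly_eval f (x(i := t)) = 0))"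
proof -
  let ?\<psi> = "iso_ext \<phi> i"
  have iso': "iso_vars ?\<psi> UNIV" using iso_vars_ext[OF iso i(1)] i(2) by simp
  obtain F where F: "f = ?\<psi> F" using iso_surj[OF iso'] by blast
  have "i \<notin> poly_vars (?\<psi> [:h:])" for h
    using iso_ext_const[OF iso, of i h] iso_range[OF iso] i(1) by auto
  then have deg: "degree F > 0" using f F degree_eq_zeroE[of F] by (cases "degree F = 0") auto
  have "\<exists>t. poly_eval f (x(i := t)) = 0" if x: "poly_eval (\<phi> (lead_coeff F)) x \<noteq> 0" for x
  proof -
    let ?q = "map_poly (\<lambda>a. poly_eval (\<phi> a) x) F"
    have "coeff ?q (degree F) \<noteq> 0" using x by (simp add: coeff_map_poly iso_0[OF iso])
    then have "degree F \<le> degree ?q" by (rule le_degree)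
    then have "\<not> constant (poly ?q)" using deg by (simp add: constant_degree)
    then obtain t where "poly ?q t = 0" using fundamental_theorem_of_algebra by blast
    then show ?thesis using iso_ext_eval[OF iso i(1), of F x t] F by auto
  qed
  moreover have "\<phi> (lead_coeff F) \<noteq> 0" using deg by (subst iso_eq_0_iff[OF iso]) auto
  ultimately show ?thesis by (intro exI[of _ "\<phi> (lead_coeff F)"]) simp
qed

lemma poly_eval_eq_0_3: "(\<And>x. poly_eval p x = 0) \<Longrightarrow> p = (0 :: 3 cpoly)"
proof -
  assume z: "\<And>x. poly_eval p x = 0"
  obtain \<phi> :: "complex poly poly \<Rightarrow> 3 cpoly" and I where *: "iso_vars \<phi> I" "1 \<notin> I" "insert 1 I = UNIV"
    using iso_vars_3[of 1] by blast
  have iso: "iso_vars (iso_ext \<phi> 1) UNIV" using iso_vars_ext[OF *(1,2)] *(3) by simp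
  obtain q where "p = iso_ext \<phi> 1 q" using iso_surj[OF iso] by blast
  then show "p = 0" using z iso_eval[OF iso, of q] iso_0[OF iso] by simp
qed

lemma poly_eval_eq_0_8: "(\<And>x. poly_eval p x = 0) \<Longrightarrow> p = (0 :: (3 option + 3 option) cpoly)"
proof -
  assume z: "\<And>x. poly_eval p x = 0"
  obtain \<phi> :: "complex poly poly poly poly poly poly poly \<Rightarrow> (3 option + 3 option) cpoly" and I
    where *: "iso_vars \<phi> I" "Inr None \<notin> I" "insert (Inr None) I = UNIV"
    using iso_vars_8 by blast
  have iso: "iso_vars (iso_ext \<phi> (Inr None)) UNIV" using iso_vars_ext[OF *(1,2)] *(3) by simp
  obtain q where "p = iso_ext \<phi> (Inr None) q" using iso_surj[OF iso] by blast
  then show "p = 0" using z iso_eval[OF iso, of q] iso_0[OF iso] by simp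
qed

lemma irreducible_dvd_mult_3:
  fixes F :: "3 cpoly"
  assumes "irreducible F" "F dvd a * b"
  shows "F dvd a \<or> F dvd b"
proof -
  obtain \<phi> :: "complex poly poly \<Rightarrow> 3 cpoly" and I where *: "iso_vars \<phi> I" "1 \<notin> I" "insert 1 I = UNIV"
    using iso_vars_3[of 1] by blast
  have iso: "iso_vars (iso_ext \<phi> 1) UNIV" using iso_vars_ext[OF *(1,2)] *(3) by simp
  show ?thesis by (rule iso_vars_irreducible_prime[OF iso assms])
qed

lemma irreducible_dvd_mult_8:
  fixes F :: "(3 option + 3 option) cpoly"
  assumes "irreducible F" "F dvd a * b"
  shows "F dvd a \<or> F dvd b"
proof -
  obtain \<phi> :: "complex poly poly poly poly poly poly poly \<Rightarrow> (3 option + 3 option) cpoly" and I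
    where *: "iso_vars \<phi> I" "Inr None \<notin> I" "insert (Inr None) I = UNIV"
    using iso_vars_8 by blast
  have iso: "iso_vars (iso_ext \<phi> (Inr None)) UNIV" using iso_vars_ext[OF *(1,2)] *(3) by simp
  show ?thesis by (rule iso_vars_irreducible_prime[OF iso assms])
qed

lemma irreducible_elimination_8:
  fixes F :: "(3 option + 3 option) cpoly"
  assumes "irreducible F" "Inr None \<in> poly_vars F" "\<not> F dvd G"
  obtains A B H where "A * F + B * G = H" "H \<noteq> 0" "Inr None \<notin> poly_vars H"
proof -
  obtain \<phi> :: "complex poly poly poly poly poly poly poly \<Rightarrow> (3 option + 3 option) cpoly" and I
    where *: "iso_vars \<phi> I" "Inr None \<notin> I" "insert (Inr None) I = UNIV"
    using iso_vars_8 by blast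
  show ?thesis using iso_vars_elimination[OF * assms] that by blast
qed

lemma cpoly_0_neq_poly_vars: "poly_vars p = {} \<Longrightarrow> p = Cst (Poly_Mapping.lookup p 0)"
proof -
  assume "poly_vars p = {}"
  then have "poly_vars p \<subseteq> {}" by simp
  then have "\<exists>c. p = Cst c"
    by (induction rule: cpoly_vars_induct) (auto simp flip: Cst_add Cst_mult)
  then show ?thesis by (auto simp: Cst_def)
qed

text \<open>Otherwise eliminating a variable \<open>i\<close> of \<open>f\<close> gives a nonzero
  combination \<open>H\<close> of \<open>f\<close> and \<open>g\<close> free of \<open>i\<close>. At
  a point where \<open>H\<close> and the leading coefficient of \<open>f\<close> are nonzero,
  changing the coordinate \<open>i\<close> alone reaches a zero of \<open>f\<close>, hence of
  \<open>g\<close>, while \<open>H\<close> keeps its nonzero value.\<close>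

lemma hypersurface_nullstellensatz:
  fixes f g :: "3 cpoly"
  assumes f: "irreducible f" and van: "zero_set f \<subseteq> zero_set g"
  shows "f dvd g"
proof (rule ccontr)
  assume ndvd: "\<not> f dvd g"
  have "poly_vars f \<noteq> {}"
  proof
    assume "poly_vars f = {}"
    then obtain c where c: "f = Cst c" using cpoly_0_neq_poly_vars by blast
    with f have "c \<noteq> 0" by (auto simp: irreducible_def)
    then have "f * Cst (1 / c) = 1" by (simp add: c flip: Cst_mult)
    then have "f dvd 1" by (metis dvdI)
    with f show False by (auto simp: irreducible_def)
  qed
  then obtain i where i: "i \<in> poly_vars f" by blast
  obtain \<phi> :: "complex poly poly \<Rightarrow> 3 cpoly" and I where *: "iso_vars \<phi> I" "i \<notin> I" "insert i I = UNIV"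
    using iso_vars_3[of i] by blast
  obtain A B H where H: "A * f + B * g = H" "H \<noteq> 0" "i \<notin> poly_vars H"
    using iso_vars_elimination[OF * f i ndvd] by blast
  obtain l where l: "l \<noteq> 0" "\<And>x. poly_eval l x \<noteq> 0 \<Longrightarrow> \<exists>t. poly_eval f (x(i := t)) = 0"
    using iso_vars_root[OF * i] by blast
  obtain y where y: "poly_eval H y \<noteq> 0" using H(2) poly_eval_eq_0_3 by blast
  obtain z where z: "poly_eval l z \<noteq> 0" using l(1) poly_eval_eq_0_3 by blast
  obtain x where x: "poly_eval H x \<noteq> 0" "poly_eval l x \<noteq> 0"
    using pfun_common_nonzero[OF pfun_poly_eval[OF order_refl] y pfun_poly_eval[OF order_refl] z] by blast
  obtain t where t: "poly_eval f (x(i := t)) = 0" using l(2)[OF x(2)] by blast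
  then have "poly_eval g (x(i := t)) = 0" using van by (auto simp: zero_set_def)
  with t have "poly_eval H (x(i := t)) = 0" by (simp flip: H(1))
  moreover have "poly_eval H (x(i := t)) = poly_eval H x" using H(3) by (intro poly_eval_cong) auto
  ultimately show False using x by simp
qed

subsection \<open>Constructible predicates and elimination of quantifiers\<close>

inductive_set PF :: "(('v \<Rightarrow> complex) \<Rightarrow> complex) set" where
  PF_const: "(\<lambda>e. c) \<in> PF"
| PF_var: "(\<lambda>e. e v) \<in> PF"
| PF_add: "P \<in> PF \<Longrightarrow> Q \<in> PF \<Longrightarrow> (\<lambda>e. P e + Q e) \<in> PF"
| PF_mult: "P \<in> PF \<Longrightarrow> Q \<in> PF \<Longrightarrow> (\<lambda>e. P e * Q e) \<in> PF"

text \<open>Definable conditions are kept as predicates on environments instead of formulas, so that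
  eliminating a quantifier is a closure property of \<open>CP\<close>. Each predicate involves
  finitely many variables even if the variable type is infinite.\<close>

inductive_set CP :: "(('v \<Rightarrow> complex) \<Rightarrow> bool) set" where
  CP_eq: "P \<in> PF \<Longrightarrow> (\<lambda>e. P e = 0) \<in> CP"
| CP_not: "\<phi> \<in> CP \<Longrightarrow> (\<lambda>e. \<not> \<phi> e) \<in> CP"
| CP_conj: "\<phi> \<in> CP \<Longrightarrow> \<psi> \<in> CP \<Longrightarrow> (\<lambda>e. \<phi> e \<and> \<psi> e) \<in> CP"

lemma PF_diff: "P \<in> PF \<Longrightarrow> Q \<in> PF \<Longrightarrow> (\<lambda>e. P e - Q e) \<in> PF"
  using PF_add[OF _ PF_mult[OF PF_const[of "-1"]], of P Q] by simp

lemma PF_uminus: "P \<in> PF \<Longrightarrow> (\<lambda>e. - P e) \<in> PF"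
  using PF_mult[OF PF_const[of "-1"]] by simp

lemma PF_sum: "(\<And>a. a \<in> A \<Longrightarrow> P a \<in> PF) \<Longrightarrow> (\<lambda>e. \<Sum>a\<in>A. P a e) \<in> PF"
  by (induction A rule: infinite_finite_induct) (auto intro: PF_const PF_add)

lemma PF_prod: "(\<And>a. a \<in> A \<Longrightarrow> P a \<in> PF) \<Longrightarrow> (\<lambda>e. \<Prod>a\<in>A. P a e) \<in> PF"
  by (induction A rule: infinite_finite_induct) (auto intro: PF_const PF_mult)

lemma PF_power: "P \<in> PF \<Longrightarrow> (\<lambda>e. P e ^ n) \<in> PF"
  by (induction n) (auto intro: PF_const PF_mult)

lemma PF_poly_eval: "(\<And>i. (\<lambda>e. \<sigma> e i) \<in> PF) \<Longrightarrow> (\<lambda>e. poly_eval g (\<sigma> e)) \<in> PF"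
  unfolding poly_eval_def by (intro PF_sum PF_mult PF_const PF_prod PF_power)

text \<open>The bound \<open>K\<close> depends neither on the substituted polynomials nor on their degree; this is
  what makes all degrees below linear in \<open>D\<close>.\<close>

lemma PF_compose_degree:
  fixes P :: "('v \<Rightarrow> complex) \<Rightarrow> complex"
  assumes "P \<in> PF"
  shows "\<exists>K. \<forall>D (\<sigma> :: ('i \<Rightarrow> complex) \<Rightarrow> 'v \<Rightarrow> complex). (\<forall>v. pfun D (\<lambda>p. \<sigma> p v)) \<longrightarrow> pfun (K * D) (\<lambda>p. P (\<sigma> p))"
  using assms
proof induction
  case (PF_const c)
  then show ?case by (auto intro: pfun_const)
next
  case (PF_var v)
  then show ?case by (intro exI[of _ 1]) auto
next
  case (PF_add P Q)
  from PF_add.IH(1) obtain K where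
    K: "\<forall>D (\<sigma> :: ('i \<Rightarrow> complex) \<Rightarrow> 'v \<Rightarrow> complex). (\<forall>v. pfun D (\<lambda>p. \<sigma> p v)) \<longrightarrow> pfun (K * D) (\<lambda>p. P (\<sigma> p))" ..
  from PF_add.IH(2) obtain L where
    L: "\<forall>D (\<sigma> :: ('i \<Rightarrow> complex) \<Rightarrow> 'v \<Rightarrow> complex). (\<forall>v. pfun D (\<lambda>p. \<sigma> p v)) \<longrightarrow> pfun (L * D) (\<lambda>p. Q (\<sigma> p))" ..
  show ?case
    by (intro exI[of _ "K + L"] allI impI pfun_add pfun_mono[OF K[rule_format]] pfun_mono[OF L[rule_format]]) (auto simp: algebra_simps)
next
  case (PF_mult P Q)
  from PF_mult.IH(1) obtain K where
    K: "\<forall>D (\<sigma> :: ('i \<Rightarrow> complex) \<Rightarrow> 'v \<Rightarrow> complex). (\<forall>v. pfun D (\<lambda>p. \<sigma> p v)) \<longrightarrow> pfun (K * D) (\<lambda>p. P (\<sigma> p))" ..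
  from PF_mult.IH(2) obtain L where
    L: "\<forall>D (\<sigma> :: ('i \<Rightarrow> complex) \<Rightarrow> 'v \<Rightarrow> complex). (\<forall>v. pfun D (\<lambda>p. \<sigma> p v)) \<longrightarrow> pfun (L * D) (\<lambda>p. Q (\<sigma> p))" ..
  show ?case
    by (intro exI[of _ "K + L"] allI impI pfun_mult[OF K[rule_format] L[rule_format]]) (auto simp: algebra_simps)
qed

lemma CP_neq: "P \<in> PF \<Longrightarrow> (\<lambda>e. P e \<noteq> 0) \<in> CP"
  by (intro CP_not CP_eq)

lemma CP_eq2: "P \<in> PF \<Longrightarrow> Q \<in> PF \<Longrightarrow> (\<lambda>e. P e = Q e) \<in> CP"
  using CP_eq[OF PF_diff, of P Q] by simp

lemma CP_disj:
  assumes "\<phi> \<in> CP" "\<psi> \<in> CP"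
  shows "(\<lambda>e. \<phi> e \<or> \<psi> e) \<in> CP"
proof -
  have "(\<lambda>e. \<not> (\<not> \<phi> e \<and> \<not> \<psi> e)) \<in> CP" by (intro CP_not CP_conj assms)
  then show ?thesis by simp
qed

lemma CP_imp:
  assumes "\<phi> \<in> CP" "\<psi> \<in> CP"
  shows "(\<lambda>e. \<phi> e \<longrightarrow> \<psi> e) \<in> CP"
proof -
  have "(\<lambda>e. \<not> \<phi> e \<or> \<psi> e) \<in> CP" by (intro CP_not CP_disj assms)
  then show ?thesis by simp
qed

lemma CP_const: "(\<lambda>e. b) \<in> CP"
proof -
  have "(\<lambda>e. (if b then 0 else 1 :: complex) = 0) \<in> CP" by (rule CP_eq[OF PF_const])
  moreover have "((if b then 0 else 1 :: complex) = 0) = b" by simp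
  ultimately show ?thesis by (simp only:)
qed

lemma CP_ball: "finite A \<Longrightarrow> (\<And>a. a \<in> A \<Longrightarrow> \<phi> a \<in> CP) \<Longrightarrow> (\<lambda>e. \<forall>a\<in>A. \<phi> a e) \<in> CP"
  by (induction rule: finite_induct) (auto intro: CP_const CP_conj)

lemma CP_bex: "finite A \<Longrightarrow> (\<And>a. a \<in> A \<Longrightarrow> \<phi> a \<in> CP) \<Longrightarrow> (\<lambda>e. \<exists>a\<in>A. \<phi> a e) \<in> CP"
  by (induction rule: finite_induct) (auto intro: CP_const CP_disj)

text \<open>Both the elimination of a quantifier and the later argument about generic points work
  with the pattern of vanishing polynomials only.\<close>

lemma CP_normal_form:
  assumes "\<phi> \<in> CP"
  shows "\<exists>\<P> B. finite \<P> \<and> \<P> \<subseteq> PF \<and> (\<forall>e. \<phi> e \<longleftrightarrow> {P\<in>\<P>. P e = 0} \<in> B)"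
  using assms
proof induction
  case (CP_eq P)
  have "P e = 0 \<longleftrightarrow> {Q\<in>{P}. Q e = 0} \<in> {{P}}" for e by auto
  then show ?case using CP_eq by (intro exI[of _ "{P}"] exI[of _ "{{P}}"]) blast
next
  case (CP_not \<phi>)
  then obtain \<P> B where *: "finite \<P>" "\<P> \<subseteq> PF" "\<And>e. \<phi> e \<longleftrightarrow> {P\<in>\<P>. P e = 0} \<in> B" by blast
  then show ?case by (intro exI[of _ \<P>] exI[of _ "- B"]) auto
next
  case (CP_conj \<phi> \<psi>)
  then obtain \<P> B \<Q> C where *: "finite \<P>" "\<P> \<subseteq> PF" "\<And>e. \<phi> e \<longleftrightarrow> {P\<in>\<P>. P e = 0} \<in> B"
    "finite \<Q>" "\<Q> \<subseteq> PF" "\<And>e. \<psi> e \<longleftrightarrow> {P\<in>\<Q>. P e = 0} \<in> C" by blast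
  have "\<phi> e \<and> \<psi> e \<longleftrightarrow> {P\<in>\<P> \<union> \<Q>. P e = 0} \<in> {S. S \<inter> \<P> \<in> B \<and> S \<inter> \<Q> \<in> C}" for e
  proof -
    have "{P\<in>\<P> \<union> \<Q>. P e = 0} \<inter> \<P> = {P\<in>\<P>. P e = 0}" "{P\<in>\<P> \<union> \<Q>. P e = 0} \<inter> \<Q> = {P\<in>\<Q>. P e = 0}" by auto
    then show ?thesis using * by simp
  qed
  then show ?case using *(1,2,4,5)
    by (intro exI[of _ "\<P> \<union> \<Q>"] exI[of _ "{S. S \<inter> \<P> \<in> B \<and> S \<inter> \<Q> \<in> C}"]) auto
qed

text \<open>\<open>b\<close> counts coefficients and is a formal bound, so \<open>b = 0\<close>
  forces the zero polynomial, and the degree may drop at special environments. The algorithms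
  therefore split on the formal leading coefficient, at index \<open>b - 1\<close>.\<close>

definition PFP :: "nat \<Rightarrow> (('v \<Rightarrow> complex) \<Rightarrow> complex poly) \<Rightarrow> bool" where
  "PFP b Q \<longleftrightarrow> (\<forall>e. \<forall>j\<ge>b. coeff (Q e) j = 0) \<and> (\<forall>j. (\<lambda>e. coeff (Q e) j) \<in> PF)"

lemma PFP_coeff: "PFP b Q \<Longrightarrow> (\<lambda>e. coeff (Q e) j) \<in> PF"
  by (simp add: PFP_def)

lemma PFP_zero: "PFP b Q \<Longrightarrow> j \<ge> b \<Longrightarrow> coeff (Q e) j = 0"
  by (simp add: PFP_def)

lemma PFP_mono: "PFP b Q \<Longrightarrow> b \<le> c \<Longrightarrow> PFP c Q"
  by (auto simp: PFP_def)

lemma PFP_add: "PFP b P \<Longrightarrow> PFP b Q \<Longrightarrow> PFP b (\<lambda>e. P e + Q e)"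
  by (simp add: PFP_def PF_add)

lemma PFP_diff: "PFP b P \<Longrightarrow> PFP b Q \<Longrightarrow> PFP b (\<lambda>e. P e - Q e)"
  by (simp add: PFP_def PF_diff)

lemma PFP_mult: "PFP b P \<Longrightarrow> PFP c Q \<Longrightarrow> PFP (b + c) (\<lambda>e. P e * Q e)"
proof -
  assume P: "PFP b P" and Q: "PFP c Q"
  have "coeff (P e * Q e) j = 0" if "j \<ge> b + c" for e j
    unfolding coeff_mult
  proof (rule sum.neutral, safe)
    fix i assume "i \<le> j"
    show "coeff (P e) i * coeff (Q e) (j - i) = 0"
      using PFP_zero[OF P, of i e] PFP_zero[OF Q, of "j - i" e] that by (cases "i \<ge> b") auto
  qed
  moreover have "(\<lambda>e. coeff (P e * Q e) j) \<in> PF" for j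
    unfolding coeff_mult by (intro PF_sum PF_mult PFP_coeff[OF P] PFP_coeff[OF Q])
  ultimately show ?thesis by (simp add: PFP_def)
qed

lemma PFP_monom: "P \<in> PF \<Longrightarrow> PFP (Suc n) (\<lambda>e. monom (P e) n)"
proof -
  assume P: "P \<in> PF"
  have "(\<lambda>e. coeff (monom (P e) n) j) \<in> PF" for j
    by (cases "n = j") (simp_all add: P PF_const)
  then show ?thesis by (simp add: PFP_def)
qed

lemma PFP_const: "P \<in> PF \<Longrightarrow> PFP 1 (\<lambda>e. [:P e:])"
  using PFP_monom[of P 0] by (simp add: monom_0)

lemma PFP_prod: "finite A \<Longrightarrow> (\<And>a. a \<in> A \<Longrightarrow> \<exists>b. PFP b (P a)) \<Longrightarrow> \<exists>b. PFP b (\<lambda>e. \<Prod>a\<in>A. P a e)"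
proof (induction rule: finite_induct)
  case empty
  show ?case using PFP_const[OF PF_const[of 1]] by (auto simp: one_pCons)
next
  case (insert a A)
  then obtain b where b: "PFP b (\<lambda>e. \<Prod>a\<in>A. P a e)" by auto
  obtain c where "PFP c (P a)" using insert.prems by blast
  from PFP_mult[OF this b] show ?case using insert.hyps by auto
qed

lemma PF_univariate:
  assumes "P \<in> PF"
  shows "\<exists>b Q. PFP b Q \<and> (\<forall>e x. P (e(v := x)) = poly (Q e) x)"
  using assms
proof induction
  case (PF_const c)
  show ?case using PFP_const[OF PF.PF_const[of c]] by (intro exI[of _ 1] exI[of _ "\<lambda>e. [:c:]"]) auto
next
  case (PF_var w)
  show ?case
  proof (cases "w = v")
    case True
    then show ?thesis using PFP_monom[OF PF.PF_const[of 1], of 1]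
      by (intro exI[of _ 2] exI[of _ "\<lambda>e. monom 1 1"]) (auto simp: poly_monom numeral_2_eq_2)
  next
    case False
    then show ?thesis using PFP_const[OF PF.PF_var[of w]] by (intro exI[of _ 1] exI[of _ "\<lambda>e. [:e w:]"]) auto
  qed
next
  case (PF_add P Q)
  from PF_add.IH(1) obtain b P' where P: "PFP b P'" "\<forall>e x. P (e(v := x)) = poly (P' e) x" by blast
  from PF_add.IH(2) obtain c Q' where Q: "PFP c Q'" "\<forall>e x. Q (e(v := x)) = poly (Q' e) x" by blast
  note * = P(1) Q(1) P(2) Q(2)
  have "PFP (max b c) (\<lambda>e. P' e + Q' e)"
    by (intro PFP_add PFP_mono[OF *(1)] PFP_mono[OF *(2)]) auto
  with * show ?case
    by (intro exI[of _ "max b c"] exI[of _ "\<lambda>e. P' e + Q' e"]) (auto simp del: fun_upd_apply)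
next
  case (PF_mult P Q)
  from PF_mult.IH(1) obtain b P' where P: "PFP b P'" "\<forall>e x. P (e(v := x)) = poly (P' e) x" by blast
  from PF_mult.IH(2) obtain c Q' where Q: "PFP c Q'" "\<forall>e x. Q (e(v := x)) = poly (Q' e) x" by blast
  note * = P(1) Q(1) P(2) Q(2)
  with PFP_mult[OF *(1,2)] show ?case
    by (intro exI[of _ "b + c"] exI[of _ "\<lambda>e. P' e * Q' e"]) (auto simp del: fun_upd_apply)
qed

lemma PFP_eq_0: "PFP b Q \<Longrightarrow> (\<lambda>e. Q e = 0) \<in> CP"
proof -
  assume Q: "PFP b Q"
  have "Q e = 0 \<longleftrightarrow> (\<forall>j\<in>{..<b}. coeff (Q e) j = 0)" for e
    using PFP_zero[OF Q, of _ e] by (auto simp: poly_eq_iff) (metis not_le lessThan_iff)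
  then show ?thesis using CP_ball[of "{..<b}" "\<lambda>j e. coeff (Q e) j = 0"] CP_eq[OF PFP_coeff[OF Q]] by simp
qed

lemma PFP_truncate:
  assumes "PFP (Suc n) P"
  shows "PFP n (\<lambda>e. P e - monom (coeff (P e) n) n)"
proof -
  have "PFP (Suc n) (\<lambda>e. P e - monom (coeff (P e) n) n)"
    by (intro PFP_diff assms PFP_monom PFP_coeff[OF assms])
  moreover have "coeff (P e - monom (coeff (P e) n) n) n = 0" for e by simp
  ultimately show ?thesis unfolding PFP_def by (metis le_antisym not_less_eq_eq)
qed

text \<open>One step of pseudo-division at formal degrees: the terms of index \<open>m\<close>
  cancel without division by a coefficient.\<close>

lemma PFP_reduce:
  assumes P: "PFP (Suc n) P" and R: "PFP (Suc m) R" and "n \<le> m"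
  shows "PFP m (\<lambda>e. smult (coeff (P e) n) (R e) - monom (coeff (R e) m) (m - n) * P e)"
proof -
  have "PFP (Suc m) (\<lambda>e. [:coeff (P e) n:] * R e)"
    unfolding PFP_def using R by (auto simp: PFP_def intro: PF_mult PFP_coeff[OF P])
  then have 1: "PFP (Suc m) (\<lambda>e. smult (coeff (P e) n) (R e))" by simp
  have co: "coeff (monom (coeff (R e) m) (m - n) * P e) j =
      (if j < m - n then 0 else coeff (R e) m * coeff (P e) (j - (m - n)))" for e j
    by (simp add: coeff_monom_mult)
  have "PFP (Suc m) (\<lambda>e. monom (coeff (R e) m) (m - n) * P e)"
    unfolding PFP_def co
  proof (intro conjI allI impI)
    fix j
    show "(\<lambda>e. if j < m - n then 0 else coeff (R e) m * coeff (P e) (j - (m - n))) \<in> PF"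
      by (cases "j < m - n") (auto intro!: PF_const PF_mult PFP_coeff[OF P] PFP_coeff[OF R])
  qed (use assms(3) PFP_zero[OF P] in auto)
  with 1 have "PFP (Suc m) (\<lambda>e. smult (coeff (P e) n) (R e) - monom (coeff (R e) m) (m - n) * P e)"
    by (rule PFP_diff)
  moreover have "coeff (smult (coeff (P e) n) (R e) - monom (coeff (R e) m) (m - n) * P e) m = 0" for e
    using assms(3) by (simp add: co)
  ultimately show ?thesis unfolding PFP_def by (metis le_antisym not_less_eq_eq)
qed

text \<open>Multiplying by the formal leading coefficient, which the first conjunct makes nonzero,
  does not change divisibility, so pseudo-division lowers the bound of \<open>R\<close> step by
  step. Below index \<open>n\<close> divisibility means \<open>R e = 0\<close>.\<close>

lemma CP_dvd:
  assumes P: "PFP (Suc n) P" and "PFP m R"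
  shows "(\<lambda>e. coeff (P e) n \<noteq> 0 \<and> P e dvd R e) \<in> CP"
  using assms(2)
proof (induction m arbitrary: R)
  case 0
  then have "R e = 0" for e by (simp add: PFP_def poly_eq_iff)
  then show ?case using CP_neq[OF PFP_coeff[OF P]] by simp
next
  case (Suc m)
  show ?case
  proof (cases "n \<le> m")
    case True
    let ?R = "\<lambda>e. smult (coeff (P e) n) (R e) - monom (coeff (R e) m) (m - n) * P e"
    have "(\<lambda>e. coeff (P e) n \<noteq> 0 \<and> P e dvd ?R e) \<in> CP"
      by (rule Suc.IH[OF PFP_reduce[OF P Suc.prems True]])
    moreover have "(coeff (P e) n \<noteq> 0 \<and> P e dvd ?R e) = (coeff (P e) n \<noteq> 0 \<and> P e dvd R e)" for e
    proof -
      have d: "P e dvd monom (coeff (R e) m) (m - n) * P e" by simp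
      have "P e dvd ?R e \<longleftrightarrow> P e dvd smult (coeff (P e) n) (R e)"
        using dvd_diff[OF _ d] dvd_add[OF _ d, of "?R e"] by auto
      then show ?thesis by (auto simp: dvd_smult_iff)
    qed
    ultimately show ?thesis by simp
  next
    case False
    have "(coeff (P e) n \<noteq> 0 \<and> P e dvd R e) = (coeff (P e) n \<noteq> 0 \<and> R e = 0)" for e
    proof safe
      assume c: "coeff (P e) n \<noteq> 0" and d: "P e dvd R e"
      show "R e = 0"
      proof (rule ccontr)
        assume nz: "R e \<noteq> 0"
        with d have "degree (P e) \<le> degree (R e)" by (rule dvd_imp_degree_le)
        moreover have "n \<le> degree (P e)" using c by (rule le_degree)
        moreover have "degree (R e) < Suc m"
          using PFP_zero[OF Suc.prems, of _ e] nz by (metis leading_coeff_0_iff not_le)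
        ultimately show False using False by simp
      qed
    qed auto
    then show ?thesis using CP_conj[OF CP_neq[OF PFP_coeff[OF P]] PFP_eq_0[OF Suc.prems]] by simp
  qed
qed

text \<open>The exponent is a degree bound instead of the degree, so that divisibility is asked for
  the same power of \<open>Q\<close> at all environments.\<close>

lemma poly_ex_root_nonroot:
  assumes "P \<noteq> (0 :: complex poly)" "degree P \<le> n"
  shows "(\<exists>x. poly P x = 0 \<and> poly Q x \<noteq> 0) \<longleftrightarrow> \<not> P dvd Q ^ n"
proof -
  have "(\<exists>x. poly P x = 0 \<and> poly Q x \<noteq> 0) \<longleftrightarrow> \<not> P dvd Q ^ degree P"
    using nullstellensatz_univariate[of P Q] assms(1) by blast
  moreover have "P dvd Q ^ degree P \<longleftrightarrow> P dvd Q ^ n"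
  proof
    show "P dvd Q ^ degree P \<Longrightarrow> P dvd Q ^ n"
      using assms(2) by (meson dvd_trans le_imp_power_dvd)
    assume "P dvd Q ^ n"
    then have "\<forall>x. poly P x = 0 \<longrightarrow> poly Q x = 0"
      by (metis dvdE mult_eq_0_iff poly_mult poly_power power_eq_0_iff)
    then show "P dvd Q ^ degree P" using nullstellensatz_univariate assms(1) by blast
  qed
  ultimately show ?thesis by simp
qed

text \<open>The Euclidean algorithm with parameters. Of two polynomials the one with the smaller
  bound is truncated if its formal leading coefficient is 0, and reduces the other one if not. A
  single remaining equation is settled by divisibility of a power of \<open>Q\<close>. The measure
  counts \<open>Suc b\<close>, so that deleting a zero polynomial decreases it too.\<close>

lemma CP_ex_core:
  assumes "\<And>b P. (b, P) \<in> set Ps \<Longrightarrow> PFP b P" and Q: "PFP bq Q"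
  shows "(\<lambda>e. \<exists>x. (\<forall>(b, P)\<in>set Ps. poly (P e) x = 0) \<and> poly (Q e) x \<noteq> 0) \<in> CP"
  using assms(1)
proof (induction "\<Sum>(b, P)\<leftarrow>Ps. Suc b" arbitrary: Ps rule: less_induct)
  case less
  show ?case
  proof (cases "\<exists>P. (0, P) \<in> set Ps")
    case True
    then obtain P where P: "(0, P) \<in> set Ps" by blast
    then obtain xs ys where eq: "Ps = xs @ (0, P) # ys" by (meson split_list)
    have z: "P e = 0" for e using less.prems[OF P] by (simp add: PFP_def poly_eq_iff)
    have "(\<lambda>e. \<exists>x. (\<forall>(b, P)\<in>set (xs @ ys). poly (P e) x = 0) \<and> poly (Q e) x \<noteq> 0) \<in> CP"
      by (rule less.hyps) (use less.prems eq in auto)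
    moreover have "(\<forall>(b, P)\<in>set Ps. poly (P e) x = 0) \<longleftrightarrow> (\<forall>(b, P)\<in>set (xs @ ys). poly (P e) x = 0)" for e x
      unfolding eq using z[of e] by auto
    ultimately show ?thesis by (simp only:)
  next
    case nz: False
    have PFPs: "\<exists>n. b = Suc n" if "(b, P) \<in> set Ps" for b P using nz that by (cases b) auto
    consider "Ps = []" | b P where "Ps = [(b, P)]" | b P c R Ps' where "Ps = (b, P) # (c, R) # Ps'"
      by (metis (no_types) list.exhaust prod.exhaust)
    then show ?thesis
    proof cases
      case 1
      have "(\<exists>x. poly (Q e) x \<noteq> 0) \<longleftrightarrow> Q e \<noteq> 0" for e
        using poly_all_0_iff_0[of "Q e"] by blast
      then show ?thesis using CP_not[OF PFP_eq_0[OF Q]] 1 by simp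
    next
      case (2 b P)
      then obtain n where b: "b = Suc n" using PFPs by auto
      have P: "PFP (Suc n) P" using less.prems 2 b by auto
      let ?T = "\<lambda>e. P e - monom (coeff (P e) n) n"
      have "(\<lambda>e. \<exists>x. (\<forall>(b, P)\<in>set [(n, ?T)]. poly (P e) x = 0) \<and> poly (Q e) x \<noteq> 0) \<in> CP"
        by (rule less.hyps) (use 2 b PFP_truncate[OF P] in auto)
      then have t: "(\<lambda>e. \<exists>x. poly (?T e) x = 0 \<and> poly (Q e) x \<noteq> 0) \<in> CP" by simp
      obtain q where q: "PFP q (\<lambda>e. Q e ^ n)"
        using PFP_prod[of "{..<n}" "\<lambda>_. Q"] Q by auto
      have "(\<exists>x. poly (P e) x = 0 \<and> poly (Q e) x \<noteq> 0) \<longleftrightarrow>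
          (coeff (P e) n = 0 \<and> (\<exists>x. poly (?T e) x = 0 \<and> poly (Q e) x \<noteq> 0)) \<or>
          (coeff (P e) n \<noteq> 0 \<and> \<not> (coeff (P e) n \<noteq> 0 \<and> P e dvd Q e ^ n))" for e
      proof (cases "coeff (P e) n = 0")
        case False
        have "degree (P e) \<le> n" by (rule degree_le) (use PFP_zero[OF P] in auto)
        moreover have "P e \<noteq> 0" using False by auto
        ultimately show ?thesis using False poly_ex_root_nonroot[of "P e" n "Q e"] by blast
      qed simp
      then show ?thesis unfolding 2
        using CP_disj[OF CP_conj[OF CP_eq[OF PFP_coeff[OF P, of n]] t]
          CP_conj[OF CP_neq[OF PFP_coeff[OF P, of n]] CP_not[OF CP_dvd[OF P q]]]] by simp
    next
      case (3 b0 P0 c0 R0 Ps')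
      obtain b P c R where bc: "b \<le> c" "set Ps = set ((b, P) # (c, R) # Ps')" "(\<Sum>(b, P)\<leftarrow>Ps. Suc b) = Suc b + (Suc c + (\<Sum>(b, P)\<leftarrow>Ps'. Suc b))"
      proof (cases "b0 \<le> c0")
        case True with 3 that[of b0 c0 P0 R0] show ?thesis by simp
      next
        case False with 3 that[of c0 b0 R0 P0] show ?thesis by (simp add: insert_commute)
      qed
      obtain n m where n: "b = Suc n" and m: "c = Suc m" using PFPs bc(2) by force
      have P: "PFP (Suc n) P" and R: "PFP (Suc m) R" using less.prems bc(2) n m by auto
      have nm: "n \<le> m" using bc n m by simp
      have Ps': "PFP b P" if "(b, P) \<in> set Ps'" for b P using less.prems bc(2) that by auto
      let ?T = "\<lambda>e. P e - monom (coeff (P e) n) n"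
      let ?R = "\<lambda>e. smult (coeff (P e) n) (R e) - monom (coeff (R e) m) (m - n) * P e"
      have t: "(\<lambda>e. \<exists>x. (\<forall>(b, P)\<in>set ((n, ?T) # (c, R) # Ps'). poly (P e) x = 0) \<and> poly (Q e) x \<noteq> 0) \<in> CP"
        by (rule less.hyps) (use bc n m Ps' PFP_truncate[OF P] R in auto)
      have r: "(\<lambda>e. \<exists>x. (\<forall>(b, P)\<in>set ((b, P) # (m, ?R) # Ps'). poly (P e) x = 0) \<and> poly (Q e) x \<noteq> 0) \<in> CP"
        by (rule less.hyps) (use bc n m Ps' PFP_reduce[OF P R nm] P in auto)
      have "(\<exists>x. (\<forall>(b, P)\<in>set Ps. poly (P e) x = 0) \<and> poly (Q e) x \<noteq> 0) \<longleftrightarrow>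
          (coeff (P e) n = 0 \<and> (\<exists>x. (\<forall>(b, P)\<in>set ((n, ?T) # (c, R) # Ps'). poly (P e) x = 0) \<and> poly (Q e) x \<noteq> 0)) \<or>
          (coeff (P e) n \<noteq> 0 \<and> (\<exists>x. (\<forall>(b, P)\<in>set ((b, P) # (m, ?R) # Ps'). poly (P e) x = 0) \<and> poly (Q e) x \<noteq> 0))" for e
        unfolding bc(2) by (cases "coeff (P e) n = 0") auto
      then show ?thesis
        using CP_disj[OF CP_conj[OF CP_eq[OF PFP_coeff[OF P, of n]] t]
          CP_conj[OF CP_neq[OF PFP_coeff[OF P, of n]] r]] by simp
    qed
  qed
qed

text \<open>Fix the set \<open>S\<close> of polynomials that vanish at the witness. The others must
  not vanish, which is one condition on their product, so each of the finitely many \<open>S\<close>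
  is an instance of \<open>CP_ex_core\<close>.\<close>

lemma CP_ex:
  assumes "\<phi> \<in> CP"
  shows "(\<lambda>e. \<exists>x. \<phi> (e(v := x))) \<in> CP"
proof -
  obtain \<P> B where *: "finite \<P>" "\<P> \<subseteq> PF" "\<And>e. \<phi> e \<longleftrightarrow> {P\<in>\<P>. P e = 0} \<in> B"
    using CP_normal_form[OF assms] by blast
  have "\<forall>P\<in>\<P>. \<exists>b Q. PFP b Q \<and> (\<forall>e x. P (e(v := x)) = poly (Q e) x)"
    using *(2) by (auto intro!: PF_univariate)
  from bchoice[OF this] obtain b where "\<forall>P\<in>\<P>. \<exists>Q. PFP (b P) Q \<and> (\<forall>e x. P (e(v := x)) = poly (Q e) x)" ..
  from bchoice[OF this] obtain Q where
    Q: "\<forall>P\<in>\<P>. PFP (b P) (Q P) \<and> (\<forall>e x. P (e(v := x)) = poly (Q P e) x)" ..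
  have bQ: "PFP (b P) (Q P)" "P (e(v := x)) = poly (Q P e) x" if "P \<in> \<P>" for P e x
    using Q that by simp_all
  have CPS: "(\<lambda>e. \<exists>x. {P\<in>\<P>. P (e(v := x)) = 0} = S) \<in> CP" if S: "S \<subseteq> \<P>" for S
  proof -
    have "finite S" using S *(1) by (rule finite_subset)
    then obtain xs where xs: "set xs = S" using finite_list by blast
    obtain q where q: "PFP q (\<lambda>e. \<Prod>P\<in>\<P> - S. Q P e)"
      using PFP_prod[of "\<P> - S" Q] bQ(1) *(1) by blast
    have "(\<lambda>e. \<exists>x. (\<forall>(b, P)\<in>set (map (\<lambda>P. (b P, Q P)) xs). poly (P e) x = 0) \<and> poly (\<Prod>P\<in>\<P> - S. Q P e) x \<noteq> 0) \<in> CP"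
      by (rule CP_ex_core[OF _ q]) (use xs S bQ in auto)
    moreover have "{P\<in>\<P>. P (e(v := x)) = 0} = S \<longleftrightarrow>
      (\<forall>(b, P)\<in>set (map (\<lambda>P. (b P, Q P)) xs). poly (P e) x = 0) \<and> poly (\<Prod>P\<in>\<P> - S. Q P e) x \<noteq> 0" for e x
    proof -
      have "{P\<in>\<P>. P (e(v := x)) = 0} = S \<longleftrightarrow> (\<forall>P\<in>S. P (e(v := x)) = 0) \<and> (\<forall>P\<in>\<P> - S. P (e(v := x)) \<noteq> 0)"
        using S by auto
      also have "\<dots> \<longleftrightarrow> (\<forall>P\<in>S. poly (Q P e) x = 0) \<and> (\<forall>P\<in>\<P> - S. poly (Q P e) x \<noteq> 0)"
        using S bQ(2) by (metis DiffD1 subsetD)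
      finally show ?thesis using *(1) by (simp add: xs poly_prod)
    qed
    ultimately show ?thesis by simp
  qed
  have "(\<exists>x. \<phi> (e(v := x))) \<longleftrightarrow> (\<exists>S\<in>B \<inter> Pow \<P>. \<exists>x. {P\<in>\<P>. P (e(v := x)) = 0} = S)" for e
    unfolding *(3) by auto
  then show ?thesis
    using CP_bex[of "B \<inter> Pow \<P>" "\<lambda>S e. \<exists>x. {P\<in>\<P>. P (e(v := x)) = 0} = S"] CPS *(1) by simp
qed

lemma CP_ex_finite:
  assumes "finite V" "\<phi> \<in> CP"
  shows "(\<lambda>e. \<exists>y. \<phi> (\<lambda>v. if v \<in> V then y v else e v)) \<in> CP"
  using assms(1)
proof induction
  case empty
  then show ?case using assms(2) by simp
next
  case (insert w V)
  have "(\<exists>x y. \<phi> (\<lambda>v. if v \<in> V then y v else (e(w := x)) v)) \<longleftrightarrow>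
      (\<exists>y. \<phi> (\<lambda>v. if v \<in> insert w V then y v else e v))" for e
  proof safe
    fix x y assume "\<phi> (\<lambda>v. if v \<in> V then y v else (e(w := x)) v)"
    moreover have "(\<lambda>v. if v \<in> V then y v else (e(w := x)) v) =
      (\<lambda>v. if v \<in> insert w V then (y(w := x)) v else e v)"
      using insert.hyps by auto
    ultimately show "\<exists>y. \<phi> (\<lambda>v. if v \<in> insert w V then y v else e v)" by metis
  next
    fix y assume "\<phi> (\<lambda>v. if v \<in> insert w V then y v else e v)"
    moreover have "(\<lambda>v. if v \<in> V then y v else (e(w := y w)) v) = (\<lambda>v. if v \<in> insert w V then y v else e v)"
      by auto
    ultimately show "\<exists>x y. \<phi> (\<lambda>v. if v \<in> V then y v else (e(w := x)) v)" by metis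
  qed
  then show ?case using CP_ex[OF insert.IH, of w] by simp
qed

lemma CP_all_finite:
  assumes "finite V" "\<phi> \<in> CP"
  shows "(\<lambda>e. \<forall>y. \<phi> (\<lambda>v. if v \<in> V then y v else e v)) \<in> CP"
  using CP_not[OF CP_ex_finite[OF assms(1) CP_not[OF assms(2)]]] by simp

subsection \<open>Dickson's lemma and an effective ascending chain condition\<close>

lemma nat_seq_mono_subseq:
  fixes a :: "nat \<Rightarrow> nat"
  shows "\<exists>s :: nat \<Rightarrow> nat. strict_mono s \<and> mono (\<lambda>n. a (s n))"
proof -
  obtain g where g: "strict_mono g" "monoseq (\<lambda>n. a (g n))" using seq_monosub by blast
  show ?thesis
  proof (cases "mono (\<lambda>n. a (g n))")
    case True
    with g(1) show ?thesis by (intro exI[where x = g] conjI)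
  next
    case False
    then have dec: "a (g n) \<le> a (g m)" if "m \<le> n" for m n
      using g(2) that unfolding monoseq_def mono_def by blast
    obtain N where N: "\<And>n. a (g N) \<le> a (g n)"
      using arg_min_nat_le[of "\<lambda>_. True" _ "\<lambda>n. a (g n)"] by blast
    have "a (g (N + n)) = a (g N)" for n using dec[of N "N + n"] N[of "N + n"] by simp
    then have "mono (\<lambda>n. a (g (N + n)))" by (simp add: mono_def)
    moreover have "strict_mono (\<lambda>n. g (N + n))" using g(1) by (auto simp: strict_mono_def)
    ultimately show ?thesis by (intro exI[where x = "\<lambda>n. g (N + n)"] conjI)
  qed
qed

lemma dickson_subseq:
  fixes a :: "nat \<Rightarrow> 'x \<Rightarrow> nat"
  assumes "finite V"
  shows "\<exists>s :: nat \<Rightarrow> nat. strict_mono s \<and> (\<forall>v\<in>V. mono (\<lambda>n. a (s n) v))"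
  using assms
proof induction
  case empty
  show ?case by (rule exI[where x = "\<lambda>n. n"]) (auto simp: strict_mono_def)
next
  case (insert v V)
  then obtain s :: "nat \<Rightarrow> nat" where s: "strict_mono s" "\<forall>v\<in>V. mono (\<lambda>n. a (s n) v)" by blast
  obtain t :: "nat \<Rightarrow> nat" where t: "strict_mono t" "mono (\<lambda>n. a (s (t n)) v)"
    using nat_seq_mono_subseq[of "\<lambda>n. a (s n) v"] by blast
  have "mono (\<lambda>n. a (s (t n)) w)" if "w \<in> V" for w
    using s(2) that strict_mono_mono[OF t(1)] by (auto simp: mono_def)
  with s(1) t show ?case by (intro exI[where x = "\<lambda>n. s (t n)"]) (auto simp: strict_mono_def)
qed

definition monoms_le :: "'x set \<Rightarrow> nat \<Rightarrow> 'x monom set" where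
  "monoms_le V d = {m. Poly_Mapping.keys m \<subseteq> V \<and> monom_degree m \<le> d}"

lemma finite_monoms_le:
  assumes "finite V"
  shows "finite (monoms_le V d)"
proof -
  have "finite {f. \<forall>x. (x \<in> V \<longrightarrow> f x \<in> {..d}) \<and> (x \<notin> V \<longrightarrow> f x = (0::nat))}"
    by (intro finite_set_of_finite_funs assms) auto
  moreover have "Poly_Mapping.lookup ` monoms_le V d \<subseteq>
      {f. \<forall>x. (x \<in> V \<longrightarrow> f x \<in> {..d}) \<and> (x \<notin> V \<longrightarrow> f x = (0::nat))}"
  proof clarify
    fix m x assume m: "m \<in> monoms_le V d"
    have "Poly_Mapping.lookup m x \<le> monom_degree m"
      unfolding monom_degree_def by (cases "x \<in> Poly_Mapping.keys m")
        (auto simp: in_keys_iff intro: member_le_sum)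
    then show "(x \<in> V \<longrightarrow> Poly_Mapping.lookup m x \<in> {..d}) \<and> (x \<notin> V \<longrightarrow> Poly_Mapping.lookup m x = 0)"
      using m by (auto simp: monoms_le_def in_keys_iff)
  qed
  ultimately have "finite (Poly_Mapping.lookup ` monoms_le V d)" by (rule rev_finite_subset)
  moreover have "inj_on Poly_Mapping.lookup (monoms_le V d)"
    by (intro inj_onI poly_mapping_eqI) metis
  ultimately show ?thesis by (rule finite_imageD)
qed

definition mdvd :: "'x monom \<Rightarrow> 'x monom \<Rightarrow> bool" where
  "mdvd m m' \<longleftrightarrow> (\<forall>i. Poly_Mapping.lookup m i \<le> Poly_Mapping.lookup m' i)"

lemma mdvd_add_diff: "mdvd m m' \<Longrightarrow> (m' - m) + m = m'"
  by (rule poly_mapping_eqI) (auto simp: mdvd_def lookup_add lookup_minus)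

text \<open>The degree of the entry at position \<open>k\<close> is bounded in advance by
  \<open>d k\<close>. This leaves finitely many monomials for each position and makes the length of
  a bad list bounded in terms of \<open>V\<close> and \<open>d\<close> alone.\<close>

definition bad_list :: "'x set \<Rightarrow> (nat \<Rightarrow> nat) \<Rightarrow> 'x monom list \<Rightarrow> bool" where
  "bad_list V d xs \<longleftrightarrow> (\<forall>k<length xs. xs ! k \<in> monoms_le V (d k) \<and> (\<forall>i<k. \<not> mdvd (xs ! i) (xs ! k)))"

lemma bad_list_take: "bad_list V d xs \<Longrightarrow> bad_list V d (take n xs)"
  by (auto simp: bad_list_def)

text \<open>Koenig's lemma turns arbitrarily long bad lists into an infinite one, contradicting Dickson.\<close>

lemma bad_list_bounded:
  assumes V: "finite V"
  shows "\<exists>r. \<forall>xs. bad_list V d xs \<longrightarrow> length xs \<le> r"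
proof (rule ccontr)
  assume "\<not> ?thesis"
  then have long: "\<exists>xs. bad_list V d xs \<and> length xs > r" for r by (meson not_le)
  define P where "P xs \<longleftrightarrow> (\<forall>n. \<exists>ys. bad_list V d ys \<and> length ys > n \<and> take (length xs) ys = xs)"
    for xs :: "'a monom list"
  have P0: "P []" unfolding P_def using long by auto
  have step: "\<exists>x. P (xs @ [x])" if "P xs" for xs
  proof (rule ccontr)
    assume "\<not> ?thesis"
    then have "\<forall>x. \<exists>n. \<forall>ys. length ys > n \<longrightarrow> bad_list V d ys \<longrightarrow> take (Suc (length xs)) ys \<noteq> xs @ [x]"
      by (simp add: P_def)
    then obtain n where n: "\<And>x ys. bad_list V d ys \<Longrightarrow> length ys > n x \<Longrightarrow> take (Suc (length xs)) ys \<noteq> xs @ [x]"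
      by metis
    let ?M = "monoms_le V (d (length xs))"
    obtain ys where ys: "bad_list V d ys" "length ys > Max (n ` ?M) + length xs" "take (length xs) ys = xs"
      using \<open>P xs\<close> unfolding P_def by blast
    let ?x = "ys ! length xs"
    have x: "?x \<in> ?M" using ys by (auto simp: bad_list_def)
    have "n ?x \<le> Max (n ` ?M)" using x finite_monoms_le[OF V] by auto
    then have "length ys > n ?x" using ys(2) by simp
    moreover have "take (Suc (length xs)) ys = xs @ [?x]"
      using ys(2,3) by (simp add: take_Suc_conv_app_nth)
    ultimately show False using n[OF ys(1)] by blast
  qed
  obtain X where X: "\<And>n. P (X n) \<and> length (X n) = n" "\<And>n. \<exists>x. X (Suc n) = X n @ [x]"
  proof -
    have "\<exists>X. \<forall>n. (P (X n) \<and> length (X n) = n) \<and> (\<exists>x. X (Suc n) = X n @ [x])"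
    proof (rule dependent_nat_choice)
      show "\<exists>xs. P xs \<and> length xs = 0" using P0 by simp
      fix xs n assume "P xs \<and> length xs = n"
      then show "\<exists>ys. (P ys \<and> length ys = Suc n) \<and> (\<exists>x. ys = xs @ [x])"
        using step[of xs] by force
    qed
    then show ?thesis using that by blast
  qed
  define m where "m k = X (Suc k) ! k" for k
  have Xm: "X n ! k = m k" if "k < n" for n k
    using that
  proof (induction n)
    case (Suc n)
    obtain x where x: "X (Suc n) = X n @ [x]" using X(2) by blast
    show ?case
    proof (cases "k = n")
      case False
      then show ?thesis using Suc x X(1)[of n] by (simp add: nth_append)
    qed (simp add: m_def)
  qed simp
  have bad: "bad_list V d (X n)" for n
  proof -
    obtain ys where "bad_list V d ys" "take (length (X n)) ys = X n" using X(1)[of n] unfolding P_def by blast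
    then show ?thesis using bad_list_take by metis
  qed
  have mV: "Poly_Mapping.keys (m k) \<subseteq> V" for k
  proof -
    have "X (Suc k) ! k \<in> monoms_le V (d k)"
      using bad[of "Suc k"] X(1)[of "Suc k"] unfolding bad_list_def by simp
    then show ?thesis by (simp add: Xm monoms_le_def)
  qed
  have ndvd: "\<not> mdvd (m i) (m k)" if "i < k" for i k
  proof -
    have "\<not> mdvd (X (Suc k) ! i) (X (Suc k) ! k)"
      using bad[of "Suc k"] X(1)[of "Suc k"] that unfolding bad_list_def by simp
    then show ?thesis using that by (simp add: Xm)
  qed
  obtain s :: "nat \<Rightarrow> nat" where s: "strict_mono s" "\<forall>v\<in>V. mono (\<lambda>n. Poly_Mapping.lookup (m (s n)) v)"
    using dickson_subseq[OF V, of "\<lambda>n. Poly_Mapping.lookup (m n)"] by blast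
  have "mdvd (m (s 0)) (m (s 1))"
    unfolding mdvd_def
  proof
    fix i show "Poly_Mapping.lookup (m (s 0)) i \<le> Poly_Mapping.lookup (m (s 1)) i"
    proof (cases "i \<in> V")
      case True
      then show ?thesis using s(2) by (auto simp: mono_def)
    next
      case False
      then have "i \<notin> Poly_Mapping.keys (m (s 0))" using mV by blast
      then show ?thesis by (simp add: in_keys_iff)
    qed
  qed
  moreover have "s 0 < s 1" using s(1) by (simp add: strict_mono_def)
  ultimately show False using ndvd by blast
qed

text \<open>Degree comes first, so that reducing by a leading monomial never raises the total
  degree; ties are broken by the linear order on monomials, which is compatible with
  addition.\<close>

definition glt :: "'x::linorder monom \<Rightarrow> 'x monom \<Rightarrow> bool" where
  "glt m m' \<longleftrightarrow> monom_degree m < monom_degree m' \<or> monom_degree m = monom_degree m' \<and> m < m'"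

lemma glt_irrefl: "\<not> glt m m" and glt_trans: "glt a b \<Longrightarrow> glt b c \<Longrightarrow> glt a c"
  and glt_total: "a = b \<or> glt a b \<or> glt b a" and glt_add: "glt a b \<Longrightarrow> glt (c + a) (c + b)"
  and glt_degree: "glt a b \<Longrightarrow> monom_degree a \<le> monom_degree b"
  by (auto simp: glt_def add_strict_left_mono)

lemma glt_finite_max:
  assumes "finite S" "S \<noteq> {}"
  shows "\<exists>m\<in>S. \<forall>k\<in>S. k = m \<or> glt k m"
  using assms
proof (induction rule: finite_ne_induct)
  case (insert x F)
  then obtain m where m: "m \<in> F" "\<forall>k\<in>F. k = m \<or> glt k m" by blast
  then show ?case using glt_total[of m x] glt_trans by (metis insertCI insertE)
qed auto

text \<open>A prime ideal given by its membership predicate. Coefficients are thus treated modulo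
  the ideal without forming the residue ring or its field of fractions; the instances used are
  divisibility by \<open>f\<close> and being 0.\<close>

definition prime_pred :: "('a::comm_ring_1 \<Rightarrow> bool) \<Rightarrow> bool" where
  "prime_pred Z \<longleftrightarrow> Z 0 \<and> \<not> Z 1 \<and> (\<forall>a b. Z a \<longrightarrow> Z b \<longrightarrow> Z (a + b)) \<and> (\<forall>a c. Z a \<longrightarrow> Z (c * a)) \<and>
     (\<forall>a b. Z (a * b) \<longrightarrow> Z a \<or> Z b)"

definition nnk :: "('a::comm_ring_1 \<Rightarrow> bool) \<Rightarrow> ('m \<Rightarrow>\<^sub>0 'a) \<Rightarrow> 'm set" where
  "nnk Z p = {m. \<not> Z (Poly_Mapping.lookup p m)}"

lemma lookup_single_mult:
  fixes m k :: "'x monom" and p :: "'x monom \<Rightarrow>\<^sub>0 'a::comm_ring_1"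
  shows "Poly_Mapping.lookup (Poly_Mapping.single m c * p) j =
    (\<Sum>k\<in>Poly_Mapping.keys p. if m + k = j then c * Poly_Mapping.lookup p k else 0)"
proof -
  have "Poly_Mapping.single m c * p =
      (\<Sum>k\<in>Poly_Mapping.keys p. Poly_Mapping.single (m + k) (c * Poly_Mapping.lookup p k))"
    by (subst (1) poly_mapping_sum_single[of p]) (simp add: sum_distrib_left mult_single)
  then show ?thesis by (simp add: lookup_sum lookup_single when_def)
qed

lemma lookup_single_mult_add:
  fixes m k :: "'x monom" and p :: "'x monom \<Rightarrow>\<^sub>0 'a::comm_ring_1"
  shows "Poly_Mapping.lookup (Poly_Mapping.single m c * p) (m + k) = c * Poly_Mapping.lookup p k"
proof -
  have "(\<Sum>j\<in>Poly_Mapping.keys p. if m + j = m + k then c * Poly_Mapping.lookup p j else 0) =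
      (\<Sum>j\<in>Poly_Mapping.keys p. if j = k then c * Poly_Mapping.lookup p j else 0)"
    by (intro sum.cong) auto
  also have "\<dots> = c * Poly_Mapping.lookup p k"
    by (simp add: in_keys_iff)
  finally show ?thesis by (simp add: lookup_single_mult)
qed

context
  fixes Z :: "'a::comm_ring_1 \<Rightarrow> bool"
  assumes Z: "prime_pred Z"
begin

lemma Z_rules: "Z 0" "\<not> Z 1" "Z a \<Longrightarrow> Z b \<Longrightarrow> Z (a + b)" "Z a \<Longrightarrow> Z (c * a)" "Z a \<Longrightarrow> Z (a * c)"
  "Z (a * b) \<Longrightarrow> Z a \<or> Z b"
  using Z by (auto simp: prime_pred_def mult.commute)

lemma Z_uminus: "Z a \<Longrightarrow> Z (- a)"
  using Z_rules(4)[of a "-1"] by simp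

lemma Z_sum: "(\<And>a. a \<in> A \<Longrightarrow> Z (f a)) \<Longrightarrow> Z (sum f A)"
  by (induction A rule: infinite_finite_induct) (auto intro: Z_rules)

lemma finite_nnk: "finite (nnk Z p)"
  by (rule finite_subset[of _ "Poly_Mapping.keys p"]) (auto simp: nnk_def in_keys_iff Z_rules(1))

lemma nnk_add: "nnk Z (p + q) \<subseteq> nnk Z p \<union> nnk Z q"
  by (auto simp: nnk_def lookup_add intro: Z_rules(3))

lemma nnk_diff: "nnk Z (p - q) \<subseteq> nnk Z p \<union> nnk Z q"
  using Z_rules(3)[of _ "- _"] by (auto simp: nnk_def lookup_minus dest: Z_uminus)

lemma nnk_single_mult: "nnk Z (Poly_Mapping.single m c * p) \<subseteq> (\<lambda>k. m + k) ` nnk Z p"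
  for p :: "'x monom \<Rightarrow>\<^sub>0 'a"
proof
  fix j assume j: "j \<in> nnk Z (Poly_Mapping.single m c * p)"
  show "j \<in> (\<lambda>k. m + k) ` nnk Z p"
  proof (rule ccontr)
    assume "j \<notin> (\<lambda>k. m + k) ` nnk Z p"
    then have "Z (if m + k = j then c * Poly_Mapping.lookup p k else 0)" for k
      by (auto simp: nnk_def intro: Z_rules(1,4))
    then have "Z (Poly_Mapping.lookup (Poly_Mapping.single m c * p) j)"
      unfolding lookup_single_mult by (intro Z_sum)
    then show False using j by (simp add: nnk_def)
  qed
qed

definition null :: "('x monom \<Rightarrow>\<^sub>0 'a) \<Rightarrow> bool" where
  "null p \<longleftrightarrow> nnk Z p = {}"

lemma null_0: "null 0"
  by (simp add: null_def nnk_def Z_rules)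

lemma null_add: "null p \<Longrightarrow> null q \<Longrightarrow> null (p + q)"
  using nnk_add[of p q] by (auto simp: null_def)

lemma null_mult: "null p \<Longrightarrow> null (a * p)"
proof (induction a rule: poly_mapping_add_induct)
  case (single m c)
  then show ?case using nnk_single_mult[of m c p] by (auto simp: null_def)
qed (auto simp: null_0 distrib_right intro: null_add)

definition is_lm :: "('x::linorder monom \<Rightarrow>\<^sub>0 'a) \<Rightarrow> 'x monom \<Rightarrow> bool" where
  "is_lm p m \<longleftrightarrow> m \<in> nnk Z p \<and> (\<forall>k\<in>nnk Z p. k = m \<or> glt k m)"

lemma is_lm_exists: "\<not> null p \<Longrightarrow> \<exists>m. is_lm p m"
  using glt_finite_max[OF finite_nnk[of p]] by (auto simp: is_lm_def null_def)

text \<open>Division with remainder over the fraction field of the residue ring, with denominators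
  cleared: \<open>b\<close> is a product of leading coefficients and stays outside the prime ideal.
  Each step lowers the leading monomial, and only finitely many monomials lie below it. The graded
  order keeps the remainder within the degree bound \<open>d\<close>.\<close>

lemma pseudo_reduction:
  fixes g :: "nat \<Rightarrow> 'x::linorder monom \<Rightarrow>\<^sub>0 'a"
  assumes V: "finite V" and lm: "\<And>i. i < n \<Longrightarrow> is_lm (g i) (\<mu> i)"
    and gV: "\<And>i k. i < n \<Longrightarrow> k \<in> nnk Z (g i) \<Longrightarrow> Poly_Mapping.keys k \<subseteq> V"
    and p: "nnk Z p \<subseteq> monoms_le V d"
  shows "\<exists>b A r. \<not> Z b \<and> null (Poly_Mapping.single 0 b * p - (\<Sum>i<n. A i * g i) - r) \<and>
     nnk Z r \<subseteq> monoms_le V d \<and> (null r \<or> (\<exists>m. is_lm r m \<and> (\<forall>i<n. \<not> mdvd (\<mu> i) m)))"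
  using p
proof (induction "card {k\<in>monoms_le V d. \<exists>m\<in>nnk Z p. k = m \<or> glt k m}" arbitrary: p rule: less_induct)
  case less
  have triv: ?case if "null p \<or> (\<exists>m. is_lm p m \<and> (\<forall>i<n. \<not> mdvd (\<mu> i) m))"
    by (rule exI[of _ 1], rule exI[of _ "\<lambda>_. 0"], rule exI[of _ p])
      (use that less.prems in \<open>auto simp: Z_rules null_0\<close>)
  show ?case
  proof (cases "null p \<or> (\<exists>m. is_lm p m \<and> (\<forall>i<n. \<not> mdvd (\<mu> i) m))")
    case False
    then obtain m where m: "is_lm p m" using is_lm_exists by blast
    with False obtain i where i: "i < n" "mdvd (\<mu> i) m" by blast
    define lg where "lg = Poly_Mapping.lookup (g i) (\<mu> i)"
    define lp where "lp = Poly_Mapping.lookup p m"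
    have lg: "\<not> Z lg" using lm[OF i(1)] by (simp add: lg_def is_lm_def nnk_def)
    define q where "q = Poly_Mapping.single 0 lg * p - Poly_Mapping.single (m - \<mu> i) lp * g i"
    have mV: "m \<in> monoms_le V d" using m less.prems by (auto simp: is_lm_def)
    have sub: "glt k m \<and> k \<in> monoms_le V d" if k: "k \<in> nnk Z q" for k
    proof -
      have "Poly_Mapping.lookup q m = 0"
        using lookup_single_mult_add[of 0 lg p m] lookup_single_mult_add[of "m - \<mu> i" lp "g i" "\<mu> i"]
        by (simp add: q_def lookup_minus mdvd_add_diff[OF i(2)] lg_def lp_def mult.commute)
      then have km: "k \<noteq> m" using k by (auto simp: nnk_def Z_rules)
      have "k \<in> nnk Z (Poly_Mapping.single 0 lg * p) \<or> k \<in> nnk Z (Poly_Mapping.single (m - \<mu> i) lp * g i)"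
        using k nnk_diff[of "Poly_Mapping.single 0 lg * p" "Poly_Mapping.single (m - \<mu> i) lp * g i"]
        unfolding q_def by (simp only: subset_eq Un_iff)
      then have "k \<in> nnk Z p \<or> k \<in> (\<lambda>j. (m - \<mu> i) + j) ` nnk Z (g i)"
        using nnk_single_mult[of 0 lg p] nnk_single_mult[of "m - \<mu> i" lp "g i"] by auto
      then show ?thesis
      proof
        assume "k \<in> nnk Z p"
        then show ?thesis using m km less.prems by (auto simp: is_lm_def)
      next
        assume "k \<in> (\<lambda>j. (m - \<mu> i) + j) ` nnk Z (g i)"
        then obtain j where j: "k = (m - \<mu> i) + j" "j \<in> nnk Z (g i)" by blast
        have "j = \<mu> i \<or> glt j (\<mu> i)" using lm[OF i(1)] j(2) by (auto simp: is_lm_def)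
        with km j(1) have gl: "glt k m" using glt_add[of j "\<mu> i" "m - \<mu> i"] by (auto simp: mdvd_add_diff[OF i(2)])
        have "Poly_Mapping.keys (m - \<mu> i) \<subseteq> Poly_Mapping.keys m" by (auto simp: in_keys_iff lookup_minus)
        then have "Poly_Mapping.keys k \<subseteq> V"
          using keys_add[of "m - \<mu> i" j] j gV[OF i(1) j(2)] mV by (auto simp: monoms_le_def)
        then show ?thesis using gl glt_degree[OF gl] mV by (auto simp: monoms_le_def)
      qed
    qed
    have "card {k\<in>monoms_le V d. \<exists>m\<in>nnk Z q. k = m \<or> glt k m} < card {k\<in>monoms_le V d. \<exists>m\<in>nnk Z p. k = m \<or> glt k m}"
    proof (rule psubset_card_mono)
      have "m \<notin> {k\<in>monoms_le V d. \<exists>m\<in>nnk Z q. k = m \<or> glt k m}"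
        using sub glt_irrefl glt_trans by blast
      moreover have "m \<in> {k\<in>monoms_le V d. \<exists>m\<in>nnk Z p. k = m \<or> glt k m}" using m mV by (auto simp: is_lm_def)
      moreover have "{k\<in>monoms_le V d. \<exists>m\<in>nnk Z q. k = m \<or> glt k m} \<subseteq> {k\<in>monoms_le V d. \<exists>m\<in>nnk Z p. k = m \<or> glt k m}"
        using sub m glt_trans unfolding is_lm_def by blast
      ultimately show "{k\<in>monoms_le V d. \<exists>m\<in>nnk Z q. k = m \<or> glt k m} \<subset> {k\<in>monoms_le V d. \<exists>m\<in>nnk Z p. k = m \<or> glt k m}"
        by blast
    qed (simp add: finite_monoms_le[OF V])
    from less.hyps[OF this] sub obtain b A r where *: "\<not> Z b"
      "null (Poly_Mapping.single 0 b * q - (\<Sum>i<n. A i * g i) - r)"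
      "nnk Z r \<subseteq> monoms_le V d" "null r \<or> (\<exists>m. is_lm r m \<and> (\<forall>i<n. \<not> mdvd (\<mu> i) m))" by blast
    let ?A = "A(i := A i + Poly_Mapping.single 0 b * Poly_Mapping.single (m - \<mu> i) lp)"
    have "(\<Sum>i<n. ?A i * g i) = (\<Sum>j<n. A j * g j + (if j = i then Poly_Mapping.single 0 b * Poly_Mapping.single (m - \<mu> i) lp * g i else 0))"
      by (intro sum.cong) (auto simp: algebra_simps)
    also have "\<dots> = (\<Sum>i<n. A i * g i) + Poly_Mapping.single 0 b * Poly_Mapping.single (m - \<mu> i) lp * g i"
      using i(1) by (simp add: sum.distrib)
    finally have sumA: "(\<Sum>i<n. ?A i * g i) = (\<Sum>i<n. A i * g i) + Poly_Mapping.single 0 b * Poly_Mapping.single (m - \<mu> i) lp * g i" .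
    have "Poly_Mapping.single 0 (b * lg) * p - (\<Sum>i<n. ?A i * g i) - r =
        Poly_Mapping.single 0 b * q - (\<Sum>i<n. A i * g i) - r"
    proof -
      have s: "Poly_Mapping.single 0 (b * lg) = Poly_Mapping.single 0 b * Poly_Mapping.single (0 :: 'x monom) lg"
        by (simp add: mult_single)
      show ?thesis unfolding q_def sumA s by (simp add: algebra_simps)
    qed
    moreover have "\<not> Z (b * lg)" using *(1) lg Z_rules(6) by blast
    ultimately show ?thesis using * by (intro exI[of _ "b * lg"] exI[of _ ?A] exI[of _ r]) simp
  qed (rule triv)
qed

definition in_span :: "(nat \<Rightarrow> 'x monom \<Rightarrow>\<^sub>0 'a) \<Rightarrow> nat \<Rightarrow> ('x monom \<Rightarrow>\<^sub>0 'a) \<Rightarrow> bool" where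
  "in_span h n p \<longleftrightarrow> (\<exists>C. null (p - (\<Sum>j<n. C j * h j)))"

lemma in_span_null: "null p \<Longrightarrow> in_span h n p"
  unfolding in_span_def by (rule exI[of _ "\<lambda>_. 0"]) simp

lemma in_span_add:
  assumes "in_span h n p" "in_span h n q"
  shows "in_span h n (p + q)"
proof -
  obtain B where B: "null (p - (\<Sum>j<n. B j * h j))" using assms(1) unfolding in_span_def by blast
  obtain C where C: "null (q - (\<Sum>j<n. C j * h j))" using assms(2) unfolding in_span_def by blast
  have "p + q - (\<Sum>j<n. (B j + C j) * h j) = (p - (\<Sum>j<n. B j * h j)) + (q - (\<Sum>j<n. C j * h j))"
    by (simp add: algebra_simps sum.distrib)
  then have "null (p + q - (\<Sum>j<n. (B j + C j) * h j))" using null_add[OF B C] by (simp only:)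
  then show ?thesis unfolding in_span_def by (intro exI[of _ "\<lambda>j. B j + C j"])
qed

lemma in_span_mult:
  assumes "in_span h n p"
  shows "in_span h n (a * p)"
proof -
  obtain B where B: "null (p - (\<Sum>j<n. B j * h j))" using assms unfolding in_span_def by blast
  have "a * p - (\<Sum>j<n. (a * B j) * h j) = a * (p - (\<Sum>j<n. B j * h j))"
    by (simp add: algebra_simps sum_distrib_left)
  then have "null (a * p - (\<Sum>j<n. (a * B j) * h j))" using null_mult[OF B, of a] by (simp only:)
  then show ?thesis unfolding in_span_def by (intro exI[of _ "\<lambda>j. a * B j"])
qed

lemma in_span_uminus: "in_span h n p \<Longrightarrow> in_span h n (- p)"
  using in_span_mult[of h n p "-1"] by simp

lemma in_span_diff: "in_span h n p \<Longrightarrow> in_span h n q \<Longrightarrow> in_span h n (p - q)"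
  using in_span_add[OF _ in_span_uminus, of h n p q] by simp

lemma in_span_sum: "(\<And>a. a \<in> S \<Longrightarrow> in_span h n (f a)) \<Longrightarrow> in_span h n (sum f S)"
  by (induction S rule: infinite_finite_induct) (auto intro: in_span_add in_span_null null_0)

lemma in_span_self:
  assumes "k < n"
  shows "in_span h n (h k)"
proof -
  have "(\<Sum>j<n. (if j = k then 1 else 0) * h j) = (\<Sum>j<n. if j = k then h j else 0)"
    by (intro sum.cong) auto
  also have "\<dots> = h k" using assms by simp
  finally have "null (h k - (\<Sum>j<n. (if j = k then 1 else 0) * h j))" by (simp add: null_0)
  then show ?thesis unfolding in_span_def by (intro exI[of _ "\<lambda>j. if j = k then 1 else 0"])
qed

lemma in_span_mono:
  assumes "in_span h n p" "n \<le> m"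
  shows "in_span h m p"
proof -
  obtain B where B: "null (p - (\<Sum>j<n. B j * h j))" using assms(1) unfolding in_span_def by blast
  have "in_span h m (\<Sum>j<n. B j * h j)"
    using assms(2) by (intro in_span_sum in_span_mult in_span_self) auto
  from in_span_add[OF in_span_null[OF B] this] show ?thesis by simp
qed

text \<open>If no \<open>h k\<close> enters the ideal of its predecessors after scaling, its
  remainder modulo the earlier remainders is never null, and the leading monomials form a bad list.
  The degree bounds \<open>d\<close> of \<open>h\<close> pass to the remainders
  \<open>g\<close>.\<close>

lemma reduced_sequence:
  fixes h :: "nat \<Rightarrow> 'x::linorder monom \<Rightarrow>\<^sub>0 'a"
  assumes V: "finite V" and hV: "\<And>k. k \<le> r \<Longrightarrow> nnk Z (h k) \<subseteq> monoms_le V (d k)"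
    and bad: "\<And>k b. k \<le> r \<Longrightarrow> \<not> Z b \<Longrightarrow> \<not> in_span h k (Poly_Mapping.single 0 b * h k)"
    and "n \<le> Suc r"
  shows "\<exists>g \<mu>. \<forall>i<n. is_lm (g i) (\<mu> i) \<and> nnk Z (g i) \<subseteq> monoms_le V (d i) \<and>
    (\<forall>j<i. \<not> mdvd (\<mu> j) (\<mu> i)) \<and> in_span h (Suc i) (g i)"
  using \<open>n \<le> Suc r\<close>
proof (induction n)
  case (Suc n)
  then have "n \<le> Suc r" by simp
  from Suc.IH[OF this] obtain g \<mu> where "\<forall>i<n. is_lm (g i) (\<mu> i) \<and> nnk Z (g i) \<subseteq> monoms_le V (d i) \<and>
    (\<forall>j<i. \<not> mdvd (\<mu> j) (\<mu> i)) \<and> in_span h (Suc i) (g i)" by (elim exE)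
  then have g: "\<And>i. i < n \<Longrightarrow> is_lm (g i) (\<mu> i)" "\<And>i. i < n \<Longrightarrow> nnk Z (g i) \<subseteq> monoms_le V (d i)"
    "\<And>i j. i < n \<Longrightarrow> j < i \<Longrightarrow> \<not> mdvd (\<mu> j) (\<mu> i)" "\<And>i. i < n \<Longrightarrow> in_span h (Suc i) (g i)" by simp_all
  have gV: "Poly_Mapping.keys k \<subseteq> V" if "i < n" "k \<in> nnk Z (g i)" for i k
    using g(2)[OF that(1)] that(2) by (auto simp: monoms_le_def)
  have nr: "n \<le> r" using Suc.prems by simp
  have "\<exists>b A q. \<not> Z b \<and> null (Poly_Mapping.single 0 b * h n - (\<Sum>i<n. A i * g i) - q) \<and>
     nnk Z q \<subseteq> monoms_le V (d n) \<and> (null q \<or> (\<exists>m. is_lm q m \<and> (\<forall>i<n. \<not> mdvd (\<mu> i) m)))"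
    by (rule pseudo_reduction[OF V]) (use g(1) gV hV[OF nr] in simp_all)
  then obtain b A q where *: "\<not> Z b" "null (Poly_Mapping.single 0 b * h n - (\<Sum>i<n. A i * g i) - q)"
    "nnk Z q \<subseteq> monoms_le V (d n)" "null q \<or> (\<exists>m. is_lm q m \<and> (\<forall>i<n. \<not> mdvd (\<mu> i) m))" by blast
  have Ag: "in_span h n (\<Sum>i<n. A i * g i)"
    by (intro in_span_sum in_span_mult in_span_mono[OF g(4)]) auto
  have "\<not> null q"
  proof
    assume "null q"
    with *(2) have "in_span h n (Poly_Mapping.single 0 b * h n - (\<Sum>i<n. A i * g i) - q + (q + (\<Sum>i<n. A i * g i)))"
      by (intro in_span_add Ag) (auto intro: in_span_null)
    with bad[OF nr *(1)] show False by simp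
  qed
  with *(4) obtain m where m: "is_lm q m" "\<And>i. i < n \<Longrightarrow> \<not> mdvd (\<mu> i) m" by blast
  have "in_span h (Suc n) (Poly_Mapping.single 0 b * h n - (\<Sum>i<n. A i * g i) -
      (Poly_Mapping.single 0 b * h n - (\<Sum>i<n. A i * g i) - q))"
    by (intro in_span_diff in_span_mult in_span_self in_span_mono[OF Ag] in_span_null[OF *(2)]) auto
  then have "in_span h (Suc n) q" by simp
  with g m *(3) show ?case
    by (intro exI[of _ "g(n := q)"] exI[of _ "\<mu>(n := m)"]) (auto simp: less_Suc_eq)
qed auto

end

text \<open>\<open>r\<close> is the bound for bad lists, so it depends on the variables and the
  degree bounds but not on the prime ideal or on the coefficients. This uniformity later makes the
  order of contact independent of \<open>f\<close>.\<close>

theorem effective_acc: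
  fixes V :: "'x::linorder set"
  assumes V: "finite V"
  shows "\<exists>r. \<forall>(Z :: 'a::comm_ring_1 \<Rightarrow> bool) h. prime_pred Z \<longrightarrow>
    (\<forall>k\<le>r. nnk Z (h k) \<subseteq> monoms_le V (d k)) \<longrightarrow>
    (\<exists>k\<le>r. \<exists>b. \<not> Z b \<and> in_span Z h k (Poly_Mapping.single 0 b * h k))"
proof -
  obtain r where r: "\<And>xs. bad_list V d xs \<Longrightarrow> length xs \<le> r" using bad_list_bounded[OF V] by blast
  have "\<exists>k\<le>r. \<exists>b. \<not> Z b \<and> in_span Z h k (Poly_Mapping.single 0 b * h k)"
    if Z: "prime_pred Z" and h: "\<forall>k\<le>r. nnk Z (h k) \<subseteq> monoms_le V (d k)"
    for Z :: "'a \<Rightarrow> bool" and h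
  proof (rule ccontr)
    assume "\<not> ?thesis"
    then have bad: "\<And>k b. k \<le> r \<Longrightarrow> \<not> Z b \<Longrightarrow> \<not> in_span Z h k (Poly_Mapping.single 0 b * h k)" by blast
    obtain g \<mu> where g: "\<forall>i<Suc r. is_lm Z (g i) (\<mu> i) \<and> nnk Z (g i) \<subseteq> monoms_le V (d i) \<and>
        (\<forall>j<i. \<not> mdvd (\<mu> j) (\<mu> i)) \<and> in_span Z h (Suc i) (g i)"
      using reduced_sequence[OF Z V _ bad order_refl, where d = d] h by blast
    have "bad_list V d (map \<mu> [0..<Suc r])"
      unfolding bad_list_def
    proof (intro allI impI conjI)
      fix k assume k: "k < length (map \<mu> [0..<Suc r])"
      then have k': "k < Suc r" by simp
      have "\<mu> k \<in> monoms_le V (d k)" using g k' is_lm_def[OF Z, of "g k" "\<mu> k"] by blast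
      then show "map \<mu> [0..<Suc r] ! k \<in> monoms_le V (d k)" using nth_map_upt[of k "Suc r" 0 \<mu>] k' by simp
      fix i assume "i < k"
      then show "\<not> mdvd (map \<mu> [0..<Suc r] ! i) (map \<mu> [0..<Suc r] ! k)"
        using g k' nth_map_upt[of k "Suc r" 0 \<mu>] nth_map_upt[of i "Suc r" 0 \<mu>] by simp
    qed
    from r[OF this] show False by simp
  qed
  then show ?thesis by blast
qed

lemma prime_pred_eq_0: "prime_pred (\<lambda>a :: complex. a = 0)"
  by (simp add: prime_pred_def)

text \<open>Choose successively members of \<open>G\<close> that do not vanish on all common zeros
  of those chosen before. \<open>effective_acc\<close> for the zero ideal of the complex numbers
  would put a nonzero constant multiple of some choice into the ideal of the earlier ones, contrary
  to its choice.\<close>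

lemma hilbert_basis_zero_set:
  fixes G :: "3 cpoly set"
  shows "\<exists>G0\<subseteq>G. finite G0 \<and> (\<Inter>g\<in>G. zero_set g) = (\<Inter>g\<in>G0. zero_set g)"
proof (rule ccontr)
  let ?Z = "\<lambda>a :: complex. a = 0"
  assume "\<not> ?thesis"
  then have "\<exists>g\<in>G. \<not> (\<Inter>g\<in>G0. zero_set g) \<subseteq> zero_set g" if "G0 \<subseteq> G" "finite G0" for G0
    using that by blast
  then have "\<exists>g. \<forall>G0. G0 \<subseteq> G \<longrightarrow> finite G0 \<longrightarrow> g G0 \<in> G \<and> \<not> (\<Inter>g\<in>G0. zero_set g) \<subseteq> zero_set (g G0)"
    by metis
  then obtain nxt where nxt: "\<And>G0. G0 \<subseteq> G \<Longrightarrow> finite G0 \<Longrightarrow> nxt G0 \<in> G"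
    "\<And>G0. G0 \<subseteq> G \<Longrightarrow> finite G0 \<Longrightarrow> \<not> (\<Inter>g\<in>G0. zero_set g) \<subseteq> zero_set (nxt G0)" by blast
  define S where "S = rec_nat {} (\<lambda>_ G0. insert (nxt G0) G0)"
  have S: "S 0 = {}" "S (Suc n) = insert (nxt (S n)) (S n)" for n by (simp_all add: S_def)
  have SG: "S n \<subseteq> G \<and> finite (S n)" for n by (induction n) (auto simp: S nxt)
  define h where "h n = nxt (S n)" for n
  have Sh: "S n = h ` {..<n}" for n by (induction n) (auto simp: S h_def lessThan_Suc)
  obtain r where "\<forall>(Z :: complex \<Rightarrow> bool) h'. prime_pred Z \<longrightarrow>
      (\<forall>k\<le>r. nnk Z (h' k) \<subseteq> monoms_le (UNIV :: 3 set) (total_degree (h k))) \<longrightarrow>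
      (\<exists>k\<le>r. \<exists>b. \<not> Z b \<and> in_span Z h' k (Poly_Mapping.single 0 b * h' k))"
    using effective_acc[where ?'a = complex, OF finite[of "UNIV :: 3 set"], of "\<lambda>k. total_degree (h k)"] by blast
  moreover have "nnk ?Z (h k) \<subseteq> monoms_le UNIV (total_degree (h k))" for k
    by (auto simp: nnk_def monoms_le_def in_keys_iff intro: monom_degree_le_total_degree)
  ultimately obtain k b where kb: "b \<noteq> 0" "in_span ?Z h k (Poly_Mapping.single 0 b * h k)"
    using prime_pred_eq_0 by blast
  then obtain C where "null ?Z (Poly_Mapping.single 0 b * h k - (\<Sum>j<k. C j * h j))"
    unfolding in_span_def[OF prime_pred_eq_0] by blast
  then have "Poly_Mapping.single 0 b * h k - (\<Sum>j<k. C j * h j) = 0"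
    unfolding null_def[OF prime_pred_eq_0] nnk_def by (intro poly_mapping_eqI) auto
  then have "poly_eval (Cst b * h k - (\<Sum>j<k. C j * h j)) x = 0" for x by (simp add: Cst_def)
  then have "b * poly_eval (h k) x = (\<Sum>j<k. poly_eval (C j) x * poly_eval (h j) x)" for x by simp
  then have "(\<Inter>g\<in>S k. zero_set g) \<subseteq> zero_set (h k)"
    using kb(1) unfolding Sh by (auto simp: zero_set_def) (metis (no_types, lifting) lessThan_iff mult_eq_0_iff sum.neutral)
  then show False using nxt(2)[of "S k"] SG[of k] by (simp add: h_def)
qed

subsection \<open>Irreducible curves and their Chow forms\<close>

text \<open>Among the prime factors of \<open>N\<close> one lies in the prime ideal, since no unit
  does.\<close>

lemma ex_irreducible_in_prime_ideal:
  fixes I :: "(3 option + 3 option) cpoly set"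
  assumes prime: "\<And>a b. a * b \<in> I \<Longrightarrow> a \<in> I \<or> b \<in> I" and ideal: "\<And>a b. a \<in> I \<Longrightarrow> a * b \<in> I"
    and one: "1 \<notin> I" and N: "N \<in> I" "N \<noteq> 0"
  shows "\<exists>F\<in>I. irreducible F"
proof -
  obtain \<phi> :: "complex poly poly poly poly poly poly poly \<Rightarrow> (3 option + 3 option) cpoly" and J
    where *: "iso_vars \<phi> J" "Inr None \<notin> J" "insert (Inr None) J = UNIV"
    using iso_vars_8 by blast
  let ?\<psi> = "iso_ext \<phi> (Inr None)"
  have iso: "iso_vars ?\<psi> UNIV" using iso_vars_ext[OF *(1,2)] *(3) by simp
  note dvd_iff = iso_dvd_iff[OF iso refl]
  obtain x where x: "N = ?\<psi> x" using iso_surj[OF iso] by blast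
  have "x \<noteq> 0 \<Longrightarrow> ?\<psi> x \<in> I \<Longrightarrow> \<exists>F\<in>I. irreducible F"
  proof (induction x rule: prime_divisors_induct)
    case (unit x)
    then have "?\<psi> x dvd 1" using dvd_iff[of x 1] iso_1[OF iso] by simp
    then obtain k where "1 = ?\<psi> x * k" by (elim dvdE)
    then have "1 \<in> I" using ideal[OF unit.prems(2), of k] by simp
    then show ?case using one by simp
  next
    case (factor p x)
    have "?\<psi> p \<in> I \<or> ?\<psi> x \<in> I" using factor.prems(2) prime by (simp add: iso_mult[OF iso])
    then show ?case
    proof
      assume pI: "?\<psi> p \<in> I"
      have p: "irreducible p" using factor(1) prime_elem_imp_irreducible prime_imp_prime_elem by blast
      have "irreducible (?\<psi> p)"
      proof (rule irreducibleI)
        show "?\<psi> p \<noteq> 0" using p iso_eq_0_iff[OF iso, of p] by (auto simp: irreducible_def)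
        show "\<not> ?\<psi> p dvd 1" using p dvd_iff[of p 1] iso_1[OF iso] by (auto simp: irreducible_def)
        fix a b assume ab: "?\<psi> p = a * b"
        obtain a' where a': "a = ?\<psi> a'" using iso_surj[OF iso] by blast
        obtain b' where b': "b = ?\<psi> b'" using iso_surj[OF iso] by blast
        have "p = a' * b'" using ab iso_inj[OF iso] by (simp add: a' b' flip: iso_mult[OF iso])
        then have "a' dvd 1 \<or> b' dvd 1" using p by (auto simp: irreducible_def)
        then show "a dvd 1 \<or> b dvd 1" using dvd_iff[of _ 1] iso_1[OF iso] by (auto simp: a' b')
      qed
      then show ?thesis using pI by blast
    next
      assume "?\<psi> x \<in> I"
      then show ?thesis using factor by auto
    qed
  qed auto
  then show ?thesis using N x iso_0[OF iso] by auto
qed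

lemma poly_eval_eq_0_4:
  assumes z: "\<And>x. poly_eval p x = 0"
  shows "p = (0 :: 3 option cpoly)"
proof -
  let ?\<phi> = "iso_ext (iso_ext (iso_ext (iso_ext Cst None) (Some 1)) (Some 2)) (Some 3)
     :: complex poly poly poly poly \<Rightarrow> 3 option cpoly"
  let ?I = "{Some 3, Some 2, Some 1, None} :: 3 option set"
  have iso: "iso_vars ?\<phi> ?I"
    by (intro iso_vars_ext iso_vars_Cst) auto
  have "y \<in> ?I" for y :: "3 option"
  proof (cases y)
    case (Some z) then show ?thesis using exhaust_3[of z] by blast
  qed blast
  then obtain q where "p = ?\<phi> q" using iso_surj[OF iso, of p] by blast
  then show "p = 0" using z iso_eval[OF iso, of q] iso_0[OF iso] by simp
qed

section \<open>Pairs of planes in coordinates\<close>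

definition dot :: "(3 \<Rightarrow> complex) \<Rightarrow> (3 \<Rightarrow> complex) \<Rightarrow> complex" where
  "dot a p = (\<Sum>i\<in>UNIV. a i * p i)"

text \<open>The constant term carries a minus sign so that \<open>pl a s\<close> describes the
  points with \<open>dot a p = s\<close>.\<close>

definition pl :: "(3 \<Rightarrow> complex) \<Rightarrow> complex \<Rightarrow> 3 option \<Rightarrow> complex" where
  "pl a s = case_option (- s) a"

definition pt :: "(3 \<Rightarrow> complex) \<Rightarrow> (3 \<Rightarrow> complex) \<Rightarrow> complex \<Rightarrow> complex \<Rightarrow> 3 option + 3 option \<Rightarrow> complex" where
  "pt a b s t = case_sum (pl a s) (pl b t)"

definition chow_set :: "space3 set \<Rightarrow> (3 option + 3 option \<Rightarrow> complex) set" where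
  "chow_set \<gamma> = {case_sum u v | u v. \<gamma> \<inter> plane u \<inter> plane v \<noteq> {}}"

lemma pl_simps [simp]: "pl a s None = - s" "pl a s (Some i) = a i"
  by (simp_all add: pl_def)

lemma pt_simps [simp]: "pt a b s t (Inl x) = pl a s x" "pt a b s t (Inr x) = pl b t x"
  by (simp_all add: pt_def)

lemma pl_collapse: "pl (\<lambda>i. u (Some i)) (- u None) = u"
  by (rule ext) (simp add: pl_def split: option.split)

lemma pt_collapse: "pt (\<lambda>i. x (Inl (Some i))) (\<lambda>i. x (Inr (Some i))) (- x (Inl None)) (- x (Inr None)) = x"
  using pl_collapse[of "\<lambda>y. x (Inl y)"] pl_collapse[of "\<lambda>y. x (Inr y)"]
  by (intro ext) (simp add: pt_def split: sum.split)

lemma mem_plane_pl: "p \<in> plane (pl a s) \<longleftrightarrow> dot a p = s"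
  by (auto simp: plane_def dot_def)

lemma pt_mem_chow_set_iff: "pt a b s t \<in> chow_set \<gamma> \<longleftrightarrow> (\<exists>p\<in>\<gamma>. dot a p = s \<and> dot b p = t)"
proof
  assume "pt a b s t \<in> chow_set \<gamma>"
  then obtain u v where uv: "pt a b s t = case_sum u v" "\<gamma> \<inter> plane u \<inter> plane v \<noteq> {}"
    by (auto simp: chow_set_def)
  have "u = pl a s" using uv(1) by (metis ext pt_simps(1) sum.case(1))
  moreover have "v = pl b t" using uv(1) by (metis ext pt_simps(2) sum.case(2))
  ultimately show "\<exists>p\<in>\<gamma>. dot a p = s \<and> dot b p = t" using uv(2) by (auto simp: mem_plane_pl)
next
  assume "\<exists>p\<in>\<gamma>. dot a p = s \<and> dot b p = t"
  then have "\<gamma> \<inter> plane (pl a s) \<inter> plane (pl b t) \<noteq> {}" by (auto simp: mem_plane_pl)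
  then show "pt a b s t \<in> chow_set \<gamma>" unfolding chow_set_def pt_def by blast
qed

lemma chow_set_iff: "x \<in> chow_set \<gamma> \<longleftrightarrow> (\<exists>a b. \<exists>p\<in>\<gamma>. x = pt a b (dot a p) (dot b p))"
proof
  assume "x \<in> chow_set \<gamma>"
  then have "pt (\<lambda>i. x (Inl (Some i))) (\<lambda>i. x (Inr (Some i))) (- x (Inl None)) (- x (Inr None)) \<in> chow_set \<gamma>"
    by (simp only: pt_collapse)
  then show "\<exists>a b. \<exists>p\<in>\<gamma>. x = pt a b (dot a p) (dot b p)"
    unfolding pt_mem_chow_set_iff using pt_collapse[of x] by metis
qed (auto simp: pt_mem_chow_set_iff)

lemma pfun_dot: "(\<And>i. pfun m (\<lambda>y. a y i)) \<Longrightarrow> (\<And>i. pfun n (\<lambda>y. p y i)) \<Longrightarrow> m + n \<le> k \<Longrightarrow>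
    pfun k (\<lambda>y. dot (a y) (p y))"
  unfolding dot_def by (intro pfun_sum pfun_mult)

lemma pfun_pt: "(\<And>i. pfun n (\<lambda>y. a y i)) \<Longrightarrow> (\<And>i. pfun n (\<lambda>y. b y i)) \<Longrightarrow> pfun n s \<Longrightarrow> pfun n t \<Longrightarrow>
    pfun n (\<lambda>y. pt (a y) (b y) (s y) (t y) o')"
proof -
  assume *: "\<And>i. pfun n (\<lambda>y. a y i)" "\<And>i. pfun n (\<lambda>y. b y i)" "pfun n s" "pfun n t"
  have neg: "pfun n (\<lambda>y. - r y)" if "pfun n r" for r using pfun_diff[OF pfun_const[of n 0] that] by simp
  show ?thesis
  proof (cases o')
    case (Inl z) then show ?thesis using * neg[OF *(3)] by (cases z) auto
  next
    case (Inr z) then show ?thesis using * neg[OF *(4)] by (cases z) auto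
  qed
qed

lemma pfun_poly_eval_compose:
  assumes "total_degree g \<le> n" "\<And>i. pfun d (\<lambda>y. \<sigma> y i)"
  shows "pfun (n * d) (\<lambda>y. poly_eval g (\<sigma> y))"
  using pfun_compose[OF pfun_poly_eval[OF assms(1)] assms(2)] .

lemma vanishing_idealD: "g \<in> vanishing_ideal X \<Longrightarrow> x \<in> X \<Longrightarrow> poly_eval g x = 0"
  by (auto simp: vanishing_ideal_def)

lemma zariski_closed_inter:
  assumes "zariski_closed X"
  shows "zariski_closed (X \<inter> zero_set g)"
proof -
  obtain G where "X = (\<Inter>g\<in>G. zero_set g)" using assms by (auto simp: zariski_closed_def)
  then have "X \<inter> zero_set g = (\<Inter>g\<in>insert g G. zero_set g)" by auto
  then show ?thesis unfolding zariski_closed_def by blast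
qed

section \<open>Irreducible curves and the ideal of their Chow set\<close>

context
  fixes \<gamma> :: "space3 set"
  assumes curve: "irreducible_curve \<gamma>"
begin

lemma curve_irreducible:
  assumes "\<And>p. p \<in> \<gamma> \<Longrightarrow> poly_eval g p * poly_eval h p = 0"
  shows "(\<forall>p\<in>\<gamma>. poly_eval g p = 0) \<or> (\<forall>p\<in>\<gamma>. poly_eval h p = 0)"
proof -
  have cl: "zariski_closed \<gamma>" and irr: "\<And>A B. zariski_closed A \<Longrightarrow> zariski_closed B \<Longrightarrow> \<gamma> = A \<union> B \<Longrightarrow> \<gamma> = A \<or> \<gamma> = B"
    using curve by (auto simp: irreducible_curve_def irreducible_variety_def)
  have "\<gamma> = (\<gamma> \<inter> zero_set g) \<union> (\<gamma> \<inter> zero_set h)" using assms by (auto simp: zero_set_def)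
  from irr[OF zariski_closed_inter[OF cl] zariski_closed_inter[OF cl] this]
  show ?thesis by (auto simp: zero_set_def)
qed

lemma curve_pfun_irreducible:
  assumes "pfun n g" "pfun m h" "\<And>p. p \<in> \<gamma> \<Longrightarrow> g p * h p = 0"
  shows "(\<forall>p\<in>\<gamma>. g p = 0) \<or> (\<forall>p\<in>\<gamma>. h p = 0)"
proof -
  obtain g' h' where "g = poly_eval g'" "h = poly_eval h'" using assms(1,2) by (auto simp: pfun_def)
  with assms(3) show ?thesis using curve_irreducible[of g' h'] by simp
qed

text \<open>The product of the differences \<open>g - c\<close> over the finitely many values
  vanishes on the curve, so by irreducibility one factor does.\<close>

lemma curve_finite_values:
  assumes g: "pfun n g" and fin: "finite (g ` \<gamma>)" and p: "p \<in> \<gamma>"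
  shows "\<forall>q\<in>\<gamma>. g q = g p"
proof -
  have "\<exists>c\<in>S. \<forall>q\<in>\<gamma>. g q = c" if "finite S" "\<forall>q\<in>\<gamma>. (\<Prod>c\<in>S. g q - c) = 0" for S
    using that
  proof (induction)
    case empty
    then show ?case using p by auto
  next
    case (insert c S)
    have "(\<forall>q\<in>\<gamma>. g q - c = 0) \<or> (\<forall>q\<in>\<gamma>. (\<Prod>c\<in>S. g q - c) = 0)"
    proof (rule curve_pfun_irreducible)
      show "pfun n (\<lambda>q. g q - c)" by (intro pfun_diff g pfun_const)
      show "pfun (\<Sum>c\<in>S. n) (\<lambda>q. \<Prod>c\<in>S. g q - c)" by (intro pfun_prod pfun_diff g pfun_const)
      show "(g q - c) * (\<Prod>c\<in>S. g q - c) = 0" if "q \<in> \<gamma>" for q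
        using insert.prems insert.hyps that by simp
    qed
    then show ?case using insert.IH by auto
  qed
  moreover have "\<forall>q\<in>\<gamma>. (\<Prod>c\<in>g ` \<gamma>. g q - c) = 0" using fin by auto
  ultimately obtain c where "\<forall>q\<in>\<gamma>. g q = c" using fin by blast
  then show ?thesis using p by simp
qed

lemma curve_two_points: "\<exists>p\<in>\<gamma>. \<exists>q\<in>\<gamma>. p \<noteq> q"
proof -
  have "irreducible_chain \<gamma> 1" using curve by (auto simp: irreducible_curve_def has_dimension_def)
  then obtain Y :: "nat \<Rightarrow> space3 set" where Y: "\<forall>i\<le>1. irreducible_variety (Y i) \<and> Y i \<subseteq> \<gamma>" "\<forall>i<1. Y i \<subset> Y (Suc i)"
    unfolding irreducible_chain_def by blast
  then have "Y 0 \<noteq> {}" "Y 0 \<subset> Y 1" "Y 1 \<subseteq> \<gamma>" by (auto simp: irreducible_variety_def)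
  then obtain p where p: "p \<in> Y 0" by auto
  obtain q where q: "q \<in> Y 1" "q \<notin> Y 0" using \<open>Y 0 \<subset> Y 1\<close> by (rule psubsetE) (auto simp: subset_iff)
  have "p \<in> \<gamma>" "q \<in> \<gamma>" using p q \<open>Y 0 \<subset> Y 1\<close> \<open>Y 1 \<subseteq> \<gamma>\<close> by auto
  moreover have "p \<noteq> q" using p q by auto
  ultimately show ?thesis by (intro bexI)
qed

lemma curve_nonempty: "\<gamma> \<noteq> {}"
  using curve_two_points by blast

lemma curve_dot_infinite:
  assumes "p \<in> \<gamma>" "q \<in> \<gamma>" "dot a p \<noteq> dot a q"
  shows "infinite ((\<lambda>p. dot a p) ` \<gamma>)"
proof
  assume fin: "finite ((\<lambda>p. dot a p) ` \<gamma>)"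
  have "pfun 1 (\<lambda>p. dot a p)" by (intro pfun_dot[of 0 _ 1] pfun_const pfun_var) auto
  from curve_finite_values[OF this fin assms(1)] assms show False by metis
qed

lemma curve_basis:
  obtains G0 :: "3 cpoly set" where "finite G0" "\<gamma> = (\<Inter>g\<in>G0. zero_set g)"
proof -
  obtain G where "\<gamma> = (\<Inter>g\<in>G. zero_set g)"
    using curve by (auto simp: irreducible_curve_def irreducible_variety_def zariski_closed_def)
  then show ?thesis using that hilbert_basis_zero_set[of G] by auto
qed

text \<open>The Chow set is a projection of the incidence relation between pairs of planes and
  points of the curve. A finite basis of equations makes this relation a member of
  \<open>CP\<close>, and the quantified point is eliminated.\<close>

lemma chow_set_constructible:
  obtains \<P> :: "((((3 option + 3 option) + 3) \<Rightarrow> complex) \<Rightarrow> complex) set"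
    and Q :: "_ \<Rightarrow> (3 option + 3 option) cpoly" and B
  where "finite \<P>" "\<And>x. x \<in> chow_set \<gamma> \<longleftrightarrow> {P\<in>\<P>. poly_eval (Q P) x = 0} \<in> B"
proof -
  obtain G0 :: "3 cpoly set" where G0: "finite G0" "\<gamma> = (\<Inter>g\<in>G0. zero_set g)" by (rule curve_basis)
  define inc where "inc s e = e (Inl (s None)) + (\<Sum>i\<in>UNIV. e (Inl (s (Some i))) * e (Inr i))"
    for s :: "3 option \<Rightarrow> 3 option + 3 option" and e :: "(3 option + 3 option) + 3 \<Rightarrow> complex"
  define \<phi> where "\<phi> e \<longleftrightarrow> (\<forall>g\<in>G0. poly_eval g (\<lambda>i. e (Inr i)) = 0) \<and> inc Inl e = 0 \<and> inc Inr e = 0"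
    for e :: "(3 option + 3 option) + 3 \<Rightarrow> complex"
  have inc: "inc s \<in> PF" for s
    unfolding inc_def[abs_def] by (intro PF_add PF_var PF_sum PF_mult)
  have "(\<lambda>e. \<forall>g\<in>G0. poly_eval g (\<lambda>i. e (Inr i)) = (0::complex)) \<in> CP"
    by (intro CP_ball G0(1) CP_eq PF_poly_eval PF_var)
  then have "\<phi> \<in> CP" unfolding \<phi>_def[abs_def] by (intro CP_conj CP_eq inc)
  define \<Phi> where "\<Phi> e \<longleftrightarrow> (\<exists>y. \<phi> (\<lambda>v. if v \<in> range Inr then y v else e v))" for e
  have "\<Phi> \<in> CP"
    unfolding \<Phi>_def[abs_def] by (intro CP_ex_finite \<open>\<phi> \<in> CP\<close>) simp
  from CP_normal_form[OF this]
  obtain \<P> B where PB: "finite \<P>" "\<P> \<subseteq> PF" "\<And>e. \<Phi> e \<longleftrightarrow> {P\<in>\<P>. P e = 0} \<in> B"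
    by blast
  have nr: "Inl w \<notin> range Inr" for w :: "3 option + 3 option" by auto
  have ex: "x \<in> chow_set \<gamma> \<longleftrightarrow> \<Phi> (case_sum x (\<lambda>_. 0))" for x
    unfolding \<Phi>_def
  proof
    assume "x \<in> chow_set \<gamma>"
    then obtain u v p where *: "x = case_sum u v" "p \<in> \<gamma>" "p \<in> plane u" "p \<in> plane v" by (auto simp: chow_set_def)
    then have "\<phi> (\<lambda>v. if v \<in> range Inr then case_sum (\<lambda>_. 0) p v else case_sum x (\<lambda>_. 0) v)"
      using G0(2) by (auto simp: \<phi>_def inc_def plane_def zero_set_def nr)
    then show "\<exists>y. \<phi> (\<lambda>v. if v \<in> range Inr then y v else case_sum x (\<lambda>_. 0) v)"
      by (intro exI[where x = "case_sum (\<lambda>_. 0) p"])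
  next
    assume "\<exists>y. \<phi> (\<lambda>v. if v \<in> range Inr then y v else case_sum x (\<lambda>_. 0) v)"
    then obtain y where y: "\<phi> (\<lambda>v. if v \<in> range Inr then y v else case_sum x (\<lambda>_. 0) v)" ..
    let ?p = "\<lambda>i. y (Inr i)"
    have "?p \<in> \<gamma>" "?p \<in> plane (\<lambda>o'. x (Inl o'))" "?p \<in> plane (\<lambda>o'. x (Inr o'))"
      using y G0(2) by (auto simp: \<phi>_def inc_def plane_def zero_set_def nr)
    moreover have "x = case_sum (\<lambda>o'. x (Inl o')) (\<lambda>o'. x (Inr o'))" by (rule ext) (simp split: sum.split)
    ultimately show "x \<in> chow_set \<gamma>" unfolding chow_set_def by blast
  qed
  have "\<exists>q. \<forall>x. P (case_sum x (\<lambda>_. 0)) = poly_eval q x" if P: "P \<in> \<P>" for P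
  proof -
    obtain K where K: "\<forall>D (\<sigma> :: (3 option + 3 option \<Rightarrow> complex) \<Rightarrow> _). (\<forall>v. pfun D (\<lambda>p. \<sigma> p v)) \<longrightarrow> pfun (K * D) (\<lambda>p. P (\<sigma> p))"
      using PF_compose_degree[where ?'i = "3 option + 3 option", of P] P PB(2) by blast
    have "pfun 1 (\<lambda>x. case_sum x (\<lambda>_. 0) v)" for v :: "(3 option + 3 option) + 3"
      by (cases v) (auto intro: pfun_var pfun_const)
    then have "pfun (K * 1) (\<lambda>x. P (case_sum x (\<lambda>_. 0)))"
      using K[rule_format, of 1 "\<lambda>x. case_sum x (\<lambda>_. 0)"] by simp
    then obtain g where "\<And>x. P (case_sum x (\<lambda>_. 0)) = poly_eval g x" by (rule pfunE) blast
    then show ?thesis by blast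
  qed
  then have "\<forall>P\<in>\<P>. \<exists>q. \<forall>x. P (case_sum x (\<lambda>_. 0)) = poly_eval q x" by blast
  from bchoice[OF this] obtain Q where Q: "\<forall>P\<in>\<P>. \<forall>x. P (case_sum x (\<lambda>_. 0)) = poly_eval (Q P) x" ..
  have "x \<in> chow_set \<gamma> \<longleftrightarrow> {P\<in>\<P>. poly_eval (Q P) x = 0} \<in> B" for x
  proof -
    have "{P\<in>\<P>. P (case_sum x (\<lambda>_. 0)) = 0} = {P\<in>\<P>. poly_eval (Q P) x = 0}" using Q by auto
    then show ?thesis unfolding ex PB(3) by simp
  qed
  with PB(1) show ?thesis using that by blast
qed

text \<open>For fixed directions the planes through a point \<open>p\<close> of the curve depend
  polynomially on \<open>p\<close>. Directions generic for both \<open>A\<close> and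
  \<open>B\<close> turn a product vanishing on the Chow set into a product of two polynomials
  vanishing on the irreducible curve.\<close>

lemma chow_ideal_prime:
  assumes "A * B \<in> vanishing_ideal (chow_set \<gamma>)"
  shows "A \<in> vanishing_ideal (chow_set \<gamma>) \<or> B \<in> vanishing_ideal (chow_set \<gamma>)"
proof (rule ccontr)
  assume "\<not> ?thesis"
  then obtain a0 b0 p0 a1 b1 p1 where
    0: "p0 \<in> \<gamma>" "poly_eval A (pt a0 b0 (dot a0 p0) (dot b0 p0)) \<noteq> 0" and
    1: "p1 \<in> \<gamma>" "poly_eval B (pt a1 b1 (dot a1 p1) (dot b1 p1)) \<noteq> 0"
    by (auto simp: vanishing_ideal_def chow_set_iff)
  define a where "a w i = w (Inl i)" for w :: "3 + 3 \<Rightarrow> complex" and i :: 3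
  define b where "b w i = w (Inr i)" for w :: "3 + 3 \<Rightarrow> complex" and i :: 3
  have ab: "pfun 1 (\<lambda>w. a w i)" "pfun 1 (\<lambda>w. b w i)" for i by (simp_all add: a_def b_def pfun_var)
  have pf: "pfun (total_degree g * 1) (\<lambda>w. poly_eval g (pt (a w) (b w) (dot (a w) p) (dot (b w) p)))" for g p
    by (intro pfun_poly_eval_compose order_refl pfun_pt ab pfun_dot[where m = 1 and n = 0] pfun_const) auto
  have cs: "a (case_sum c d) = c" "b (case_sum c d) = d" for c d by (auto simp: a_def b_def)
  obtain w where w: "poly_eval A (pt (a w) (b w) (dot (a w) p0) (dot (b w) p0)) \<noteq> 0"
    "poly_eval B (pt (a w) (b w) (dot (a w) p1) (dot (b w) p1)) \<noteq> 0"
    using pfun_common_nonzero[OF pf[of A p0] _ pf[of B p1], where x = "case_sum a0 b0" and y = "case_sum a1 b1"]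
      0(2) 1(2) by (auto simp: cs)
  let ?g = "\<lambda>g p. poly_eval g (pt (a w) (b w) (dot (a w) p) (dot (b w) p))"
  have pg: "pfun (total_degree g * 1) (?g g)" for g
    by (intro pfun_poly_eval_compose order_refl pfun_pt pfun_dot[where m = 0 and n = 1] pfun_const pfun_var) auto
  have "(\<forall>p\<in>\<gamma>. ?g A p = 0) \<or> (\<forall>p\<in>\<gamma>. ?g B p = 0)"
  proof (rule curve_pfun_irreducible[OF pg pg])
    fix p assume "p \<in> \<gamma>"
    then have "pt (a w) (b w) (dot (a w) p) (dot (b w) p) \<in> chow_set \<gamma>" by (auto simp: chow_set_iff)
    from vanishing_idealD[OF assms this] show "?g A p * ?g B p = 0" by simp
  qed
  with w 0(1) 1(1) show False by blast
qed

text \<open>The Chow set is dominant over all coordinates except the last constant term: for generic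
  directions the values \<open>dot a z\<close> along the curve are infinitely many, and
  \<open>H\<close> restricted to these planes is a nonzero univariate polynomial \<open>r\<close>
  that would have all of them as roots.\<close>

lemma chow_ideal_no_elimination:
  assumes H: "H \<in> vanishing_ideal (chow_set \<gamma>)" "Inr None \<notin> poly_vars H"
  shows "H = 0"
proof (rule ccontr)
  assume "H \<noteq> 0"
  then obtain x where x: "poly_eval H x \<noteq> 0" using poly_eval_eq_0_8 by blast
  obtain p q where pq: "p \<in> \<gamma>" "q \<in> \<gamma>" "p \<noteq> q" using curve_two_points by blast
  then obtain j where j: "p j \<noteq> q j" by blast
  let ?l = "\<lambda>x :: 3 option + 3 option \<Rightarrow> complex. \<Sum>i\<in>UNIV. x (Inl (Some i)) * (p i - q i)"
  have l1: "pfun 1 ?l" by (intro pfun_sum pfun_mult[of 1 _ 0] pfun_var pfun_const) auto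
  have "?l (\<lambda>v. if v = Inl (Some j) then 1 else 0) = p j - q j"
    by (simp add: if_distrib[of "\<lambda>x. x * _"] cong: if_cong)
  then have l2: "?l (\<lambda>v. if v = Inl (Some j) then 1 else 0) \<noteq> 0" using j by simp
  obtain y where y: "poly_eval H y \<noteq> 0" "?l y \<noteq> 0"
  proof -
    have "\<exists>y. poly_eval H y \<noteq> 0 \<and> ?l y \<noteq> 0"
      by (rule pfun_common_nonzero[where P = "poly_eval H" and Q = ?l and x = x
            and y = "\<lambda>v. if v = Inl (Some j) then 1 else 0" and n = "total_degree H" and m = 1])
        (fact pfun_poly_eval[OF order_refl] x l1 l2)+
    then show ?thesis using that by blast
  qed
  define a where "a = (\<lambda>i. y (Inl (Some i)))"
  define b where "b = (\<lambda>i. y (Inr (Some i)))"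
  have "dot a p - dot a q = ?l y" by (simp add: dot_def a_def algebra_simps sum_subtractf)
  then have "dot a p \<noteq> dot a q" using y(2) by auto
  then have inf: "infinite ((\<lambda>p. dot a p) ` \<gamma>)" using curve_dot_infinite pq by blast
  have y': "y = pt a b (- y (Inl None)) (- y (Inr None))" using pt_collapse[of y] by (simp add: a_def b_def)
  have "pfun (total_degree H) (poly_eval H)" by (rule pfun_poly_eval) simp
  from pfun_on_line[OF this, of "pt a b 0 0" "\<lambda>v. if v = Inl None then -1 else 0"]
  obtain r where r: "\<And>t. poly r t = poly_eval H (\<lambda>i. pt a b 0 0 i + t * (if i = Inl None then -1 else 0))" by blast
  have r': "poly r s = poly_eval H (pt a b s t)" for s t
    unfolding r
  proof (rule poly_eval_cong)
    fix i :: "3 option + 3 option" assume "i \<in> poly_vars H"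
    then have "i \<noteq> Inr None" using H(2) by blast
    then show "pt a b 0 0 i + s * (if i = Inl None then - 1 else 0) = pt a b s t i"
      by (cases i) (auto simp: pl_def split: option.split)
  qed
  have "r \<noteq> 0" using r'[of "- y (Inl None)" "- y (Inr None)"] y(1) y' by auto
  then have "finite {s. poly r s = 0}" by (rule poly_roots_finite)
  then obtain s where s: "s \<in> (\<lambda>p. dot a p) ` \<gamma>" "poly r s \<noteq> 0" using inf by (metis (mono_tags) finite_subset mem_Collect_eq subsetI)
  then obtain z where z: "z \<in> \<gamma>" "s = dot a z" by blast
  have "pt a b (dot a z) (dot b z) \<in> chow_set \<gamma>" using z(1) by (auto simp: chow_set_iff)
  then have "poly_eval H (pt a b (dot a z) (dot b z)) = 0" using H(1) by (rule vanishing_idealD[rotated])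
  then show False using s(2) r' z(2) by simp
qed

text \<open>If only 0 vanished on the Chow set, this constructible set would contain all points with
  \<open>N\<close> nonzero. But a plane \<open>u\<close> meeting the curve in finitely many points
  and a generic plane \<open>v\<close> avoiding these points give such a pair outside the Chow set.
  The degree of the curve provides \<open>u\<close>.\<close>

lemma chow_ideal_nontrivial:
  assumes deg: "has_curve_degree \<gamma> d"
  shows "\<exists>N\<in>vanishing_ideal (chow_set \<gamma>). N \<noteq> 0"
proof -
  obtain \<P> :: "((((3 option + 3 option) + 3) \<Rightarrow> complex) \<Rightarrow> complex) set"
    and Q :: "_ \<Rightarrow> (3 option + 3 option) cpoly" and B
    where PQ: "finite \<P>" "\<And>x. x \<in> chow_set \<gamma> \<longleftrightarrow> {P\<in>\<P>. poly_eval (Q P) x = 0} \<in> B"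
    by (rule chow_set_constructible) blast
  let ?S = "{P\<in>\<P>. Q P = 0}"
  define N where "N = (\<Prod>P\<in>\<P> - ?S. Q P)"
  have "\<exists>z. \<forall>P\<in>\<P> - ?S. poly_eval (Q P) z \<noteq> 0"
    using PQ(1) poly_eval_eq_0_8
    by (intro pfun_finite_common_nonzero[where n = "\<lambda>P. total_degree (Q P)"] pfun_poly_eval) auto
  then obtain z where z: "poly_eval N z \<noteq> 0" using PQ(1) by (auto simp: N_def)
  have pat: "{P\<in>\<P>. poly_eval (Q P) x = 0} = ?S" if "poly_eval N x \<noteq> 0" for x
    using that PQ(1) by (auto simp: N_def)
  have SB: "?S \<notin> B"
  proof
    assume "?S \<in> B"
    then have all: "x \<in> chow_set \<gamma>" if "poly_eval N x \<noteq> 0" for x using PQ(2) pat[OF that] by simp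
    obtain q :: "3 option cpoly" where q: "q \<noteq> 0" "\<And>u. poly_eval q u \<noteq> 0 \<Longrightarrow> finite (\<gamma> \<inter> plane u)"
      using deg unfolding has_curve_degree_def by blast
    define q' where "q' x = poly_eval q (\<lambda>o'. x (Inl o'))" for x :: "3 option + 3 option \<Rightarrow> complex"
    have q': "pfun (total_degree q * 1) q'"
      unfolding q'_def[abs_def] by (intro pfun_poly_eval_compose pfun_var) auto
    have "\<exists>u. poly_eval q u \<noteq> 0" using q(1) poly_eval_eq_0_4 by blast
    then obtain u where "q' (case_sum u (\<lambda>_. 0)) \<noteq> 0" by (auto simp: q'_def)
    then obtain x where x: "q' x \<noteq> 0" "poly_eval N x \<noteq> 0"
      using pfun_common_nonzero[OF q' _ pfun_poly_eval[OF order_refl] z] by blast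
    let ?u = "\<lambda>o'. x (Inl o')"
    have fin: "finite (\<gamma> \<inter> plane ?u)" using x(1) q(2) by (simp add: q'_def)
    let ?inc = "\<lambda>(p :: space3) v. v None + (\<Sum>i\<in>UNIV. v (Some i) * p i)"
    let ?A = "insert None (Some ` (\<gamma> \<inter> plane ?u))"
    let ?P = "\<lambda>a v. case a of None \<Rightarrow> poly_eval N (case_sum ?u v) | Some p \<Rightarrow> ?inc p v"
    have "pfun (total_degree N * 1) (\<lambda>v. poly_eval N (case_sum ?u v))"
    proof (intro pfun_poly_eval_compose order_refl)
      show "pfun 1 (\<lambda>v. case_sum ?u v i)" for i by (cases i) (auto intro: pfun_const pfun_var)
    qed
    moreover have "pfun 1 (?inc p)" for p
      by (intro pfun_add pfun_sum pfun_mult[of 1 _ 0] pfun_var pfun_const) auto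
    moreover have "case_sum ?u (\<lambda>o'. x (Inr o')) = x" by (rule ext) (simp split: sum.split)
    then have "poly_eval N (case_sum ?u (\<lambda>o'. x (Inr o'))) \<noteq> 0" using x(2) by simp
    moreover have "\<exists>v. ?inc p v \<noteq> 0" for p
      by (rule exI[of _ "\<lambda>o'. if o' = None then 1 else 0"]) simp
    ultimately have "\<exists>v. \<forall>a\<in>?A. ?P a v \<noteq> 0"
      using fin by (intro pfun_finite_common_nonzero[where n = "\<lambda>a. case a of None \<Rightarrow> total_degree N * 1 | Some p \<Rightarrow> 1"])
        (auto split: option.split simp del: mult_1_right)
    then obtain v where v: "poly_eval N (case_sum ?u v) \<noteq> 0" "\<And>p. p \<in> \<gamma> \<inter> plane ?u \<Longrightarrow> ?inc p v \<noteq> 0"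
      by auto
    have "case_sum ?u v \<in> chow_set \<gamma>" using all v(1) by blast
    then obtain u' v' p where *: "case_sum ?u v = case_sum u' v'" "p \<in> \<gamma>" "p \<in> plane u'" "p \<in> plane v'"
      by (auto simp: chow_set_def)
    have "u' = ?u" "v' = v" using *(1) by (metis ext sum.case(1), metis ext sum.case(2))
    with * v(2)[of p] show False by (auto simp: plane_def)
  qed
  have "poly_eval N x = 0" if x: "x \<in> chow_set \<gamma>" for x
  proof (rule ccontr)
    assume "poly_eval N x \<noteq> 0"
    from pat[OF this] x PQ(2)[of x] SB show False by simp
  qed
  then have "N \<in> vanishing_ideal (chow_set \<gamma>)" by (simp add: vanishing_ideal_def)
  moreover have "N \<noteq> 0" using z by auto
  ultimately show ?thesis by blast
qed

lemma chow_set_nonempty: "chow_set \<gamma> \<noteq> {}"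
proof -
  obtain p where "p \<in> \<gamma>" using curve_nonempty by blast
  then have "pt a b (dot a p) (dot b p) \<in> chow_set \<gamma>" for a b
    unfolding pt_mem_chow_set_iff by blast
  then show ?thesis by blast
qed

text \<open>Eliminating the variable \<open>Inr None\<close> from \<open>F\<close> and a member
  \<open>g\<close> that is not a multiple of \<open>F\<close> would produce a nonzero member free of
  this variable, which \<open>chow_ideal_no_elimination\<close> excludes.\<close>

lemma chow_ideal_principal:
  assumes F: "irreducible F" "F \<in> vanishing_ideal (chow_set \<gamma>)"
  shows "g \<in> vanishing_ideal (chow_set \<gamma>) \<longleftrightarrow> F dvd g" and "Inr None \<in> poly_vars F"
proof -
  show v0: "Inr None \<in> poly_vars F"
  proof (rule ccontr)
    assume "Inr None \<notin> poly_vars F"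
    then have "F = 0" by (rule chow_ideal_no_elimination[OF F(2)])
    then show False using F(1) by (simp add: irreducible_def)
  qed
  show "g \<in> vanishing_ideal (chow_set \<gamma>) \<longleftrightarrow> F dvd g"
  proof
    assume g: "g \<in> vanishing_ideal (chow_set \<gamma>)"
    show "F dvd g"
    proof (rule ccontr)
      assume "\<not> F dvd g"
      then obtain A B H where H: "A * F + B * g = H" "H \<noteq> 0" "Inr None \<notin> poly_vars H"
        using irreducible_elimination_8[OF F(1) v0] by blast
      have "H \<in> vanishing_ideal (chow_set \<gamma>)"
        using F(2) g by (auto simp: vanishing_ideal_def simp flip: H(1))
      then show False using chow_ideal_no_elimination H by blast
    qed
  next
    assume "F dvd g"
    then show "g \<in> vanishing_ideal (chow_set \<gamma>)" using F(2) by (auto simp: vanishing_ideal_def elim!: dvdE)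
  qed
qed

lemma chow_form_exists:
  assumes "has_curve_degree \<gamma> d"
  shows "\<exists>F. chow_form \<gamma> F"
proof -
  obtain N where N: "N \<in> vanishing_ideal (chow_set \<gamma>)" "N \<noteq> 0"
    using chow_ideal_nontrivial[OF assms] by blast
  have "1 \<notin> vanishing_ideal (chow_set \<gamma>)" using chow_set_nonempty by (auto simp: vanishing_ideal_def)
  then obtain F where F: "F \<in> vanishing_ideal (chow_set \<gamma>)" "irreducible F"
    using ex_irreducible_in_prime_ideal[OF chow_ideal_prime _ _ N] by (auto simp: vanishing_ideal_def)
  have "zero_set F = zariski_closure (chow_set \<gamma>)"
    unfolding zariski_closure_def
  proof (intro equalityI INT_greatest)
    fix g assume "g \<in> vanishing_ideal (chow_set \<gamma>)"
    then have "F dvd g" using chow_ideal_principal(1)[OF F(2,1)] by blast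
    then show "zero_set F \<subseteq> zero_set g" by (auto simp: zero_set_def elim!: dvdE)
  qed (use F(1) in auto)
  then show ?thesis using F(2) by (auto simp: chow_form_def chow_set_def)
qed

lemma chow_form_ideal:
  assumes "chow_form \<gamma> F"
  shows "irreducible F" "F \<in> vanishing_ideal (chow_set \<gamma>)"
proof -
  show "irreducible F" using assms by (simp add: chow_form_def)
  have "zero_set F = zariski_closure (chow_set \<gamma>)" using assms by (simp add: chow_form_def chow_set_def)
  moreover have "chow_set \<gamma> \<subseteq> zariski_closure (chow_set \<gamma>)"
    by (auto simp: zariski_closure_def zero_set_def vanishing_ideal_def)
  ultimately show "F \<in> vanishing_ideal (chow_set \<gamma>)" by (auto simp: vanishing_ideal_def zero_set_def)
qed

text \<open>\<open>G\<close> collects the polynomials of the constructible description that are not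
  divisible by \<open>F\<close>; off its zeros all points of the zero set of \<open>F\<close> have
  the same pattern. Were this the pattern of points outside the Chow set, \<open>G\<close> would
  vanish on the Chow set and be divisible by \<open>F\<close>.\<close>

lemma chow_form_dense:
  assumes F: "chow_form \<gamma> F"
  shows "\<exists>G. \<not> F dvd G \<and> (\<forall>x. poly_eval F x = 0 \<longrightarrow> poly_eval G x \<noteq> 0 \<longrightarrow> x \<in> chow_set \<gamma>)"
proof -
  note F = chow_form_ideal[OF F]
  obtain \<P> :: "((((3 option + 3 option) + 3) \<Rightarrow> complex) \<Rightarrow> complex) set"
    and Q :: "_ \<Rightarrow> (3 option + 3 option) cpoly" and B
    where PQ: "finite \<P>" "\<And>x. x \<in> chow_set \<gamma> \<longleftrightarrow> {P\<in>\<P>. poly_eval (Q P) x = 0} \<in> B"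
    by (rule chow_set_constructible) blast
  let ?S = "{P\<in>\<P>. F dvd Q P}"
  define G where "G = (\<Prod>P\<in>\<P> - ?S. Q P)"
  have ndvd: "\<not> F dvd (\<Prod>P\<in>A. Q P)" if "finite A" "A \<subseteq> \<P> - ?S" for A
    using that
  proof (induction)
    case empty
    then show ?case using F(1) by (simp add: irreducible_def)
  next
    case (insert P A)
    then show ?case using irreducible_dvd_mult_8[OF F(1), of "Q P" "prod Q A"] by auto
  qed
  have G: "\<not> F dvd G" unfolding G_def using PQ(1) by (intro ndvd) auto
  have pat: "{P\<in>\<P>. poly_eval (Q P) x = 0} = ?S" if "poly_eval F x = 0" "poly_eval G x \<noteq> 0" for x
  proof -
    have "poly_eval (Q P) x = 0" if "F dvd Q P" for P
      using that \<open>poly_eval F x = 0\<close> by (auto elim!: dvdE)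
    moreover have "poly_eval (Q P) x \<noteq> 0" if "P \<in> \<P>" "\<not> F dvd Q P" for P
      using that \<open>poly_eval G x \<noteq> 0\<close> PQ(1) by (auto simp: G_def)
    ultimately show ?thesis by blast
  qed
  have "?S \<in> B"
  proof (rule ccontr)
    assume nB: "?S \<notin> B"
    have "poly_eval G x = 0" if x: "x \<in> chow_set \<gamma>" for x
    proof (rule ccontr)
      assume "poly_eval G x \<noteq> 0"
      with pat vanishing_idealD[OF F(2) x] have "{P\<in>\<P>. poly_eval (Q P) x = 0} = ?S" by blast
      with x PQ(2)[of x] nB show False by simp
    qed
    then have "G \<in> vanishing_ideal (chow_set \<gamma>)" by (auto simp: vanishing_ideal_def)
    then show False using chow_ideal_principal(1)[OF F] G by blast
  qed
  then have "x \<in> chow_set \<gamma>" if "poly_eval F x = 0" "poly_eval G x \<noteq> 0" for x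
    using pat[OF that] PQ(2)[of x] by simp
  with G show ?thesis by blast
qed

end

subsection \<open>The Hilbert function of a curve\<close>

lemma underdetermined_system:
  fixes a :: "'i \<Rightarrow> 'j \<Rightarrow> 'a::field"
  assumes "finite J" "finite I" "card J < card I"
  shows "\<exists>c. (\<exists>i\<in>I. c i \<noteq> 0) \<and> (\<forall>j\<in>J. (\<Sum>i\<in>I. c i * a i j) = 0)"
  using assms
proof (induction J arbitrary: I a rule: finite_induct)
  case empty
  then obtain i where "i \<in> I" by (metis card.empty less_irrefl ex_in_conv)
  then show ?case by (intro exI[of _ "\<lambda>_. 1"]) auto
next
  case (insert j J)
  show ?case
  proof (cases "\<forall>i\<in>I. a i j = 0")
    case True
    have "card J < card I" using insert by simp
    then obtain c where "\<exists>i\<in>I. c i \<noteq> 0" "\<forall>j\<in>J. (\<Sum>i\<in>I. c i * a i j) = 0"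
      using insert.IH[OF insert.prems(1), of a] by blast
    then show ?thesis using True by (intro exI[of _ c]) auto
  next
    case False
    then obtain k where k: "k \<in> I" "a k j \<noteq> 0" by blast
    have "card J < card (I - {k})" using insert k by simp
    then obtain c where c: "\<exists>i\<in>I - {k}. c i \<noteq> 0"
      "\<forall>l\<in>J. (\<Sum>i\<in>I - {k}. c i * (a i l - a i j / a k j * a k l)) = 0"
      using insert.IH[of "I - {k}" "\<lambda>i l. a i l - a i j / a k j * a k l"] insert.prems(1) by auto
    define d where "d = c(k := - (\<Sum>i\<in>I - {k}. c i * a i j) / a k j)"
    have sum: "(\<Sum>i\<in>I. d i * a i l) = (\<Sum>i\<in>I - {k}. c i * (a i l - a i j / a k j * a k l))" for l
    proof -
      have "(\<Sum>i\<in>I. d i * a i l) = d k * a k l + (\<Sum>i\<in>I - {k}. d i * a i l)"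
        using k(1) insert.prems(1) by (simp add: sum.remove)
      also have "(\<Sum>i\<in>I - {k}. d i * a i l) = (\<Sum>i\<in>I - {k}. c i * a i l)"
        by (intro sum.cong) (auto simp: d_def)
      also have "d k * a k l = - (\<Sum>i\<in>I - {k}. c i * (a i j / a k j * a k l))"
        by (simp add: d_def sum_divide_distrib sum_distrib_right sum_negf mult.assoc)
      finally show ?thesis by (simp add: right_diff_distrib sum_subtractf)
    qed
    have "(\<Sum>i\<in>I. d i * a i l) = 0" if "l \<in> insert j J" for l
      unfolding sum using that c(2) k(2) by auto
    moreover have "\<exists>i\<in>I. d i \<noteq> 0" using c(1) by (auto simp: d_def)
    ultimately show ?thesis by blast
  qed
qed

definition spn :: "'p set \<Rightarrow> 'b set \<Rightarrow> ('b \<Rightarrow> 'p \<Rightarrow> complex) \<Rightarrow> ('p \<Rightarrow> complex) \<Rightarrow> bool" where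
  "spn X J e f \<longleftrightarrow> (\<exists>c. \<forall>p\<in>X. f p = (\<Sum>b\<in>J. c b * e b p))"

lemma spn_cong: "spn X J e f \<Longrightarrow> (\<And>p. p \<in> X \<Longrightarrow> g p = f p) \<Longrightarrow> spn X J e g"
  unfolding spn_def by auto

lemma spn_base: "finite J \<Longrightarrow> b \<in> J \<Longrightarrow> spn X J e (e b)"
  unfolding spn_def by (rule exI[of _ "\<lambda>b'. if b' = b then 1 else 0"]) (simp add: if_distrib[of "\<lambda>x. x * _"] cong: if_cong)

lemma spn_0: "spn X J e (\<lambda>p. 0)"
  unfolding spn_def by (rule exI[of _ "\<lambda>_. 0"]) simp

lemma spn_add:
  assumes "spn X J e f" "spn X J e g"
  shows "spn X J e (\<lambda>p. f p + g p)"
proof -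
  obtain c where c: "\<forall>p\<in>X. f p = (\<Sum>b\<in>J. c b * e b p)" using assms(1) unfolding spn_def by blast
  obtain d where d: "\<forall>p\<in>X. g p = (\<Sum>b\<in>J. d b * e b p)" using assms(2) unfolding spn_def by blast
  show ?thesis unfolding spn_def
    by (rule exI[of _ "\<lambda>b. c b + d b"]) (simp add: c d algebra_simps sum.distrib)
qed

lemma spn_scale:
  assumes "spn X J e f"
  shows "spn X J e (\<lambda>p. k * f p)"
proof -
  obtain c where c: "\<forall>p\<in>X. f p = (\<Sum>b\<in>J. c b * e b p)" using assms(1) unfolding spn_def by blast
  show ?thesis unfolding spn_def
    by (rule exI[of _ "\<lambda>b. k * c b"]) (simp add: c sum_distrib_left mult.assoc)
qed

lemma spn_sum: "(\<And>a. a \<in> A \<Longrightarrow> spn X J e (f a)) \<Longrightarrow> spn X J e (\<lambda>p. \<Sum>a\<in>A. f a p)"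
  by (induction A rule: infinite_finite_induct) (auto intro: spn_0 spn_add)

lemma spn_mono:
  assumes "spn X J e f" "J \<subseteq> J'" "finite J'"
  shows "spn X J' e f"
proof -
  obtain c where c: "\<forall>p\<in>X. f p = (\<Sum>b\<in>J. c b * e b p)" using assms(1) unfolding spn_def by blast
  have "(\<Sum>b\<in>J. c b * e b p) = (\<Sum>b\<in>J'. (if b \<in> J then c b else 0) * e b p)" for p
    using assms(2,3) by (intro sum.mono_neutral_cong_left) auto
  with c show ?thesis unfolding spn_def by (intro exI[of _ "\<lambda>b. if b \<in> J then c b else 0"]) auto
qed

lemma spn_dependent:
  assumes "finite J" "finite I" "card J < card I" "\<And>i. i \<in> I \<Longrightarrow> spn X J e (f i)"
  shows "\<exists>c. (\<exists>i\<in>I. c i \<noteq> 0) \<and> (\<forall>p\<in>X. (\<Sum>i\<in>I. c i * f i p) = 0)"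
proof -
  have "\<forall>i\<in>I. \<exists>a. \<forall>p\<in>X. f i p = (\<Sum>b\<in>J. a b * e b p)" using assms(4) unfolding spn_def by blast
  from bchoice[OF this] obtain a where a: "\<forall>i\<in>I. \<forall>p\<in>X. f i p = (\<Sum>b\<in>J. a i b * e b p)" ..
  obtain c where c: "\<exists>i\<in>I. c i \<noteq> 0" "\<forall>b\<in>J. (\<Sum>i\<in>I. c i * a i b) = 0"
    using underdetermined_system[OF assms(1-3), of a] by blast
  have "(\<Sum>i\<in>I. c i * f i p) = 0" if "p \<in> X" for p
  proof -
    have "(\<Sum>i\<in>I. c i * f i p) = (\<Sum>i\<in>I. \<Sum>b\<in>J. c i * a i b * e b p)"
      using a that by (intro sum.cong) (auto simp: sum_distrib_left mult.assoc)
    also have "\<dots> = (\<Sum>b\<in>J. (\<Sum>i\<in>I. c i * a i b) * e b p)"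
      by (subst sum.swap) (simp add: sum_distrib_right)
    also have "\<dots> = 0" using c(2) by simp
    finally show ?thesis .
  qed
  with c(1) show ?thesis by blast
qed

definition xyz_index :: "nat \<Rightarrow> nat \<Rightarrow> nat \<Rightarrow> (nat \<times> nat \<times> nat) set" where
  "xyz_index e1 e2 m = {(i, j, k). i + j + k \<le> m \<and> j < e1 \<and> k < e2}"

lemma finite_xyz_index: "finite (xyz_index e1 e2 m)"
  by (rule finite_subset[of _ "{..m} \<times> {..m} \<times> {..m}"]) (auto simp: xyz_index_def)

text \<open>An integral equation of degree \<open>e\<close> for \<open>y\<close> over
  \<open>x\<close>. The bound on \<open>i + j\<close> says that replacing \<open>y ^ e\<close> does
  not raise the total degree.\<close>

definition monic_rel :: "'p set \<Rightarrow> ('p \<Rightarrow> complex) \<Rightarrow> ('p \<Rightarrow> complex) \<Rightarrow> nat \<Rightarrow> bool" where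
  "monic_rel X x y e \<longleftrightarrow> spn X {(i, j). i + j \<le> e \<and> j < e} (\<lambda>(i, j) p. x p ^ i * y p ^ j) (\<lambda>p. y p ^ e)"

text \<open>Rewriting with either equation does not raise the total degree and lowers
  \<open>j + k\<close>, so it ends with both exponents bounded.\<close>

lemma xyz_reduce:
  assumes y: "monic_rel X x y e1" and z: "monic_rel X x z e2"
  shows "i + j + k \<le> m \<Longrightarrow> spn X (xyz_index e1 e2 m) (\<lambda>(i, j, k) p. x p ^ i * y p ^ j * z p ^ k)
      (\<lambda>p. x p ^ i * y p ^ j * z p ^ k)"
proof (induction "j + k" arbitrary: i j k rule: less_induct)
  case less
  let ?S = "spn X (xyz_index e1 e2 m) (\<lambda>(i, j, k) p. x p ^ i * y p ^ j * z p ^ k)"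
  consider "j \<ge> e1" | "k \<ge> e2" | "j < e1" "k < e2" by linarith
  then show ?case
  proof cases
    case 1
    obtain c where c: "\<forall>p\<in>X. y p ^ e1 = (\<Sum>b\<in>{(i, j). i + j \<le> e1 \<and> j < e1}. c b * (\<lambda>(i, j) p. x p ^ i * y p ^ j) b p)"
      using y unfolding monic_rel_def spn_def by blast
    have "?S (\<lambda>p. \<Sum>b\<in>{(i, j). i + j \<le> e1 \<and> j < e1}. c b * (x p ^ (i + fst b) * y p ^ (j - e1 + snd b) * z p ^ k))"
      by (intro spn_sum spn_scale less.hyps) (use 1 less.prems in auto)
    then show ?thesis
    proof (rule spn_cong)
      fix p assume "p \<in> X"
      have "y p ^ j = y p ^ (j - e1) * y p ^ e1" using 1 by (simp flip: power_add)
      also have "\<dots> = y p ^ (j - e1) * (\<Sum>b\<in>{(i, j). i + j \<le> e1 \<and> j < e1}. c b * (x p ^ fst b * y p ^ snd b))"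
        using c \<open>p \<in> X\<close> by (simp add: case_prod_unfold)
      finally show "x p ^ i * y p ^ j * z p ^ k =
          (\<Sum>b\<in>{(i, j). i + j \<le> e1 \<and> j < e1}. c b * (x p ^ (i + fst b) * y p ^ (j - e1 + snd b) * z p ^ k))"
        by (simp add: sum_distrib_left sum_distrib_right power_add mult_ac)
    qed
  next
    case 2
    obtain c where c: "\<forall>p\<in>X. z p ^ e2 = (\<Sum>b\<in>{(i, j). i + j \<le> e2 \<and> j < e2}. c b * (\<lambda>(i, j) p. x p ^ i * z p ^ j) b p)"
      using z unfolding monic_rel_def spn_def by blast
    have "?S (\<lambda>p. \<Sum>b\<in>{(i, j). i + j \<le> e2 \<and> j < e2}. c b * (x p ^ (i + fst b) * y p ^ j * z p ^ (k - e2 + snd b)))"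
      by (intro spn_sum spn_scale less.hyps) (use 2 less.prems in auto)
    then show ?thesis
    proof (rule spn_cong)
      fix p assume "p \<in> X"
      have "z p ^ k = z p ^ (k - e2) * z p ^ e2" using 2 by (simp flip: power_add)
      also have "\<dots> = z p ^ (k - e2) * (\<Sum>b\<in>{(i, j). i + j \<le> e2 \<and> j < e2}. c b * (x p ^ fst b * z p ^ snd b))"
        using c \<open>p \<in> X\<close> by (simp add: case_prod_unfold)
      finally show "x p ^ i * y p ^ j * z p ^ k =
          (\<Sum>b\<in>{(i, j). i + j \<le> e2 \<and> j < e2}. c b * (x p ^ (i + fst b) * y p ^ j * z p ^ (k - e2 + snd b)))"
        by (simp add: sum_distrib_left sum_distrib_right power_add mult_ac)
    qed
  next
    case 3
    then have "(i, j, k) \<in> xyz_index e1 e2 m" using less.prems by (simp add: xyz_index_def)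
    from spn_base[OF finite_xyz_index this, of X "\<lambda>(i, j, k) p. x p ^ i * y p ^ j * z p ^ k"] show ?thesis by simp
  qed
qed

text \<open>By \<open>lin\<close> every coordinate is a combination of \<open>x\<close>,
  \<open>y\<close> and \<open>z\<close>, so multiplication by a coordinate raises the degree bound
  by one; monomials follow by induction on the degree.\<close>

lemma xyz_span:
  assumes y: "monic_rel X x y e1" and z: "monic_rel X x z e2"
    and lin: "\<And>i. \<exists>\<alpha> \<beta> \<delta>. \<forall>p\<in>X. p i = \<alpha> * x p + \<beta> * y p + \<delta> * z p"
    and g: "pfun m g"
  shows "spn X (xyz_index e1 e2 m) (\<lambda>(i, j, k) p. x p ^ i * y p ^ j * z p ^ k) g"
proof -
  let ?S = "\<lambda>m. spn X (xyz_index e1 e2 m) (\<lambda>(i, j, k) p. x p ^ i * y p ^ j * z p ^ k)"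
  note red = xyz_reduce[OF y z]
  have mult: "?S (Suc m) (\<lambda>p. p i * f p)" if f: "?S m f" for m f i
  proof -
    obtain c where c: "\<forall>p\<in>X. f p = (\<Sum>b\<in>xyz_index e1 e2 m. c b * (\<lambda>(i, j, k) p. x p ^ i * y p ^ j * z p ^ k) b p)"
      using f unfolding spn_def by blast
    obtain \<alpha> \<beta> \<delta> where l: "\<forall>p\<in>X. p i = \<alpha> * x p + \<beta> * y p + \<delta> * z p" using lin by blast
    have "?S (Suc m) (\<lambda>p. \<Sum>b\<in>xyz_index e1 e2 m. c b * (\<alpha> * (x p ^ Suc (fst b) * y p ^ fst (snd b) * z p ^ snd (snd b)) +
        \<beta> * (x p ^ fst b * y p ^ Suc (fst (snd b)) * z p ^ snd (snd b)) +
        \<delta> * (x p ^ fst b * y p ^ fst (snd b) * z p ^ Suc (snd (snd b)))))"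
      by (intro spn_sum spn_scale spn_add red) (auto simp: xyz_index_def)
    then show ?thesis
    proof (rule spn_cong)
      fix p assume p: "p \<in> X"
      then have "p i * f p = (\<alpha> * x p + \<beta> * y p + \<delta> * z p) * (\<Sum>b\<in>xyz_index e1 e2 m. c b * (x p ^ fst b * y p ^ fst (snd b) * z p ^ snd (snd b)))"
        using c l by (simp add: case_prod_unfold)
      then show "p i * f p = (\<Sum>b\<in>xyz_index e1 e2 m. c b * (\<alpha> * (x p ^ Suc (fst b) * y p ^ fst (snd b) * z p ^ snd (snd b)) +
        \<beta> * (x p ^ fst b * y p ^ Suc (fst (snd b)) * z p ^ snd (snd b)) +
        \<delta> * (x p ^ fst b * y p ^ fst (snd b) * z p ^ Suc (snd (snd b)))))"
        by (simp add: sum_distrib_left algebra_simps)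
    qed
  qed
  have mono: "?S (monom_degree k) (mono_eval k)" for k
  proof (induction "monom_degree k" arbitrary: k)
    case 0
    then have "k = 0" by (intro poly_mapping_eqI) (auto simp: monom_degree_def in_keys_iff)
    then show ?case using red[of 0 0 0 0] by (simp add: spn_cong)
  next
    case (Suc n)
    then have "Poly_Mapping.keys k \<noteq> {}" by (auto simp: monom_degree_def)
    then obtain i where i: "i \<in> Poly_Mapping.keys k" by blast
    then have k: "k = Poly_Mapping.single i 1 + (k - Poly_Mapping.single i 1)"
      by (intro poly_mapping_eqI) (auto simp: lookup_add lookup_minus lookup_single when_def in_keys_iff)
    let ?k = "k - Poly_Mapping.single i 1"
    have "monom_degree k = 1 + monom_degree ?k" by (subst k) simp
    then have deg: "monom_degree ?k = n" using Suc(2) by simp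
    have "?S (Suc n) (\<lambda>p. p i * mono_eval ?k p)" using mult[OF Suc(1)[OF deg[symmetric]]] deg by simp
    moreover have "mono_eval k p = p i * mono_eval ?k p" for p by (subst k) (simp add: mono_eval_add)
    ultimately show ?case using Suc(2) by (simp add: spn_cong)
  qed
  obtain h where h: "total_degree h \<le> m" "\<And>p. g p = poly_eval h p" using g by (rule pfunE) blast
  have "?S m (\<lambda>p. \<Sum>k\<in>Poly_Mapping.keys h. Poly_Mapping.lookup h k * mono_eval k p)"
  proof (intro spn_sum spn_scale)
    fix k assume "k \<in> Poly_Mapping.keys h"
    then have "monom_degree k \<le> m" using h(1) by (simp add: total_degree_le_iff)
    then have "xyz_index e1 e2 (monom_degree k) \<subseteq> xyz_index e1 e2 m" by (auto simp: xyz_index_def)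
    from spn_mono[OF mono this finite_xyz_index] show "?S m (mono_eval k)" .
  qed
  then show ?thesis by (rule spn_cong) (simp add: h(2) poly_eval_mono)
qed

definition crs :: "(3 \<Rightarrow> complex) \<Rightarrow> (3 \<Rightarrow> complex) \<Rightarrow> 3 \<Rightarrow> complex" where
  "crs a b = (\<lambda>i. if i = 1 then a 2 * b 3 - a 3 * b 2 else if i = 2 then a 3 * b 1 - a 1 * b 3 else a 1 * b 2 - a 2 * b 1)"

lemma crs_simps [simp]: "crs a b 1 = a 2 * b 3 - a 3 * b 2" "crs a b 2 = a 3 * b 1 - a 1 * b 3"
  "crs a b 3 = a 1 * b 2 - a 2 * b 1"
  by (simp_all add: crs_def)

lemma dot_3: "dot a b = a 1 * b 1 + a 2 * b 2 + a 3 * b 3"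
  by (simp add: dot_def sum_3)

lemma cramer_3:
  "dot a (crs b c) * p i = dot a p * crs b c i + dot b p * crs c a i + dot c p * crs a b i"
proof -
  have "i = 1 \<or> i = 2 \<or> i = 3" by (rule exhaust_3)
  then show ?thesis by (elim disjE) (simp_all add: dot_3 algebra_simps)
qed

text \<open>The part of degree \<open>e\<close> in the two constant terms jointly. For fixed
  directions and maximal \<open>e\<close> it is the top form of \<open>F\<close> in these terms, and
  its values are the coefficients that have to be nonzero for an integral equation.\<close>

definition top_part :: "(3 option + 3 option) cpoly \<Rightarrow> nat \<Rightarrow> (3 option + 3 option) cpoly" where
  "top_part F e = (\<Sum>m\<in>{m\<in>Poly_Mapping.keys F. Poly_Mapping.lookup m (Inl None) + Poly_Mapping.lookup m (Inr None) = e}.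
     Poly_Mapping.single m (Poly_Mapping.lookup F m))"

definition rest_eval :: "(3 option + 3 option) monom \<Rightarrow> (3 \<Rightarrow> complex) \<Rightarrow> (3 \<Rightarrow> complex) \<Rightarrow> complex" where
  "rest_eval m a b = (\<Prod>i\<in>UNIV. a i ^ Poly_Mapping.lookup m (Inl (Some i))) * (\<Prod>i\<in>UNIV. b i ^ Poly_Mapping.lookup m (Inr (Some i)))"

lemma mono_eval_pt:
  "mono_eval m (pt a b s t) = rest_eval m a b * (- s) ^ Poly_Mapping.lookup m (Inl None) * (- t) ^ Poly_Mapping.lookup m (Inr None)"
proof -
  have "mono_eval m x = (\<Prod>v\<in>UNIV. x v ^ Poly_Mapping.lookup m v)" for x
    by (rule mono_eval_superset) auto
  also have "(\<Prod>v\<in>UNIV. x v ^ Poly_Mapping.lookup m v) =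
      (\<Prod>v\<in>UNIV. x (Inl v) ^ Poly_Mapping.lookup m (Inl v)) * (\<Prod>v\<in>UNIV. x (Inr v) ^ Poly_Mapping.lookup m (Inr v))"
    for x :: "3 option + 3 option \<Rightarrow> complex"
    by (simp add: UNIV_Plus_UNIV[symmetric] prod.Plus del: UNIV_Plus_UNIV)
  finally show ?thesis
    by (simp add: UNIV_option_conv prod.insert prod.reindex rest_eval_def mult_ac)
qed

lemma poly_eval_top_part:
  "poly_eval (top_part F e) (pt a b s t) =
    (\<Sum>m\<in>{m\<in>Poly_Mapping.keys F. Poly_Mapping.lookup m (Inl None) + Poly_Mapping.lookup m (Inr None) = e}.
      Poly_Mapping.lookup F m * mono_eval m (pt a b s t))"
  by (simp add: top_part_def)

lemma linear_power_expand:
  assumes "m0 + m1 \<le> e"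
  shows "spn X {(i, j). i + j \<le> e \<and> j < e} (\<lambda>(i, j) p. x p ^ i * y p ^ j)
    (\<lambda>p. (x p + l * y p) ^ m0 * y p ^ m1 - (if m0 + m1 = e then l ^ m0 * y p ^ e else 0))"
proof -
  let ?J = "{(i, j). i + j \<le> e \<and> j < e}"
  have fin: "finite ?J" by (rule finite_subset[of _ "{..e} \<times> {..e}"]) auto
  let ?t = "\<lambda>k p. of_nat (m0 choose k) * x p ^ k * (l * y p) ^ (m0 - k) * y p ^ m1"
  let ?r = "\<lambda>k p. if k = 0 \<and> m0 + m1 = e then l ^ m0 * y p ^ e else 0"
  have "spn X ?J (\<lambda>(i, j) p. x p ^ i * y p ^ j) (\<lambda>p. ?t k p - ?r k p)" if k: "k \<le> m0" for k
  proof (cases "k = 0 \<and> m0 + m1 = e")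
    case True
    then have "?t k p - ?r k p = 0" for p by (auto simp: power_mult_distrib power_add)
    then show ?thesis by (intro spn_cong[OF spn_0]) auto
  next
    case False
    then have "(k, m0 - k + m1) \<in> ?J" using assms k by auto
    from spn_scale[OF spn_base[OF fin this], of X "\<lambda>(i, j) p. x p ^ i * y p ^ j" "of_nat (m0 choose k) * l ^ (m0 - k)"]
    show ?thesis by (rule spn_cong) (use False in \<open>auto simp: power_mult_distrib power_add\<close>)
  qed
  then have "spn X ?J (\<lambda>(i, j) p. x p ^ i * y p ^ j) (\<lambda>p. \<Sum>k\<le>m0. ?t k p - ?r k p)"
    by (intro spn_sum) auto
  then show ?thesis
  proof (rule spn_cong)
    fix p
    have "(\<Sum>k\<le>m0. ?r k p) = (\<Sum>k\<le>m0. if k = 0 then (if m0 + m1 = e then l ^ m0 * y p ^ e else 0) else 0)"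
      by (intro sum.cong) auto
    also have "\<dots> = (if m0 + m1 = e then l ^ m0 * y p ^ e else 0)"
      by (subst sum.delta) auto
    finally show "(x p + l * y p) ^ m0 * y p ^ m1 - (if m0 + m1 = e then l ^ m0 * y p ^ e else 0) =
        (\<Sum>k\<le>m0. ?t k p - ?r k p)"
      by (simp add: sum_subtractf binomial_ring sum_distrib_right)
  qed
qed

text \<open>With \<open>dot a p = dot x p + l * dot b p\<close> the Chow equation relates
  \<open>dot x\<close> and \<open>dot b\<close>, and the power \<open>e\<close> of
  \<open>dot b\<close> has the coefficient \<open>T\<close>, the top part at the constants
  \<open>l\<close> and 1. Dividing by it gives the integral equation.\<close>

lemma chow_monic_rel:
  assumes van: "\<And>p. p \<in> X \<Longrightarrow> poly_eval F (pt a b (dot a p) (dot b p)) = 0"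
    and e: "\<And>m. m \<in> Poly_Mapping.keys F \<Longrightarrow> Poly_Mapping.lookup m (Inl None) + Poly_Mapping.lookup m (Inr None) \<le> e"
    and top: "poly_eval (top_part F e) (pt a b l 1) \<noteq> 0"
    and x: "x = (\<lambda>i. a i - l * b i)"
  shows "monic_rel X (dot x) (dot b) e"
proof -
  let ?S = "spn X {(i, j). i + j \<le> e \<and> j < e} (\<lambda>(i, j) p. dot x p ^ i * dot b p ^ j)"
  define m0 where "m0 m = Poly_Mapping.lookup m (Inl None)" for m :: "(3 option + 3 option) monom"
  define m1 where "m1 m = Poly_Mapping.lookup m (Inr None)" for m :: "(3 option + 3 option) monom"
  define T where "T = poly_eval (top_part F e) (pt a b l 1)"
  define c where "c m = Poly_Mapping.lookup F m * rest_eval m a b * (- 1) ^ (m0 m + m1 m)" for m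
  have dax: "dot a p = dot x p + l * dot b p" for p by (simp add: x dot_3 algebra_simps)
  have neg: "(- z) ^ k = (- 1) ^ k * z ^ k" for z :: complex and k by (rule power_minus)
  have T: "T = (\<Sum>m\<in>Poly_Mapping.keys F. if m0 m + m1 m = e then c m * l ^ m0 m else 0)"
  proof -
    have "T = (\<Sum>m\<in>{m\<in>Poly_Mapping.keys F. m0 m + m1 m = e}. c m * l ^ m0 m)"
      unfolding T_def poly_eval_top_part m0_def[symmetric] m1_def[symmetric]
    proof (intro sum.cong refl)
      fix m
      show "Poly_Mapping.lookup F m * mono_eval m (pt a b l 1) = c m * l ^ m0 m"
        unfolding mono_eval_pt c_def m0_def[symmetric] m1_def[symmetric] neg[of l] power_add by (simp add: mult_ac)
    qed
    then show ?thesis by (simp add: sum.inter_filter)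
  qed
  have "?S (\<lambda>p. \<Sum>m\<in>Poly_Mapping.keys F. c m * ((dot x p + l * dot b p) ^ m0 m * dot b p ^ m1 m -
      (if m0 m + m1 m = e then l ^ m0 m * dot b p ^ e else 0)))"
    by (intro spn_sum spn_scale linear_power_expand) (use e in \<open>auto simp: m0_def m1_def\<close>)
  then have "?S (\<lambda>p. - T * dot b p ^ e)"
  proof (rule spn_cong)
    fix p assume p: "p \<in> X"
    have "0 = (\<Sum>m\<in>Poly_Mapping.keys F. Poly_Mapping.lookup F m * mono_eval m (pt a b (dot a p) (dot b p)))"
      using van[OF p] by (simp add: poly_eval_mono)
    also have "\<dots> = (\<Sum>m\<in>Poly_Mapping.keys F. c m * ((dot x p + l * dot b p) ^ m0 m * dot b p ^ m1 m))"
    proof (intro sum.cong refl)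
      fix m
      show "Poly_Mapping.lookup F m * mono_eval m (pt a b (dot a p) (dot b p)) =
          c m * ((dot x p + l * dot b p) ^ m0 m * dot b p ^ m1 m)"
        unfolding mono_eval_pt c_def m0_def[symmetric] m1_def[symmetric] neg[of "dot a p"] neg[of "dot b p"]
          dax[symmetric] power_add by (simp add: mult_ac)
    qed
    finally have 1: "(\<Sum>m\<in>Poly_Mapping.keys F. c m * ((dot x p + l * dot b p) ^ m0 m * dot b p ^ m1 m)) = 0" by simp
    have 2: "T * dot b p ^ e = (\<Sum>m\<in>Poly_Mapping.keys F. c m * (if m0 m + m1 m = e then l ^ m0 m * dot b p ^ e else 0))"
      unfolding T sum_distrib_right by (intro sum.cong) auto
    show "- T * dot b p ^ e = (\<Sum>m\<in>Poly_Mapping.keys F. c m * ((dot x p + l * dot b p) ^ m0 m * dot b p ^ m1 m -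
      (if m0 m + m1 m = e then l ^ m0 m * dot b p ^ e else 0)))"
      unfolding right_diff_distrib sum_subtractf 1 2[symmetric] by simp
  qed
  from spn_scale[OF this, of "- 1 / T"] show ?thesis
    unfolding monic_rel_def by (rule spn_cong) (use top in \<open>simp add: T_def\<close>)
qed

text \<open>Homogeneity in the two constant terms allows the second one to be scaled to 1.\<close>

lemma top_part_nonzero:
  assumes "F \<noteq> 0"
  obtains e a b l where "e \<le> total_degree F"
    "\<And>m. m \<in> Poly_Mapping.keys F \<Longrightarrow> Poly_Mapping.lookup m (Inl None) + Poly_Mapping.lookup m (Inr None) \<le> e"
    "poly_eval (top_part F e) (pt a b l 1) \<noteq> 0"
proof -
  define h where "h m = Poly_Mapping.lookup m (Inl None) + Poly_Mapping.lookup m (Inr None)" for m :: "(3 option + 3 option) monom"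
  have ne: "Poly_Mapping.keys F \<noteq> {}" using assms by simp
  define e where "e = Max (h ` Poly_Mapping.keys F)"
  have le: "h m \<le> e" if "m \<in> Poly_Mapping.keys F" for m using that by (simp add: e_def)
  have "e \<in> h ` Poly_Mapping.keys F" unfolding e_def using ne by (intro Max_in) auto
  then obtain m where m: "m \<in> Poly_Mapping.keys F" "h m = e" by auto
  have "Poly_Mapping.lookup (top_part F e) m = Poly_Mapping.lookup F m"
    using m unfolding top_part_def h_def[symmetric] by (simp add: lookup_sum lookup_single when_def)
  then have "top_part F e \<noteq> 0" using m(1) by (auto simp: in_keys_iff)
  then obtain x where x: "poly_eval (top_part F e) x \<noteq> 0" using poly_eval_eq_0_8 by blast
  have "\<exists>y. poly_eval (top_part F e) y \<noteq> 0 \<and> y (Inr None) \<noteq> 0"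
    by (rule pfun_common_nonzero[where n = "total_degree (top_part F e)" and m = 1 and x = x and y = "\<lambda>_. 1"])
      (simp_all add: pfun_poly_eval pfun_var x)
  then obtain y where y: "poly_eval (top_part F e) y \<noteq> 0" "y (Inr None) \<noteq> 0" by blast
  define a where "a = (\<lambda>i. y (Inl (Some i)))"
  define b where "b = (\<lambda>i. y (Inr (Some i)))"
  define s where "s = - y (Inl None)"
  define t where "t = - y (Inr None)"
  have yp: "y = pt a b s t" using pt_collapse[of y] by (simp add: a_def b_def s_def t_def)
  have t: "t \<noteq> 0" using y(2) by (simp add: t_def)
  have "poly_eval (top_part F e) (pt a b s t) = t ^ e * poly_eval (top_part F e) (pt a b (s / t) 1)"
    unfolding poly_eval_top_part sum_distrib_left
  proof (rule sum.cong)
    fix m assume "m \<in> {m\<in>Poly_Mapping.keys F. Poly_Mapping.lookup m (Inl None) + Poly_Mapping.lookup m (Inr None) = e}"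
    then have e: "e = Poly_Mapping.lookup m (Inl None) + Poly_Mapping.lookup m (Inr None)" by simp
    have 1: "(- s) ^ k = t ^ k * (- (s / t)) ^ k" for k using t by (simp flip: power_mult_distrib)
    have 2: "(- t) ^ k = t ^ k * (- 1) ^ k" for k by (simp flip: power_mult_distrib)
    show "Poly_Mapping.lookup F m * mono_eval m (pt a b s t) =
        t ^ e * (Poly_Mapping.lookup F m * mono_eval m (pt a b (s / t) 1))"
      unfolding mono_eval_pt e power_add 1 2 by (simp only: mult_ac)
  qed simp
  then have "poly_eval (top_part F e) (pt a b (s / t) 1) \<noteq> 0" using y(1) yp t by auto
  moreover have "e \<le> total_degree F"
  proof -
    have "(\<Sum>i\<in>{Inl None, Inr None}. Poly_Mapping.lookup m i) \<le> (\<Sum>i\<in>UNIV. Poly_Mapping.lookup m i)"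
      by (rule sum_mono2) auto
    also have "\<dots> = monom_degree m" by (rule monom_degree_superset[symmetric]) auto
    finally have "h m \<le> monom_degree m" by (simp add: h_def)
    then show ?thesis using m monom_degree_le_total_degree[OF m(1)] by simp
  qed
  ultimately show ?thesis using that[of e a b "s / t"] le by (simp add: h_def)
qed

text \<open>In generic coordinates the Chow form makes two of them integral over the third one, so that
  monomials with bounded exponents of those two suffice.\<close>

lemma curve_hilbert_function:
  assumes "irreducible_curve \<gamma>" "chow_form \<gamma> F"
  obtains e :: "nat \<times> nat \<times> nat \<Rightarrow> space3 \<Rightarrow> complex" and J where
    "\<And>m. finite (J m)" "\<And>m. card (J m) \<le> (m + 1) * (total_degree F)\<^sup>2"
    "\<And>m g. pfun m g \<Longrightarrow> spn \<gamma> (J m) e g"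
proof -
  note F = chow_form_ideal[OF assms]
  have van: "poly_eval F (pt a b (dot a p) (dot b p)) = 0" if "p \<in> \<gamma>" for a b p
  proof -
    have "pt a b (dot a p) (dot b p) \<in> chow_set \<gamma>" using that by (auto simp: pt_mem_chow_set_iff)
    then show ?thesis by (rule vanishing_idealD[OF F(2)])
  qed
  have "F \<noteq> 0" using F(1) by auto
  then obtain e a b l where e: "e \<le> total_degree F"
    "\<And>m. m \<in> Poly_Mapping.keys F \<Longrightarrow> Poly_Mapping.lookup m (Inl None) + Poly_Mapping.lookup m (Inr None) \<le> e"
    "poly_eval (top_part F e) (pt a b l 1) \<noteq> 0" by (rule top_part_nonzero) blast
  \<comment> \<open>One vector \<open>w\<close> packs a common direction \<open>X\<close>, two
    directions \<open>Y 0\<close> and \<open>Y 1\<close>, and two scalars. With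
    \<open>A k = X + L k * Y k\<close> both integral equations are over the same function
    \<open>dot X\<close>.\<close>
  define X where "X w i = w (0, i)" for w :: "nat \<times> 3 \<Rightarrow> complex" and i
  define Y where "Y k w i = w (Suc k, i)" for k and w :: "nat \<times> 3 \<Rightarrow> complex" and i
  define L where "L k w = w (k + 3, 1)" for k and w :: "nat \<times> 3 \<Rightarrow> complex"
  define A where "A k w i = X w i + L k w * Y k w i" for k w i
  have pf: "pfun 1 (\<lambda>w. X w i)" "pfun 1 (\<lambda>w. Y k w i)" "pfun 1 (\<lambda>w. L k w)" for i k
    by (simp_all add: X_def Y_def L_def pfun_var)
  have pA: "pfun 2 (\<lambda>w. A k w i)" for k i
    unfolding A_def by (intro pfun_add pfun_mult[of 1 _ 1] pfun_mono[OF pf(1)] pf) auto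
  define P where "P k w = (if k = 2 then dot (X w) (crs (Y 0 w) (Y 1 w))
      else poly_eval (top_part F e) (pt (A k w) (Y k w) (L k w) 1))" for k :: nat and w
  have "\<exists>w. \<forall>k\<in>{0, 1, 2}. P k w \<noteq> 0"
  proof (rule pfun_finite_common_nonzero[where n = "\<lambda>k. if k = 2 then 3 else total_degree (top_part F e) * 2"])
    fix k :: nat assume k: "k \<in> {0, 1, 2}"
    show "pfun (if k = 2 then 3 else total_degree (top_part F e) * 2) (P k)"
    proof (cases "k = 2")
      case True
      have "pfun 2 (\<lambda>w. Y 0 w j * Y 1 w j' - Y 0 w j' * Y 1 w j)" for j j'
        by (intro pfun_diff pfun_mult[of 1 _ 1] pf) auto
      then have "pfun 2 (\<lambda>w. crs (Y 0 w) (Y 1 w) i)" for i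
        unfolding crs_def by (cases "i = 1"; cases "i = 2") simp_all
      then have "pfun 3 (\<lambda>w. dot (X w) (crs (Y 0 w) (Y 1 w)))" by (intro pfun_dot[of 1 _ 2] pf) auto
      then show ?thesis using True by (simp add: P_def[abs_def])
    next
      case False
      have "pfun (total_degree (top_part F e) * 2) (\<lambda>w. poly_eval (top_part F e) (pt (A k w) (Y k w) (L k w) 1))"
        by (intro pfun_poly_eval_compose order_refl pfun_pt pA pfun_const pfun_mono[OF pf(2)] pfun_mono[OF pf(3)]) auto
      then show ?thesis using False by (simp add: P_def[abs_def])
    qed
    show "\<exists>w. P k w \<noteq> 0"
    proof (cases "k = 2")
      case True
      let ?w = "\<lambda>(j :: nat, i :: 3). if (j = 0 \<and> i = 1) \<or> (j = 1 \<and> i = 2) \<or> (j = 2 \<and> i = 3) then 1 else 0 :: complex"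
      have "P k ?w \<noteq> 0" using True by (simp add: P_def dot_3 X_def Y_def)
      then show ?thesis by (intro exI[where x = ?w])
    next
      case False
      \<comment> \<open>\<open>X = a - l * b\<close>, \<open>Y k = b\<close> and
        \<open>L k = l\<close> give back \<open>A k = a\<close>, so the nonvanishing known for
        \<open>a\<close>, \<open>b\<close> and \<open>l\<close> transfers.\<close>
      let ?w = "\<lambda>(j :: nat, i :: 3). if j = 0 then a i - l * b i else if j = Suc k then b i else l"
      have "A k ?w = a" "Y k ?w = b" "L k ?w = l"
        using False k by (auto simp: A_def X_def Y_def L_def fun_eq_iff)
      then have "P k ?w \<noteq> 0" using False e(3) by (simp add: P_def)
      then show ?thesis by (intro exI[where x = ?w])
    qed
  qed simp
  then obtain w where w: "\<And>k. k \<in> {0, 1, 2} \<Longrightarrow> P k w \<noteq> 0" by blast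
  have rel: "monic_rel \<gamma> (dot (X w)) (dot (Y k w)) e" if "k < 2" for k
  proof (rule chow_monic_rel[where a = "A k w" and l = "L k w" and F = F])
    have "k \<in> {0, 1, 2}" using that by auto
    from w[OF this] show "poly_eval (top_part F e) (pt (A k w) (Y k w) (L k w) 1) \<noteq> 0"
      using that by (simp add: P_def)
  qed (auto simp: A_def van e(2))
  define J where "J = xyz_index e e"
  define E where "E = (\<lambda>(i, j, k) p. dot (X w) p ^ i * dot (Y 0 w) p ^ j * dot (Y 1 w) p ^ k)"
  have J3: "spn \<gamma> (J m) E g" if g: "pfun m g" for m g
    unfolding J_def E_def
  proof (rule xyz_span[OF rel rel _ g])
    fix i
    define D where "D = dot (X w) (crs (Y 0 w) (Y 1 w))"
    have D: "D \<noteq> 0" using w[of 2] by (simp add: P_def D_def)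
    have "D * p i = dot (X w) p * crs (Y 0 w) (Y 1 w) i + dot (Y 0 w) p * crs (Y 1 w) (X w) i +
        dot (Y 1 w) p * crs (X w) (Y 0 w) i" for p
      unfolding D_def by (rule cramer_3)
    then have "p i = crs (Y 0 w) (Y 1 w) i / D * dot (X w) p + crs (Y 1 w) (X w) i / D * dot (Y 0 w) p +
        crs (X w) (Y 0 w) i / D * dot (Y 1 w) p" for p
      using D by (simp add: add_divide_distrib[symmetric] eq_divide_eq mult.commute)
    then show "\<exists>\<alpha> \<beta> \<delta>. \<forall>p\<in>\<gamma>. p i = \<alpha> * dot (X w) p + \<beta> * dot (Y 0 w) p + \<delta> * dot (Y 1 w) p" by blast
  qed auto
  have J1: "finite (J m)" for m by (simp add: J_def finite_xyz_index)
  have J2: "card (J m) \<le> (m + 1) * (total_degree F)\<^sup>2" for m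
  proof -
    have "card (J m) \<le> card ({..m} \<times> {..<e} \<times> {..<e})"
      by (intro card_mono) (auto simp: J_def xyz_index_def)
    also have "\<dots> = (m + 1) * e\<^sup>2" by (simp add: power2_eq_square)
    also have "\<dots> \<le> (m + 1) * (total_degree F)\<^sup>2" using e(1) by (intro mult_left_mono power_mono) auto
    finally show ?thesis .
  qed
  show ?thesis by (rule that[of J E]) (fact J1 J2, fact J2, rule J3)
qed

lemma interpolation:
  fixes S :: "space3 set"
  assumes "finite S" "q \<in> S"
  obtains h where "pfun (card S) h" "h q = 1" "\<And>q'. q' \<in> S \<Longrightarrow> q' \<noteq> q \<Longrightarrow> h q' = 0"
proof -
  have "\<forall>q'. \<exists>i. q' \<noteq> q \<longrightarrow> q' i \<noteq> q i" by auto
  from choice[OF this] obtain c where c: "\<And>q'. q' \<noteq> q \<Longrightarrow> q' (c q') \<noteq> q (c q')" by blast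
  define h where "h p = (\<Prod>q'\<in>S - {q}. (p (c q') - q' (c q')) * (1 / (q (c q') - q' (c q'))))" for p :: space3
  have "pfun (\<Sum>q'\<in>S - {q}. 1) h"
    unfolding h_def[abs_def]
    by (intro pfun_prod pfun_mult[of 1 _ 0] pfun_diff pfun_const pfun_var) auto
  then have "pfun (card S) h" by (rule pfun_mono) (simp add: assms)
  moreover have "h q = 1" unfolding h_def
  proof (rule prod.neutral, rule ballI)
    fix q' assume "q' \<in> S - {q}"
    then have "q (c q') - q' (c q') \<noteq> 0" using c[of q'] by auto
    then show "(q (c q') - q' (c q')) * (1 / (q (c q') - q' (c q'))) = 1" by simp
  qed
  moreover have "h q' = 0" if "q' \<in> S" "q' \<noteq> q" for q'
    unfolding h_def using that assms(1) by (intro prod_zero) auto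
  ultimately show ?thesis using that by blast
qed

text \<open>If the polynomial \<open>g\<close> had too many zeros \<open>q\<close> on the curve, the products of powers of \<open>g\<close> with
  interpolation polynomials at the zeros would span too large a space.\<close>

lemma curve_zeros_bound:
  assumes curve: "irreducible_curve \<gamma>" "chow_form \<gamma> F"
    and g: "pfun n g" and p: "p \<in> \<gamma>" "g p \<noteq> 0"
  shows "finite {q\<in>\<gamma>. g q = 0}" "card {q\<in>\<gamma>. g q = 0} \<le> (total_degree F)\<^sup>2 * n"
proof -
  let ?K = "(total_degree F)\<^sup>2"
  have bound: "card S \<le> ?K * n" if S: "finite S" "S \<subseteq> {q\<in>\<gamma>. g q = 0}" for S
  proof (rule ccontr)
    assume "\<not> ?thesis"
    then have big: "card S \<ge> ?K * n + 1" by simp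
    define N where "N = card S"
    \<comment> \<open>\<open>k\<close> exceeds \<open>(N + 1) * ?K\<close>, so that
      \<open>N > ?K * n\<close> makes the number \<open>k * N\<close> of products larger than the
      dimension bound \<open>(k * n + N + 1) * ?K\<close>.\<close>
    define k where "k = (N + 1) * ?K + 1"
    obtain e :: "nat \<times> nat \<times> nat \<Rightarrow> space3 \<Rightarrow> complex" and J where J:
      "\<And>m. finite (J m)" "\<And>m. card (J m) \<le> (m + 1) * ?K"
      "\<And>m g. pfun m g \<Longrightarrow> spn \<gamma> (J m) e g"
      by (rule curve_hilbert_function[OF curve]) blast
    have "\<forall>q\<in>S. \<exists>h. pfun N h \<and> h q = 1 \<and> (\<forall>q'\<in>S. q' \<noteq> q \<longrightarrow> h q' = 0)"
    proof
      fix q assume "q \<in> S"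
      from interpolation[OF S(1) this] obtain h where
        "pfun (card S) h" "h q = 1" "\<And>q'. q' \<in> S \<Longrightarrow> q' \<noteq> q \<Longrightarrow> h q' = 0" by blast
      then show "\<exists>h. pfun N h \<and> h q = 1 \<and> (\<forall>q'\<in>S. q' \<noteq> q \<longrightarrow> h q' = 0)"
        unfolding N_def by (intro exI[of _ h]) simp
    qed
    from bchoice[OF this] obtain h where
      h: "\<forall>q\<in>S. pfun N (h q) \<and> h q q = 1 \<and> (\<forall>q'\<in>S. q' \<noteq> q \<longrightarrow> h q q' = 0)" ..
    let ?I = "{..<k} \<times> S"
    let ?f = "\<lambda>i p. g p ^ fst i * h (snd i) p"
    have "card (J (k * n + N)) \<le> (k * n + N + 1) * ?K" by (rule J(2))
    also have "\<dots> = k * (?K * n) + (N + 1) * ?K" by (simp add: algebra_simps)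
    also have "\<dots> < k * (?K * n) + k" by (simp add: k_def)
    also have "\<dots> = k * (?K * n + 1)" by simp
    also have "\<dots> \<le> k * N" using big unfolding N_def by (intro mult_left_mono) auto
    also have "\<dots> = card ?I" by (simp add: N_def card_cartesian_product)
    finally have card: "card (J (k * n + N)) < card ?I" .
    have sp: "spn \<gamma> (J (k * n + N)) e (?f i)" if i: "i \<in> ?I" for i
    proof (rule J(3))
      have 1: "pfun (fst i * n) (\<lambda>p. g p ^ fst i)" by (rule pfun_power[OF g])
      have 2: "pfun N (h (snd i))" using h i by auto
      have "fst i * n + N \<le> k * n + N" using i by auto
      from pfun_mult[OF 1 2 this] show "pfun (k * n + N) (?f i)" .
    qed
    have "\<exists>c. (\<exists>i\<in>?I. c i \<noteq> 0) \<and> (\<forall>p\<in>\<gamma>. (\<Sum>i\<in>?I. c i * ?f i p) = 0)"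
      by (rule spn_dependent[OF J(1) _ card sp]) (simp_all add: S(1))
    then obtain c where
      c: "\<exists>i\<in>?I. c i \<noteq> 0" "\<forall>p\<in>\<gamma>. (\<Sum>i\<in>?I. c i * ?f i p) = 0" by blast
    \<comment> \<open>\<open>l\<close> is the lowest power of \<open>g\<close> occurring in the
      relation. Irreducibility cancels \<open>g ^ l\<close>, and evaluating the rest at a zero
      \<open>q\<close> of \<open>g\<close> isolates \<open>c (l, q)\<close>.\<close>
    define l where "l = (LEAST l. l < k \<and> (\<exists>q\<in>S. c (l, q) \<noteq> 0))"
    have "\<exists>l. l < k \<and> (\<exists>q\<in>S. c (l, q) \<noteq> 0)" using c(1) by auto
    from LeastI_ex[OF this] obtain q where l: "l < k" and q: "q \<in> S" "c (l, q) \<noteq> 0"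
      unfolding l_def[symmetric] by blast
    have low: "c (j, q) = 0" if "j < l" "q \<in> S" for j q
      using not_less_Least[of j "\<lambda>l. l < k \<and> (\<exists>q\<in>S. c (l, q) \<noteq> 0)"] that l unfolding l_def[symmetric] by auto
    define R where "R p = (\<Sum>j<k. \<Sum>q\<in>S. (if j < l then 0 else c (j, q)) * (g p ^ (j - l) * h q p))" for p
    have gR: "g p ^ l * R p = 0" if "p \<in> \<gamma>" for p
    proof -
      have "g p ^ l * R p = (\<Sum>j<k. \<Sum>q\<in>S. c (j, q) * (g p ^ j * h q p))"
        unfolding R_def sum_distrib_left
      proof (intro sum.cong refl)
        fix j r assume "r \<in> S"
        show "g p ^ l * ((if j < l then 0 else c (j, r)) * (g p ^ (j - l) * h r p)) = c (j, r) * (g p ^ j * h r p)"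
        proof (cases "j < l")
          case False
          then have "g p ^ j = g p ^ l * g p ^ (j - l)" by (simp flip: power_add)
          with False show ?thesis by simp
        qed (simp add: low \<open>r \<in> S\<close>)
      qed
      also have "\<dots> = (\<Sum>i\<in>?I. c i * ?f i p)" by (simp add: sum.cartesian_product case_prod_unfold)
      finally show ?thesis using c(2) that by simp
    qed
    have gl: "pfun (l * n) (\<lambda>p. g p ^ l)" by (rule pfun_power[OF g])
    have trm: "pfun (k * n + N) (\<lambda>p. g p ^ (j - l) * h q p)" if "j < k" "q \<in> S" for j q
    proof -
      have "(j - l) * n \<le> k * n" using that by (intro mult_right_mono) auto
      then show ?thesis using h that by (intro pfun_mult[OF pfun_power[OF g], where m = N]) auto
    qed
    have "pfun (k * n + N) R"
      unfolding R_def[abs_def]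
      by (intro pfun_sum pfun_mult[where n = 0 and m = "k * n + N"] pfun_const trm) auto
    from curve_pfun_irreducible[OF curve(1) gl this gR]
    have "(\<forall>p\<in>\<gamma>. g p ^ l = 0) \<or> (\<forall>p\<in>\<gamma>. R p = 0)" .
    then have "R q = 0" using p S(2) q(1) by auto
    moreover have "R q = c (l, q)"
    proof -
      have gq: "g q = 0" using q(1) S(2) by auto
      have "R q = (\<Sum>j<k. if j = l then (\<Sum>r\<in>S. c (l, r) * h r q) else 0)"
        unfolding R_def using gq by (intro sum.cong) (auto simp: power_0_left)
      also have "\<dots> = (\<Sum>r\<in>S. c (l, r) * h r q)" using l by simp
      also have "\<dots> = (\<Sum>r\<in>S. if r = q then c (l, r) else 0)"
        using h q(1) by (intro sum.cong) auto
      also have "\<dots> = c (l, q)" using q(1) S(1) by simp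
      finally show ?thesis .
    qed
    ultimately show False using q(2) by simp
  qed
  show "finite {q\<in>\<gamma>. g q = 0}"
  proof (rule ccontr)
    assume "infinite {q\<in>\<gamma>. g q = 0}"
    from infinite_arbitrarily_large[OF this, of "?K * n + 1"]
    obtain S where "finite S" "S \<subseteq> {q\<in>\<gamma>. g q = 0}" "card S = ?K * n + 1" by blast
    with bound[of S] show False by simp
  qed
  then show "card {q\<in>\<gamma>. g q = 0} \<le> ?K * n" by (rule bound) simp
qed

subsection \<open>Curves on the intersection of two surfaces\<close>

abbreviation Z0 :: "complex \<Rightarrow> bool" where
  "Z0 \<equiv> \<lambda>a. a = 0"

lemma nnk_Z0: "nnk Z0 p = Poly_Mapping.keys p"
  by (auto simp: nnk_def in_keys_iff)

lemma lookup_mult_leading: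
  fixes f k :: "3 cpoly"
  assumes f: "is_lm Z0 f \<mu>" and k: "is_lm Z0 k \<nu>"
  shows "Poly_Mapping.lookup (f * k) (\<mu> + \<nu>) = Poly_Mapping.lookup f \<mu> * Poly_Mapping.lookup k \<nu>"
proof -
  note lm = is_lm_def[OF prime_pred_eq_0, unfolded nnk_Z0]
  have "f * k = (\<Sum>m\<in>Poly_Mapping.keys f. Poly_Mapping.single m (Poly_Mapping.lookup f m) * k)"
    by (subst (1) poly_mapping_sum_single[of f]) (simp add: sum_distrib_right)
  then have "Poly_Mapping.lookup (f * k) (\<mu> + \<nu>) =
      (\<Sum>m\<in>Poly_Mapping.keys f. Poly_Mapping.lookup (Poly_Mapping.single m (Poly_Mapping.lookup f m) * k) (\<mu> + \<nu>))"
    by (simp add: lookup_sum)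
  also have "\<dots> = (\<Sum>m\<in>Poly_Mapping.keys f. if m = \<mu> then Poly_Mapping.lookup f \<mu> * Poly_Mapping.lookup k \<nu> else 0)"
  proof (rule sum.cong)
    fix m assume m: "m \<in> Poly_Mapping.keys f"
    show "Poly_Mapping.lookup (Poly_Mapping.single m (Poly_Mapping.lookup f m) * k) (\<mu> + \<nu>) =
        (if m = \<mu> then Poly_Mapping.lookup f \<mu> * Poly_Mapping.lookup k \<nu> else 0)"
    proof (cases "m = \<mu>")
      case True
      then show ?thesis by (simp add: lookup_single_mult_add)
    next
      case False
      then have gm: "glt m \<mu>" using f m by (auto simp: lm)
      have "m + j \<noteq> \<mu> + \<nu>" if "j \<in> Poly_Mapping.keys k" for j
      proof -
        have "j = \<nu> \<or> glt j \<nu>" using k that by (auto simp: lm)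
        then have "glt (m + j) (\<mu> + \<nu>)"
          using glt_add[OF gm, of j] glt_add[of j \<nu> \<mu>] glt_add[OF gm, of \<nu>] glt_trans[of "m + j" "\<mu> + j" "\<mu> + \<nu>"]
          by (auto simp: add.commute)
        then show ?thesis using glt_irrefl by metis
      qed
      then have "Poly_Mapping.lookup (Poly_Mapping.single m (Poly_Mapping.lookup f m) * k) (\<mu> + \<nu>) = 0"
        unfolding lookup_single_mult by (intro sum.neutral) auto
      then show ?thesis using False by simp
    qed
  qed simp
  also have "\<dots> = Poly_Mapping.lookup f \<mu> * Poly_Mapping.lookup k \<nu>"
    using f by (simp add: lm)
  finally show ?thesis .
qed

section \<open>Counting monomials in three variables\<close>

lemma card_pairs_le: "2 * card {(i, j). i + j \<le> (k::nat)} = (k + 1) * (k + 2)"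
proof (induction k)
  case 0
  have "{(i, j). i + j \<le> (0::nat)} = {(0, 0)}" by auto
  then show ?case by simp
next
  case (Suc k)
  have eq: "{(i, j). i + j \<le> Suc k} = {(i, j). i + j \<le> k} \<union> (\<lambda>i. (i, Suc k - i)) ` {..Suc k}"
    by (auto simp: image_iff)
  have "card {(i, j). i + j \<le> Suc k} = card {(i, j). i + j \<le> k} + card ((\<lambda>i. (i, Suc k - i)) ` {..Suc k})"
    unfolding eq
  proof (rule card_Un_disjoint)
    show "finite {(i, j). i + j \<le> k}" by (rule finite_subset[of _ "{..k} \<times> {..k}"]) auto
  qed auto
  also have "card ((\<lambda>i. (i, Suc k - i)) ` {..Suc k}) = k + 2" by (subst card_image) (auto simp: inj_on_def)
  finally show ?case using Suc by simp
qed

lemma card_triples_le: "6 * card {(i, j, l). i + j + l \<le> (k::nat)} = (k + 1) * (k + 2) * (k + 3)"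
proof (induction k)
  case 0
  have "{(i, j, l). i + j + l \<le> (0::nat)} = {(0, 0, 0)}" by auto
  then show ?case by simp
next
  case (Suc k)
  have eq: "{(i, j, l). i + j + l \<le> Suc k} = {(i, j, l). i + j + l \<le> k} \<union> (\<lambda>(i, j). (i, j, Suc k - i - j)) ` {(i, j). i + j \<le> Suc k}"
    by (auto simp: image_iff)
  have "card {(i, j, l). i + j + l \<le> Suc k} = card {(i, j, l). i + j + l \<le> k} +
      card ((\<lambda>(i, j). (i, j, Suc k - i - j)) ` {(i, j). i + j \<le> Suc k})"
    unfolding eq
  proof (rule card_Un_disjoint)
    show "finite {(i, j, l). i + j + l \<le> k}" by (rule finite_subset[of _ "{..k} \<times> {..k} \<times> {..k}"]) auto
    have "finite {(i, j). i + j \<le> Suc k}" by (rule finite_subset[of _ "{..Suc k} \<times> {..Suc k}"]) auto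
    then show "finite ((\<lambda>(i, j). (i, j, Suc k - i - j)) ` {(i, j). i + j \<le> Suc k})" by simp
  qed auto
  also have "card ((\<lambda>(i, j). (i, j, Suc k - i - j)) ` {(i, j). i + j \<le> Suc k}) = card {(i, j). i + j \<le> Suc k}"
    by (rule card_image) (auto simp: inj_on_def)
  finally have "6 * card {(i, j, l). i + j + l \<le> Suc k} =
      6 * card {(i, j, l). i + j + l \<le> k} + 3 * (2 * card {(i, j). i + j \<le> Suc k})" by simp
  then show ?case unfolding Suc card_pairs_le by (simp add: algebra_simps)
qed

lemma card_monoms_le: "6 * card (monoms_le (UNIV :: 3 set) k) = (k + 1) * (k + 2) * (k + 3)"
proof -
  let ?h = "\<lambda>m :: 3 monom. (Poly_Mapping.lookup m 1, Poly_Mapping.lookup m 2, Poly_Mapping.lookup m 3)"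
  have deg: "monom_degree m = Poly_Mapping.lookup m 1 + Poly_Mapping.lookup m 2 + Poly_Mapping.lookup m 3" for m :: "3 monom"
    using monom_degree_superset[of UNIV m] by (simp add: sum_3)
  have "bij_betw ?h (monoms_le UNIV k) {(i, j, l). i + j + l \<le> k}"
    unfolding bij_betw_def
  proof
    show "inj_on ?h (monoms_le UNIV k)"
    proof (rule inj_onI, rule poly_mapping_eqI)
      fix m m' :: "3 monom" and i :: 3 assume "?h m = ?h m'"
      moreover have "i = 1 \<or> i = 2 \<or> i = 3" by (rule exhaust_3)
      ultimately show "Poly_Mapping.lookup m i = Poly_Mapping.lookup m' i" by auto
    qed
    show "?h ` monoms_le UNIV k = {(i, j, l). i + j + l \<le> k}"
    proof (intro equalityI subsetI)
      fix x assume "x \<in> {(i, j, l). i + j + l \<le> k}"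
      then obtain i j l where x: "x = (i, j, l)" "i + j + l \<le> k" by auto
      let ?m = "Poly_Mapping.single 1 i + Poly_Mapping.single 2 j + Poly_Mapping.single 3 l :: 3 monom"
      have "x = ?h ?m" by (simp add: x lookup_add lookup_single)
      moreover have "?m \<in> monoms_le UNIV k" using x(2) by (simp add: monoms_le_def)
      ultimately show "x \<in> ?h ` monoms_le UNIV k" by (rule image_eqI)
    qed (auto simp: monoms_le_def deg)
  qed
  then have "card (monoms_le (UNIV :: 3 set) k) = card {(i, j, l). i + j + l \<le> k}" by (rule bij_betw_same_card)
  then show ?thesis by (simp add: card_triples_le)
qed

lemma card_nondivisible:
  fixes \<mu> :: "3 monom"
  assumes "monom_degree \<mu> \<le> k"
  shows "card {m\<in>monoms_le UNIV k. \<not> mdvd \<mu> m} + card (monoms_le (UNIV :: 3 set) (k - monom_degree \<mu>)) = card (monoms_le (UNIV :: 3 set) k)"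
proof -
  have "(\<lambda>m. m + \<mu>) ` monoms_le UNIV (k - monom_degree \<mu>) = {m\<in>monoms_le UNIV k. mdvd \<mu> m}"
  proof (intro equalityI subsetI)
    fix m assume m: "m \<in> {m\<in>monoms_le UNIV k. mdvd \<mu> m}"
    then have eq: "(m - \<mu>) + \<mu> = m" by (intro mdvd_add_diff) auto
    then have "monom_degree (m - \<mu>) + monom_degree \<mu> = monom_degree m" using monom_degree_add[of "m - \<mu>" \<mu>] by simp
    then have "m - \<mu> \<in> monoms_le UNIV (k - monom_degree \<mu>)" using m by (auto simp: monoms_le_def)
    then show "m \<in> (\<lambda>m. m + \<mu>) ` monoms_le UNIV (k - monom_degree \<mu>)" by (intro image_eqI[where x = "m - \<mu>"]) (simp_all add: eq)
  qed (use assms in \<open>auto simp: monoms_le_def mdvd_def lookup_add\<close>)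
  moreover have "card ((\<lambda>m. m + \<mu>) ` monoms_le UNIV (k - monom_degree \<mu>)) = card (monoms_le (UNIV :: 3 set) (k - monom_degree \<mu>))"
    by (rule card_image) (auto simp: inj_on_def)
  ultimately have "card (monoms_le (UNIV :: 3 set) (k - monom_degree \<mu>)) = card {m\<in>monoms_le UNIV k. mdvd \<mu> m}" by simp
  moreover have "card (monoms_le (UNIV :: 3 set) k) = card ({m\<in>monoms_le UNIV k. \<not> mdvd \<mu> m} \<union> {m\<in>monoms_le UNIV k. mdvd \<mu> m})"
    by (rule arg_cong[where f = card]) auto
  moreover have "\<dots> = card {m\<in>monoms_le UNIV k. \<not> mdvd \<mu> m} + card {m\<in>monoms_le UNIV k. mdvd \<mu> m}"
    by (rule card_Un_disjoint) (auto intro: finite_subset[OF _ finite_monoms_le[of UNIV k]])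
  ultimately show ?thesis by simp
qed

section \<open>Separating irreducible curves from each other\<close>

lemma curve_coordinate_infinite:
  assumes "irreducible_curve \<gamma>"
  obtains i where "infinite ((\<lambda>p. p i) ` \<gamma>)"
proof -
  obtain p q where pq: "p \<in> \<gamma>" "q \<in> \<gamma>" "p \<noteq> q" using curve_two_points[OF assms] by blast
  then obtain i where i: "p i \<noteq> q i" by blast
  have "infinite ((\<lambda>p. p i) ` \<gamma>)"
  proof
    assume fin: "finite ((\<lambda>p. p i) ` \<gamma>)"
    have "pfun 1 (\<lambda>p :: space3. p i)" by (rule pfun_var) simp
    from curve_finite_values[OF assms this fin pq(1)] pq(2) i show False by metis
  qed
  then show ?thesis by (rule that)
qed

lemma curve_infinite: "irreducible_curve \<gamma> \<Longrightarrow> infinite \<gamma>"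
  by (metis curve_coordinate_infinite finite_imageI)

lemma curve_subset_eq:
  assumes "irreducible_curve \<gamma>" "irreducible_curve \<gamma>'" "chow_form \<gamma>' F" "\<gamma> \<subseteq> \<gamma>'"
  shows "\<gamma> = \<gamma>'"
proof (rule ccontr)
  assume "\<gamma> \<noteq> \<gamma>'"
  then obtain p where p: "p \<in> \<gamma>'" "p \<notin> \<gamma>" using assms(4) by blast
  obtain G where G: "\<gamma> = (\<Inter>g\<in>G. zero_set g)"
    using assms(1) by (auto simp: irreducible_curve_def irreducible_variety_def zariski_closed_def)
  then obtain g where g: "g \<in> G" "poly_eval g p \<noteq> 0" using p(2) by (auto simp: zero_set_def)
  have "finite {q\<in>\<gamma>'. poly_eval g q = 0}"
    by (rule curve_zeros_bound(1)[OF assms(2,3) pfun_poly_eval[OF order_refl] p(1) g(2)])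
  moreover have "\<gamma> \<subseteq> {q\<in>\<gamma>'. poly_eval g q = 0}" using assms(4) G g(1) by (auto simp: zero_set_def)
  ultimately show False using curve_infinite[OF assms(1)] finite_subset by blast
qed

text \<open>The product of equations that vanish on one other curve each but not on \<gamma>; by
  irreducibility it does not vanish identically on \<gamma>.\<close>

lemma curve_separator:
  assumes S: "finite S" "\<And>\<gamma>. \<gamma> \<in> S \<Longrightarrow> irreducible_curve \<gamma> \<and> (\<exists>F. chow_form \<gamma> F)" and "\<gamma> \<in> S"
  shows "\<exists>E. (\<forall>\<gamma>'\<in>S. \<gamma>' \<noteq> \<gamma> \<longrightarrow> (\<forall>p\<in>\<gamma>'. poly_eval E p = 0)) \<and> (\<exists>p\<in>\<gamma>. poly_eval E p \<noteq> 0)"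
proof -
  have ex: "\<exists>h. (\<forall>p\<in>\<gamma>'. poly_eval h p = 0) \<and> (\<exists>p\<in>\<gamma>. poly_eval h p \<noteq> 0)" if \<gamma>': "\<gamma>' \<in> S" "\<gamma>' \<noteq> \<gamma>" for \<gamma>'
  proof -
    obtain p where p: "p \<in> \<gamma>" "p \<notin> \<gamma>'"
      using curve_subset_eq[of \<gamma> \<gamma>'] S(2) assms(3) \<gamma>' by blast
    obtain G where G: "\<gamma>' = (\<Inter>g\<in>G. zero_set g)"
      using S(2)[OF \<gamma>'(1)] by (auto simp: irreducible_curve_def irreducible_variety_def zariski_closed_def)
    then obtain g where "g \<in> G" "poly_eval g p \<noteq> 0" using p(2) by (auto simp: zero_set_def)
    moreover have "\<forall>q\<in>\<gamma>'. poly_eval g q = 0" using G \<open>g \<in> G\<close> by (auto simp: zero_set_def)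
    ultimately show ?thesis using p(1) by blast
  qed
  have "\<exists>E. (\<forall>\<gamma>'\<in>S'. (\<forall>p\<in>\<gamma>'. poly_eval E p = 0)) \<and> (\<exists>p\<in>\<gamma>. poly_eval E p \<noteq> 0)"
    if "finite S'" "S' \<subseteq> S - {\<gamma>}" for S'
    using that
  proof (induction)
    case empty
    obtain p where "p \<in> \<gamma>" using curve_nonempty S(2)[OF assms(3)] by blast
    then show ?case by (intro exI[of _ 1]) auto
  next
    case (insert \<gamma>' S')
    then obtain E where E: "\<forall>\<gamma>'\<in>S'. (\<forall>p\<in>\<gamma>'. poly_eval E p = 0)" "\<exists>p\<in>\<gamma>. poly_eval E p \<noteq> 0" by blast
    obtain h where h: "\<forall>p\<in>\<gamma>'. poly_eval h p = 0" "\<exists>p\<in>\<gamma>. poly_eval h p \<noteq> 0"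
      using ex[of \<gamma>'] insert.prems by blast
    have "\<exists>p\<in>\<gamma>. poly_eval (E * h) p \<noteq> 0"
      using curve_irreducible[of \<gamma> E h] S(2)[OF assms(3)] E(2) h(2) by auto
    then show ?case using E(1) h(1) by (intro exI[of _ "E * h"]) auto
  qed
  from this[of "S - {\<gamma>}"] S(1) show ?thesis by blast
qed

lemma poly_eval_poly_Var:
  "poly_eval (\<Sum>j\<le>n. Cst (c j) * Var i ^ j) p = poly (\<Sum>j\<le>n. monom (c j) j) (p i)"
  by (simp add: poly_sum poly_monom)

text \<open>A dimension count in degree \<open>m\<close>. Multiples of \<open>f\<close> and
  \<open>g\<close> miss about \<open>D * n * m\<close> dimensions of the polynomials of degree at
  most \<open>m\<close>, while each curve contributes about \<open>m\<close> further polynomials: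
  powers of a nonconstant coordinate times a polynomial vanishing on all other curves. More than
  \<open>D * n\<close> curves would give more polynomials than dimensions, yet every linear relation
  between them is trivial.\<close>

lemma bezout_curves:
  fixes f g :: "3 cpoly"
  assumes f: "irreducible f" "total_degree f = D" and g: "\<not> f dvd g" "total_degree g \<le> n"
    and S: "finite S" "\<And>\<gamma>. \<gamma> \<in> S \<Longrightarrow> irreducible_curve \<gamma> \<and> (\<exists>F. chow_form \<gamma> F) \<and> \<gamma> \<subseteq> zero_set f \<inter> zero_set g"
  shows "card S \<le> D * n"
proof (rule ccontr)
  assume "\<not> ?thesis"
  then have big: "D * n + 1 \<le> card S" by simp
  have "\<forall>\<gamma>\<in>S. \<exists>E. (\<forall>\<gamma>'\<in>S. \<gamma>' \<noteq> \<gamma> \<longrightarrow> (\<forall>p\<in>\<gamma>'. poly_eval E p = 0)) \<and> (\<exists>p\<in>\<gamma>. poly_eval E p \<noteq> 0)"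
    using curve_separator[OF S(1)] S(2) by blast
  from bchoice[OF this] obtain E where
    E: "\<forall>\<gamma>\<in>S. (\<forall>\<gamma>'\<in>S. \<gamma>' \<noteq> \<gamma> \<longrightarrow> (\<forall>p\<in>\<gamma>'. poly_eval (E \<gamma>) p = 0)) \<and> (\<exists>p\<in>\<gamma>. poly_eval (E \<gamma>) p \<noteq> 0)" ..
  have "\<forall>\<gamma>\<in>S. \<exists>i. infinite ((\<lambda>p. p i) ` \<gamma>)" using curve_coordinate_infinite S(2) by metis
  from bchoice[OF this] obtain co where co: "\<forall>\<gamma>\<in>S. infinite ((\<lambda>p. p (co \<gamma>)) ` \<gamma>)" ..
  define m0 where "m0 = (\<Sum>\<gamma>\<in>S. total_degree (E \<gamma>))"
  have Em0: "total_degree (E \<gamma>) \<le> m0" if "\<gamma> \<in> S" for \<gamma>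
    unfolding m0_def using member_le_sum[OF that, of "\<lambda>\<gamma>. total_degree (E \<gamma>)"] S(1) by simp
  \<comment> \<open>The summand \<open>D * n * (m0 + 1)\<close> lets the surplus of one additional
    curve outweigh the loss from the degree bound \<open>m0\<close> of the separating polynomials;
    \<open>n + D\<close> keeps all differences of degrees nonnegative.\<close>
  define m where "m = m0 + D * n * (m0 + 1) + n + D"
  have f0: "f \<noteq> 0" using f(1) by auto
  obtain \<mu> where \<mu>: "is_lm Z0 f \<mu>"
    using is_lm_exists[OF prime_pred_eq_0, of f] f0 by (auto simp: null_def[OF prime_pred_eq_0] nnk_Z0)
  have \<mu>D: "monom_degree \<mu> = D"
  proof (rule antisym)
    show "monom_degree \<mu> \<le> D"
      using \<mu> monom_degree_le_total_degree[of \<mu> f] f(2) by (simp add: is_lm_def[OF prime_pred_eq_0] nnk_Z0)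
    have "total_degree f \<le> monom_degree \<mu>"
      using \<mu> by (intro total_degree_leI) (auto dest: glt_degree simp: is_lm_def[OF prime_pred_eq_0] nnk_Z0)
    then show "D \<le> monom_degree \<mu>" using f(2) by simp
  qed
  \<comment> \<open>The multipliers of \<open>g\<close> are monomials outside the leading ideal of
    \<open>f\<close>; otherwise products of \<open>f\<close> and \<open>g\<close> would be counted
    among the multiples of both.\<close>
  define N where "N = {k\<in>monoms_le UNIV (m - n). \<not> mdvd \<mu> k}"
  define I where "I = (S \<times> {..m - m0}) <+> (N <+> monoms_le (UNIV :: 3 set) (m - D))"
  define P where "P = case_sum (\<lambda>(\<gamma>, j). Var (co \<gamma>) ^ j * E \<gamma>)
     (case_sum (\<lambda>k. g * Poly_Mapping.single k 1) (\<lambda>k. f * Poly_Mapping.single k 1))"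
  have mbounds: "n \<le> m" "D \<le> m" "m0 \<le> m" "D \<le> m - n" by (simp_all add: m_def)
  have finN: "finite N" using finite_monoms_le[of "UNIV :: 3 set" "m - n"] by (simp add: N_def)
  have finI: "finite I" unfolding I_def using finN S(1) finite_monoms_le[of "UNIV :: 3 set"] by simp
  have degP: "total_degree (P i) \<le> m" if iI: "i \<in> I" for i
  proof -
    consider \<gamma> j where "i = Inl (\<gamma>, j)" "\<gamma> \<in> S" "j \<le> m - m0" | k where "i = Inr (Inl k)" "k \<in> N"
      | k where "i = Inr (Inr k)" "k \<in> monoms_le UNIV (m - D)" using iI unfolding I_def by auto
    then show ?thesis
    proof cases
      case 1
      have "total_degree (P i) \<le> total_degree (Var (co \<gamma>) ^ j) + total_degree (E \<gamma>)"
        unfolding P_def 1 using total_degree_mult_le by simp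
      also have "\<dots> \<le> (m - m0) + m0"
        using total_degree_power_le[of "Var (co \<gamma>)" j] Em0[OF 1(2)] 1(3) by simp
      finally show ?thesis using mbounds by simp
    next
      case 2
      have "total_degree (P i) \<le> total_degree g + total_degree (Poly_Mapping.single k (1::complex))"
        unfolding P_def 2 using total_degree_mult_le by simp
      also have "\<dots> \<le> n + (m - n)"
        using g(2) 2(2) by (intro add_mono) (auto simp: total_degree_def N_def monoms_le_def)
      finally show ?thesis using mbounds by simp
    next
      case 3
      have "total_degree (P i) \<le> total_degree f + total_degree (Poly_Mapping.single k (1::complex))"
        unfolding P_def 3 using total_degree_mult_le by simp
      also have "\<dots> \<le> D + (m - D)"
        using f(2) 3(2) by (intro add_mono) (auto simp: total_degree_def monoms_le_def)
      finally show ?thesis using mbounds by simp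
    qed
  qed
  have keysP: "Poly_Mapping.keys (P i) \<subseteq> monoms_le UNIV m" if "i \<in> I" for i
    using degP[OF that] by (auto simp: monoms_le_def total_degree_le_iff)
  have card: "card (monoms_le (UNIV :: 3 set) m) < card I"
  proof -
    have cI: "card I = card S * (m - m0 + 1) + (card N + card (monoms_le (UNIV :: 3 set) (m - D)))"
      unfolding I_def using finN S(1) finite_monoms_le[of "UNIV :: 3 set"] by (simp add: card_Plus card_cartesian_product)
    have cN: "card N + card (monoms_le (UNIV :: 3 set) (m - n - D)) = card (monoms_le (UNIV :: 3 set) (m - n))"
      unfolding N_def using card_nondivisible[of \<mu> "m - n"] mbounds \<mu>D by simp
    define q where "q = m0 + D * n * (m0 + 1)"
    have mq: "m = q + n + D" by (simp add: m_def q_def)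
    have c: "6 * int (card (monoms_le (UNIV :: 3 set) k)) = (int k + 1) * (int k + 2) * (int k + 3)" for k
      using arg_cong[OF card_monoms_le[of k], of int] by (simp add: algebra_simps)
    \<comment> \<open>Six times the Hilbert function of a complete intersection of degrees
      \<open>D\<close> and \<open>n\<close>.\<close>
    have "6 * int (card (monoms_le (UNIV :: 3 set) m)) - 6 * int (card (monoms_le (UNIV :: 3 set) (m - D)))
        - 6 * int (card (monoms_le (UNIV :: 3 set) (m - n))) + 6 * int (card (monoms_le (UNIV :: 3 set) (m - n - D))) =
        3 * int D * int n * (2 * int m + 4 - int D - int n)"
    proof -
      have i: "int (m - D) = int m - int D" "int (m - n) = int m - int n" "int (m - n - D) = int m - int n - int D"
        using mbounds by (simp_all add: of_nat_diff)
      show ?thesis unfolding c i by (simp add: algebra_simps)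
    qed
    also have "\<dots> \<le> 6 * (int D * int n * (int m + 2))"
    proof -
      have "int D * int n * (2 * int m + 4 - int D - int n) \<le> int D * int n * (2 * int m + 4)"
        by (intro mult_left_mono) auto
      then show ?thesis by (simp add: algebra_simps)
    qed
    finally have 1: "int (card (monoms_le (UNIV :: 3 set) m)) \<le> int D * int n * (int m + 2) + int (card N)
        + int (card (monoms_le (UNIV :: 3 set) (m - D)))"
      using cN by linarith
    have "int D * int n * (int m + 2) < (int D * int n + 1) * (int m - int m0 + 1)"
    proof -
      have "int m = int m0 + int D * int n * (int m0 + 1) + int n + int D" by (simp add: m_def algebra_simps)
      then have "int m - int m0 + 1 > int D * int n * (int m0 + 1)" by linarith
      then show ?thesis by (simp add: algebra_simps)
    qed
    also have "\<dots> \<le> int (card S) * (int m - int m0 + 1)"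
      using big mbounds(3) by (intro mult_right_mono) (simp_all flip: of_nat_mult)
    also have "\<dots> = int (card S * (m - m0 + 1))"
    proof -
      have "int m - int m0 + 1 = int (m - m0 + 1)" using mbounds by simp
      then show ?thesis by (simp only: of_nat_mult)
    qed
    finally show ?thesis using 1 cI by linarith
  qed
  obtain c where c: "\<exists>i\<in>I. c i \<noteq> 0" "\<forall>k\<in>monoms_le UNIV m. (\<Sum>i\<in>I. c i * Poly_Mapping.lookup (P i) k) = 0"
    using underdetermined_system[OF finite_monoms_le[OF finite] finI card, of "\<lambda>i. Poly_Mapping.lookup (P i)"] by blast
  have sum0: "(\<Sum>i\<in>I. Cst (c i) * P i) = 0"
  proof (rule poly_mapping_eqI)
    fix k
    have "Poly_Mapping.lookup (\<Sum>i\<in>I. Cst (c i) * P i) k = (\<Sum>i\<in>I. c i * Poly_Mapping.lookup (P i) k)"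
      unfolding lookup_sum Cst_def using lookup_single_mult_add[of 0 _ _ k] by (intro sum.cong) auto
    also have "\<dots> = 0"
    proof (cases "k \<in> monoms_le UNIV m")
      case False
      then have "Poly_Mapping.lookup (P i) k = 0" if "i \<in> I" for i
        using keysP[OF that] by (auto simp: in_keys_iff)
      then show ?thesis by simp
    qed (use c(2) in simp)
    finally show "Poly_Mapping.lookup (\<Sum>i\<in>I. Cst (c i) * P i) k = Poly_Mapping.lookup 0 k" by simp
  qed
  define A where "A \<gamma> = (\<Sum>j\<le>m - m0. Cst (c (Inl (\<gamma>, j))) * Var (co \<gamma>) ^ j)" for \<gamma>
  define B where "B = (\<Sum>k\<in>N. Poly_Mapping.single k (c (Inr (Inl k))))"
  define C where "C = (\<Sum>k\<in>monoms_le (UNIV :: 3 set) (m - D). Poly_Mapping.single k (c (Inr (Inr k))))"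
  have CB: "Cst a * (h * Poly_Mapping.single k 1) = h * Poly_Mapping.single k a" for a h and k :: "3 monom"
    by (simp add: Cst_def mult_single mult.left_commute)
  have "(\<Sum>i\<in>I. Cst (c i) * P i) = (\<Sum>\<gamma>\<in>S. A \<gamma> * E \<gamma>) + (g * B + f * C)"
    unfolding I_def using finN S(1) finite_monoms_le[of "UNIV :: 3 set"]
    by (simp add: sum.Plus P_def A_def B_def C_def CB sum_distrib_left sum_distrib_right
        sum.cartesian_product case_prod_unfold mult.assoc)
  with sum0 have eq: "(\<Sum>\<gamma>\<in>S. A \<gamma> * E \<gamma>) + (g * B + f * C) = 0" by simp
  have cA: "c (Inl (\<gamma>, j)) = 0" if \<gamma>: "\<gamma> \<in> S" and j: "j \<le> m - m0" for \<gamma> j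
  proof -
    have "poly_eval (A \<gamma>) p * poly_eval (E \<gamma>) p = 0" if p: "p \<in> \<gamma>" for p
    proof -
      have "0 = poly_eval ((\<Sum>\<gamma>\<in>S. A \<gamma> * E \<gamma>) + (g * B + f * C)) p" using eq by simp
      also have "\<dots> = (\<Sum>\<gamma>\<in>S. poly_eval (A \<gamma>) p * poly_eval (E \<gamma>) p)"
      proof -
        have "p \<in> zero_set f" "p \<in> zero_set g" using S(2)[OF \<gamma>] p by auto
        then show ?thesis by (simp add: zero_set_def)
      qed
      also have "\<dots> = (\<Sum>\<gamma>'\<in>S. if \<gamma>' = \<gamma> then poly_eval (A \<gamma>) p * poly_eval (E \<gamma>) p else 0)"
        using E \<gamma> p by (intro sum.cong) auto
      also have "\<dots> = poly_eval (A \<gamma>) p * poly_eval (E \<gamma>) p" using \<gamma> S(1) by simp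
      finally show ?thesis by simp
    qed
    then have "(\<forall>p\<in>\<gamma>. poly_eval (A \<gamma>) p = 0) \<or> (\<forall>p\<in>\<gamma>. poly_eval (E \<gamma>) p = 0)"
      using S(2)[OF \<gamma>] by (intro curve_irreducible) auto
    then have "\<forall>p\<in>\<gamma>. poly_eval (A \<gamma>) p = 0" using E \<gamma> by blast
    then have "\<forall>p\<in>\<gamma>. poly (\<Sum>j\<le>m - m0. monom (c (Inl (\<gamma>, j))) j) (p (co \<gamma>)) = 0"
      unfolding A_def poly_eval_poly_Var .
    then have sub: "(\<lambda>p. p (co \<gamma>)) ` \<gamma> \<subseteq> {x. poly (\<Sum>j\<le>m - m0. monom (c (Inl (\<gamma>, j))) j) x = 0}" by auto
    have "(\<Sum>j\<le>m - m0. monom (c (Inl (\<gamma>, j))) j) = 0"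
      using co \<gamma> finite_subset[OF sub] poly_roots_finite by blast
    then have "coeff (\<Sum>j\<le>m - m0. monom (c (Inl (\<gamma>, j))) j) j = 0" by simp
    then show ?thesis using j by (simp add: coeff_sum)
  qed
  then have "A \<gamma> = 0" if "\<gamma> \<in> S" for \<gamma> using that by (simp add: A_def)
  then have eq2: "g * B + f * C = 0" using eq by simp
  have lookB: "Poly_Mapping.lookup B k = (if k \<in> N then c (Inr (Inl k)) else 0)" for k
    unfolding B_def using finN by (simp add: lookup_sum lookup_single when_def)
  have lookC: "Poly_Mapping.lookup C k = (if k \<in> monoms_le UNIV (m - D) then c (Inr (Inr k)) else 0)" for k
    unfolding C_def using finite_monoms_le[of "UNIV :: 3 set" "m - D"] by (simp add: lookup_sum lookup_single when_def)
  \<comment> \<open>If \<open>f\<close> divided a nonzero \<open>B\<close>, some monomial of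
    \<open>B\<close> would be a multiple of the leading monomial of \<open>f\<close>, which the
    choice of \<open>N\<close> excludes.\<close>
  have "B = 0"
  proof (rule ccontr)
    assume "B \<noteq> 0"
    have "g * B = f * (- C)" using eq2 by (simp add: eq_neg_iff_add_eq_0)
    then have "f dvd g * B" by simp
    then have "f dvd B" using irreducible_dvd_mult_3[OF f(1)] g(1) by blast
    then obtain k where k: "B = f * k" by (elim dvdE)
    with \<open>B \<noteq> 0\<close> have "k \<noteq> 0" by auto
    then obtain \<nu> where \<nu>: "is_lm Z0 k \<nu>"
      using is_lm_exists[OF prime_pred_eq_0, of k] by (auto simp: null_def[OF prime_pred_eq_0] nnk_Z0)
    have "Poly_Mapping.lookup B (\<mu> + \<nu>) \<noteq> 0"
      unfolding k lookup_mult_leading[OF \<mu> \<nu>] using \<mu> \<nu>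
      by (simp add: is_lm_def[OF prime_pred_eq_0] nnk_Z0 in_keys_iff)
    then have "\<mu> + \<nu> \<in> N" unfolding lookB by (auto split: if_splits)
    then show False by (simp add: N_def mdvd_def lookup_add)
  qed
  then have "f * C = 0" using eq2 by simp
  then have "C = 0" using f0 by simp
  have "c i = 0" if iI: "i \<in> I" for i
  proof -
    consider \<gamma> j where "i = Inl (\<gamma>, j)" "\<gamma> \<in> S" "j \<le> m - m0" | k where "i = Inr (Inl k)" "k \<in> N"
      | k where "i = Inr (Inr k)" "k \<in> monoms_le UNIV (m - D)" using iI unfolding I_def by auto
    then show ?thesis
    proof cases
      case 2
      then show ?thesis using lookB[of k] \<open>B = 0\<close> by simp
    next
      case 3
      then show ?thesis using lookC[of k] \<open>C = 0\<close> by simp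
    qed (use cA in simp)
  qed
  then show False using c(1) by blast
qed

subsection \<open>Approaching a point of a curve through its Chow form\<close>

lemma tendsto_poly_eval:
  assumes "\<And>i. ((\<lambda>x. \<sigma> x i) \<longlongrightarrow> l i) F"
  shows "((\<lambda>x. poly_eval h (\<sigma> x)) \<longlongrightarrow> poly_eval h l) F"
  by (induction h rule: cpoly_induct) (auto intro!: tendsto_intros assms)

text \<open>The equation of a cone with vertex \<open>p\<close> containing the curve. Forms of
  degree \<open>m\<close> have a dimension quadratic in \<open>m\<close>, their restrictions to the
  curve one linear in \<open>m\<close>; with \<open>m\<close> twice the square of
  \<open>total_degree F\<close> the former is larger, so some nonzero form vanishes at all
  differences \<open>q - p\<close>.\<close>

lemma cone_polynomial:
  assumes "irreducible_curve \<gamma>" "chow_form \<gamma> F"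
  obtains h :: "3 cpoly" and m \<omega> where "poly_eval h \<omega> \<noteq> 0"
    "\<And>c \<omega>. poly_eval h (\<lambda>i. c * \<omega> i) = c ^ m * poly_eval h \<omega>"
    "\<And>q. q \<in> \<gamma> \<Longrightarrow> poly_eval h (\<lambda>i. q i - p i) = 0"
proof -
  obtain e :: "nat \<times> nat \<times> nat \<Rightarrow> space3 \<Rightarrow> complex" and J where J:
    "\<And>m. finite (J m)" "\<And>m. card (J m) \<le> (m + 1) * (total_degree F)\<^sup>2"
    "\<And>m g. pfun m g \<Longrightarrow> spn \<gamma> (J m) e g"
    by (rule curve_hilbert_function[OF assms]) blast
  define m where "m = 2 * (total_degree F)\<^sup>2"
  define I where "I = {(i, j). i + j \<le> m}"
  define mon where "mon = (\<lambda>(i, j). Poly_Mapping.single 1 i + Poly_Mapping.single 2 j +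
    Poly_Mapping.single 3 (m - i - j) :: 3 monom)"
  have finI: "finite I" unfolding I_def by (rule finite_subset[of _ "{..m} \<times> {..m}"]) auto
  have inj: "inj_on mon I"
  proof (rule inj_onI)
    fix x y assume xy: "x \<in> I" "y \<in> I" "mon x = mon y"
    then have "Poly_Mapping.lookup (mon x) 1 = Poly_Mapping.lookup (mon y) 1"
      "Poly_Mapping.lookup (mon x) 2 = Poly_Mapping.lookup (mon y) 2" by simp_all
    then show "x = y" by (simp add: mon_def case_prod_unfold lookup_add lookup_single prod_eq_iff)
  qed
  have "2 * card (J m) \<le> 2 * ((m + 1) * (total_degree F)\<^sup>2)" by (intro mult_le_mono2 J(2))
  also have "\<dots> = (m + 1) * m" by (simp add: m_def)
  also have "(m + 1) * m < (m + 1) * (m + 2)" by simp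
  also have "\<dots> = 2 * card I" unfolding I_def card_pairs_le ..
  finally have card: "card (J m) < card I" by simp
  have deg: "monom_degree (mon x) = m" if "x \<in> I" for x
    using that by (auto simp: mon_def I_def)
  let ?f = "\<lambda>x q. mono_eval (mon x) (\<lambda>i. q i - p i)"
  have "\<exists>c. (\<exists>x\<in>I. c x \<noteq> 0) \<and> (\<forall>q\<in>\<gamma>. (\<Sum>x\<in>I. c x * ?f x q) = 0)"
  proof (rule spn_dependent[OF J(1) finI card])
    fix x assume x: "x \<in> I"
    have "total_degree (Poly_Mapping.single (mon x) (1 :: complex)) \<le> m"
      using deg[OF x] by (intro total_degree_leI) simp
    moreover have "pfun 1 (\<lambda>q :: space3. q i - p i)" for i by (intro pfun_diff pfun_var pfun_const) simp
    ultimately have "pfun (m * 1) (\<lambda>q. poly_eval (Poly_Mapping.single (mon x) 1) (\<lambda>i. q i - p i))"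
      by (rule pfun_poly_eval_compose)
    then have "pfun m (?f x)" by simp
    then show "spn \<gamma> (J m) e (?f x)" by (rule J(3))
  qed
  then obtain c where c: "\<exists>x\<in>I. c x \<noteq> 0" "\<forall>q\<in>\<gamma>. (\<Sum>x\<in>I. c x * ?f x q) = 0" by blast
  define h where "h = (\<Sum>x\<in>I. Poly_Mapping.single (mon x) (c x))"
  obtain x where x: "x \<in> I" "c x \<noteq> 0" using c(1) by blast
  have "Poly_Mapping.lookup h (mon x) = (\<Sum>y\<in>I. if y = x then c y else 0)"
    unfolding h_def lookup_sum using inj x(1) by (intro sum.cong) (auto simp: lookup_single when_def inj_on_def)
  then have "Poly_Mapping.lookup h (mon x) \<noteq> 0" using x finI by simp
  then have "h \<noteq> 0" by auto
  then obtain \<omega> where \<omega>: "poly_eval h \<omega> \<noteq> 0" using poly_eval_eq_0_3 by blast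
  have hom: "poly_eval h (\<lambda>i. k * \<omega> i) = k ^ m * poly_eval h \<omega>" for k \<omega>
  proof -
    have "mono_eval (mon x) (\<lambda>i. k * \<omega> i) = k ^ m * mono_eval (mon x) \<omega>" if "x \<in> I" for x
    proof -
      obtain i j where ij: "x = (i, j)" "i + j \<le> m" using \<open>x \<in> I\<close> by (auto simp: I_def)
      have "k ^ i * k ^ j * k ^ (m - i - j) = k ^ m" using ij(2) by (simp flip: power_add)
      then show ?thesis by (simp add: mon_def ij(1) mono_eval_add power_mult_distrib mult_ac)
    qed
    then show ?thesis by (simp add: h_def sum_distrib_left mult_ac)
  qed
  show ?thesis
  proof (rule that[OF \<omega> hom])
    fix q assume "q \<in> \<gamma>"
    then show "poly_eval h (\<lambda>i. q i - p i) = 0" using c(2) by (simp add: h_def)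
  qed
qed

text \<open>\<open>crs a b\<close> is the direction common to the planes with normals
  \<open>a\<close> and \<open>b\<close>. It lies off the cone together with a neighbourhood, so the
  component of \<open>q - p\<close> in this direction is bounded by a multiple of the two others,
  which \<open>dot a\<close> and \<open>dot b\<close> control.\<close>

lemma cone_estimate:
  fixes h :: "3 cpoly"
  assumes h: "\<And>c \<omega>. poly_eval h (\<lambda>i. c * \<omega> i) = c ^ m * poly_eval h \<omega>"
    "\<And>q. q \<in> \<gamma> \<Longrightarrow> poly_eval h (\<lambda>i. q i - p i) = 0"
    and ab: "poly_eval h (crs a b) \<noteq> 0" and ne: "\<gamma> \<noteq> {}"
  shows "\<exists>C. \<forall>q\<in>\<gamma>. \<forall>i. cmod (q i - p i) \<le> C * (cmod (dot a q - dot a p) + cmod (dot b q - dot b p))"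
proof -
  define d where "d = crs a b"
  have "\<exists>\<eta>>0. \<forall>\<omega>. (\<forall>i. cmod (\<omega> i - d i) < \<eta>) \<longrightarrow> poly_eval h \<omega> \<noteq> 0"
  proof (rule ccontr)
    assume "\<not> ?thesis"
    then have "\<forall>n. \<exists>\<omega>. (\<forall>i. cmod (\<omega> i - d i) < inverse (real (Suc n))) \<and> poly_eval h \<omega> = 0"
      by (metis inverse_positive_iff_positive of_nat_0_less_iff zero_less_Suc)
    from choice[OF this] obtain \<omega> where
      \<omega>: "\<forall>n. (\<forall>i. cmod (\<omega> n i - d i) < inverse (real (Suc n))) \<and> poly_eval h (\<omega> n) = 0" ..
    have "(\<lambda>n. \<omega> n i - d i) \<longlonglongrightarrow> 0" for i
    proof (rule Lim_null_comparison[OF _ LIMSEQ_inverse_real_of_nat])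
      show "\<forall>\<^sub>F n in sequentially. cmod (\<omega> n i - d i) \<le> inverse (real (Suc n))"
        using \<omega> by (intro always_eventually allI less_imp_le) blast
    qed
    then have "(\<lambda>n. \<omega> n i) \<longlonglongrightarrow> d i" for i by (rule LIM_zero_cancel)
    then have "(\<lambda>n. poly_eval h (\<omega> n)) \<longlonglongrightarrow> poly_eval h d" by (rule tendsto_poly_eval)
    moreover have "(\<lambda>n. poly_eval h (\<omega> n)) = (\<lambda>n. 0)" using \<omega> by auto
    ultimately have "poly_eval h d = 0" using LIMSEQ_unique tendsto_const by metis
    then show False using ab by (simp add: d_def)
  qed
  then obtain \<eta> where \<eta>: "\<eta> > 0" "\<And>\<omega>. (\<And>i. cmod (\<omega> i - d i) < \<eta>) \<Longrightarrow> poly_eval h \<omega> \<noteq> 0" by blast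
  have "d \<noteq> (\<lambda>_. 0)"
  proof
    assume d0: "d = (\<lambda>_. 0)"
    obtain q where q: "q \<in> \<gamma>" using ne by blast
    have "poly_eval h d = 0 ^ m * poly_eval h (\<lambda>i. q i - p i)" using h(1)[of 0 "\<lambda>i. q i - p i"] by (simp add: d0)
    then show False using ab h(2)[OF q] by (simp add: d_def)
  qed
  then obtain k where k: "d k \<noteq> 0" by auto
  define c where "c = (\<lambda>i. if i = k then 1 / d k else 0)"
  have "dot c d = 1" using k by (simp add: dot_def c_def if_distrib[of "\<lambda>x. x * _"] cong: if_cong)
  moreover have "dot a (crs b c) = dot c (crs a b)" by (simp add: dot_3 algebra_simps)
  ultimately have det: "dot a (crs b c) = 1" by (simp add: d_def)
  define M where "M = (\<Sum>i\<in>UNIV. cmod (crs b c i) + cmod (crs c a i))"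
  define D where "D = (\<Sum>i\<in>UNIV. cmod (d i))"
  have M: "cmod (crs b c i) \<le> M" "cmod (crs c a i) \<le> M" for i
  proof -
    have "cmod (crs b c i) + cmod (crs c a i) \<le> M"
      unfolding M_def by (rule member_le_sum) auto
    then show "cmod (crs b c i) \<le> M" "cmod (crs c a i) \<le> M"
      using norm_ge_zero[of "crs b c i"] norm_ge_zero[of "crs c a i"] by linarith+
  qed
  have D: "cmod (d i) \<le> D" for i unfolding D_def by (rule member_le_sum) auto
  have M0: "M \<ge> 0" using M(1)[of 1] norm_ge_zero order_trans by blast
  have "cmod (q i - p i) \<le> (M + M / \<eta> * D) * (cmod (dot a q - dot a p) + cmod (dot b q - dot b p))" if q: "q \<in> \<gamma>" for q i
  proof -
    define w where "w = (\<lambda>i. q i - p i)"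
    define \<delta> where "\<delta> = cmod (dot a w) + cmod (dot b w)"
    have dw: "dot x w = dot x q - dot x p" for x by (simp add: w_def dot_3 algebra_simps)
    define \<epsilon> where "\<epsilon> i = dot a w * crs b c i + dot b w * crs c a i" for i
    define \<mu> where "\<mu> = dot c w"
    have w: "w i = \<epsilon> i + \<mu> * d i" for i
      using cramer_3[of a b c w i] det by (simp add: \<epsilon>_def \<mu>_def d_def)
    have \<epsilon>: "cmod (\<epsilon> i) \<le> M * \<delta>" for i
    proof -
      have "cmod (\<epsilon> i) \<le> cmod (dot a w) * cmod (crs b c i) + cmod (dot b w) * cmod (crs c a i)"
        unfolding \<epsilon>_def by (rule order_trans[OF norm_triangle_ineq]) (simp add: norm_mult)
      also have "\<dots> \<le> cmod (dot a w) * M + cmod (dot b w) * M"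
        by (intro add_mono mult_left_mono M) auto
      finally show ?thesis by (simp add: \<delta>_def algebra_simps)
    qed
    have \<mu>: "cmod \<mu> \<le> M * \<delta> / \<eta>"
    proof (rule ccontr)
      assume "\<not> ?thesis"
      then have big: "M * \<delta> < cmod \<mu> * \<eta>" using \<eta>(1) by (simp add: field_simps)
      moreover have "0 \<le> M * \<delta>" using M0 by (simp add: \<delta>_def)
      ultimately have \<mu>0: "\<mu> \<noteq> 0" by auto
      have "poly_eval h (\<lambda>i. w i / \<mu>) \<noteq> 0"
      proof (rule \<eta>(2))
        fix i
        have "w i / \<mu> - d i = \<epsilon> i / \<mu>" using \<mu>0 by (simp add: w add_divide_distrib)
        also have "cmod \<dots> < \<eta>"
        proof -
          have "cmod (\<epsilon> i) < \<eta> * cmod \<mu>" using order_le_less_trans[OF \<epsilon>[of i] big] by (simp only: mult.commute)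
          then show ?thesis using \<mu>0 by (simp add: norm_divide pos_divide_less_eq)
        qed
        finally show "cmod (w i / \<mu> - d i) < \<eta>" .
      qed
      moreover have "poly_eval h w = \<mu> ^ m * poly_eval h (\<lambda>i. w i / \<mu>)"
        using h(1)[of \<mu> "\<lambda>i. w i / \<mu>"] \<mu>0 by simp
      ultimately show False using h(2)[OF q] \<mu>0 by (simp add: w_def)
    qed
    have "cmod (w i) \<le> cmod (\<epsilon> i) + cmod \<mu> * cmod (d i)"
      unfolding w by (rule order_trans[OF norm_triangle_ineq]) (simp add: norm_mult)
    also have "\<dots> \<le> M * \<delta> + M * \<delta> / \<eta> * D"
      using \<epsilon> \<mu> D M0 \<eta>(1) by (intro add_mono mult_mono) (auto simp: \<delta>_def)
    also have "\<dots> = (M + M / \<eta> * D) * \<delta>" by (simp add: algebra_simps)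
    finally show ?thesis by (simp only: \<delta>_def dw) (simp add: w_def)
  qed
  then show ?thesis by blast
qed

lemma uniform_limit_sum:
  fixes f :: "'a \<Rightarrow> nat \<Rightarrow> complex \<Rightarrow> complex"
  assumes "finite A" "\<And>j. j \<in> A \<Longrightarrow> uniform_limit K (f j) (l j) sequentially"
  shows "uniform_limit K (\<lambda>n t. \<Sum>j\<in>A. f j n t) (\<lambda>t. \<Sum>j\<in>A. l j t) sequentially"
  using assms
proof (induction A rule: finite_induct)
  case empty
  show ?case by (simp add: uniform_limit_const)
next
  case (insert x A)
  then show ?case by (auto intro!: uniform_limit_add)
qed

text \<open>Hurwitz's theorem applies although leading coefficients may tend to 0 and some roots may
  escape to infinity: it only asks for a nonconstant limit and controls the roots near
  \<open>t0\<close>.\<close>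

lemma polynomial_roots_converge:
  fixes a :: "nat \<Rightarrow> nat \<Rightarrow> complex"
  assumes lim: "\<And>j. j \<le> d \<Longrightarrow> (\<lambda>n. a n j) \<longlonglongrightarrow> b j" and nz: "(\<Sum>j\<le>d. b j * w ^ j) \<noteq> 0"
    and root: "(\<Sum>j\<le>d. b j * t0 ^ j) = 0" and "\<epsilon> > 0"
  shows "\<forall>\<^sub>F n in sequentially. \<exists>t. dist t t0 < \<epsilon> \<and> (\<Sum>j\<le>d. a n j * t ^ j) = 0"
proof (rule ccontr)
  let ?P = "\<lambda>n. \<exists>t. dist t t0 < \<epsilon> \<and> (\<Sum>j\<le>d. a n j * t ^ j) = 0"
  assume "\<not> (\<forall>\<^sub>F n in sequentially. ?P n)"
  then have "\<exists>\<^sub>F n in sequentially. \<not> ?P n" by (simp add: not_eventually)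
  then have "infinite {n. \<not> ?P n}" by (simp add: frequently_cofinite cofinite_eq_sequentially[symmetric])
  then obtain r :: "nat \<Rightarrow> nat" where r: "strict_mono r" "\<And>n. \<not> ?P (r n)"
    using infinite_enumerate[of "{n. \<not> ?P n}"] by blast
  have "(\<Sum>j\<le>d. b j * t0 ^ j) \<noteq> 0"
  proof (rule Hurwitz_no_zeros[of "ball t0 \<epsilon>" "\<lambda>n t. \<Sum>j\<le>d. a (r n) j * t ^ j" "\<lambda>t. \<Sum>j\<le>d. b j * t ^ j"])
    fix K assume "compact K" "K \<subseteq> ball t0 \<epsilon>"
    show "uniform_limit K (\<lambda>n t. \<Sum>j\<le>d. a (r n) j * t ^ j) (\<lambda>t. \<Sum>j\<le>d. b j * t ^ j) sequentially"
    proof (rule uniform_limit_sum)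
      show "finite {..d}" by simp
      fix j assume "j \<in> {..d}"
      then have "(\<lambda>n. a (r n) j) \<longlonglongrightarrow> b j" using LIMSEQ_subseq_LIMSEQ[OF lim r(1)] by (simp add: comp_def)
      then have "uniform_limit K (\<lambda>n t. a (r n) j) (\<lambda>t. b j) sequentially"
        by (intro uniform_limitI) (auto dest: tendstoD)
      moreover have "uniform_limit K (\<lambda>n t. t ^ j) (\<lambda>t. t ^ j) sequentially" by (rule uniform_limit_const)
      moreover have "bounded ((\<lambda>t. t ^ j) ` K)"
        by (intro compact_imp_bounded compact_continuous_image continuous_intros \<open>compact K\<close>)
      moreover have "bounded ((\<lambda>t. b j) ` K)" by (rule finite_imp_bounded[OF finite_subset[of _ "{b j}"]]) auto
      ultimately show "uniform_limit K (\<lambda>n t. a (r n) j * t ^ j) (\<lambda>t. b j * t ^ j) sequentially"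
        by (intro uniform_lim_mult) auto
    qed
  next
    show "\<not> (\<lambda>t. \<Sum>j\<le>d. b j * t ^ j) constant_on ball t0 \<epsilon>"
    proof
      assume "(\<lambda>t. \<Sum>j\<le>d. b j * t ^ j) constant_on ball t0 \<epsilon>"
      then obtain c where c: "\<And>t. t \<in> ball t0 \<epsilon> \<Longrightarrow> (\<Sum>j\<le>d. b j * t ^ j) = c" unfolding constant_on_def by blast
      with root \<open>\<epsilon> > 0\<close> have "c = 0" by force
      define q where "q = (\<Sum>j\<le>d. monom (b j) j)"
      have q: "poly q t = (\<Sum>j\<le>d. b j * t ^ j)" for t by (simp add: q_def poly_sum poly_monom)
      have "q \<noteq> 0" using q[of w] nz by auto
      then have "finite {t. poly q t = 0}" by (rule poly_roots_finite)
      moreover have "ball t0 \<epsilon> \<subseteq> {t. poly q t = 0}" using c \<open>c = 0\<close> q by auto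
      ultimately have "finite (ball t0 \<epsilon>)" by (rule rev_finite_subset)
      then show False using uncountable_ball[OF \<open>\<epsilon> > 0\<close>, of t0] countable_finite by blast
    qed
  next
    show "(\<Sum>j\<le>d. a (r n) j * t ^ j) \<noteq> 0" if "t \<in> ball t0 \<epsilon>" for n t
      using r(2)[of n] that by (metis dist_commute mem_ball)
  next
    show "t0 \<in> ball t0 \<epsilon>" using \<open>\<epsilon> > 0\<close> by simp
  qed (intro holomorphic_intros open_ball connected_ball)+
  then show False using root by simp
qed

lemma roots_sequence:
  fixes a :: "nat \<Rightarrow> nat \<Rightarrow> complex"
  assumes "\<And>j. j \<le> d \<Longrightarrow> (\<lambda>n. a n j) \<longlonglongrightarrow> b j" "(\<Sum>j\<le>d. b j * w ^ j) \<noteq> 0" "(\<Sum>j\<le>d. b j * t0 ^ j) = 0"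
  obtains \<nu> :: "nat \<Rightarrow> nat" and t where "filterlim \<nu> sequentially sequentially" "t \<longlonglongrightarrow> t0"
    "\<And>k. (\<Sum>j\<le>d. a (\<nu> k) j * t k ^ j) = 0"
proof -
  have "\<exists>n t. n \<ge> k \<and> dist t t0 < inverse (real (Suc k)) \<and> (\<Sum>j\<le>d. a n j * t ^ j) = 0" for k
    using eventually_conj[OF eventually_ge_at_top[of k] polynomial_roots_converge[OF assms, of "inverse (real (Suc k))"]]
    by (auto dest!: eventually_happens)
  then have "\<forall>k. \<exists>p. fst p \<ge> k \<and> dist (snd p) t0 < inverse (real (Suc k)) \<and> (\<Sum>j\<le>d. a (fst p) j * snd p ^ j) = 0"
    by (metis fst_conv snd_conv)
  from choice[OF this] obtain p :: "nat \<Rightarrow> nat \<times> complex" where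
    p: "\<And>k. fst (p k) \<ge> k" "\<And>k. dist (snd (p k)) t0 < inverse (real (Suc k))"
      "\<And>k. (\<Sum>j\<le>d. a (fst (p k)) j * snd (p k) ^ j) = 0" by blast
  show ?thesis
  proof (rule that)
    show "filterlim (\<lambda>k. fst (p k)) sequentially sequentially"
      by (rule filterlim_at_top_mono[OF filterlim_ident]) (simp add: p(1))
    show "(\<lambda>k. snd (p k)) \<longlonglongrightarrow> t0"
    proof (rule tendsto_dist_iff[THEN iffD2], rule Lim_null_comparison[OF _ LIMSEQ_inverse_real_of_nat])
      show "\<forall>\<^sub>F k in sequentially. norm (dist (snd (p k)) t0) \<le> inverse (real (Suc k))"
        using p(2) by (intro always_eventually allI) (simp add: less_imp_le)
    qed
  qed (rule p(3))
qed

section \<open>Chow forms at generic pairs of planes\<close>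

lemma pd_eq_0D:
  assumes "pd v F = 0"
  shows "v \<notin> poly_vars F"
proof
  assume "v \<in> poly_vars F"
  then obtain m where m: "m \<in> Poly_Mapping.keys F" "Poly_Mapping.lookup m v \<noteq> 0"
    by (auto simp: poly_vars_def in_keys_iff)
  let ?s = "Poly_Mapping.single v (1 :: nat)"
  let ?c = "\<lambda>n. Poly_Mapping.lookup F n * of_nat (Poly_Mapping.lookup n v)"
  have split: "n = (n - ?s) + ?s" if "Poly_Mapping.lookup n v \<noteq> 0" for n :: "'a monom"
    using that by (intro poly_mapping_eqI) (auto simp: lookup_add lookup_minus lookup_single when_def)
  have "Poly_Mapping.lookup (pd v F) (m - ?s) = (\<Sum>n\<in>Poly_Mapping.keys F. if n = m then ?c n else 0)"
    unfolding pd_def lookup_sum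
  proof (intro sum.cong refl)
    fix n
    show "Poly_Mapping.lookup (Poly_Mapping.single (n - ?s) (?c n)) (m - ?s) = (if n = m then ?c n else 0)"
      using split[of n] split[OF m(2)] by (cases "Poly_Mapping.lookup n v = 0") (auto simp: lookup_single when_def)
  qed
  then show False using m assms by (simp add: in_keys_iff)
qed

text \<open>On each line in the direction \<open>v\<close> divisibility would give
  \<open>pderiv q = q * r\<close> for the restriction \<open>q\<close> of \<open>F\<close>, and
  comparing degrees forces \<open>pderiv q = 0\<close>. Then the partial derivative vanishes
  everywhere, so that \<open>v\<close> does not occur in \<open>F\<close>.\<close>

lemma not_dvd_pd:
  fixes F :: "(3 option + 3 option) cpoly"
  assumes "v \<in> poly_vars F"
  shows "\<not> F dvd pd v F"
proof
  assume "F dvd pd v F"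
  then obtain Q where Q: "pd v F = F * Q" by (rule dvdE)
  have "poly_eval (pd v F) x = 0" for x
  proof -
    let ?x = "\<lambda>t i. x i + t * (if i = v then 1 else 0)"
    obtain q where q: "\<And>t. poly q t = poly_eval F (?x t)"
      using pfun_on_line[OF pfun_poly_eval[OF order_refl], of F x "\<lambda>i. if i = v then 1 else 0"] by blast
    obtain r where r: "\<And>t. poly r t = poly_eval Q (?x t)"
      using pfun_on_line[OF pfun_poly_eval[OF order_refl], of Q x "\<lambda>i. if i = v then 1 else 0"] by blast
    have d: "poly (pderiv q) t = poly_eval (pd v F) (?x t)" for t
    proof -
      have "((\<lambda>t. poly_eval F (?x t)) has_field_derivative
          (\<Sum>i\<in>UNIV. poly_eval (pd i F) (?x t) * (if i = v then 1 else 0))) (at t)"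
        by (rule has_field_derivative_poly_eval) (auto intro!: derivative_eq_intros)
      then have "(poly q has_field_derivative poly_eval (pd v F) (?x t)) (at t)"
        by (simp add: fun_eq_iff[of "poly q", THEN iffD2, OF allI, OF q] if_distrib[of "\<lambda>x. _ * x"] cong: if_cong)
      then show ?thesis using poly_DERIV DERIV_unique by blast
    qed
    have "pderiv q = q * r"
      by (rule poly_eq_poly_eq_iff[THEN iffD1]) (auto simp: d q r Q)
    have "pderiv q = 0"
    proof (rule ccontr)
      assume "pderiv q \<noteq> 0"
      then have "degree q \<noteq> 0" by (simp add: pderiv_eq_0_iff)
      moreover have "degree (pderiv q) \<ge> degree q"
        using \<open>pderiv q \<noteq> 0\<close> \<open>pderiv q = q * r\<close> by (auto simp: degree_mult_eq)
      ultimately show False by (simp add: degree_pderiv)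
    qed
    then show ?thesis using d[of 0] by simp
  qed
  then have "pd v F = 0" by (rule poly_eval_eq_0_8)
  then show False using pd_eq_0D assms by metis
qed

text \<open>\<open>H\<close> arises by eliminating the second constant term from \<open>F\<close>
  and from its derivative times the polynomial \<open>G\<close> of \<open>chow_form_dense\<close>.
  Off the zeros of \<open>H\<close> every root \<open>t\<close> of \<open>F\<close> comes from a
  point of the curve and is simple.\<close>

lemma chow_form_generic:
  assumes curve: "irreducible_curve \<gamma>" and F: "chow_form \<gamma> F"
  obtains H where "\<exists>a b s. poly_eval H (pt a b s 0) \<noteq> 0" "\<And>a b s t. poly_eval H (pt a b s 0) \<noteq> 0 \<Longrightarrow> poly_eval F (pt a b s t) = 0 \<Longrightarrow>
    pt a b s t \<in> chow_set \<gamma> \<and> poly_eval (pd (Inr None) F) (pt a b s t) \<noteq> 0"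
proof -
  note F' = chow_form_ideal[OF curve F]
  have v0: "Inr None \<in> poly_vars F" by (rule chow_ideal_principal(2)[OF curve F'])
  obtain G where G: "\<not> F dvd G" "\<And>x. poly_eval F x = 0 \<Longrightarrow> poly_eval G x \<noteq> 0 \<Longrightarrow> x \<in> chow_set \<gamma>"
    using chow_form_dense[OF curve F] by blast
  have "\<not> F dvd G * pd (Inr None) F"
    using irreducible_dvd_mult_8[OF F'(1)] G(1) not_dvd_pd[OF v0] by blast
  then obtain A B H where H: "A * F + B * (G * pd (Inr None) F) = H" "H \<noteq> 0" "Inr None \<notin> poly_vars H"
    by (rule irreducible_elimination_8[OF F'(1) v0])
  have free: "poly_eval H (pt a b s t) = poly_eval H (pt a b s 0)" for a b s t
  proof (rule poly_eval_cong)
    fix i assume "i \<in> poly_vars H"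
    then have "i \<noteq> Inr None" using H(3) by auto
    then show "pt a b s t i = pt a b s 0 i" by (cases i rule: sum.exhaust[case_product option.exhaust option.exhaust]) (auto simp: pt_def pl_def split: sum.splits option.splits)
  qed
  obtain x where "poly_eval H x \<noteq> 0" using poly_eval_eq_0_8[of H] H(2) by blast
  then have "\<exists>a b s. poly_eval H (pt a b s 0) \<noteq> 0" using pt_collapse[of x] free by metis
  then show ?thesis
  proof (rule that)
    fix a b s t assume *: "poly_eval H (pt a b s 0) \<noteq> 0" "poly_eval F (pt a b s t) = 0"
    have "poly_eval H (pt a b s t) = poly_eval B (pt a b s t) * (poly_eval G (pt a b s t) * poly_eval (pd (Inr None) F) (pt a b s t))"
      using *(2) by (simp flip: H(1))
    then have "poly_eval G (pt a b s t) \<noteq> 0" "poly_eval (pd (Inr None) F) (pt a b s t) \<noteq> 0"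
      using *(1) free[of a b s t] by auto
    then show "pt a b s t \<in> chow_set \<gamma> \<and> poly_eval (pd (Inr None) F) (pt a b s t) \<noteq> 0"
      using G(2)[OF *(2)] by blast
  qed
qed

lemma eval_mod_linear:
  fixes F :: "'i cpoly" and l :: "('i \<Rightarrow> complex) \<Rightarrow> complex"
  assumes l: "pfun n l"
  shows "\<exists>B. \<forall>x. poly_eval F x - poly_eval F (x(v := x v - l x)) = l x * poly_eval B x"
proof (induction F rule: cpoly_induct)
  case (Cst c)
  show ?case by (rule exI[of _ 0]) simp
next
  case (Var i)
  show ?case by (rule exI[of _ "if i = v then 1 else 0"]) simp
next
  case (add p q)
  then obtain B C where BC: "\<And>x. poly_eval p x - poly_eval p (x(v := x v - l x)) = l x * poly_eval B x"
    "\<And>x. poly_eval q x - poly_eval q (x(v := x v - l x)) = l x * poly_eval C x" by blast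
  show ?case
    by (intro exI[of _ "B + C"] allI) (simp only: poly_eval_add distrib_left BC[symmetric], simp)
next
  case (mult p q)
  then obtain B C where BC: "\<And>x. poly_eval p x - poly_eval p (x(v := x v - l x)) = l x * poly_eval B x"
    "\<And>x. poly_eval q x - poly_eval q (x(v := x v - l x)) = l x * poly_eval C x" by blast
  have "pfun (max n 1) (\<lambda>x. (x(v := x v - l x)) i)" for i
    by (cases "i = v") (auto intro!: pfun_diff pfun_var pfun_mono[OF l])
  then have "pfun (total_degree p * max n 1) (\<lambda>x. poly_eval p (x(v := x v - l x)))"
    by (rule pfun_poly_eval_compose[OF order_refl])
  then obtain k where k: "\<And>x. poly_eval p (x(v := x v - l x)) = poly_eval k x"
    unfolding pfun_def fun_eq_iff by blast
  show ?case
  proof (intro exI allI)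
    fix x
    let ?y = "x(v := x v - l x)"
    have "poly_eval (p * q) x - poly_eval (p * q) ?y =
        (poly_eval p x - poly_eval p ?y) * poly_eval q x + poly_eval p ?y * (poly_eval q x - poly_eval q ?y)"
      by (simp add: algebra_simps)
    also have "\<dots> = l x * poly_eval (B * q + k * C) x"
      unfolding BC unfolding k by (simp add: algebra_simps)
    finally show "poly_eval (p * q) x - poly_eval (p * q) ?y = l x * poly_eval (B * q + k * C) x" .
  qed
qed

text \<open>Otherwise \<open>F\<close> would vanish on all pairs whose first plane passes through
  \<open>p\<close>, hence be divisible by the linear form \<open>l\<close> of this incidence. By
  irreducibility the cofactor is a unit, so every point of the curve would coincide with
  \<open>p\<close>. The lemma keeps the limit equation for the second constant term from vanishing
  identically.\<close>

lemma chow_form_pencil: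
  assumes curve: "irreducible_curve \<gamma>" and F: "chow_form \<gamma> F"
  shows "\<exists>a b T. poly_eval F (pt a b (dot a p) T) \<noteq> 0"
proof (rule ccontr)
  assume contra: "\<not> ?thesis"
  note F' = chow_form_ideal[OF curve F]
  let ?v = "Inl None :: 3 option + 3 option"
  define l where "l x = x ?v + dot (\<lambda>i. x (Inl (Some i))) p" for x :: "3 option + 3 option \<Rightarrow> complex"
  have "pfun 1 l" unfolding l_def by (intro pfun_add pfun_dot[of 1 _ 0] pfun_var pfun_const) auto
  then obtain L where L: "l = poly_eval L" by (auto simp: pfun_def)
  obtain B where B: "\<And>x. poly_eval F x - poly_eval F (x(?v := x ?v - l x)) = l x * poly_eval B x"
    using eval_mod_linear[OF \<open>pfun 1 l\<close>] by blast
  have "poly_eval F (x(?v := x ?v - l x)) = 0" for x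
  proof -
    let ?a = "\<lambda>i. x (Inl (Some i))"
    have "x(?v := x ?v - l x) = pt ?a (\<lambda>i. x (Inr (Some i))) (dot ?a p) (- x (Inr None))"
      using pt_collapse[of "x(?v := x ?v - l x)"] by (simp add: l_def)
    then show ?thesis using contra by simp
  qed
  then have "poly_eval (F - L * B) x = 0" for x using B[of x] by (simp add: L)
  then have "F = L * B" using poly_eval_eq_0_8[of "F - L * B"] by simp
  then have "L dvd 1 \<or> B dvd 1" using F'(1) by (auto simp: irreducible_def)
  then show False
  proof
    assume "L dvd 1"
    then obtain U where "1 = L * U" by (rule dvdE)
    then have "poly_eval L (\<lambda>_. 0) * poly_eval U (\<lambda>_. 0) = 1" by (metis poly_eval_1 poly_eval_mult)
    then show False by (simp add: l_def dot_def flip: L)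
  next
    assume "B dvd 1"
    then obtain U where "1 = B * U" by (rule dvdE)
    then have "poly_eval B x * poly_eval U x = 1" for x by (metis poly_eval_1 poly_eval_mult)
    then have B0: "poly_eval B x \<noteq> 0" for x by (metis mult_zero_left zero_neq_one)
    have "q = p" if "q \<in> \<gamma>" for q
    proof
      fix i
      let ?a = "\<lambda>j :: 3. if j = i then 1 else 0 :: complex"
      have "poly_eval F (pt ?a ?a (dot ?a q) (dot ?a q)) = 0"
        by (rule vanishing_idealD[OF F'(2)]) (use that in \<open>auto simp: pt_mem_chow_set_iff\<close>)
      then have "l (pt ?a ?a (dot ?a q) (dot ?a q)) = 0" using B0 \<open>F = L * B\<close> by (simp add: L)
      then show "q i = p i" by (simp add: l_def dot_def if_distrib[of "\<lambda>x. x * _"] cong: if_cong)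
    qed
    then show False using curve_two_points[OF curve] by metis
  qed
qed

lemma poly_eval_pt_bivariate:
  "\<exists>q :: complex poly poly. \<forall>s t. poly_eval F (pt a b s t) = poly (poly q [:t:]) s"
proof (induction F rule: cpoly_induct)
  case (Cst c)
  show ?case by (rule exI[of _ "[:[:c:]:]"]) simp
next
  case (Var i)
  consider "i = Inl None" | j where "i = Inl (Some j)" | "i = Inr None" | j where "i = Inr (Some j)"
    by (metis old.sum.exhaust option.exhaust)
  then show ?case
  proof cases
    case 1 then show ?thesis by (intro exI[of _ "[:[:0, -1:]:]"]) simp
  next
    case 2 then show ?thesis by (intro exI[of _ "[:[:a j:]:]"]) simp
  next
    case 3 then show ?thesis by (intro exI[of _ "[:0, -1:]"]) simp
  next
    case 4 then show ?thesis by (intro exI[of _ "[:[:b j:]:]"]) simp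
  qed
next
  case (add p q)
  then obtain P Q :: "complex poly poly" where
    "\<And>s t. poly_eval p (pt a b s t) = poly (poly P [:t:]) s" "\<And>s t. poly_eval q (pt a b s t) = poly (poly Q [:t:]) s" by blast
  then show ?case by (intro exI[of _ "P + Q"]) simp
next
  case (mult p q)
  then obtain P Q :: "complex poly poly" where
    "\<And>s t. poly_eval p (pt a b s t) = poly (poly P [:t:]) s" "\<And>s t. poly_eval q (pt a b s t) = poly (poly Q [:t:]) s" by blast
  then show ?case by (intro exI[of _ "P * Q"]) simp
qed

lemma poly_eval_pt_expansion:
  obtains c :: "nat \<Rightarrow> complex poly" and d where
    "\<And>s t. poly_eval F (pt a b s t) = (\<Sum>j\<le>d. poly (c j) s * t ^ j)"
proof -
  obtain q :: "complex poly poly" where q: "\<And>s t. poly_eval F (pt a b s t) = poly (poly q [:t:]) s"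
    using poly_eval_pt_bivariate by blast
  have "poly (poly q [:t:]) s = (\<Sum>j\<le>degree q. poly (coeff q j) s * t ^ j)" for s t
    by (simp add: poly_altdef[of q] poly_sum)
  with q show ?thesis by (intro that) simp
qed

text \<open>A double root of the limit attracts two different roots, because the nearby roots are simple.\<close>

lemma chow_form_sequences:
  assumes curve: "irreducible_curve \<gamma>" and F: "chow_form \<gamma> F"
    and H: "\<And>a b s t. poly_eval H (pt a b s 0) \<noteq> 0 \<Longrightarrow> poly_eval F (pt a b s t) = 0 \<Longrightarrow>
      pt a b s t \<in> chow_set \<gamma> \<and> poly_eval (pd (Inr None) F) (pt a b s t) \<noteq> 0"
    and h: "\<And>c \<omega>. poly_eval h (\<lambda>i. c * \<omega> i) = c ^ m * poly_eval h \<omega>"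
      "\<And>q. q \<in> \<gamma> \<Longrightarrow> poly_eval h (\<lambda>i. q i - p i) = 0"
    and generic: "poly_eval h (crs a b) \<noteq> 0" "poly_eval H (pt a b s0 0) \<noteq> 0"
      "poly_eval F (pt a b (dot a p) T) \<noteq> 0"
    and root: "poly_eval F (pt a b (dot a p) (dot b p)) = 0"
  obtains q where "\<And>k. q k \<in> \<gamma>" "\<And>i. (\<lambda>k. q k i) \<longlonglongrightarrow> p i" "\<And>k :: nat. dot a (q k) \<noteq> dot a p"
    "poly_eval (pd (Inr None) F) (pt a b (dot a p) (dot b p)) = 0 \<Longrightarrow>
      \<exists>\<nu> q'. filterlim \<nu> sequentially sequentially \<and> (\<forall>k. q' k \<in> \<gamma>) \<and> (\<forall>i. (\<lambda>k. q' k i) \<longlonglongrightarrow> p i) \<and>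
        (\<forall>k. dot a (q' k) = dot a (q (\<nu> k)) \<and> q' k \<noteq> q (\<nu> k))"
proof -
  let ?F = "\<lambda>s t. poly_eval F (pt a b s t)"
  obtain c :: "nat \<Rightarrow> complex poly" and d where c: "\<And>s t. ?F s t = (\<Sum>j\<le>d. poly (c j) s * t ^ j)"
    using poly_eval_pt_expansion[of F a b] by blast
  obtain r where r: "\<And>s. poly_eval H (pt a b s 0) = poly r s"
    using poly_eval_pt_bivariate[of H a b] by (metis (no_types))
  have "r \<noteq> 0" using generic(2) r[of s0] by auto
  \<comment> \<open>The first plane is translated towards the one through \<open>p\<close>; starting
    at index \<open>N\<close> skips the finitely many translates of this sequence at which
    \<open>H\<close> vanishes.\<close>
  define s1 where "s1 n = dot a p + of_real (inverse (real (Suc n)))" for n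
  have "inj s1" by (rule injI) (simp add: s1_def)
  then have "finite (s1 -` {x. poly r x = 0})"
    using poly_roots_finite[OF \<open>r \<noteq> 0\<close>] by (intro finite_vimageI)
  then obtain N where N: "\<And>n. n \<in> s1 -` {x. poly r x = 0} \<Longrightarrow> n < N"
    by (metis finite_nat_set_iff_bounded)
  define s where "s n = s1 (n + N)" for n
  have rs: "poly r (s n) \<noteq> 0" for n using N[of "n + N"] by (auto simp: s_def)
  have s_ne: "s n \<noteq> dot a p" for n by (simp add: s_def s1_def del: of_nat_Suc)
  have "(\<lambda>n. of_real (inverse (real (Suc n))) :: complex) \<longlonglongrightarrow> of_real 0"
    by (intro tendsto_of_real LIMSEQ_inverse_real_of_nat)
  then have "s1 \<longlonglongrightarrow> dot a p + 0" unfolding s1_def by (intro tendsto_add tendsto_const) simp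
  then have s_lim: "s \<longlonglongrightarrow> dot a p" unfolding s_def using LIMSEQ_ignore_initial_segment by fastforce
  have c_lim: "(\<lambda>n. poly (c j) (s n)) \<longlonglongrightarrow> poly (c j) (dot a p)" for j
    by (rule isCont_tendsto_compose[OF poly_isCont s_lim])
  have chow: "pt a b (s n) t \<in> chow_set \<gamma>" "poly_eval (pd (Inr None) F) (pt a b (s n) t) \<noteq> 0" if "?F (s n) t = 0" for n t
    using H[of a b "s n" t] that rs[of n] by (simp_all add: r)
  obtain C where C: "\<And>q i. q \<in> \<gamma> \<Longrightarrow> cmod (q i - p i) \<le> C * (cmod (dot a q - dot a p) + cmod (dot b q - dot b p))"
    using cone_estimate[OF h generic(1) curve_nonempty[OF curve]] by blast
  have conv: "(\<lambda>k. q k i) \<longlonglongrightarrow> p i"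
    if "\<And>k. q k \<in> \<gamma>" "(\<lambda>k. dot a (q k)) \<longlonglongrightarrow> dot a p" "(\<lambda>k. dot b (q k)) \<longlonglongrightarrow> dot b p" for q :: "nat \<Rightarrow> space3" and i
  proof -
    have "(\<lambda>k. C * (cmod (dot a (q k) - dot a p) + cmod (dot b (q k) - dot b p))) \<longlonglongrightarrow> C * (0 + 0)"
      by (intro tendsto_mult_left tendsto_add tendsto_norm_zero LIM_zero that(2,3))
    then have lim: "(\<lambda>k. C * (cmod (dot a (q k) - dot a p) + cmod (dot b (q k) - dot b p))) \<longlonglongrightarrow> 0" by simp
    have "(\<lambda>k. q k i - p i) \<longlonglongrightarrow> 0"
      by (rule Lim_null_comparison[OF always_eventually lim]) (intro allI C that(1))
    then show ?thesis by (rule LIM_zero_cancel)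
  qed
  obtain \<nu> t where \<nu>: "filterlim \<nu> sequentially sequentially" and t: "t \<longlonglongrightarrow> dot b p"
    and t0: "\<And>k. (\<Sum>j\<le>d. poly (c j) (s (\<nu> k)) * t k ^ j) = 0"
    using roots_sequence[of d "\<lambda>n j. poly (c j) (s n)" "\<lambda>j. poly (c j) (dot a p)" T "dot b p"] c_lim generic(3) root
    unfolding c by blast
  have "\<forall>k. \<exists>q\<in>\<gamma>. dot a q = s (\<nu> k) \<and> dot b q = t k"
    using chow(1)[unfolded c, OF t0] unfolding pt_mem_chow_set_iff by blast
  from choice[OF this[unfolded Bex_def]] obtain q where
    q: "\<And>k. q k \<in> \<gamma>" "\<And>k. dot a (q k) = s (\<nu> k)" "\<And>k. dot b (q k) = t k" by blast
  have s\<nu>: "(\<lambda>k. s (\<nu> k)) \<longlonglongrightarrow> dot a p" by (rule filterlim_compose[OF s_lim \<nu>])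
  show ?thesis
  proof (rule that[of q])
    show "(\<lambda>k. q k i) \<longlonglongrightarrow> p i" for i by (rule conv) (simp_all add: q s\<nu> t)
    assume dbl: "poly_eval (pd (Inr None) F) (pt a b (dot a p) (dot b p)) = 0"
    \<comment> \<open>\<open>e\<close> gives the coefficients of the divided difference of
      \<open>F\<close> in the last variable. On the diagonal this is the derivative up to sign, so
      at a double root the divided difference has the limit root \<open>dot b p\<close> once
      more.\<close>
    define e where "e n u j = (\<Sum>i=Suc j..d. poly (c i) n * u ^ (i - j - 1))" for n u j
    have diff: "?F x y - ?F x u = (y - u) * (\<Sum>j\<le>d. e x u j * y ^ j)" for x y u
    proof -
      have "(\<Sum>j\<le>d. e x u j * y ^ j) = (\<Sum>j<d. e x u j * y ^ j)"
        by (rule sum.mono_neutral_right) (auto simp: e_def)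
      then show ?thesis unfolding c by (cases "d = 0") (simp_all add: polyfun_diff e_def)
    qed
    have deriv: "(\<Sum>j\<le>d. e x u j * u ^ j) = - poly_eval (pd (Inr None) F) (pt a b x u)" for x u
    proof -
      have *: "((\<lambda>y. (y - u) * (\<Sum>j\<le>d. e x u j * y ^ j)) has_field_derivative (\<Sum>j\<le>d. e x u j * u ^ j)) (at u)"
        by (auto intro!: derivative_eq_intros)
      have "((\<lambda>y. pt a b x y i) has_field_derivative (if i = Inr None then -1 else 0)) (at u)" for i
        by (cases i rule: sum.exhaust[case_product option.exhaust option.exhaust])
          (auto simp: pt_def pl_def intro!: derivative_eq_intros split: sum.splits option.splits)
      then have "((\<lambda>y. ?F x y) has_field_derivative
          (\<Sum>i\<in>UNIV. poly_eval (pd i F) (pt a b x u) * (if i = Inr None then -1 else 0))) (at u)"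
        by (rule has_field_derivative_poly_eval)
      then have "((\<lambda>y. ?F x y) has_field_derivative - poly_eval (pd (Inr None) F) (pt a b x u)) (at u)"
        by (simp add: if_distrib[of "\<lambda>x. _ * x"] sum.delta cong: if_cong)
      then have "((\<lambda>y. ?F x y - ?F x u) has_field_derivative - poly_eval (pd (Inr None) F) (pt a b x u)) (at u)"
        by (auto intro!: derivative_eq_intros)
      then show ?thesis unfolding diff by (rule DERIV_unique[OF *])
    qed
    have "(\<lambda>k. e (s (\<nu> k)) (t k) j) \<longlonglongrightarrow> e (dot a p) (dot b p) j" for j
      unfolding e_def by (intro tendsto_intros t filterlim_compose[OF c_lim \<nu>])
    moreover have "(\<Sum>j\<le>d. e (dot a p) (dot b p) j * T ^ j) \<noteq> 0"
      using diff[of "dot a p" T "dot b p"] generic(3) root by auto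
    moreover have "(\<Sum>j\<le>d. e (dot a p) (dot b p) j * dot b p ^ j) = 0" by (simp add: deriv dbl)
    ultimately obtain \<nu>' t' where \<nu>': "filterlim \<nu>' sequentially sequentially" and t': "t' \<longlonglongrightarrow> dot b p"
      and t'0: "\<And>k. (\<Sum>j\<le>d. e (s (\<nu> (\<nu>' k))) (t (\<nu>' k)) j * t' k ^ j) = 0"
      using roots_sequence[of d "\<lambda>k j. e (s (\<nu> k)) (t k) j" "\<lambda>j. e (dot a p) (dot b p) j" T "dot b p"] by blast
    have F0: "?F (s (\<nu> k)) (t k) = 0" for k using t0 c by simp
    have F0': "?F (s (\<nu> (\<nu>' k))) (t' k) = 0" for k
      using diff[of "s (\<nu> (\<nu>' k))" "t' k" "t (\<nu>' k)"] t'0[of k] F0[of "\<nu>' k"] by simp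
    \<comment> \<open>A coincidence would make this root a zero of the derivative, but the roots at
      these parameters are simple.\<close>
    have ne: "t' k \<noteq> t (\<nu>' k)" for k
      using deriv[of "s (\<nu> (\<nu>' k))" "t' k"] t'0[of k] chow(2)[OF F0'[of k]] by auto
    have "\<forall>k. \<exists>q\<in>\<gamma>. dot a q = s (\<nu> (\<nu>' k)) \<and> dot b q = t' k"
      using chow(1)[OF F0'] unfolding pt_mem_chow_set_iff by blast
    from choice[OF this[unfolded Bex_def]] obtain q' where
      q': "\<And>k. q' k \<in> \<gamma>" "\<And>k. dot a (q' k) = s (\<nu> (\<nu>' k))" "\<And>k. dot b (q' k) = t' k" by blast
    have "(\<lambda>k. q' k i) \<longlonglongrightarrow> p i" for i
      by (rule conv) (simp_all add: q' t' filterlim_compose[OF s\<nu> \<nu>'])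
    moreover have "q' k \<noteq> q (\<nu>' k)" for k using ne[of k] q(3) q'(3) by metis
    ultimately show "\<exists>\<nu> q'. filterlim \<nu> sequentially sequentially \<and> (\<forall>k. q' k \<in> \<gamma>) \<and> (\<forall>i. (\<lambda>k. q' k i) \<longlonglongrightarrow> p i) \<and>
        (\<forall>k. dot a (q' k) = dot a (q (\<nu> k)) \<and> q' k \<noteq> q (\<nu> k))"
      using \<nu>' q' q(2) by (intro exI[of _ \<nu>'] exI[of _ q']) auto
  qed (use q s_ne in auto)
qed

section \<open>Limits of secants\<close>

lemma secant_expansion:
  fixes q q' :: "nat \<Rightarrow> 'i::finite \<Rightarrow> complex"
  assumes "\<And>i. (\<lambda>k. q k i) \<longlonglongrightarrow> p i" "\<And>i. (\<lambda>k. q' k i) \<longlonglongrightarrow> p i"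
  shows "\<exists>A. (\<forall>k. poly_eval g (q k) - poly_eval g (q' k) = (\<Sum>i\<in>UNIV. (q k i - q' k i) * A i k)) \<and>
    (\<forall>i. A i \<longlonglongrightarrow> poly_eval (pd i g) p)"
proof (induction g rule: cpoly_induct)
  case (Cst c)
  show ?case by (rule exI[of _ "\<lambda>i k. 0"]) simp
next
  case (Var j)
  show ?case
    by (rule exI[of _ "\<lambda>i k. if i = j then 1 else 0"])
      (simp add: pd_Var if_distrib[of "\<lambda>x. _ * x"] cong: if_cong)
next
  case (add f g)
  then obtain A B where "\<forall>k. poly_eval f (q k) - poly_eval f (q' k) = (\<Sum>i\<in>UNIV. (q k i - q' k i) * A i k)"
    "\<forall>k. poly_eval g (q k) - poly_eval g (q' k) = (\<Sum>i\<in>UNIV. (q k i - q' k i) * B i k)"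
    "\<forall>i. A i \<longlonglongrightarrow> poly_eval (pd i f) p" "\<forall>i. B i \<longlonglongrightarrow> poly_eval (pd i g) p" by blast
  then show ?case
    by (intro exI[of _ "\<lambda>i k. A i k + B i k"])
      (auto simp: pd_add distrib_left sum.distrib add_diff_add intro!: tendsto_add)
next
  case (mult f g)
  then obtain A B where *: "\<forall>k. poly_eval f (q k) - poly_eval f (q' k) = (\<Sum>i\<in>UNIV. (q k i - q' k i) * A i k)"
    "\<forall>k. poly_eval g (q k) - poly_eval g (q' k) = (\<Sum>i\<in>UNIV. (q k i - q' k i) * B i k)"
    "\<forall>i. A i \<longlonglongrightarrow> poly_eval (pd i f) p" "\<forall>i. B i \<longlonglongrightarrow> poly_eval (pd i g) p" by blast
  have "poly_eval (f * g) (q k) - poly_eval (f * g) (q' k) =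
      (\<Sum>i\<in>UNIV. (q k i - q' k i) * (A i k * poly_eval g (q k) + poly_eval f (q' k) * B i k))" for k
  proof -
    have "poly_eval (f * g) (q k) - poly_eval (f * g) (q' k) =
        (poly_eval f (q k) - poly_eval f (q' k)) * poly_eval g (q k) + poly_eval f (q' k) * (poly_eval g (q k) - poly_eval g (q' k))"
      by (simp add: algebra_simps)
    also have "\<dots> = (\<Sum>i\<in>UNIV. (q k i - q' k i) * (A i k * poly_eval g (q k) + poly_eval f (q' k) * B i k))"
      using *(1,2) by (simp add: sum_distrib_left sum_distrib_right distrib_left sum.distrib mult_ac)
    finally show ?thesis .
  qed
  moreover have "(\<lambda>k. A i k * poly_eval g (q k) + poly_eval f (q' k) * B i k) \<longlonglongrightarrow> poly_eval (pd i (f * g)) p" for i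
    unfolding pd_mult poly_eval_add poly_eval_mult using *(3,4)
    by (intro tendsto_add tendsto_mult tendsto_poly_eval assms) auto
  ultimately show ?case by (intro exI[of _ "\<lambda>i k. A i k * poly_eval g (q k) + poly_eval f (q' k) * B i k"]) blast
qed

text \<open>The normalized differences have a convergent subsequence on the unit sphere. A
  polynomial with equal values at the two ends of each secant has derivative 0 at \<open>p\<close>
  in the limit direction.\<close>

lemma limit_direction:
  fixes q q' :: "nat \<Rightarrow> 'i::finite \<Rightarrow> complex"
  assumes lim: "\<And>i. (\<lambda>k. q k i) \<longlonglongrightarrow> p i" "\<And>i. (\<lambda>k. q' k i) \<longlonglongrightarrow> p i" and ne: "\<And>k. q k \<noteq> q' k"
  obtains w where "w \<noteq> (\<lambda>i. 0)"
    "\<And>g. (\<And>k. poly_eval g (q k) = poly_eval g (q' k)) \<Longrightarrow> (\<Sum>i\<in>UNIV. w i * poly_eval (pd i g) p) = 0"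
proof -
  define v :: "nat \<Rightarrow> complex ^ 'i" where "v k = (\<chi> i. q k i - q' k i)" for k
  have v0: "v k \<noteq> 0" for k using ne[of k] by (auto simp: v_def vec_eq_iff fun_eq_iff)
  have "\<forall>k. v k /\<^sub>R norm (v k) \<in> sphere 0 1" using v0 by simp
  then have "\<exists>l\<in>sphere (0 :: complex ^ 'i) 1. \<exists>r. strict_mono r \<and> ((\<lambda>k. v k /\<^sub>R norm (v k)) \<circ> r) \<longlonglongrightarrow> l"
    by (rule compact_sphere[of "0 :: complex ^ 'i" 1, unfolded compact_def, THEN spec, THEN mp])
  then obtain l and r :: "nat \<Rightarrow> nat" where l: "l \<in> sphere (0 :: complex ^ 'i) 1" and r: "strict_mono r"
    "((\<lambda>k. v k /\<^sub>R norm (v k)) \<circ> r) \<longlonglongrightarrow> l"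
    by blast
  show ?thesis
  proof (rule that[of "\<lambda>i. l $ i"])
    show "(\<lambda>i. l $ i) \<noteq> (\<lambda>i. 0)"
    proof
      assume "(\<lambda>i. l $ i) = (\<lambda>i. 0)"
      then have "l = 0" by (simp add: vec_eq_iff fun_eq_iff)
      then show False using l by simp
    qed
    fix g assume g: "\<And>k. poly_eval g (q k) = poly_eval g (q' k)"
    obtain A where A: "\<And>k. poly_eval g (q k) - poly_eval g (q' k) = (\<Sum>i\<in>UNIV. (q k i - q' k i) * A i k)"
      "\<And>i. A i \<longlonglongrightarrow> poly_eval (pd i g) p"
      using secant_expansion[of q p q' g, OF lim] by blast
    have "(\<lambda>k. \<Sum>i\<in>UNIV. (v (r k) /\<^sub>R norm (v (r k))) $ i * A i (r k)) \<longlonglongrightarrow> (\<Sum>i\<in>UNIV. l $ i * poly_eval (pd i g) p)"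
      using r LIMSEQ_subseq_LIMSEQ[OF A(2) r(1)]
      by (intro tendsto_sum tendsto_mult tendsto_vec_nth) (simp_all add: comp_def)
    moreover have "(\<Sum>i\<in>UNIV. (v k /\<^sub>R norm (v k)) $ i * A i k) = 0" for k
    proof -
      have "(\<Sum>i\<in>UNIV. (v k /\<^sub>R norm (v k)) $ i * A i k) = (\<Sum>i\<in>UNIV. (q k i - q' k i) * A i k) /\<^sub>R norm (v k)"
        by (simp add: v_def scaleR_sum_right)
      then show ?thesis using A(1)[of k] g[of k] by simp
    qed
    ultimately show "(\<Sum>i\<in>UNIV. l $ i * poly_eval (pd i g) p) = 0"
      using LIMSEQ_unique[OF tendsto_const] by fastforce
  qed
qed

text \<open>Incidence with the curve, expressed by the coefficients of \<open>F\<close> only; this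
  makes it definable.\<close>

definition through :: "(3 option + 3 option) cpoly \<Rightarrow> space3 \<Rightarrow> bool" where
  "through F p \<longleftrightarrow> (\<forall>a b. poly_eval F (pt a b (dot a p) (dot b p)) = 0)"

text \<open>Two kinds of secants are recorded. Points off the plane \<open>dot a = dot a p\<close>
  give a tangent vector by comparison with \<open>p\<close>; at a multiple root of the projection,
  pairs of distinct points in a common plane parallel to it give a limit direction annihilated by
  \<open>a\<close>.\<close>

definition approached :: "space3 set \<Rightarrow> (3 option + 3 option) cpoly \<Rightarrow> space3 \<Rightarrow> space3 \<Rightarrow> space3 \<Rightarrow> bool" where
  "approached \<gamma> F p a b \<longleftrightarrow> (\<exists>q. (\<forall>k. q k \<in> \<gamma>) \<and> (\<forall>i. (\<lambda>k. q k i) \<longlonglongrightarrow> p i) \<and> (\<forall>k :: nat. dot a (q k) \<noteq> dot a p) \<and>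
    (poly_eval (pd (Inr None) F) (pt a b (dot a p) (dot b p)) = 0 \<longrightarrow>
      (\<exists>\<nu> q'. filterlim \<nu> sequentially sequentially \<and> (\<forall>k. q' k \<in> \<gamma>) \<and> (\<forall>i. (\<lambda>k. q' k i) \<longlonglongrightarrow> p i) \<and>
        (\<forall>k. dot a (q' k) = dot a (q (\<nu> k)) \<and> q' k \<noteq> q (\<nu> k)))))"

lemma pfun_crs:
  "(\<And>i. pfun m (\<lambda>y. a y i)) \<Longrightarrow> (\<And>i. pfun n (\<lambda>y. b y i)) \<Longrightarrow> m + n \<le> k \<Longrightarrow> pfun k (\<lambda>y. crs (a y) (b y) i)"
  using exhaust_3[of i] by (elim disjE) (auto intro!: pfun_diff pfun_mult[of m _ n])

lemma crs_surj:
  assumes "\<omega> \<noteq> (\<lambda>i. 0)"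
  shows "\<exists>a b k. k \<noteq> 0 \<and> crs a b = (\<lambda>i. k * \<omega> i)"
proof -
  have ext: "x = y" if "x 1 = y 1" "x 2 = y 2" "x 3 = y 3" for x y :: space3
    using that exhaust_3 by (metis ext)
  define v :: "complex \<Rightarrow> complex \<Rightarrow> complex \<Rightarrow> space3" where
    "v x y z = (\<lambda>i. if i = 1 then x else if i = 2 then y else z)" for x y z
  have v: "v x y z 1 = x" "v x y z 2 = y" "v x y z 3 = z" for x y z by (simp_all add: v_def)
  consider "\<omega> 1 \<noteq> 0" | "\<omega> 2 \<noteq> 0" | "\<omega> 3 \<noteq> 0" using assms ext[of \<omega> "\<lambda>i. 0"] by auto
  then show ?thesis
  proof cases
    case 1
    have "crs (v (- \<omega> 2) (\<omega> 1) 0) (v (- \<omega> 3) 0 (\<omega> 1)) = (\<lambda>i. \<omega> 1 * \<omega> i)" by (rule ext) (simp_all add: v)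
    then show ?thesis using 1 by blast
  next
    case 2
    have "crs (v 0 (- \<omega> 3) (\<omega> 2)) (v (\<omega> 2) (- \<omega> 1) 0) = (\<lambda>i. \<omega> 2 * \<omega> i)" by (rule ext) (simp_all add: v)
    then show ?thesis using 2 by blast
  next
    case 3
    have "crs (v (\<omega> 3) 0 (- \<omega> 1)) (v 0 (\<omega> 3) (- \<omega> 2)) = (\<lambda>i. \<omega> 3 * \<omega> i)" by (rule ext) (simp_all add: v)
    then show ?thesis using 3 by blast
  qed
qed

lemma approached_generic:
  assumes curve: "irreducible_curve \<gamma>" and F: "chow_form \<gamma> F" and p: "through F p"
  obtains n and P :: "(3 + 3 \<Rightarrow> complex) \<Rightarrow> complex" and z where "pfun n P" "P z \<noteq> 0"
    "\<And>a b. P (case_sum a b) \<noteq> 0 \<Longrightarrow> approached \<gamma> F p a b"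
proof -
  obtain H and a1 b1 :: space3 and s1 where H: "poly_eval H (pt a1 b1 s1 0) \<noteq> 0"
    "\<And>a b s t. poly_eval H (pt a b s 0) \<noteq> 0 \<Longrightarrow> poly_eval F (pt a b s t) = 0 \<Longrightarrow>
      pt a b s t \<in> chow_set \<gamma> \<and> poly_eval (pd (Inr None) F) (pt a b s t) \<noteq> 0"
    using chow_form_generic[OF curve F] by metis
  obtain h m \<omega> where h: "poly_eval h \<omega> \<noteq> 0"
    "\<And>c \<omega>. poly_eval h (\<lambda>i. c * \<omega> i) = c ^ m * poly_eval h \<omega>"
    "\<And>q. q \<in> \<gamma> \<Longrightarrow> poly_eval h (\<lambda>i. q i - p i) = 0"
    using cone_polynomial[OF curve F, of p] by metis
  obtain a2 b2 T where T: "poly_eval F (pt a2 b2 (dot a2 p) T) \<noteq> 0"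
    using chow_form_pencil[OF curve F] by blast
  have "\<exists>a b. poly_eval h (crs a b) \<noteq> 0"
  proof (cases "\<omega> = (\<lambda>i. 0)")
    case True
    have "crs \<omega> \<omega> = \<omega>" unfolding True by (rule ext) (simp add: crs_def)
    then show ?thesis using h(1) by metis
  next
    case False
    then obtain a b k where "k \<noteq> 0" "crs a b = (\<lambda>i. k * \<omega> i)" using crs_surj by blast
    then have "poly_eval h (crs a b) \<noteq> 0" using h(1) by (simp add: h(2))
    then show ?thesis by blast
  qed
  then obtain a3 b3 where h3: "poly_eval h (crs a3 b3) \<noteq> 0" by blast
  define A B where "A z i = z (Inl i)" and "B z i = z (Inr i)" for z :: "3 + 3 \<Rightarrow> complex" and i
  have AB [simp]: "A (case_sum a b) = a" "B (case_sum a b) = b" for a b by (auto simp: A_def B_def)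
  have pAB: "pfun k (\<lambda>z. A z i)" "pfun k (\<lambda>z. B z i)" if "1 \<le> k" for k i
    unfolding A_def B_def using that by (simp_all add: pfun_var)
  define P where "P i z = (if i = 0 then poly_eval h (crs (A z) (B z))
    else if i = 1 then poly_eval H (pt (A z) (B z) s1 0)
    else poly_eval F (pt (A z) (B z) (dot (A z) p) T))" for i :: nat and z
  have P: "\<exists>n. pfun n (P i)" for i
  proof -
    have "pfun 2 (\<lambda>z. crs (A z) (B z) i)" for i by (intro pfun_crs[of 1 _ 1] pAB) auto
    then have 0: "pfun (total_degree h * 2) (\<lambda>z. poly_eval h (crs (A z) (B z)))"
      by (rule pfun_poly_eval_compose[OF order_refl])
    have "pfun 1 (\<lambda>z. pt (A z) (B z) s1 0 i)" for i by (intro pfun_pt pAB pfun_const) auto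
    then have 1: "pfun (total_degree H * 1) (\<lambda>z. poly_eval H (pt (A z) (B z) s1 0))"
      by (rule pfun_poly_eval_compose[OF order_refl])
    have "pfun 1 (\<lambda>z. pt (A z) (B z) (dot (A z) p) T i)" for i
      by (intro pfun_pt pAB pfun_const pfun_dot[of 1 _ 0]) auto
    then have 2: "pfun (total_degree F * 1) (\<lambda>z. poly_eval F (pt (A z) (B z) (dot (A z) p) T))"
      by (rule pfun_poly_eval_compose[OF order_refl])
    show ?thesis unfolding P_def using 0 1 2 by (cases "i = 0"; cases "i = 1") auto
  qed
  then obtain n where n: "\<And>i. pfun (n i) (P i)" by metis
  have "P 0 (case_sum a3 b3) \<noteq> 0" "P 1 (case_sum a1 b1) \<noteq> 0" "P 2 (case_sum a2 b2) \<noteq> 0"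
    using h3 H(1) T by (simp_all add: P_def)
  then have "\<exists>z. \<forall>i\<in>{0, 1, 2}. P i z \<noteq> 0"
    by (intro pfun_finite_common_nonzero[where n = n] n) auto
  then obtain z where z: "\<forall>i\<in>{0, 1, 2}. P i z \<noteq> 0" ..
  show ?thesis
  proof (rule that)
    show "pfun (\<Sum>i\<in>{0, 1, 2}. n i) (\<lambda>z. \<Prod>i\<in>{0, 1, 2}. P i z)" by (rule pfun_prod) (rule n)
    show "(\<Prod>i\<in>{0, 1, 2}. P i z) \<noteq> 0" using z by simp
    fix a b assume "(\<Prod>i\<in>{0, 1, 2}. P i (case_sum a b)) \<noteq> 0"
    then have ne: "poly_eval h (crs a b) \<noteq> 0" "poly_eval H (pt a b s1 0) \<noteq> 0" "poly_eval F (pt a b (dot a p) T) \<noteq> 0"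
      by (auto simp: P_def)
    have "poly_eval F (pt a b (dot a p) (dot b p)) = 0" using p by (simp add: through_def)
    from chow_form_sequences[OF curve F H(2) h(2,3) ne this] show "approached \<gamma> F p a b"
      unfolding approached_def by metis
  qed
qed

text \<open>A common first direction \<open>a\<close> with two second directions serves two
  projections at once; the last condition makes the three directions independent.\<close>

lemma generic_frame:
  assumes P: "pfun n P" "P z \<noteq> 0" and w: "w \<noteq> (\<lambda>i. 0)"
  shows "\<exists>a b b'. P (case_sum a b) \<noteq> 0 \<and> P (case_sum a b') \<noteq> 0 \<and> dot a w \<noteq> 0 \<and> dot a (crs b b') \<noteq> 0"
proof -
  define A B B' where "A x i = x (0, i)" and "B x i = x (1, i)" and "B' x i = x (2, i)"
    for x :: "nat \<times> 3 \<Rightarrow> complex" and i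
  have pA: "pfun k (\<lambda>z. A z i)" "pfun k (\<lambda>z. B z i)" "pfun k (\<lambda>z. B' z i)" if "1 \<le> k" for k i
    unfolding A_def B_def B'_def using that by (simp_all add: pfun_var)
  have pc: "pfun 1 (\<lambda>x. case_sum (A x) (B x) i)" "pfun 1 (\<lambda>x. case_sum (A x) (B' x) i)" for i
    by (cases i; simp add: pA)+
  have P1: "pfun (n * 1) (\<lambda>x. P (case_sum (A x) (B x)))" "pfun (n * 1) (\<lambda>x. P (case_sum (A x) (B' x)))"
    by (rule pfun_compose[OF P(1)], rule pc)+
  have P2: "pfun 1 (\<lambda>x. dot (A x) w)" "pfun 3 (\<lambda>x. dot (A x) (crs (B x) (B' x)))"
    by (intro pfun_dot[of 1 _ 0] pfun_dot[of 1 _ 2] pfun_crs[of 1 _ 1] pA pfun_const; simp)+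
  obtain j where j: "w j \<noteq> 0" using w by auto
  have zz: "case_sum a b = z" if "\<And>i. a i = z (Inl i)" "\<And>i. b i = z (Inr i)" for a b
    using that by (auto simp: fun_eq_iff split: sum.splits)
  obtain x1 where x1: "P (case_sum (A x1) (B x1)) \<noteq> 0" "P (case_sum (A x1) (B' x1)) \<noteq> 0"
  proof
    show "P (case_sum (A (\<lambda>(k, i). if k = 0 then z (Inl i) else z (Inr i))) (B (\<lambda>(k, i). if k = 0 then z (Inl i) else z (Inr i)))) \<noteq> 0"
      by (subst zz) (simp_all add: A_def B_def P(2))
    show "P (case_sum (A (\<lambda>(k, i). if k = 0 then z (Inl i) else z (Inr i))) (B' (\<lambda>(k, i). if k = 0 then z (Inl i) else z (Inr i)))) \<noteq> 0"
      by (subst zz) (simp_all add: A_def B'_def P(2))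
  qed
  obtain x2 where x2: "dot (A x2) w \<noteq> 0"
  proof
    show "dot (A (\<lambda>(k, i). if i = j then 1 else 0)) w \<noteq> 0"
      using j by (simp add: A_def dot_def if_distrib[of "\<lambda>x. x * _"] cong: if_cong)
  qed
  obtain x3 where x3: "dot (A x3) (crs (B x3) (B' x3)) \<noteq> 0"
  proof
    let ?x = "\<lambda>(k, i). if k = (0 :: nat) \<and> i = (1 :: 3) \<or> k = 1 \<and> i = 2 \<or> k = 2 \<and> i = 3 then 1 else 0 :: complex"
    show "dot (A ?x) (crs (B ?x) (B' ?x)) \<noteq> 0" by (simp add: dot_3 A_def B_def B'_def)
  qed
  let ?Q = "\<lambda>x. P (case_sum (A x) (B x)) * P (case_sum (A x) (B' x))"
  let ?R = "\<lambda>x. dot (A x) w * dot (A x) (crs (B x) (B' x))"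
  have Q: "pfun (n * 1 + n * 1) ?Q" by (rule pfun_mult[OF P1 order_refl])
  have R: "pfun (1 + 3) ?R" by (rule pfun_mult[OF P2 order_refl])
  obtain y where y: "?R y \<noteq> 0"
    using pfun_common_nonzero[where P = "\<lambda>x. dot (A x) w" and Q = "\<lambda>x. dot (A x) (crs (B x) (B' x))", OF P2(1) x2 P2(2) x3]
    by auto
  have "\<exists>z. ?Q z \<noteq> 0 \<and> ?R z \<noteq> 0"
    by (rule pfun_common_nonzero[where P = ?Q and Q = ?R, OF Q _ R y]) (use x1 in simp)
  then obtain z where "?Q z \<noteq> 0" "?R z \<noteq> 0" by blast
  then have "P (case_sum (A z) (B z)) \<noteq> 0 \<and> P (case_sum (A z) (B' z)) \<noteq> 0 \<and> dot (A z) w \<noteq> 0 \<and> dot (A z) (crs (B z) (B' z)) \<noteq> 0"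
    by auto
  then show ?thesis by blast
qed

lemma approached_ex:
  assumes curve: "irreducible_curve \<gamma>" and F: "chow_form \<gamma> F" and p: "through F p" and w: "w \<noteq> (\<lambda>i. 0)"
  shows "\<exists>a b b'. approached \<gamma> F p a b \<and> approached \<gamma> F p a b' \<and> dot a w \<noteq> 0 \<and> dot a (crs b b') \<noteq> 0"
proof -
  obtain n and P :: "(3 + 3 \<Rightarrow> complex) \<Rightarrow> complex" and z where P: "pfun n P" "P z \<noteq> 0"
    "\<And>a b. P (case_sum a b) \<noteq> 0 \<Longrightarrow> approached \<gamma> F p a b"
    by (rule approached_generic[OF curve F p]) blast
  show ?thesis using generic_frame[OF P(1,2) w] P(3) by blast
qed

text \<open>A point all of whose pairs of planes are zeros of the Chow form is a limit of points of
  the curve, and zero sets of polynomials are closed under limits. Hence the Chow form determines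
  its curve.\<close>

lemma through_iff_mem:
  assumes curve: "irreducible_curve \<gamma>" and F: "chow_form \<gamma> F"
  shows "through F p \<longleftrightarrow> p \<in> \<gamma>"
proof
  assume "p \<in> \<gamma>"
  then show "through F p"
    unfolding through_def using vanishing_idealD[OF chow_form_ideal(2)[OF curve F]] pt_mem_chow_set_iff by blast
next
  assume "through F p"
  then obtain a b where "approached \<gamma> F p a b" using approached_ex[OF curve F, of p "\<lambda>_. 1"] by (auto simp: fun_eq_iff)
  then obtain q :: "nat \<Rightarrow> space3" where q: "\<And>k. q k \<in> \<gamma>" "\<And>i. (\<lambda>k. q k i) \<longlonglongrightarrow> p i"
    unfolding approached_def by blast
  obtain G where G: "\<gamma> = (\<Inter>g\<in>G. zero_set g)"
    using curve by (auto simp: irreducible_curve_def irreducible_variety_def zariski_closed_def)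
  have "poly_eval g p = 0" if "g \<in> G" for g
  proof -
    have "(\<lambda>k. poly_eval g (q k)) \<longlonglongrightarrow> poly_eval g p" by (rule tendsto_poly_eval) (rule q(2))
    moreover have "(\<lambda>k. poly_eval g (q k)) = (\<lambda>k. 0)" using q(1) that by (auto simp: G zero_set_def)
    ultimately show ?thesis using LIMSEQ_unique[OF tendsto_const] by metis
  qed
  then show "p \<in> \<gamma>" by (auto simp: G zero_set_def)
qed

text \<open>A limit of secants through \<open>p\<close> supplies a tangent vector at every point of
  the curve, singular points included.\<close>

lemma curve_tangent:
  assumes curve: "irreducible_curve \<gamma>" and F: "chow_form \<gamma> F" and p: "p \<in> \<gamma>"
  obtains w where "w \<noteq> (\<lambda>i. 0)" "\<And>g. g \<in> vanishing_ideal \<gamma> \<Longrightarrow> (\<Sum>i\<in>UNIV. w i * poly_eval (pd i g) p) = 0"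
proof -
  have "through F p" using through_iff_mem[OF curve F] p by blast
  then obtain a b where "approached \<gamma> F p a b" using approached_ex[OF curve F, of p "\<lambda>_. 1"] by (auto simp: fun_eq_iff)
  then obtain q :: "nat \<Rightarrow> space3" where q: "\<And>k. q k \<in> \<gamma>" "\<And>i. (\<lambda>k. q k i) \<longlonglongrightarrow> p i" "\<And>k. q k \<noteq> p"
    unfolding approached_def by metis
  obtain w where w: "w \<noteq> (\<lambda>i. 0)"
    "\<And>g. (\<And>k. poly_eval g (q k) = poly_eval g p) \<Longrightarrow> (\<Sum>i\<in>UNIV. w i * poly_eval (pd i g) p) = 0"
    by (rule limit_direction[of q p "\<lambda>k. p"]) (auto simp: q)
  show ?thesis by (rule that[OF w]) (simp_all add: vanishing_idealD q(1) p)
qed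

text \<open>Were \<open>p\<close> a multiple root of one projection, nearby pairs of points in
  common planes with normal \<open>a\<close> would have a limit direction annihilated by
  \<open>a\<close>. It is tangent, hence a multiple of \<open>w\<close>, but \<open>a\<close> was
  chosen with \<open>dot a w\<close> nonzero.\<close>

lemma nonsingular_transversal:
  assumes curve: "irreducible_curve \<gamma>" and F: "chow_form \<gamma> F" and p: "nonsingular_point \<gamma> p"
  shows "\<exists>a b b'. dot a (crs b b') \<noteq> 0 \<and> poly_eval (pd (Inr None) F) (pt a b (dot a p) (dot b p)) \<noteq> 0 \<and>
    poly_eval (pd (Inr None) F) (pt a b' (dot a p) (dot b' p)) \<noteq> 0"
proof -
  obtain w where w: "w \<noteq> (\<lambda>i. 0)" "tangent_space \<gamma> p = range (\<lambda>a i. a * w i)"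
    using p by (auto simp: nonsingular_point_def)
  have "through F p" using through_iff_mem[OF curve F] p by (auto simp: nonsingular_point_def)
  then obtain a b b' where ab: "approached \<gamma> F p a b" "approached \<gamma> F p a b'" "dot a w \<noteq> 0" "dot a (crs b b') \<noteq> 0"
    using approached_ex[OF curve F _ w(1)] by blast
  have simple: "poly_eval (pd (Inr None) F) (pt a b (dot a p) (dot b p)) \<noteq> 0" if ap: "approached \<gamma> F p a b" for b
  proof
    assume "poly_eval (pd (Inr None) F) (pt a b (dot a p) (dot b p)) = 0"
    then obtain q q' :: "nat \<Rightarrow> space3" and \<nu> where q: "\<And>k. q k \<in> \<gamma>" "\<And>i. (\<lambda>k. q k i) \<longlonglongrightarrow> p i"
      "\<And>k. q' k \<in> \<gamma>" "\<And>i. (\<lambda>k. q' k i) \<longlonglongrightarrow> p i" "filterlim \<nu> sequentially sequentially"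
      "\<And>k. dot a (q' k) = dot a (q (\<nu> k))" "\<And>k. q' k \<noteq> q (\<nu> k)"
      using ap unfolding approached_def by blast
    have q\<nu>: "(\<lambda>k. q (\<nu> k) i) \<longlonglongrightarrow> p i" for i by (rule filterlim_compose[OF q(2) q(5)])
    obtain v where v: "v \<noteq> (\<lambda>i. 0)"
      "\<And>g. (\<And>k. poly_eval g (q' k) = poly_eval g (q (\<nu> k))) \<Longrightarrow> (\<Sum>i\<in>UNIV. v i * poly_eval (pd i g) p) = 0"
      using limit_direction[of q' p "\<lambda>k. q (\<nu> k)", OF q(4) q\<nu> q(7)] by blast
    have "deriv (\<lambda>s. poly_eval g (\<lambda>i. p i + s * v i)) 0 = 0" if "g \<in> vanishing_ideal \<gamma>" for g
    proof -
      have "((\<lambda>s. poly_eval g (\<lambda>i. p i + s * v i)) has_field_derivative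
          (\<Sum>i\<in>UNIV. poly_eval (pd i g) (\<lambda>i. p i + 0 * v i) * v i)) (at 0)"
        by (rule has_field_derivative_poly_eval) (auto intro!: derivative_eq_intros)
      moreover have "(\<Sum>i\<in>UNIV. v i * poly_eval (pd i g) p) = 0"
        by (rule v(2)) (simp add: vanishing_idealD[OF that] q(1,3))
      ultimately show ?thesis by (simp add: DERIV_imp_deriv mult.commute)
    qed
    then have "v \<in> tangent_space \<gamma> p" by (simp add: tangent_space_def)
    then obtain c where c: "v = (\<lambda>i. c * w i)" unfolding w(2) by blast
    let ?l = "\<Sum>i\<in>UNIV. Cst (a i) * Var i"
    have l: "poly_eval ?l x = dot a x" for x by (simp add: dot_def)
    have "(\<Sum>i\<in>UNIV. v i * poly_eval (pd i ?l) p) = 0" by (rule v(2)) (simp only: l q(6))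
    then have "c * dot a w = 0"
      by (simp add: c pd_add pd_mult pd_Var sum_3 dot_3 algebra_simps)
    then show False using ab(3) v(1) c by auto
  qed
  then show ?thesis using ab by blast
qed

subsection \<open>The vector field of two cylinders through a curve\<close>

definition jac :: "3 cpoly \<Rightarrow> 3 cpoly \<Rightarrow> 3 cpoly \<Rightarrow> 3 cpoly" where
  "jac g k h = pd 1 h * (pd 2 g * pd 3 k - pd 3 g * pd 2 k) +
    pd 2 h * (pd 3 g * pd 1 k - pd 1 g * pd 3 k) + pd 3 h * (pd 1 g * pd 2 k - pd 2 g * pd 1 k)"

definition grad :: "3 cpoly \<Rightarrow> space3 \<Rightarrow> space3" where
  "grad g p = (\<lambda>i. poly_eval (pd i g) p)"

lemma poly_eval_jac: "poly_eval (jac g k h) p = dot (grad h p) (crs (grad g p) (grad k p))"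
  by (simp add: jac_def grad_def dot_3)

lemma jac_derivation [simp]:
  "jac g k (u + v) = jac g k u + jac g k v" "jac g k (u * v) = jac g k u * v + u * jac g k v"
  "jac g k (Cst c) = 0" "jac g k 0 = 0" "jac g k 1 = 0"
  by (simp_all add: jac_def pd_add pd_mult algebra_simps)

lemma jac_sum: "jac g k (\<Sum>a\<in>A. u a) = (\<Sum>a\<in>A. jac g k (u a))"
  by (induction A rule: infinite_finite_induct) auto

lemma jac_power: "jac g k (u ^ n) = of_nat n * u ^ (n - 1) * jac g k u"
proof (induction n)
  case (Suc n)
  then show ?case by (cases n) (simp_all add: algebra_simps)
qed simp

text \<open>All three gradients annihilate one nonzero tangent vector, so their triple product
  vanishes; this covers singular points too.\<close>

lemma jac_vanishing_ideal:
  assumes curve: "irreducible_curve \<gamma>" and F: "chow_form \<gamma> F"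
    and "g \<in> vanishing_ideal \<gamma>" "k \<in> vanishing_ideal \<gamma>" "h \<in> vanishing_ideal \<gamma>"
  shows "jac g k h \<in> vanishing_ideal \<gamma>"
proof -
  have "dot (grad h q) (crs (grad g q) (grad k q)) = 0" if q: "q \<in> \<gamma>" for q
  proof -
    obtain w where w: "w \<noteq> (\<lambda>i. 0)" "\<And>g. g \<in> vanishing_ideal \<gamma> \<Longrightarrow> (\<Sum>i\<in>UNIV. w i * poly_eval (pd i g) q) = 0"
      by (rule curve_tangent[OF curve F q]) blast
    have "dot (grad u q) w = 0" if "u \<in> vanishing_ideal \<gamma>" for u
      using w(2)[OF that] by (simp add: dot_def grad_def mult.commute)
    then have "dot (grad h q) (crs (grad g q) (grad k q)) * w i = 0" for i using assms(3-5) by (simp add: cramer_3)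
    then show ?thesis using w(1) by auto
  qed
  then show ?thesis by (auto simp: vanishing_ideal_def poly_eval_jac)
qed

lemma jac_funpow_vanishing_ideal:
  assumes "irreducible_curve \<gamma>" "chow_form \<gamma> F"
    "g \<in> vanishing_ideal \<gamma>" "k \<in> vanishing_ideal \<gamma>" "h \<in> vanishing_ideal \<gamma>"
  shows "(jac g k ^^ j) h \<in> vanishing_ideal \<gamma>"
  by (induction j) (simp_all add: assms(5) jac_vanishing_ideal[OF assms(1-4)])

text \<open>The formal Taylor series of \<open>h\<close> along the integral curve of the vector
  field through \<open>p\<close>. It is multiplicative with values in a domain, and infinite contact
  with \<open>f\<close> means that the series of \<open>f\<close> is 0.\<close>

definition flow :: "3 cpoly \<Rightarrow> 3 cpoly \<Rightarrow> space3 \<Rightarrow> 3 cpoly \<Rightarrow> complex fps" where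
  "flow g k p h = Abs_fps (\<lambda>j. poly_eval ((jac g k ^^ j) h) p / fact j)"

lemma flow_add: "flow g k p (u + v) = flow g k p u + flow g k p v"
proof -
  have "(jac g k ^^ j) (u + v) = (jac g k ^^ j) u + (jac g k ^^ j) v" for j by (induction j) simp_all
  then show ?thesis by (simp add: flow_def fps_eq_iff add_divide_distrib)
qed

lemma fps_deriv_flow: "fps_deriv (flow g k p h) = flow g k p (jac g k h)"
  by (rule fps_ext) (simp add: flow_def funpow_swap1 del: of_nat_Suc)

lemma flow_mult: "flow g k p (u * v) = flow g k p u * flow g k p v"
proof -
  have "flow g k p (u * v) $ n = (flow g k p u * flow g k p v) $ n" for n u v
  proof (induction n arbitrary: u v)
    case 0
    show ?case by (simp add: flow_def)
  next
    case (Suc n)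
    have "of_nat (Suc n) * flow g k p (u * v) $ Suc n = flow g k p (jac g k u * v) $ n + flow g k p (u * jac g k v) $ n"
      using arg_cong[OF fps_deriv_flow[of g k p "u * v"], of "\<lambda>x. x $ n"] by (simp add: flow_add)
    also have "\<dots> = fps_deriv (flow g k p u * flow g k p v) $ n"
      unfolding Suc by (simp add: fps_deriv_flow)
    also have "\<dots> = of_nat (Suc n) * (flow g k p u * flow g k p v) $ Suc n" by (simp only: fps_deriv_nth Suc_eq_plus1)
    finally show ?case by (simp del: of_nat_Suc)
  qed
  then show ?thesis by (simp add: fps_eq_iff)
qed

lemma flow_eq_0_iff: "flow g k p h = 0 \<longleftrightarrow> (\<forall>j. poly_eval ((jac g k ^^ j) h) p = 0)"
  by (simp add: flow_def fps_eq_iff)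

lemma flow_prime: "flow g k p (u * v) = 0 \<longleftrightarrow> flow g k p u = 0 \<or> flow g k p v = 0"
  by (simp add: flow_mult)

lemma flow_jac: "flow g k p h = 0 \<Longrightarrow> flow g k p (jac g k h) = 0"
  by (simp flip: fps_deriv_flow)

lemma flow_nonzero: "poly_eval h p \<noteq> 0 \<Longrightarrow> flow g k p h \<noteq> 0"
  unfolding flow_eq_0_iff by (auto intro: exI[of _ 0])

lemma Cst_of_nat: "Cst (of_nat n) = of_nat n"
  by (induction n) (simp_all add: Cst_add)

text \<open>\<open>x\<close> has nonzero derivative along the flow, so it is transcendental there:
  differentiating a relation and cancelling the series of \<open>jac g k x\<close> lowers the
  degree.\<close>

lemma flow_transversal:
  assumes x: "poly_eval (jac g k x) p \<noteq> 0" and "flow g k p (\<Sum>j\<le>n. Cst (c j) * x ^ j) = 0" and "j \<le> n"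
  shows "c j = 0"
  using assms(2,3)
proof (induction n arbitrary: c j)
  case 0
  then show ?case using flow_nonzero[of "Cst (c 0)" p g k] by auto
next
  case (Suc n)
  have term': "Cst (c (Suc j)) * jac g k (x ^ Suc j) = Cst (of_nat (Suc j) * c (Suc j)) * x ^ j * jac g k x" for j
    using jac_power[of g k x "Suc j"] by (simp add: Cst_mult Cst_of_nat mult_ac del: power_Suc of_nat_Suc)
  have "jac g k (\<Sum>j\<le>Suc n. Cst (c j) * x ^ j) = (\<Sum>j\<le>n. Cst (of_nat (Suc j) * c (Suc j)) * x ^ j) * jac g k x"
    unfolding sum.atMost_Suc_shift sum_distrib_right by (simp add: jac_sum term' del: power_Suc of_nat_Suc)
  with flow_jac[OF Suc.prems(1)] have "flow g k p (\<Sum>j\<le>n. Cst (of_nat (Suc j) * c (Suc j)) * x ^ j) = 0"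
    using flow_nonzero[OF x] by (simp add: flow_prime)
  then have 0: "c (Suc j) = 0" if "j \<le> n" for j using Suc.IH[of "\<lambda>j. of_nat (Suc j) * c (Suc j)" j] that by (simp del: of_nat_Suc)
  then have "(\<Sum>j\<le>Suc n. Cst (c j) * x ^ j) = Cst (c 0)" unfolding sum.atMost_Suc_shift by simp
  then have "c 0 = 0" using Suc.prems(1) flow_nonzero[of "Cst (c 0)" p g k] by auto
  then show ?case using 0 Suc.prems(2) by (cases j) auto
qed

text \<open>Two functions on a curve are algebraically dependent.  Applying the flow to such a relation
  between \<open>f\<close> and \<open>x\<close>, divided by the largest possible power of \<open>f\<close>, leaves a relation in \<open>x\<close> alone.\<close>

lemma flow_contained:
  assumes curve: "irreducible_curve \<gamma>" and F: "chow_form \<gamma> F"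
    and gk: "g \<in> vanishing_ideal \<gamma>" "k \<in> vanishing_ideal \<gamma>" and p: "p \<in> \<gamma>"
    and trans: "poly_eval (jac g k x) p \<noteq> 0" and x: "total_degree x \<le> 1" and f: "flow g k p f = 0"
  shows "\<gamma> \<subseteq> zero_set f"
proof (rule ccontr)
  assume "\<not> \<gamma> \<subseteq> zero_set f"
  then have nf: "f \<notin> vanishing_ideal \<gamma>" by (auto simp: vanishing_ideal_def zero_set_def)
  obtain e :: "nat \<times> nat \<times> nat \<Rightarrow> space3 \<Rightarrow> complex" and J where J:
    "\<And>m. finite (J m)" "\<And>m. card (J m) \<le> (m + 1) * (total_degree F)\<^sup>2"
    "\<And>m g. pfun m g \<Longrightarrow> spn \<gamma> (J m) e g"
    by (rule curve_hilbert_function[OF curve F]) blast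
  define A where "A = (total_degree F)\<^sup>2"
  define D where "D = total_degree f"
  \<comment> \<open>This choice makes \<open>(A * D + B + 1) * A\<close> one less than
    \<open>(A + 1) * (B + 1)\<close>, the number of products of powers of \<open>f\<close> and
    \<open>x\<close>.\<close>
  define B where "B = A * A * D"
  let ?I = "{..A} \<times> {..B}"
  have "card (J (A * D + B)) \<le> (A * D + B + 1) * A" using J(2)[of "A * D + B"] by (simp add: A_def)
  also have "\<dots> < (A + 1) * (B + 1)" by (simp add: B_def algebra_simps)
  also have "\<dots> = card ?I" by simp
  finally have card: "card (J (A * D + B)) < card ?I" .
  have "\<exists>c. (\<exists>z\<in>?I. c z \<noteq> 0) \<and> (\<forall>q\<in>\<gamma>. (\<Sum>z\<in>?I. c z * poly_eval (f ^ fst z * x ^ snd z) q) = 0)"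
  proof (rule spn_dependent[OF J(1) _ card])
    fix z assume z: "z \<in> ?I"
    have "fst z * D \<le> A * D" "snd z * 1 \<le> B" using z by auto
    then have "fst z * D + snd z * 1 \<le> A * D + B" by (rule add_mono)
    moreover have "pfun (fst z * D) (\<lambda>q. poly_eval f q ^ fst z)" "pfun (snd z * 1) (\<lambda>q. poly_eval x q ^ snd z)"
      by (intro pfun_power pfun_poly_eval x; simp add: D_def)+
    ultimately have "pfun (A * D + B) (\<lambda>q. poly_eval f q ^ fst z * poly_eval x q ^ snd z)"
      by (intro pfun_mult)
    moreover have "poly_eval (f ^ fst z * x ^ snd z) = (\<lambda>q. poly_eval f q ^ fst z * poly_eval x q ^ snd z)" by (rule ext) simp
    ultimately show "spn \<gamma> (J (A * D + B)) e (poly_eval (f ^ fst z * x ^ snd z))"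
      by (intro J(3)) simp
  qed simp
  then obtain c where c: "\<exists>z\<in>?I. c z \<noteq> 0" "\<And>q. q \<in> \<gamma> \<Longrightarrow> (\<Sum>z\<in>?I. c z * poly_eval (f ^ fst z * x ^ snd z) q) = 0" by blast
  define Q where "Q i = (\<Sum>j\<le>B. Cst (c (i, j)) * x ^ j)" for i
  define i0 where "i0 = (LEAST i. i \<le> A \<and> (\<exists>j\<le>B. c (i, j) \<noteq> 0))"
  have "\<exists>i. i \<le> A \<and> (\<exists>j\<le>B. c (i, j) \<noteq> 0)" using c(1) by auto
  then have "i0 \<le> A \<and> (\<exists>j\<le>B. c (i0, j) \<noteq> 0)" unfolding i0_def by (rule LeastI_ex)
  then have i0: "i0 \<le> A" "\<exists>j\<le>B. c (i0, j) \<noteq> 0" by simp_all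
  have low: "c (i, j) = 0" if "i < i0" "j \<le> B" for i j
    using not_less_Least[OF that(1)[unfolded i0_def]] that i0(1) by auto
  have "f ^ i0 * (\<Sum>i\<in>{i0..A}. f ^ (i - i0) * Q i) = (\<Sum>i\<in>{i0..A}. f ^ i * Q i)"
    unfolding sum_distrib_left by (intro sum.cong refl) (simp add: power_add[symmetric] mult.assoc[symmetric])
  also have "\<dots> = (\<Sum>i\<le>A. f ^ i * Q i)"
    by (rule sum.mono_neutral_left) (auto simp: Q_def low)
  also have "\<dots> = (\<Sum>z\<in>?I. Cst (c z) * (f ^ fst z * x ^ snd z))"
    by (simp add: Q_def sum_distrib_left sum.cartesian_product case_prod_unfold mult_ac)
  finally have "f ^ i0 * (\<Sum>i\<in>{i0..A}. f ^ (i - i0) * Q i) \<in> vanishing_ideal \<gamma>"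
    using c(2) by (simp add: vanishing_ideal_def)
  moreover have "f ^ i0 \<notin> vanishing_ideal \<gamma>" using nf by (auto simp: vanishing_ideal_def)
  ultimately have "(\<Sum>i\<in>{i0..A}. f ^ (i - i0) * Q i) \<in> vanishing_ideal \<gamma>"
    using curve_irreducible[OF curve, of "f ^ i0" "\<Sum>i\<in>{i0..A}. f ^ (i - i0) * Q i"] by (auto simp: vanishing_ideal_def)
  then have "flow g k p (\<Sum>i\<in>{i0..A}. f ^ (i - i0) * Q i) = 0"
    unfolding flow_eq_0_iff using vanishing_idealD[OF jac_funpow_vanishing_ideal[OF curve F gk] p] by blast
  moreover have "flow g k p (\<Sum>i\<in>{Suc i0..A}. f ^ (i - i0) * Q i) = 0"
  proof -
    have "(\<Sum>i\<in>{Suc i0..A}. f ^ (i - i0) * Q i) = f * (\<Sum>i\<in>{Suc i0..A}. f ^ (i - Suc i0) * Q i)"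
      unfolding sum_distrib_left
      by (intro sum.cong refl) (simp add: power_Suc[symmetric] mult.assoc[symmetric] Suc_diff_le[symmetric] del: power_Suc)
    then show ?thesis by (simp add: flow_mult f)
  qed
  ultimately have "flow g k p (Q i0) = 0"
    using i0(1) by (simp add: sum.atLeast_Suc_atMost flow_add)
  then have "c (i0, j) = 0" if "j \<le> B" for j using flow_transversal[OF trans _ that] by (simp add: Q_def)
  then show False using i0(2) by blast
qed

text \<open>The cross product of two covectors annihilating \<open>d\<close> is proportional to
  \<open>d\<close>; this is written with minors since either vector may vanish.\<close>

lemma crs_tangent:
  assumes "dot u d = 0" "dot v d = 0"
  shows "d i * crs u v j = d j * crs u v i"
proof -
  have d: "u 1 * d 1 = - (u 2 * d 2 + u 3 * d 3)" "v 1 * d 1 = - (v 2 * d 2 + v 3 * d 3)"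
    "u 2 * d 2 = - (u 1 * d 1 + u 3 * d 3)" "v 2 * d 2 = - (v 1 * d 1 + v 3 * d 3)"
    using assms by (simp_all add: dot_3 add_eq_0_iff algebra_simps)
  have 12: "d 1 * crs u v 2 = d 2 * crs u v 1"
  proof -
    have "d 1 * crs u v 2 = u 3 * (v 1 * d 1) - v 3 * (u 1 * d 1)" by (simp add: algebra_simps)
    also have "\<dots> = d 2 * crs u v 1" unfolding d(1,2) by (simp add: algebra_simps)
    finally show ?thesis .
  qed
  have 13: "d 1 * crs u v 3 = d 3 * crs u v 1"
  proof -
    have "d 1 * crs u v 3 = v 2 * (u 1 * d 1) - u 2 * (v 1 * d 1)" by (simp add: algebra_simps)
    also have "\<dots> = d 3 * crs u v 1" unfolding d(1,2) by (simp add: algebra_simps)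
    finally show ?thesis .
  qed
  have 23: "d 2 * crs u v 3 = d 3 * crs u v 2"
  proof -
    have "d 2 * crs u v 3 = u 1 * (v 2 * d 2) - v 1 * (u 2 * d 2)" by (simp add: algebra_simps)
    also have "\<dots> = d 3 * crs u v 2" unfolding d(3,4) by (simp add: algebra_simps)
    finally show ?thesis .
  qed
  show ?thesis using exhaust_3[of i] exhaust_3[of j] 12 13 23 by (elim disjE) simp_all
qed

lemma holomorphic_on_poly_eval:
  "(\<And>i. (\<lambda>s. \<phi> s i) holomorphic_on S) \<Longrightarrow> (\<lambda>s. poly_eval f (\<phi> s)) holomorphic_on S"
  by (induction f rule: cpoly_induct) (auto intro!: holomorphic_intros)

text \<open>Along a parametrization the vector field is a holomorphic multiple \<open>l\<close> of
  the velocity, because the gradients of \<open>g\<close> and \<open>k\<close> annihilate both. So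
  iterated derivatives along the field are combinations of ordinary derivatives in the
  parameter.\<close>

lemma osculates_jac:
  assumes gk: "g \<in> vanishing_ideal \<gamma>" "k \<in> vanishing_ideal \<gamma>" and osc: "osculates \<gamma> f r p" and "n \<le> r"
  shows "poly_eval ((jac g k ^^ n) f) p = 0"
proof -
  obtain \<phi> e where e: "e > 0" and hol: "\<And>i. (\<lambda>s. \<phi> s i) holomorphic_on ball 0 e" and p: "\<phi> 0 = p"
    and ne: "\<exists>i. deriv (\<lambda>s. \<phi> s i) 0 \<noteq> 0" and op: "openin (top_of_set \<gamma>) (\<phi> ` ball 0 e)"
    and vanish: "\<And>k. k \<le> r \<Longrightarrow> (deriv ^^ k) (\<lambda>s. poly_eval f (\<phi> s)) 0 = 0"
    using osc unfolding osculates_def local_parametrization_def by blast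
  have \<gamma>: "\<phi> s \<in> \<gamma>" if "s \<in> ball 0 e" for s using openin_imp_subset[OF op] that by blast
  define d where "d s = (\<lambda>i. deriv (\<lambda>s. \<phi> s i) s)" for s
  have dhol: "(\<lambda>s. d s i) holomorphic_on ball 0 e" for i
    unfolding d_def by (intro holomorphic_deriv hol open_ball)
  have chain: "((\<lambda>s. poly_eval h (\<phi> s)) has_field_derivative dot (grad h (\<phi> s)) (d s)) (at s)" if "s \<in> ball 0 e" for h s
    unfolding dot_def grad_def d_def
    by (rule has_field_derivative_poly_eval) (rule holomorphic_derivI[OF hol open_ball that])
  have tang: "dot (grad h (\<phi> s)) (d s) = 0" if s: "s \<in> ball 0 e" and h: "h \<in> vanishing_ideal \<gamma>" for h s
  proof (rule DERIV_unique[OF chain[OF s]])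
    show "((\<lambda>s. poly_eval h (\<phi> s)) has_field_derivative 0) (at s)"
      by (rule has_field_derivative_transform_within_open[OF DERIV_const open_ball s])
        (simp add: vanishing_idealD[OF h \<gamma>])
  qed
  obtain i where i: "d 0 i \<noteq> 0" using ne by (auto simp: d_def)
  have "continuous_on (ball 0 e) (\<lambda>s. d s i)" by (rule holomorphic_on_imp_continuous_on[OF dhol])
  then have "open (ball 0 e \<inter> (\<lambda>s. d s i) -` (- {0}))"
    by (intro continuous_open_preimage) auto
  moreover have "0 \<in> ball 0 e \<inter> (\<lambda>s. d s i) -` (- {0})" using e i by simp
  ultimately obtain S where S: "open S" "0 \<in> S" "S \<subseteq> ball 0 e" "\<And>s. s \<in> S \<Longrightarrow> d s i \<noteq> 0"
    by (metis (no_types, lifting) ComplD Int_iff Int_lower1 singletonI vimage_eq)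
  define l where "l s = crs (grad g (\<phi> s)) (grad k (\<phi> s)) i / d s i" for s
  have sub: "(\<lambda>s. u s) holomorphic_on S" if "u holomorphic_on ball 0 e" for u
    using that S(3) by (rule holomorphic_on_subset)
  have hS: "(\<lambda>s. poly_eval h (\<phi> s)) holomorphic_on S" for h
    by (rule sub, rule holomorphic_on_poly_eval, rule hol)
  have lhol: "l holomorphic_on S"
    using exhaust_3[of i] unfolding l_def
    by (elim disjE) (auto simp: grad_def intro!: holomorphic_intros hS sub[OF dhol] dest: S(4))
  have step: "poly_eval (jac g k h) (\<phi> s) = l s * deriv (\<lambda>s. poly_eval h (\<phi> s)) s" if "s \<in> S" for h s
  proof -
    have s: "s \<in> ball 0 e" using S(3) that by blast
    let ?X = "crs (grad g (\<phi> s)) (grad k (\<phi> s))"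
    have X: "d s i * ?X j = d s j * ?X i" for j by (rule crs_tangent[OF tang[OF s gk(1)] tang[OF s gk(2)]])
    have "d s i * poly_eval (jac g k h) (\<phi> s) = (\<Sum>j\<in>UNIV. grad h (\<phi> s) j * (d s i * ?X j))"
      by (simp add: poly_eval_jac dot_def sum_distrib_left mult_ac)
    also have "\<dots> = dot (grad h (\<phi> s)) (d s) * ?X i"
      unfolding X by (simp add: dot_def sum_distrib_left mult_ac)
    also have "dot (grad h (\<phi> s)) (d s) = deriv (\<lambda>s. poly_eval h (\<phi> s)) s"
      by (rule DERIV_imp_deriv[symmetric, OF chain[OF s]])
    finally show ?thesis using S(4)[OF that] by (simp add: l_def field_simps)
  qed
  \<comment> \<open>All orders \<open>m\<close> with \<open>m + n \<le> r\<close> are carried along,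
    since the product rule with the factor \<open>l\<close> involves every lower derivative.\<close>
  have "(deriv ^^ m) (\<lambda>s. poly_eval ((jac g k ^^ n) f) (\<phi> s)) 0 = 0" if "m + n \<le> r" for m
    using that
  proof (induction n arbitrary: m)
    case 0
    then show ?case using vanish by simp
  next
    case (Suc n)
    let ?u = "\<lambda>s. poly_eval ((jac g k ^^ n) f) (\<phi> s)"
    have du: "deriv ?u holomorphic_on S" by (rule holomorphic_deriv[OF hS S(1)])
    have "(deriv ^^ m) (\<lambda>s. poly_eval ((jac g k ^^ Suc n) f) (\<phi> s)) 0 = (deriv ^^ m) (\<lambda>s. l s * deriv ?u s) 0"
      by (rule higher_deriv_transform_within_open[OF hS _ S(1,2)])
        (use step lhol du in \<open>auto intro!: holomorphic_intros\<close>)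
    also have "\<dots> = (\<Sum>j = 0..m. of_nat (m choose j) * (deriv ^^ j) l 0 * (deriv ^^ (m - j)) (deriv ?u) 0)"
      by (rule higher_deriv_mult[OF lhol du S(1,2)])
    also have "\<dots> = 0"
    proof (rule sum.neutral, safe)
      fix j assume "j \<in> {0..m}"
      then have "(deriv ^^ Suc (m - j)) ?u 0 = 0" using Suc.prems by (intro Suc.IH) simp
      then show "of_nat (m choose j) * (deriv ^^ j) l 0 * (deriv ^^ (m - j)) (deriv ?u) 0 = 0"
        by (simp add: funpow_swap1)
    qed
    finally show ?case .
  qed
  from this[of 0] show ?thesis using \<open>n \<le> r\<close> p by simp
qed

subsection \<open>Differential polynomials with parameters\<close>

text \<open>Variables of the definable conditions: the coefficients of a Chow form, directions in space,
  the coordinates of a point, the partial derivatives of \<open>f\<close> there, the coefficients of the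
  polynomials describing the family, and the ratio of two Chow coordinates.\<close>

datatype pvar = VF "(3 option + 3 option) monom" | VA nat 3 | VP 3 | VJ "3 list"
  | VY nat "(3 option + 3 option) monom monom" | VX

text \<open>Polynomials in space built uniformly from parameters, coordinates and derivatives of
  \<open>f\<close>. They admit two readings: evaluated at a point they are polynomial functions of
  the environment, and sorted by powers of the parameters they have coefficients depending on
  \<open>f\<close> only. Closure under \<open>pd\<close> makes iterated derivatives along the field
  expressible.\<close>

inductive_set DP :: "pvar set \<Rightarrow> ((pvar \<Rightarrow> complex) \<Rightarrow> 3 cpoly \<Rightarrow> 3 cpoly) set" for V where
  DP_Cst: "(\<lambda>e f. Cst c) \<in> DP V"
| DP_Var: "(\<lambda>e f. Var i) \<in> DP V"
| DP_param: "v \<in> V \<Longrightarrow> (\<lambda>e f. Cst (e v)) \<in> DP V"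
| DP_jet: "(\<lambda>e f. foldr pd \<alpha> f) \<in> DP V"
| DP_add: "G \<in> DP V \<Longrightarrow> H \<in> DP V \<Longrightarrow> (\<lambda>e f. G e f + H e f) \<in> DP V"
| DP_mult: "G \<in> DP V \<Longrightarrow> H \<in> DP V \<Longrightarrow> (\<lambda>e f. G e f * H e f) \<in> DP V"

lemma DP_uminus: "G \<in> DP V \<Longrightarrow> (\<lambda>e f. - G e f) \<in> DP V"
  using DP_mult[OF DP_Cst[of "-1"]] by (simp add: Cst_def single_uminus)

lemma DP_diff: "G \<in> DP V \<Longrightarrow> H \<in> DP V \<Longrightarrow> (\<lambda>e f. G e f - H e f) \<in> DP V"
  using DP_add[OF _ DP_uminus] by simp

lemma DP_sum: "(\<And>a. a \<in> A \<Longrightarrow> G a \<in> DP V) \<Longrightarrow> (\<lambda>e f. \<Sum>a\<in>A. G a e f) \<in> DP V"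
  using DP_Cst[of 0] by (induction A rule: infinite_finite_induct) (auto intro: DP_add)

lemma DP_prod: "(\<And>a. a \<in> A \<Longrightarrow> G a \<in> DP V) \<Longrightarrow> (\<lambda>e f. \<Prod>a\<in>A. G a e f) \<in> DP V"
  using DP_Cst[of 1] by (induction A rule: infinite_finite_induct) (auto intro: DP_mult)

lemma DP_power: "G \<in> DP V \<Longrightarrow> (\<lambda>e f. G e f ^ n) \<in> DP V"
  using DP_Cst[of 1] by (induction n) (auto intro: DP_mult)

lemma DP_pd: "G \<in> DP V \<Longrightarrow> (\<lambda>e f. pd i (G e f)) \<in> DP V"
proof (induction rule: DP.induct)
  case (DP_Cst c)
  show ?case using DP.DP_Cst[of 0] by simp
next
  case (DP_Var j)
  show ?case using DP.DP_Cst[of "if i = j then 1 else 0"] by (simp add: pd_Var if_distrib[of Cst] cong: if_cong)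
next
  case (DP_param v)
  show ?case using DP.DP_Cst[of 0] by simp
next
  case (DP_jet \<alpha>)
  show ?case using DP.DP_jet[of "i # \<alpha>"] by (simp only: foldr.simps comp_def)
next
  case (DP_add G H)
  then show ?case unfolding pd_add by (intro DP.DP_add)
next
  case (DP_mult G H)
  then show ?case unfolding pd_mult by (intro DP.DP_add DP.DP_mult)
qed

lemma DP_jac: "G \<in> DP V \<Longrightarrow> K \<in> DP V \<Longrightarrow> H \<in> DP V \<Longrightarrow> (\<lambda>e f. jac (G e f) (K e f) (H e f)) \<in> DP V"
  unfolding jac_def by (intro DP_add DP_mult DP_diff DP_pd)

lemma DP_PF:
  assumes "G \<in> DP V"
  shows "\<exists>P\<in>PF. \<forall>e f p. (\<forall>i. e (VP i) = p i) \<longrightarrow> (\<forall>\<alpha>. e (VJ \<alpha>) = poly_eval (foldr pd \<alpha> f) p) \<longrightarrow>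
    poly_eval (G e f) p = P e"
  using assms
proof induction
  case (DP_Cst c)
  show ?case by (rule bexI[OF _ PF_const[of c]]) simp
next
  case (DP_Var i)
  show ?case by (rule bexI[OF _ PF_var[of "VP i"]]) simp
next
  case (DP_param v)
  show ?case by (rule bexI[OF _ PF_var[of v]]) simp
next
  case (DP_jet \<alpha>)
  show ?case by (rule bexI[OF _ PF_var[of "VJ \<alpha>"]]) simp
next
  case (DP_add G H)
  then obtain P Q where "P \<in> PF" "Q \<in> PF"
    "\<forall>e f p. (\<forall>i. e (VP i) = p i) \<longrightarrow> (\<forall>\<alpha>. e (VJ \<alpha>) = poly_eval (foldr pd \<alpha> f) p) \<longrightarrow> poly_eval (G e f) p = P e"
    "\<forall>e f p. (\<forall>i. e (VP i) = p i) \<longrightarrow> (\<forall>\<alpha>. e (VJ \<alpha>) = poly_eval (foldr pd \<alpha> f) p) \<longrightarrow> poly_eval (H e f) p = Q e"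
    by blast
  then show ?case by (intro bexI[OF _ PF_add[of P Q]]) simp_all
next
  case (DP_mult G H)
  then obtain P Q where "P \<in> PF" "Q \<in> PF"
    "\<forall>e f p. (\<forall>i. e (VP i) = p i) \<longrightarrow> (\<forall>\<alpha>. e (VJ \<alpha>) = poly_eval (foldr pd \<alpha> f) p) \<longrightarrow> poly_eval (G e f) p = P e"
    "\<forall>e f p. (\<forall>i. e (VP i) = p i) \<longrightarrow> (\<forall>\<alpha>. e (VJ \<alpha>) = poly_eval (foldr pd \<alpha> f) p) \<longrightarrow> poly_eval (H e f) p = Q e"
    by blast
  then show ?case by (intro bexI[OF _ PF_mult[of P Q]]) simp_all
qed

definition specialize :: "(nat \<Rightarrow> complex) \<Rightarrow> (nat monom \<Rightarrow>\<^sub>0 3 cpoly) \<Rightarrow> 3 cpoly" where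
  "specialize w g = (\<Sum>m\<in>Poly_Mapping.keys g. Cst (mono_eval m w) * Poly_Mapping.lookup g m)"

lemma specialize_superset:
  "finite A \<Longrightarrow> Poly_Mapping.keys g \<subseteq> A \<Longrightarrow> specialize w g = (\<Sum>m\<in>A. Cst (mono_eval m w) * Poly_Mapping.lookup g m)"
  unfolding specialize_def by (rule sum.mono_neutral_left) (auto simp: in_keys_iff)

lemma specialize_single [simp]: "specialize w (Poly_Mapping.single m c) = Cst (mono_eval m w) * c"
  by (cases "c = 0") (simp_all add: specialize_def)

lemma specialize_0 [simp]: "specialize w 0 = 0"
  by (simp add: specialize_def)

lemma specialize_add [simp]: "specialize w (g + h) = specialize w g + specialize w h"
proof -
  let ?A = "Poly_Mapping.keys g \<union> Poly_Mapping.keys h"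
  have "specialize w (g + h) = (\<Sum>m\<in>?A. Cst (mono_eval m w) * Poly_Mapping.lookup (g + h) m)"
    by (rule specialize_superset) (use keys_add[of g h] in auto)
  also have "\<dots> = specialize w g + specialize w h"
    by (subst (1 2) specialize_superset[where A = ?A]) (auto simp: lookup_add distrib_left sum.distrib)
  finally show ?thesis .
qed

lemma specialize_mult [simp]: "specialize w (g * h) = specialize w g * specialize w h"
proof (induction g rule: poly_mapping_add_induct)
  case (single a c)
  show ?case
  proof (induction h rule: poly_mapping_add_induct)
    case (single b d)
    show ?case by (simp add: mult_single mono_eval_add Cst_mult mult_ac)
  qed (simp_all add: distrib_left)
qed (simp_all add: distrib_right)

lemma specialize_diff [simp]: "specialize w (g - h) = specialize w g - specialize w h"
  using specialize_add[of w "g - h" h] by (simp add: algebra_simps)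

lemma specialize_sum [simp]: "specialize w (\<Sum>a\<in>A. g a) = (\<Sum>a\<in>A. specialize w (g a))"
  by (induction A rule: infinite_finite_induct) auto

text \<open>The exponents are bounded by \<open>n\<close> for all \<open>f\<close> at once, which is
  the degree bound that \<open>effective_acc\<close> asks for. \<open>en\<close> numbers the
  parameters, so that their monomials are linearly ordered.\<close>

definition expands :: "pvar set \<Rightarrow> (pvar \<Rightarrow> nat) \<Rightarrow> nat \<Rightarrow> (3 cpoly \<Rightarrow> nat monom \<Rightarrow>\<^sub>0 3 cpoly) \<Rightarrow>
    ((pvar \<Rightarrow> complex) \<Rightarrow> 3 cpoly \<Rightarrow> 3 cpoly) \<Rightarrow> bool" where
  "expands V en n g G \<longleftrightarrow> (\<forall>f. Poly_Mapping.keys (g f) \<subseteq> monoms_le (en ` V) n \<and>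
    (\<forall>e w. (\<forall>v\<in>V. w (en v) = e v) \<longrightarrow> specialize w (g f) = G e f))"

lemma DP_expand: "G \<in> DP V \<Longrightarrow> \<exists>n g. expands V en n g G"
proof (induction rule: DP.induct)
  case (DP_Cst c)
  have "expands V en 0 (\<lambda>f. Poly_Mapping.single 0 (Cst c)) (\<lambda>e f. Cst c)" by (auto simp: expands_def monoms_le_def)
  then show ?case by blast
next
  case (DP_Var i)
  have "expands V en 0 (\<lambda>f. Poly_Mapping.single 0 (Var i)) (\<lambda>e f. Var i)" by (auto simp: expands_def monoms_le_def)
  then show ?case by blast
next
  case (DP_param v)
  then have "expands V en 1 (\<lambda>f. Poly_Mapping.single (Poly_Mapping.single (en v) 1) 1) (\<lambda>e f. Cst (e v))"
    by (auto simp: expands_def monoms_le_def)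
  then show ?case by blast
next
  case (DP_jet \<alpha>)
  have "expands V en 0 (\<lambda>f. Poly_Mapping.single 0 (foldr pd \<alpha> f)) (\<lambda>e f. foldr pd \<alpha> f)" by (auto simp: expands_def monoms_le_def)
  then show ?case by blast
next
  case (DP_add G H)
  from DP_add.IH obtain n g m h where *: "expands V en n g G" "expands V en m h H" by blast
  have "Poly_Mapping.keys (g f + h f) \<subseteq> monoms_le (en ` V) (n + m)" for f
  proof
    fix x assume "x \<in> Poly_Mapping.keys (g f + h f)"
    then have "x \<in> monoms_le (en ` V) n \<or> x \<in> monoms_le (en ` V) m"
      using keys_add[of "g f" "h f"] * unfolding expands_def by blast
    then show "x \<in> monoms_le (en ` V) (n + m)" by (auto simp: monoms_le_def)
  qed
  moreover have "specialize w (g f + h f) = G e f + H e f" if w: "\<forall>v\<in>V. w (en v) = e v" for f e w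
  proof -
    have "specialize w (g f) = G e f" "specialize w (h f) = H e f" using * w unfolding expands_def by blast+
    then show ?thesis by simp
  qed
  ultimately have "expands V en (n + m) (\<lambda>f. g f + h f) (\<lambda>e f. G e f + H e f)" unfolding expands_def by blast
  then show ?case by blast
next
  case (DP_mult G H)
  from DP_mult.IH obtain n g m h where *: "expands V en n g G" "expands V en m h H" by blast
  have "Poly_Mapping.keys (g f * h f) \<subseteq> monoms_le (en ` V) (n + m)" for f
  proof
    fix x assume "x \<in> Poly_Mapping.keys (g f * h f)"
    then obtain a b where ab: "x = a + b" "a \<in> Poly_Mapping.keys (g f)" "b \<in> Poly_Mapping.keys (h f)"
      using keys_mult[of "g f" "h f"] by blast
    then have "a \<in> monoms_le (en ` V) n" "b \<in> monoms_le (en ` V) m" using * unfolding expands_def by blast+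
    then show "x \<in> monoms_le (en ` V) (n + m)"
      using keys_add[of a b] by (auto simp: monoms_le_def ab(1) monom_degree_add)
  qed
  moreover have "specialize w (g f * h f) = G e f * H e f" if w: "\<forall>v\<in>V. w (en v) = e v" for f e w
  proof -
    have "specialize w (g f) = G e f" "specialize w (h f) = H e f" using * w unfolding expands_def by blast+
    then show ?thesis by simp
  qed
  ultimately have "expands V en (n + m) (\<lambda>f. g f * h f) (\<lambda>e f. G e f * H e f)" unfolding expands_def by blast
  then show ?case by blast
qed

text \<open>After multiplication by \<open>b\<close> the derivation maps the module spanned by the
  first \<open>m + 1\<close> iterates into itself, so every iterate enters it after multiplication
  by a power of \<open>b\<close>.\<close>

lemma funpow_jac_span:
  fixes f g k :: "3 cpoly"
  defines "h \<equiv> \<lambda>n. (jac g k ^^ n) f"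
  assumes "b * h (Suc m) = (\<Sum>j\<le>m. c j * h j)"
  shows "\<exists>N c. b ^ N * h n = (\<Sum>j\<le>m. c j * h j)"
proof -
  define A where "A = {u. \<exists>c. u = (\<Sum>j\<le>m. c j * h j)}"
  have A_add: "u + v \<in> A" if uv: "u \<in> A" "v \<in> A" for u v
  proof -
    obtain c d where "u = (\<Sum>j\<le>m. c j * h j)" "v = (\<Sum>j\<le>m. d j * h j)" using uv by (auto simp: A_def)
    then have "u + v = (\<Sum>j\<le>m. (c j + d j) * h j)" by (simp add: sum.distrib distrib_right)
    then show ?thesis unfolding A_def by (intro CollectI exI)
  qed
  have A_mult: "v * u \<in> A" if u: "u \<in> A" for u v
  proof -
    obtain c where "u = (\<Sum>j\<le>m. c j * h j)" using u by (auto simp: A_def)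
    then have "v * u = (\<Sum>j\<le>m. (v * c j) * h j)" by (simp add: sum_distrib_left mult.assoc)
    then show ?thesis unfolding A_def by (intro CollectI exI)
  qed
  have A_sum: "(\<Sum>j\<in>J. u j) \<in> A" if "\<And>j. j \<in> J \<Longrightarrow> u j \<in> A" for u and J :: "nat set"
  proof -
    have "0 \<in> A" unfolding A_def by (intro CollectI exI[of _ "\<lambda>_. 0"]) simp
    with that show ?thesis by (induction J rule: infinite_finite_induct) (auto intro: A_add)
  qed
  have A_h: "h j \<in> A" if "j \<le> m" for j
  proof -
    have "h j = (\<Sum>i\<le>m. (if i = j then 1 else 0) * h i)"
      using that by (simp add: if_distrib[of "\<lambda>x. x * _"] cong: if_cong)
    then show ?thesis unfolding A_def by (intro CollectI exI)
  qed
  have A_last: "b * h (Suc m) \<in> A" unfolding A_def using assms(2) by (intro CollectI exI)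
  have A_jac: "b * jac g k u \<in> A" if u: "u \<in> A" for u
  proof -
    obtain c where c: "u = (\<Sum>j\<le>m. c j * h j)" using u by (auto simp: A_def)
    have bh: "b * h (Suc j) \<in> A" if "j \<le> m" for j
    proof (cases "j = m")
      case True
      then show ?thesis using A_last by simp
    next
      case False
      then show ?thesis using that by (intro A_mult A_h) simp
    qed
    have "b * jac g k (c j) * h j + c j * (b * h (Suc j)) \<in> A" if "j \<le> m" for j
      by (rule A_add[OF A_mult[OF A_h[OF that]] A_mult[OF bh[OF that]]])
    then have "(\<Sum>j\<le>m. b * jac g k (c j) * h j + c j * (b * h (Suc j))) \<in> A" by (intro A_sum) auto
    moreover have "(\<Sum>j\<le>m. b * jac g k (c j) * h j + c j * (b * h (Suc j))) = b * jac g k u"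
      by (simp add: c jac_sum sum_distrib_left distrib_left mult_ac h_def)
    ultimately show ?thesis by simp
  qed
  have "\<exists>N. b ^ N * h n \<in> A"
  proof (induction n)
    case 0
    then show ?case using A_h[of 0] by (intro exI[of _ 0]) simp
  next
    case (Suc n)
    then obtain N where N: "b ^ N * h n \<in> A" by blast
    have "b * jac g k (b ^ N * h n) = of_nat N * jac g k b * (b ^ N * h n) + b ^ Suc N * h (Suc n)"
    proof -
      have "b * jac g k (b ^ N * h n) = of_nat N * (b * b ^ (N - 1)) * (jac g k b * h n) + b ^ Suc N * jac g k (h n)"
        by (simp add: jac_power algebra_simps)
      also have "of_nat N * (b * b ^ (N - 1)) = of_nat N * b ^ N" by (cases N) simp_all
      finally show ?thesis by (simp add: h_def mult_ac)
    qed
    then have "b ^ Suc N * h (Suc n) = b * jac g k (b ^ N * h n) + (- (of_nat N * jac g k b)) * (b ^ N * h n)"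
      by (simp add: algebra_simps)
    also have "\<dots> \<in> A" by (intro A_add A_jac A_mult N)
    finally show ?case by blast
  qed
  then show ?thesis unfolding A_def by blast
qed

lemma finite_chow_index: "finite (chow_index E)"
  using finite_monoms_le[of "UNIV :: (3 option + 3 option) set" "2 * E"] by (simp add: chow_index_def monoms_le_def)

section \<open>Cylinders over two projections, with the Chow form as parameter\<close>

definition slot :: "nat \<Rightarrow> (pvar \<Rightarrow> complex) \<Rightarrow> 3 option + 3 option \<Rightarrow> 3 cpoly" where
  "slot n e = case_sum
    (case_option (- (\<Sum>i\<in>UNIV. Cst (e (VA 0 i)) * Var i)) (\<lambda>i. Cst (e (VA 0 i))))
    (case_option (- (\<Sum>i\<in>UNIV. Cst (e (VA n i)) * Var i)) (\<lambda>i. Cst (e (VA n i))))"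

text \<open>The Chow form at the two planes with fixed normals through the variable point: an
  equation of the cylinder over the curve in the direction common to both planes. The normal
  \<open>VA 0\<close> is shared by the cylinders for \<open>n = 1\<close> and
  \<open>n = 2\<close>.\<close>

definition cyl :: "nat \<Rightarrow> nat \<Rightarrow> (pvar \<Rightarrow> complex) \<Rightarrow> 3 cpoly" where
  "cyl E n e = (\<Sum>m\<in>chow_index E. Cst (e (VF m)) * (\<Prod>v\<in>UNIV. slot n e v ^ Poly_Mapping.lookup m v))"

definition tower :: "nat \<Rightarrow> nat \<Rightarrow> (pvar \<Rightarrow> complex) \<Rightarrow> 3 cpoly \<Rightarrow> 3 cpoly" where
  "tower E k e f = (jac (cyl E 1 e) (cyl E 2 e) ^^ k) f"

definition tower_vars :: "nat \<Rightarrow> pvar set" where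
  "tower_vars E = VF ` chow_index E \<union> case_prod VA ` ({0, 1, 2} \<times> UNIV)"

lemma finite_tower_vars: "finite (tower_vars E)"
  by (simp add: tower_vars_def finite_chow_index)

lemma DP_cyl:
  assumes "n \<in> {1, 2}"
  shows "(\<lambda>e f. cyl E n e) \<in> DP (tower_vars E)"
proof -
  have VA: "VA j i \<in> tower_vars E" if "j \<in> {0, 1, 2}" for j i using that by (force simp: tower_vars_def)
  have "(\<lambda>e f. slot n e v) \<in> DP (tower_vars E)" for v
  proof -
    consider "v = Inl None" | i where "v = Inl (Some i)" | "v = Inr None" | i where "v = Inr (Some i)"
      by (metis old.sum.exhaust option.exhaust)
    then show ?thesis
      by cases (use assms in \<open>auto simp: slot_def intro!: DP_uminus DP_sum DP_mult DP_param DP_Var VA\<close>)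
  qed
  then show ?thesis
    unfolding cyl_def by (intro DP_sum DP_mult DP_param DP_prod DP_power) (auto simp: tower_vars_def)
qed

lemma DP_tower: "(\<lambda>e f. tower E k e f) \<in> DP (tower_vars E)"
proof (induction k)
  case 0
  show ?case using DP_jet[of "[]"] by (simp add: tower_def id_def)
next
  case (Suc k)
  then show ?case
    using DP_jac[OF DP_cyl[of 1 E] DP_cyl[of 2 E] Suc] by (simp add: tower_def)
qed

lemma prime_pred_dvd:
  assumes "irreducible (f :: 3 cpoly)"
  shows "prime_pred (\<lambda>a. f dvd a)"
  using assms irreducible_dvd_mult_3[OF assms] by (auto simp: prime_pred_def irreducible_def)

lemma null_specialize:
  assumes "irreducible (f :: 3 cpoly)" "null (\<lambda>a. f dvd a) g"
  shows "f dvd specialize w g"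
  using assms(2) unfolding null_def[OF prime_pred_dvd[OF assms(1)]] nnk_def specialize_def
  by (intro dvd_sum dvd_mult) auto

text \<open>A uniform finite order of contact forces infinite order: by the effective ascending chain
  condition, the ideals generated by \<open>tower E 0, \<dots>, tower E k\<close> become stationary modulo \<open>f\<close>, after
  inverting some \<open>b\<close>, at a \<open>k\<close> bounded independently of \<open>f\<close>.\<close>

lemma tower_trapped:
  obtains r where "\<And>f. irreducible f \<Longrightarrow> \<exists>b. \<not> f dvd b \<and> (\<forall>e p. poly_eval f p = 0 \<longrightarrow> poly_eval b p \<noteq> 0 \<longrightarrow>
    (\<forall>k\<le>r. poly_eval (tower E k e f) p = 0) \<longrightarrow> (\<forall>k. poly_eval (tower E k e f) p = 0))"
proof -
  let ?V = "tower_vars E"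
  obtain en :: "pvar \<Rightarrow> nat" where en: "inj_on en ?V"
    using finite_imp_inj_to_nat_seg[OF finite_tower_vars[of E]] by blast
  have "\<forall>k. \<exists>n g. expands ?V en n g (\<lambda>e f. tower E (Suc k) e f)"
    by (intro allI DP_expand DP_tower)
  then obtain n g where g: "\<And>k. expands ?V en (n k) (g k) (\<lambda>e f. tower E (Suc k) e f)" by metis
  obtain r where r: "\<forall>(Z :: 3 cpoly \<Rightarrow> bool) h. prime_pred Z \<longrightarrow>
    (\<forall>k\<le>r. nnk Z (h k) \<subseteq> monoms_le (en ` ?V) (n k)) \<longrightarrow>
    (\<exists>k\<le>r. \<exists>b. \<not> Z b \<and> in_span Z h k (Poly_Mapping.single 0 b * h k))"
    using effective_acc[of "en ` ?V" n] finite_tower_vars[of E] by auto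
  show ?thesis
  proof (rule that)
    fix f :: "3 cpoly" assume f: "irreducible f"
    let ?Z = "\<lambda>a. f dvd a"
    note Z = prime_pred_dvd[OF f]
    have "nnk ?Z (g k f) \<subseteq> monoms_le (en ` ?V) (n k)" for k
    proof -
      have "nnk ?Z (g k f) \<subseteq> Poly_Mapping.keys (g k f)" by (auto simp: nnk_def in_keys_iff)
      then show ?thesis using g[of k] unfolding expands_def by blast
    qed
    with r Z obtain m b where b: "m \<le> r" "\<not> f dvd b"
      "in_span ?Z (\<lambda>k. g k f) m (Poly_Mapping.single 0 b * g m f)" by meson
    then obtain C where C: "null ?Z (Poly_Mapping.single 0 b * g m f - (\<Sum>j<m. C j * g j f))"
      by (auto simp: in_span_def[OF Z])
    have "poly_eval (tower E k e f) p = 0"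
      if *: "poly_eval f p = 0" "poly_eval b p \<noteq> 0" "\<forall>k\<le>r. poly_eval (tower E k e f) p = 0" for e p k
    proof -
      define w where "w i = e (inv_into ?V en i)" for i
      have "\<forall>v\<in>?V. w (en v) = e v" using en by (simp add: w_def)
      then have sg: "specialize w (g k f) = tower E (Suc k) e f" for k
        using g[of k] unfolding expands_def by blast
      have "f dvd b * tower E (Suc m) e f - (\<Sum>j<m. specialize w (C j) * tower E (Suc j) e f)"
        using null_specialize[OF f C, of w] by (simp add: sg)
      then obtain u where u: "b * tower E (Suc m) e f - (\<Sum>j<m. specialize w (C j) * tower E (Suc j) e f) = f * u" by (rule dvdE)
      \<comment> \<open>The chain condition was applied to the iterates from the first one on,
        modulo \<open>f\<close>. As \<open>f\<close> is the iterate of index 0, its multiple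
        \<open>u * f\<close> becomes the term of index 0 and the others are shifted.\<close>
      define c where "c j = (case j of 0 \<Rightarrow> u | Suc i \<Rightarrow> specialize w (C i))" for j
      have "(\<Sum>j\<le>m. c j * tower E j e f) = u * f + (\<Sum>j<m. specialize w (C j) * tower E (Suc j) e f)"
        unfolding lessThan_Suc_atMost[symmetric] sum.lessThan_Suc_shift by (simp add: c_def tower_def)
      then have "b * tower E (Suc m) e f = (\<Sum>j\<le>m. c j * tower E j e f)"
        using u by (simp add: algebra_simps)
      then obtain N d where "b ^ N * tower E k e f = (\<Sum>j\<le>m. d j * tower E j e f)"
        unfolding tower_def using funpow_jac_span[where n = k] by blast
      then have "poly_eval (b ^ N * tower E k e f) p = poly_eval (\<Sum>j\<le>m. d j * tower E j e f) p" by (rule arg_cong)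
      then have "poly_eval b p ^ N * poly_eval (tower E k e f) p = 0"
        using *(3) b(1) by simp
      then show ?thesis using *(2) by simp
    qed
    then show "\<exists>b. \<not> f dvd b \<and> (\<forall>e p. poly_eval f p = 0 \<longrightarrow> poly_eval b p \<noteq> 0 \<longrightarrow>
      (\<forall>k\<le>r. poly_eval (tower E k e f) p = 0) \<longrightarrow> (\<forall>k. poly_eval (tower E k e f) p = 0))"
      using b(2) by blast
  qed
qed

section \<open>Environments representing a Chow form\<close>

lemma poly_eval_chow_index:
  assumes "Poly_Mapping.keys F \<subseteq> chow_index E"
  shows "poly_eval F x = (\<Sum>m\<in>chow_index E. Poly_Mapping.lookup F m * mono_eval m x)"
  using assms by (intro poly_eval_superset finite_chow_index)

lemma pd_sum: "pd v (\<Sum>a\<in>A. u a) = (\<Sum>a\<in>A. pd v (u a))"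
  by (induction A rule: infinite_finite_induct) (auto simp: pd_add)

lemma poly_eval_pd_chow_index:
  assumes "Poly_Mapping.keys F \<subseteq> chow_index E"
  shows "poly_eval (pd v F) x = (\<Sum>m\<in>chow_index E. Poly_Mapping.lookup F m * poly_eval (pd v (Poly_Mapping.single m 1)) x)"
proof -
  have "F = (\<Sum>m\<in>Poly_Mapping.keys F. Poly_Mapping.single m (Poly_Mapping.lookup F m))" by (simp add: poly_mapping_sum_single)
  also have "\<dots> = (\<Sum>m\<in>chow_index E. Poly_Mapping.single m (Poly_Mapping.lookup F m))"
    using assms by (intro sum.mono_neutral_left finite_chow_index) (auto simp: in_keys_iff)
  also have "\<dots> = (\<Sum>m\<in>chow_index E. Cst (Poly_Mapping.lookup F m) * Poly_Mapping.single m 1)"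
    by (simp add: Cst_def mult_single)
  finally have "pd v F = (\<Sum>m\<in>chow_index E. Cst (Poly_Mapping.lookup F m) * pd v (Poly_Mapping.single m 1))"
    by (metis (no_types, lifting) pd_sum pd_mult pd_Cst add.left_neutral mult_zero_left sum.cong)
  then show ?thesis by simp
qed

definition dir :: "nat \<Rightarrow> (pvar \<Rightarrow> complex) \<Rightarrow> space3" where
  "dir n e = (\<lambda>i. e (VA n i))"

definition represents :: "nat \<Rightarrow> (3 option + 3 option) cpoly \<Rightarrow> (pvar \<Rightarrow> complex) \<Rightarrow> bool" where
  "represents E F e \<longleftrightarrow> Poly_Mapping.keys F \<subseteq> chow_index E \<and> (\<forall>m\<in>chow_index E. e (VF m) = Poly_Mapping.lookup F m)"

lemma poly_eval_slot: "poly_eval (slot n e v) q = pt (dir 0 e) (dir n e) (dot (dir 0 e) q) (dot (dir n e) q) v"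
proof -
  consider "v = Inl None" | i where "v = Inl (Some i)" | "v = Inr None" | i where "v = Inr (Some i)"
    by (metis old.sum.exhaust option.exhaust)
  then show ?thesis by cases (simp_all add: slot_def dir_def dot_def)
qed

lemma poly_eval_cyl:
  assumes "represents E F e"
  shows "poly_eval (cyl E n e) q = poly_eval F (pt (dir 0 e) (dir n e) (dot (dir 0 e) q) (dot (dir n e) q))"
proof -
  have "mono_eval m x = (\<Prod>v\<in>UNIV. x v ^ Poly_Mapping.lookup m v)" for m and x :: "3 option + 3 option \<Rightarrow> complex"
    by (rule mono_eval_superset) auto
  then show ?thesis
    using assms poly_eval_chow_index[of F E] by (simp add: represents_def cyl_def poly_eval_slot)
qed

lemma cyl_vanishing_ideal:
  assumes "represents E F e" "irreducible_curve \<gamma>" "chow_form \<gamma> F"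
  shows "cyl E n e \<in> vanishing_ideal \<gamma>"
  using through_iff_mem[OF assms(2,3)] by (auto simp: vanishing_ideal_def poly_eval_cyl[OF assms(1)] through_def)

lemma grad_cyl:
  fixes n :: nat and e
  assumes "represents E F e"
  defines "x \<equiv> \<lambda>q. pt (dir 0 e) (dir n e) (dot (dir 0 e) q) (dot (dir n e) q)"
  shows "grad (cyl E n e) p i =
    - (poly_eval (pd (Inl None) F) (x p) * dir 0 e i + poly_eval (pd (Inr None) F) (x p) * dir n e i)"
proof -
  let ?q = "\<lambda>s j. p j + s * (if j = i then 1 else 0)"
  have "((\<lambda>s. poly_eval (cyl E n e) (?q s)) has_field_derivative
      (\<Sum>j\<in>UNIV. poly_eval (pd j (cyl E n e)) (?q 0) * (if j = i then 1 else 0))) (at 0)"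
    by (rule has_field_derivative_poly_eval) (auto intro!: derivative_eq_intros)
  then have 1: "((\<lambda>s. poly_eval F (x (?q s))) has_field_derivative grad (cyl E n e) p i) (at 0)"
    by (simp add: poly_eval_cyl[OF assms(1)] x_def grad_def if_distrib[of "\<lambda>x. _ * x"] cong: if_cong)
  let ?d = "\<lambda>v. if v = Inl None then - dir 0 e i else if v = Inr None then - dir n e i else 0"
  have dot: "dot a (?q s) = dot a p + s * a i" for a s
    by (simp add: dot_def distrib_left sum.distrib if_distrib[of "\<lambda>x. _ * x"] cong: if_cong)
  have "((\<lambda>s. x (?q s) v) has_field_derivative ?d v) (at 0)" for v
  proof -
    consider "v = Inl None" | i where "v = Inl (Some i)" | "v = Inr None" | i where "v = Inr (Some i)"
      by (metis old.sum.exhaust option.exhaust)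
    then show ?thesis unfolding x_def dot by cases (auto intro!: derivative_eq_intros)
  qed
  then have "((\<lambda>s. poly_eval F (x (?q s))) has_field_derivative (\<Sum>v\<in>UNIV. poly_eval (pd v F) (x (?q 0)) * ?d v)) (at 0)"
    by (rule has_field_derivative_poly_eval)
  from DERIV_unique[OF 1 this] have "grad (cyl E n e) p i = (\<Sum>v\<in>UNIV. poly_eval (pd v F) (x p) * ?d v)" by simp
  also have "\<dots> = (\<Sum>v\<in>{Inl None, Inr None}. poly_eval (pd v F) (x p) * ?d v)"
    by (rule sum.mono_neutral_right) auto
  finally show ?thesis by simp
qed

text \<open>The three directions are independent and the derivative in the last constant term is
  nonzero for both projections at \<open>p\<close>; together this makes the vector field nonzero at
  \<open>p\<close>.\<close>

definition transversal :: "(3 option + 3 option) cpoly \<Rightarrow> space3 \<Rightarrow> space3 \<Rightarrow> space3 \<Rightarrow> space3 \<Rightarrow> bool" where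
  "transversal F p a b b' \<longleftrightarrow> dot a (crs b b') \<noteq> 0 \<and>
    poly_eval (pd (Inr None) F) (pt a b (dot a p) (dot b p)) \<noteq> 0 \<and>
    poly_eval (pd (Inr None) F) (pt a b' (dot a p) (dot b' p)) \<noteq> 0"

text \<open>The gradients are combinations of \<open>a\<close> and \<open>b\<close> and of
  \<open>a\<close> and \<open>b'\<close>, so in the determinant with \<open>a\<close> only the
  multiples of \<open>b\<close> and \<open>b'\<close> survive. Their factors are the two derivatives
  with respect to the last constant term.\<close>

lemma jac_cyl_transversal:
  assumes "represents E F e" "transversal F p (dir 0 e) (dir 1 e) (dir 2 e)"
  shows "dot (dir 0 e) (crs (grad (cyl E 1 e) p) (grad (cyl E 2 e) p)) \<noteq> 0"
proof -
  have "dot a (crs (\<lambda>i. - (u * a i + v * b i)) (\<lambda>i. - (u' * a i + v' * b' i))) = v * v' * dot a (crs b b')"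
    for a b b' u v u' v' by (simp add: dot_3 algebra_simps)
  then show ?thesis
    using assms(2) unfolding transversal_def grad_cyl[OF assms(1), abs_def] by simp
qed

text \<open>Contact of order \<open>r\<close> is expressed by the coefficients of \<open>F\<close>
  and the derivatives of \<open>f\<close> at \<open>p\<close>, with one transversal choice of
  directions quantified out. No parametrization of the curve occurs, which makes the condition
  definable.\<close>

definition osculating :: "nat \<Rightarrow> nat \<Rightarrow> 3 cpoly \<Rightarrow> (3 option + 3 option) cpoly \<Rightarrow> space3 \<Rightarrow> bool" where
  "osculating E r f F p \<longleftrightarrow> (\<exists>e. represents E F e \<and> transversal F p (dir 0 e) (dir 1 e) (dir 2 e) \<and>
    (\<forall>k\<le>r. poly_eval (tower E k e f) p = 0))"

lemma ex_represents:
  assumes "Poly_Mapping.keys F \<subseteq> chow_index E"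
  shows "\<exists>e. represents E F e \<and> dir 0 e = a \<and> dir 1 e = b \<and> dir 2 e = b'"
  by (rule exI[of _ "\<lambda>v. case v of VF m \<Rightarrow> Poly_Mapping.lookup F m
      | VA n i \<Rightarrow> (if n = 0 then a i else if n = 1 then b i else b' i) | _ \<Rightarrow> 0"])
    (simp add: assms represents_def dir_def fun_eq_iff)

lemma flecnode_osculating:
  assumes curve: "irreducible_curve \<gamma>" and F: "chow_form \<gamma> F" "Poly_Mapping.keys F \<subseteq> chow_index E"
    and p: "nonsingular_point \<gamma> p" "osculates \<gamma> f r p"
  shows "osculating E r f F p"
proof -
  obtain a b b' where ab: "transversal F p a b b'"
    using nonsingular_transversal[OF curve F(1) p(1)] unfolding transversal_def by blast
  obtain e where e: "represents E F e" "dir 0 e = a" "dir 1 e = b" "dir 2 e = b'"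
    using ex_represents[OF F(2)] by blast
  have "poly_eval (tower E k e f) p = 0" if "k \<le> r" for k
    unfolding tower_def
    by (rule osculates_jac[OF cyl_vanishing_ideal[OF e(1) curve F(1)] cyl_vanishing_ideal[OF e(1) curve F(1)] p(2) that])
  then show ?thesis using e ab unfolding osculating_def by blast
qed

text \<open>Transversality makes the linear function \<open>?x\<close> a coordinate along the flow,
  so that \<open>flow_contained\<close> applies to infinite contact.\<close>

lemma tower_contained:
  assumes curve: "irreducible_curve \<gamma>" and F: "chow_form \<gamma> F" and e: "represents E F e"
    and p: "p \<in> \<gamma>" "transversal F p (dir 0 e) (dir 1 e) (dir 2 e)" "\<forall>k. poly_eval (tower E k e f) p = 0"
  shows "\<gamma> \<subseteq> zero_set f"
proof -
  let ?x = "\<Sum>i\<in>UNIV. Cst (dir 0 e i) * Var i :: 3 cpoly"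
  have "grad ?x p = dir 0 e"
    by (rule ext) (simp add: grad_def pd_sum pd_mult pd_Var if_distrib[of "poly_eval _"] if_distrib[of "\<lambda>x. _ * x"]
        if_distribR if_distrib[of "\<lambda>x. poly_eval x _"] cong: if_cong)
  then have "poly_eval (jac (cyl E 1 e) (cyl E 2 e) ?x) p \<noteq> 0"
    using jac_cyl_transversal[OF e p(2)] by (simp add: poly_eval_jac)
  moreover have "total_degree ?x \<le> 1"
    by (intro total_degree_sum_le order_trans[OF total_degree_mult_le]) simp
  moreover have "flow (cyl E 1 e) (cyl E 2 e) p f = 0" using p(3) by (simp add: flow_eq_0_iff tower_def)
  ultimately show ?thesis
    by (rule flow_contained[OF curve F cyl_vanishing_ideal[OF e curve F] cyl_vanishing_ideal[OF e curve F] p(1)])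
qed

text \<open>The tower vanishes on the whole curve. For one generic choice of directions,
  transversality fails only at zeros of two polynomials that do not vanish identically on the
  curve.\<close>

lemma contained_osculating:
  assumes curve: "irreducible_curve \<gamma>" and F: "chow_form \<gamma> F" "Poly_Mapping.keys F \<subseteq> chow_index E"
    and f: "\<gamma> \<subseteq> zero_set f"
  shows "finite {q\<in>\<gamma>. \<not> osculating E r f F q}"
proof -
  note F' = chow_form_ideal[OF curve F(1)]
  let ?P = "\<lambda>q a b. poly_eval (pd (Inr None) F) (pt a b (dot a q) (dot b q))"
  have "pd (Inr None) F \<notin> vanishing_ideal (chow_set \<gamma>)"
    using chow_ideal_principal[OF curve F'] not_dvd_pd by blast
  then obtain a0 b0 q0 where q0: "q0 \<in> \<gamma>" "?P q0 a0 b0 \<noteq> 0"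
    unfolding vanishing_ideal_def by (auto simp: chow_set_iff)
  define A B where "A z i = z (Inl i)" and "B z i = z (Inr i)" for z :: "3 + 3 \<Rightarrow> complex" and i
  have AB: "A (case_sum a b) = a" "B (case_sum a b) = b" for a b by (auto simp: A_def B_def)
  have "pfun 1 (\<lambda>z. pt (A z) (B z) (dot (A z) q0) (dot (B z) q0) i)" for i
    unfolding A_def B_def by (intro pfun_pt pfun_dot[of 1 _ 0] pfun_var pfun_const) auto
  then have pf: "pfun (total_degree (pd (Inr None) F) * 1) (\<lambda>z. ?P q0 (A z) (B z))"
    by (rule pfun_poly_eval_compose[OF order_refl])
  have nz: "?P q0 (A (case_sum a0 b0)) (B (case_sum a0 b0)) \<noteq> 0" using q0(2) by (simp add: AB)
  have "(\<lambda>_ :: 3. 1 :: complex) \<noteq> (\<lambda>_. 0)" by (simp add: fun_eq_iff)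
  from generic_frame[where P = "\<lambda>z. ?P q0 (A z) (B z)", OF pf nz this]
  obtain a b b' where ab: "?P q0 a b \<noteq> 0" "?P q0 a b' \<noteq> 0" "dot a (crs b b') \<noteq> 0"
    unfolding AB by blast
  obtain e where e: "represents E F e" "dir 0 e = a" "dir 1 e = b" "dir 2 e = b'"
    using ex_represents[OF F(2)] by blast
  have fin: "finite {q\<in>\<gamma>. ?P q a b = 0}" if "?P q0 a b \<noteq> 0" for b
  proof -
    have "pfun 1 (\<lambda>q. pt a b (dot a q) (dot b q) i)" for i
      by (intro pfun_pt pfun_dot[of 0 _ 1] pfun_var pfun_const) auto
    then have "pfun (total_degree (pd (Inr None) F) * 1) (\<lambda>q. ?P q a b)"
      by (rule pfun_poly_eval_compose[OF order_refl])
    then show ?thesis by (rule curve_zeros_bound(1)[where g = "\<lambda>q. ?P q a b", OF curve F(1) _ q0(1) that])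
  qed
  have "f \<in> vanishing_ideal \<gamma>" using f by (auto simp: vanishing_ideal_def zero_set_def)
  then have "poly_eval (tower E k e f) q = 0" if "q \<in> \<gamma>" for k q
    unfolding tower_def using jac_funpow_vanishing_ideal[OF curve F(1)] cyl_vanishing_ideal[OF e(1) curve F(1)] vanishing_idealD that by metis
  then have "osculating E r f F q" if "q \<in> \<gamma>" "?P q a b \<noteq> 0" "?P q a b' \<noteq> 0" for q
    using e ab(3) that unfolding osculating_def transversal_def by blast
  then have "{q\<in>\<gamma>. \<not> osculating E r f F q} \<subseteq> {q\<in>\<gamma>. ?P q a b = 0} \<union> {q\<in>\<gamma>. ?P q a b' = 0}" by blast
  then show ?thesis using fin[OF ab(1)] fin[OF ab(2)] by (meson finite_UnI finite_subset)
qed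

subsection \<open>Definability of the osculation condition\<close>

definition site :: "3 cpoly \<Rightarrow> (nat \<Rightarrow> (3 option + 3 option) monom cpoly) \<Rightarrow> space3 \<Rightarrow> complex \<Rightarrow> (pvar \<Rightarrow> complex) \<Rightarrow> bool" where
  "site f g p x e \<longleftrightarrow> (\<forall>i. e (VP i) = p i) \<and> (\<forall>\<alpha>. e (VJ \<alpha>) = poly_eval (foldr pd \<alpha> f) p) \<and>
    (\<forall>j \<mu>. e (VY j \<mu>) = Poly_Mapping.lookup (g j) \<mu>) \<and> e VX = x"

definition override :: "pvar set \<Rightarrow> (pvar \<Rightarrow> complex) \<Rightarrow> (pvar \<Rightarrow> complex) \<Rightarrow> pvar \<Rightarrow> complex" where
  "override V y e v = (if v \<in> V then y v else e v)"

definition dirs :: "nat set \<Rightarrow> pvar set" where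
  "dirs N = case_prod VA ` (N \<times> UNIV)"

lemma dirs_iff [simp]: "VA n i \<in> dirs N \<longleftrightarrow> n \<in> N" "VF m \<notin> dirs N" "VP i \<notin> dirs N" "VJ \<alpha> \<notin> dirs N"
  "VY j \<mu> \<notin> dirs N" "VX \<notin> dirs N"
  by (auto simp: dirs_def)

lemma finite_dirs: "finite N \<Longrightarrow> finite (dirs N)"
  by (simp add: dirs_def)

definition planes :: "nat \<Rightarrow> nat \<Rightarrow> (pvar \<Rightarrow> complex) \<Rightarrow> 3 option + 3 option \<Rightarrow> complex" where
  "planes n k e = pt (dir n e) (dir k e) (dot (dir n e) (\<lambda>i. e (VP i))) (dot (dir k e) (\<lambda>i. e (VP i)))"

lemma PF_planes: "(\<lambda>e. planes n k e v) \<in> PF"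
proof -
  consider "v = Inl None" | i where "v = Inl (Some i)" | "v = Inr None" | i where "v = Inr (Some i)"
    by (metis old.sum.exhaust option.exhaust)
  then show ?thesis
    by cases (auto simp: planes_def dir_def dot_def intro!: PF_uminus PF_sum PF_mult PF_var)
qed

text \<open>\<open>T\<close> is the identity or a partial derivative. As it is linear, its value on
  the Chow form is a combination of its values on monomials, with the variables \<open>VF m\<close>
  as coefficients.\<close>

definition form_value :: "nat \<Rightarrow> ((3 option + 3 option) cpoly \<Rightarrow> (3 option + 3 option) cpoly) \<Rightarrow> nat \<Rightarrow> nat \<Rightarrow> (pvar \<Rightarrow> complex) \<Rightarrow> complex" where
  "form_value E T n k e = (\<Sum>m\<in>chow_index E. e (VF m) * poly_eval (T (Poly_Mapping.single m 1)) (planes n k e))"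

lemma PF_form_value: "form_value E T n k \<in> PF"
proof -
  have "(\<lambda>e. form_value E T n k e) \<in> PF"
    unfolding form_value_def by (intro PF_sum PF_mult PF_var PF_poly_eval PF_planes)
  then show ?thesis by simp
qed

lemma form_value:
  assumes "represents E F e"
  shows "form_value E (\<lambda>G. G) n k e = poly_eval F (planes n k e)"
    "form_value E (pd v) n k e = poly_eval (pd v F) (planes n k e)"
  using assms poly_eval_chow_index[of F E] poly_eval_pd_chow_index[of F E]
  by (simp_all add: form_value_def represents_def)

text \<open>The coefficients of the polynomials describing the family are the variables
  \<open>VY\<close>. So the condition depends on the family only through the pattern set
  \<open>B\<close>, of which there are finitely many for given \<open>c\<close>.\<close>

definition member_cond :: "nat \<Rightarrow> nat \<Rightarrow> nat set set \<Rightarrow> (pvar \<Rightarrow> complex) \<Rightarrow> bool" where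
  "member_cond E c B e \<longleftrightarrow> (\<exists>S\<in>B. \<forall>j\<in>{..<c}. j \<in> S \<longleftrightarrow>
    (\<Sum>\<mu>\<in>monoms_le (chow_index E) c. e (VY j \<mu>) * mono_eval \<mu> (\<lambda>m. e (VF m))) \<noteq> 0)"

text \<open>The directions 3 and 4 are reserved for this universal quantifier; 0, 1 and 2 are bound
  in \<open>osculating_cond\<close>.\<close>

definition through_cond :: "nat \<Rightarrow> (pvar \<Rightarrow> complex) \<Rightarrow> bool" where
  "through_cond E e \<longleftrightarrow> (\<forall>y. form_value E (\<lambda>G. G) 3 4 (override (dirs {3, 4}) y e) = 0)"

definition osculating_cond :: "nat \<Rightarrow> nat \<Rightarrow> (nat \<Rightarrow> (pvar \<Rightarrow> complex) \<Rightarrow> complex) \<Rightarrow> (pvar \<Rightarrow> complex) \<Rightarrow> bool" where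
  "osculating_cond E r P e \<longleftrightarrow> (\<exists>y. let e = override (dirs {0, 1, 2}) y e in
    dot (dir 0 e) (crs (dir 1 e) (dir 2 e)) \<noteq> 0 \<and> form_value E (pd (Inr None)) 0 1 e \<noteq> 0 \<and>
    form_value E (pd (Inr None)) 0 2 e \<noteq> 0 \<and> (\<forall>k\<in>{..r}. P k e = 0))"

lemma CP_iff: "\<phi> \<in> CP \<Longrightarrow> \<psi> \<in> CP \<Longrightarrow> (\<lambda>e. \<phi> e \<longleftrightarrow> \<psi> e) \<in> CP"
  unfolding iff_conv_conj_imp by (intro CP_conj CP_imp)

lemma CP_member_cond: "B \<subseteq> Pow {..<c} \<Longrightarrow> member_cond E c B \<in> CP"
proof -
  assume "B \<subseteq> Pow {..<c}"
  then have "finite B" by (rule finite_subset) simp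
  moreover have "(\<lambda>e. \<Sum>\<mu>\<in>monoms_le (chow_index E) c. e (VY j \<mu>) * mono_eval \<mu> (\<lambda>m. e (VF m))) \<in> PF" for j
    unfolding mono_eval_def by (intro PF_sum PF_mult PF_var PF_prod PF_power)
  ultimately have "(\<lambda>e. member_cond E c B e) \<in> CP"
    unfolding member_cond_def by (intro CP_bex CP_ball CP_iff CP_const CP_neq finite_lessThan) auto
  then show ?thesis by simp
qed

lemma CP_through_cond: "through_cond E \<in> CP"
proof -
  have "(\<lambda>e. form_value E (\<lambda>G. G) 3 4 e = 0) \<in> CP" by (rule CP_eq[OF PF_form_value])
  from CP_all_finite[OF finite_dirs[of "{3, 4}"] this] have "(\<lambda>e. through_cond E e) \<in> CP"
    by (simp add: through_cond_def override_def[abs_def])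
  then show ?thesis by simp
qed

lemma CP_osculating_cond:
  assumes "\<And>k. P k \<in> PF"
  shows "osculating_cond E r P \<in> CP"
proof -
  have "(\<lambda>e. dot (dir 0 e) (crs (dir 1 e) (dir 2 e))) \<in> PF"
    unfolding dot_3 dir_def crs_simps by (intro PF_add PF_mult PF_diff PF_var)
  then have "(\<lambda>e. dot (dir 0 e) (crs (dir 1 e) (dir 2 e)) \<noteq> 0 \<and> form_value E (pd (Inr None)) 0 1 e \<noteq> 0 \<and>
    form_value E (pd (Inr None)) 0 2 e \<noteq> 0 \<and> (\<forall>k\<in>{..r}. P k e = 0)) \<in> CP"
    by (intro CP_conj CP_neq CP_ball CP_eq PF_form_value assms finite_atMost)
  from CP_ex_finite[OF finite_dirs[of "{0, 1, 2}"] this] have "(\<lambda>e. osculating_cond E r P e) \<in> CP"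
    by (simp add: osculating_cond_def override_def[abs_def] Let_def)
  then show ?thesis by simp
qed

lemma member_cond:
  assumes e: "represents E F e" "site f g p x e" and B: "B \<subseteq> Pow {..<c}"
    and g: "\<And>j. j < c \<Longrightarrow> Poly_Mapping.keys (g j) \<subseteq> monoms_le (chow_index E) c"
  shows "member_cond E c B e \<longleftrightarrow> {j. j < c \<and> poly_eval (g j) (Poly_Mapping.lookup F) \<noteq> 0} \<in> B"
proof -
  have "(\<Sum>\<mu>\<in>monoms_le (chow_index E) c. e (VY j \<mu>) * mono_eval \<mu> (\<lambda>m. e (VF m))) = poly_eval (g j) (Poly_Mapping.lookup F)"
    if "j < c" for j
  proof -
    have "poly_eval (g j) (Poly_Mapping.lookup F) = (\<Sum>\<mu>\<in>monoms_le (chow_index E) c. Poly_Mapping.lookup (g j) \<mu> * mono_eval \<mu> (Poly_Mapping.lookup F))"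
      by (rule poly_eval_superset[OF finite_monoms_le[OF finite_chow_index] g[OF that]])
    also have "\<dots> = (\<Sum>\<mu>\<in>monoms_le (chow_index E) c. e (VY j \<mu>) * mono_eval \<mu> (\<lambda>m. e (VF m)))"
    proof (intro sum.cong refl arg_cong2[where f = "(*)"])
      fix \<mu> assume "\<mu> \<in> monoms_le (chow_index E) c"
      then show "mono_eval \<mu> (Poly_Mapping.lookup F) = mono_eval \<mu> (\<lambda>m. e (VF m))"
        using e(1) by (intro mono_eval_cong) (auto simp: monoms_le_def represents_def)
      show "Poly_Mapping.lookup (g j) \<mu> = e (VY j \<mu>)" using e(2) by (simp add: site_def)
    qed
    finally show ?thesis by simp
  qed
  then have "member_cond E c B e \<longleftrightarrow> (\<exists>S\<in>B. \<forall>j<c. j \<in> S \<longleftrightarrow> poly_eval (g j) (Poly_Mapping.lookup F) \<noteq> 0)"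
    by (simp add: member_cond_def Ball_def)
  also have "\<dots> \<longleftrightarrow> {j. j < c \<and> poly_eval (g j) (Poly_Mapping.lookup F) \<noteq> 0} \<in> B"
  proof
    assume "\<exists>S\<in>B. \<forall>j<c. j \<in> S \<longleftrightarrow> poly_eval (g j) (Poly_Mapping.lookup F) \<noteq> 0"
    then obtain S where S: "S \<in> B" "\<forall>j<c. j \<in> S \<longleftrightarrow> poly_eval (g j) (Poly_Mapping.lookup F) \<noteq> 0" by blast
    then have "S = {j. j < c \<and> poly_eval (g j) (Poly_Mapping.lookup F) \<noteq> 0}" using B by auto
    then show "{j. j < c \<and> poly_eval (g j) (Poly_Mapping.lookup F) \<noteq> 0} \<in> B" using S(1) by simp
  qed (intro bexI, auto)
  finally show ?thesis .
qed

lemma override_stable: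
  assumes "V = dirs N"
  shows "represents E F (override V y e) \<longleftrightarrow> represents E F e" "site f g p x (override V y e) \<longleftrightarrow> site f g p x e"
  using assms by (simp_all add: represents_def site_def override_def)

lemma dir_override: "n \<in> N \<Longrightarrow> dir n (override (dirs N) y e) = (\<lambda>i. y (VA n i))"
  by (simp add: dir_def override_def)

lemma through_cond:
  assumes e: "represents E F e" "site f g p x e"
  shows "through_cond E e \<longleftrightarrow> through F p"
proof -
  have "form_value E (\<lambda>G. G) 3 4 (override (dirs {3, 4}) y e) =
      poly_eval F (pt (\<lambda>i. y (VA 3 i)) (\<lambda>i. y (VA 4 i)) (dot (\<lambda>i. y (VA 3 i)) p) (dot (\<lambda>i. y (VA 4 i)) p))" for y
  proof -
    have "(\<lambda>i. override (dirs {3, 4}) y e (VP i)) = p" using e(2) by (simp add: site_def override_def fun_eq_iff)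
    then show ?thesis
      using form_value(1)[of E F "override (dirs {3, 4}) y e" 3 4] e(1)
      by (simp add: override_stable[OF refl] planes_def dir_override)
  qed
  then have "through_cond E e \<longleftrightarrow> (\<forall>y. poly_eval F (pt (\<lambda>i. y (VA 3 i)) (\<lambda>i. y (VA 4 i)) (dot (\<lambda>i. y (VA 3 i)) p) (dot (\<lambda>i. y (VA 4 i)) p)) = 0)"
    by (simp add: through_cond_def)
  also have "\<dots> \<longleftrightarrow> through F p"
  proof
    assume *: "\<forall>y. poly_eval F (pt (\<lambda>i. y (VA 3 i)) (\<lambda>i. y (VA 4 i)) (dot (\<lambda>i. y (VA 3 i)) p) (dot (\<lambda>i. y (VA 4 i)) p)) = 0"
    have "poly_eval F (pt a b (dot a p) (dot b p)) = 0" for a b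
      using *[rule_format, of "\<lambda>v. case v of VA n i \<Rightarrow> (if n = 3 then a i else b i) | _ \<Rightarrow> 0"] by simp
    then show "through F p" by (simp add: through_def)
  qed (simp add: through_def)
  finally show ?thesis .
qed

lemma slot_cong: "dir 0 e = dir 0 e' \<Longrightarrow> dir n e = dir n e' \<Longrightarrow> slot n e = slot n e'"
  by (auto simp: slot_def dir_def fun_eq_iff)

lemma tower_cong:
  assumes "represents E F e" "represents E F e'" "\<And>n. n \<in> {0, 1, 2} \<Longrightarrow> dir n e = dir n e'"
  shows "tower E k e f = tower E k e' f"
proof -
  have "cyl E n e = cyl E n e'" if "n \<in> {1, 2}" for n
    using assms(1,2) slot_cong[of e e' n] assms(3)[of 0] assms(3)[of n] that
    by (auto simp: cyl_def represents_def intro!: sum.cong)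
  then show ?thesis by (simp add: tower_def)
qed

lemma osculating_cond:
  assumes e: "represents E F e" "site f g p x e"
    and P: "\<And>k e f p. (\<forall>i. e (VP i) = p i) \<Longrightarrow> (\<forall>\<alpha>. e (VJ \<alpha>) = poly_eval (foldr pd \<alpha> f) p) \<Longrightarrow> poly_eval (tower E k e f) p = P k e"
  shows "osculating_cond E r P e \<longleftrightarrow> osculating E r f F p"
proof -
  let ?o = "\<lambda>y. override (dirs {0, 1, 2}) y e"
  have R: "represents E F (?o y)" and S: "site f g p x (?o y)" for y
    using e by (simp_all add: override_stable[OF refl])
  have fv: "form_value E (pd (Inr None)) 0 n e' = poly_eval (pd (Inr None) F) (pt (dir 0 e') (dir n e') (dot (dir 0 e') p) (dot (dir n e') p))"
    if "represents E F e'" "site f g p x e'" for n e'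
  proof -
    have "(\<lambda>i. e' (VP i)) = p" using that(2) by (simp add: site_def fun_eq_iff)
    then show ?thesis using form_value(2)[OF that(1)] by (simp add: planes_def)
  qed
  have Pk: "P k (?o y) = poly_eval (tower E k (?o y) f) p" for k y
    by (rule P[symmetric]) (use S[of y] in \<open>simp_all add: site_def\<close>)
  have "osculating_cond E r P e \<longleftrightarrow> (\<exists>y. transversal F p (dir 0 (?o y)) (dir 1 (?o y)) (dir 2 (?o y)) \<and>
      (\<forall>k\<le>r. poly_eval (tower E k (?o y) f) p = 0))"
    unfolding osculating_cond_def Let_def transversal_def Pk fv[OF R S] by (simp only: Ball_def atMost_iff conj_assoc)
  also have "\<dots> \<longleftrightarrow> osculating E r f F p"
  proof
    assume "osculating E r f F p"
    then obtain e' where e': "represents E F e'" "transversal F p (dir 0 e') (dir 1 e') (dir 2 e')"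
      "\<forall>k\<le>r. poly_eval (tower E k e' f) p = 0" unfolding osculating_def by blast
    have d: "dir n (?o e') = dir n e'" if "n \<in> {0, 1, 2}" for n using dir_override[OF that] by (simp add: dir_def)
    have "tower E k (?o e') f = tower E k e' f" for k by (rule tower_cong[OF R e'(1) d])
    then show "\<exists>y. transversal F p (dir 0 (?o y)) (dir 1 (?o y)) (dir 2 (?o y)) \<and>
      (\<forall>k\<le>r. poly_eval (tower E k (?o y) f) p = 0)"
      using e' d by (intro exI[of _ e']) simp
  qed (use R in \<open>auto simp: osculating_def\<close>)
  finally show ?thesis .
qed

definition admissible :: "nat \<Rightarrow> nat \<Rightarrow> nat set set \<Rightarrow> (nat \<Rightarrow> (3 option + 3 option) monom cpoly) \<Rightarrow> nat \<Rightarrow> 3 cpoly \<Rightarrow>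
    space3 \<Rightarrow> (3 option + 3 option) cpoly set" where
  "admissible E c B g r f p = {F. Poly_Mapping.keys F \<subseteq> chow_index E \<and>
    {j. j < c \<and> poly_eval (g j) (Poly_Mapping.lookup F) \<noteq> 0} \<in> B \<and> through F p \<and> osculating E r f F p}"

text \<open>The ratio \<open>x\<close> of two coordinates is described without division, and the
  coefficients of \<open>F\<close> are quantified out. What remains is a condition on the ratio, the
  point, the derivatives of \<open>f\<close> and the coefficients of \<open>g\<close>.\<close>

lemma admissible_definable:
  assumes B: "B \<subseteq> Pow {..<c}" and mi: "m0 \<in> chow_index E" "i \<in> chow_index E"
  obtains \<Phi> where "\<Phi> \<in> CP"
    "\<And>f g p x e. site f g p x e \<Longrightarrow> (\<And>j. j < c \<Longrightarrow> Poly_Mapping.keys (g j) \<subseteq> monoms_le (chow_index E) c) \<Longrightarrow>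
      \<Phi> e \<longleftrightarrow> (\<exists>F\<in>admissible E c B g r f p. Poly_Mapping.lookup F m0 \<noteq> 0 \<and>
        x * Poly_Mapping.lookup F m0 = Poly_Mapping.lookup F i)"
proof -
  have "\<forall>k. \<exists>P\<in>PF. \<forall>e f p. (\<forall>i. e (VP i) = p i) \<longrightarrow> (\<forall>\<alpha>. e (VJ \<alpha>) = poly_eval (foldr pd \<alpha> f) p) \<longrightarrow>
    poly_eval (tower E k e f) p = P e"
    using DP_PF[OF DP_tower] by blast
  then obtain P where P: "\<And>k. P k \<in> PF"
    "\<And>k e f p. (\<forall>i. e (VP i) = p i) \<Longrightarrow> (\<forall>\<alpha>. e (VJ \<alpha>) = poly_eval (foldr pd \<alpha> f) p) \<Longrightarrow> poly_eval (tower E k e f) p = P k e"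
    by metis
  define \<phi> where "\<phi> e \<longleftrightarrow> member_cond E c B e \<and> through_cond E e \<and> osculating_cond E r P e \<and>
    e (VF m0) \<noteq> 0 \<and> e VX * e (VF m0) = e (VF i)" for e
  let ?V = "VF ` chow_index E"
  have "(\<lambda>e. \<phi> e) \<in> CP" unfolding \<phi>_def
    by (intro CP_conj CP_member_cond[OF B] CP_through_cond CP_osculating_cond P(1) CP_neq CP_eq2 PF_mult PF_var)
  then have CP: "(\<lambda>e. \<exists>y. \<phi> (override ?V y e)) \<in> CP"
    unfolding override_def[abs_def] by (intro CP_ex_finite finite_imageI finite_chow_index)
  show ?thesis
  proof (rule that[OF CP])
    fix f g p x e assume e: "site f g p x e" and g: "\<And>j. j < c \<Longrightarrow> Poly_Mapping.keys (g j) \<subseteq> monoms_le (chow_index E) c"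
    have S: "site f g p x (override ?V y e)" for y using e by (auto simp: site_def override_def)
    have main: "\<phi> (override ?V y e) \<longleftrightarrow> F \<in> admissible E c B g r f p \<and> Poly_Mapping.lookup F m0 \<noteq> 0 \<and>
        x * Poly_Mapping.lookup F m0 = Poly_Mapping.lookup F i" if R: "represents E F (override ?V y e)" for F y
    proof -
      have "override ?V y e VX = x" using S[of y] by (simp add: site_def)
      moreover have "override ?V y e (VF m0) = Poly_Mapping.lookup F m0" "override ?V y e (VF i) = Poly_Mapping.lookup F i"
        using R mi by (simp_all add: represents_def)
      moreover have "Poly_Mapping.keys F \<subseteq> chow_index E" using R by (simp add: represents_def)
      moreover have "member_cond E c B (override ?V y e) \<longleftrightarrow> {j. j < c \<and> poly_eval (g j) (Poly_Mapping.lookup F) \<noteq> 0} \<in> B"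
        by (rule member_cond[OF R S B g])
      moreover have "osculating_cond E r P (override ?V y e) \<longleftrightarrow> osculating E r f F p"
        by (rule osculating_cond[OF R S P(2)])
      ultimately show ?thesis
        unfolding \<phi>_def admissible_def through_cond[OF R S] by simp
    qed
    show "(\<exists>y. \<phi> (override ?V y e)) \<longleftrightarrow> (\<exists>F\<in>admissible E c B g r f p. Poly_Mapping.lookup F m0 \<noteq> 0 \<and>
        x * Poly_Mapping.lookup F m0 = Poly_Mapping.lookup F i)"
    proof
      assume "\<exists>y. \<phi> (override ?V y e)"
      then obtain y where y: "\<phi> (override ?V y e)" by blast
      define F where "F = (\<Sum>m\<in>chow_index E. Poly_Mapping.single m (y (VF m)))"
      have l: "Poly_Mapping.lookup F m = (if m \<in> chow_index E then y (VF m) else 0)" for m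
        by (simp add: F_def lookup_sum lookup_single when_def finite_chow_index)
      then have "represents E F (override ?V y e)"
        by (auto simp: represents_def in_keys_iff override_def split: if_splits)
      from main[OF this] y show "\<exists>F\<in>admissible E c B g r f p. Poly_Mapping.lookup F m0 \<noteq> 0 \<and>
        x * Poly_Mapping.lookup F m0 = Poly_Mapping.lookup F i" by blast
    next
      assume "\<exists>F\<in>admissible E c B g r f p. Poly_Mapping.lookup F m0 \<noteq> 0 \<and>
        x * Poly_Mapping.lookup F m0 = Poly_Mapping.lookup F i"
      then obtain F where F: "F \<in> admissible E c B g r f p" "Poly_Mapping.lookup F m0 \<noteq> 0"
        "x * Poly_Mapping.lookup F m0 = Poly_Mapping.lookup F i" by blast
      let ?y = "\<lambda>v. case v of VF m \<Rightarrow> Poly_Mapping.lookup F m | _ \<Rightarrow> 0"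
      have "represents E F (override ?V ?y e)" using F(1) by (auto simp: represents_def override_def admissible_def)
      from main[OF this] F show "\<exists>y. \<phi> (override ?V y e)" by blast
    qed
  qed
qed

subsection \<open>Generic points of the surface\<close>

definition senv :: "3 cpoly \<Rightarrow> (nat \<Rightarrow> (3 option + 3 option) monom cpoly) \<Rightarrow> space3 \<Rightarrow> complex \<Rightarrow> pvar \<Rightarrow> complex" where
  "senv f g p x v = (case v of VP i \<Rightarrow> p i | VJ \<alpha> \<Rightarrow> poly_eval (foldr pd \<alpha> f) p
    | VY j \<mu> \<Rightarrow> Poly_Mapping.lookup (g j) \<mu> | VX \<Rightarrow> x | _ \<Rightarrow> 0)"

lemma site_senv: "site f g p x (senv f g p x)"
  by (simp add: site_def senv_def)

lemma senv_upd: "(senv f g p 0)(VX := x) = senv f g p x"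
  by (auto simp: senv_def fun_eq_iff split: pvar.splits)

lemma pfun_senv:
  assumes "total_degree f \<le> D" "1 \<le> D"
  shows "pfun D (\<lambda>p. senv f g p x v)"
proof (cases v)
  case (VJ \<alpha>)
  have "total_degree (foldr pd \<alpha> f) \<le> D"
    by (induction \<alpha>) (use assms(1) order_trans[OF total_degree_pd_le] in \<open>simp_all\<close>)
  then show ?thesis by (simp add: senv_def VJ pfun_poly_eval)
qed (use assms(2) in \<open>simp_all add: senv_def pfun_const pfun_var\<close>)

lemma not_dvd_prod:
  fixes f :: "3 cpoly"
  assumes "irreducible f" "finite A" "\<And>a. a \<in> A \<Longrightarrow> \<not> f dvd h a"
  shows "\<not> f dvd (\<Prod>a\<in>A. h a)"
  using assms(2,3)
proof (induction A rule: finite_induct)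
  case empty
  then show ?case using assms(1) by (simp add: irreducible_def)
next
  case (insert a A)
  then show ?case using irreducible_dvd_mult_3[OF assms(1), of "h a" "prod h A"] by auto
qed

text \<open>All values in \<open>senv\<close> are constants or polynomials of degree at most
  \<open>D\<close> in the point, and \<open>P\<close> is fixed before \<open>f\<close>; so the
  constant \<open>K\<close> depends neither on \<open>f\<close> nor on the family.\<close>

lemma PF_degree_bound:
  assumes "P \<in> PF"
  obtains K where "\<And>f g D. total_degree f \<le> D \<Longrightarrow> 1 \<le> D \<Longrightarrow>
    \<exists>C. total_degree C \<le> K * D \<and> (\<forall>p. poly_eval C p = P (senv f g p 0))"
proof -
  obtain K where K: "\<forall>D (\<sigma> :: space3 \<Rightarrow> pvar \<Rightarrow> complex). (\<forall>v. pfun D (\<lambda>p. \<sigma> p v)) \<longrightarrow> pfun (K * D) (\<lambda>p. P (\<sigma> p))"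
    using PF_compose_degree[OF assms] by blast
  show ?thesis
  proof (rule that)
    fix f :: "3 cpoly" and g :: "nat \<Rightarrow> (3 option + 3 option) monom cpoly" and D
    assume "total_degree f \<le> D" "1 \<le> D"
    then have "\<forall>v. pfun D (\<lambda>p. senv f g p 0 v)" by (simp add: pfun_senv)
    then have "pfun (K * D) (\<lambda>p. P (senv f g p 0))" by (rule K[THEN spec, THEN spec, THEN mp])
    then show "\<exists>C. total_degree C \<le> K * D \<and> (\<forall>p. poly_eval C p = P (senv f g p 0))"
      by (auto simp: pfun_def fun_eq_iff)
  qed
qed

lemma poly_truncated:
  fixes q :: "complex poly"
  assumes "\<And>j. j \<ge> b \<Longrightarrow> coeff q j = 0"
  shows "poly q x = (\<Sum>j<b. coeff q j * x ^ j)"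
proof -
  have "q = (\<Sum>j<b. monom (coeff q j) j)"
    by (rule poly_eqI) (use assms in \<open>auto simp: coeff_sum\<close>)
  then have "poly q x = poly (\<Sum>j<b. monom (coeff q j) j) x" by simp
  then show ?thesis by (simp add: poly_sum poly_monom)
qed

text \<open>A definable condition on \<open>x\<close> depends on the vanishing of polynomials in \<open>x\<close> whose coefficients
  are polynomials of degree \<open>O(D)\<close> in the point \<open>p\<close>.  Where the coefficients not divisible by \<open>f\<close>
  are nonzero, the truth value for generic \<open>x\<close> is the same at all points of the surface.\<close>

definition alternative :: "nat \<Rightarrow> ((pvar \<Rightarrow> complex) \<Rightarrow> bool) \<Rightarrow> 3 cpoly \<Rightarrow>
    (nat \<Rightarrow> (3 option + 3 option) monom cpoly) \<Rightarrow> 3 cpoly \<Rightarrow> bool" where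
  "alternative N \<Phi> f g u \<longleftrightarrow>
    (\<forall>p. poly_eval f p = 0 \<longrightarrow> poly_eval u p \<noteq> 0 \<longrightarrow> infinite {x. \<Phi> (senv f g p x)}) \<or>
    (\<exists>R. (\<forall>x. \<exists>n. pfun n (\<lambda>p. poly (R p) x)) \<and> (\<forall>p. poly_eval f p = 0 \<longrightarrow> poly_eval u p \<noteq> 0 \<longrightarrow>
      R p \<noteq> 0 \<and> degree (R p) \<le> N \<and> {x. \<Phi> (senv f g p x)} \<subseteq> {x. poly (R p) x = 0}))"

definition dichotomy :: "nat \<Rightarrow> nat \<Rightarrow> ((pvar \<Rightarrow> complex) \<Rightarrow> bool) \<Rightarrow> bool" where
  "dichotomy K N \<Phi> \<longleftrightarrow> (\<forall>f g D. irreducible f \<longrightarrow> total_degree f \<le> D \<longrightarrow> 1 \<le> D \<longrightarrow>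
    (\<exists>u. \<not> f dvd u \<and> total_degree u \<le> K * D \<and> alternative N \<Phi> f g u))"

lemma CP_dichotomy:
  assumes "\<Phi> \<in> CP"
  shows "\<exists>K N. dichotomy K N \<Phi>"
proof -
  obtain \<P> B where *: "finite \<P>" "\<P> \<subseteq> PF" "\<And>e. \<Phi> e \<longleftrightarrow> {P\<in>\<P>. P e = 0} \<in> B"
    using CP_normal_form[OF assms] by blast
  have "\<forall>P\<in>\<P>. \<exists>b Q. PFP b Q \<and> (\<forall>e x. P (e(VX := x)) = poly (Q e) x)"
    using *(2) by (auto intro!: PF_univariate)
  from bchoice[OF this] obtain b where "\<forall>P\<in>\<P>. \<exists>Q. PFP (b P) Q \<and> (\<forall>e x. P (e(VX := x)) = poly (Q e) x)" ..
  from bchoice[OF this] obtain Q where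
    Q: "\<And>P. P \<in> \<P> \<Longrightarrow> PFP (b P) (Q P)" "\<And>P e x. P \<in> \<P> \<Longrightarrow> P (e(VX := x)) = poly (Q P e) x" by blast
  let ?T = "SIGMA P:\<P>. {..<b P}"
  have "\<forall>z\<in>?T. \<exists>k. \<forall>f g D. total_degree f \<le> D \<longrightarrow> 1 \<le> D \<longrightarrow>
    (\<exists>C. total_degree C \<le> k * D \<and> (\<forall>p. poly_eval C p = coeff (Q (fst z) (senv f g p 0)) (snd z)))"
  proof
    fix z assume "z \<in> ?T"
    then have "(\<lambda>e. coeff (Q (fst z) e) (snd z)) \<in> PF" by (intro PFP_coeff[OF Q(1)]) auto
    then obtain k where "\<And>f g D. total_degree f \<le> D \<Longrightarrow> 1 \<le> D \<Longrightarrow>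
      \<exists>C. total_degree C \<le> k * D \<and> (\<forall>p. poly_eval C p = coeff (Q (fst z) (senv f g p 0)) (snd z))"
      by (rule PF_degree_bound) blast
    then show "\<exists>k. \<forall>f g D. total_degree f \<le> D \<longrightarrow> 1 \<le> D \<longrightarrow>
      (\<exists>C. total_degree C \<le> k * D \<and> (\<forall>p. poly_eval C p = coeff (Q (fst z) (senv f g p 0)) (snd z)))" by blast
  qed
  from bchoice[OF this] obtain k where k: "\<And>z f g D. z \<in> ?T \<Longrightarrow> total_degree f \<le> D \<Longrightarrow> 1 \<le> D \<Longrightarrow>
    \<exists>C. total_degree C \<le> k z * D \<and> (\<forall>p. poly_eval C p = coeff (Q (fst z) (senv f g p 0)) (snd z))" by blast
  have finT: "finite ?T" using *(1) by simp
  have "dichotomy (\<Sum>z\<in>?T. k z) (\<Sum>P\<in>\<P>. b P) \<Phi>"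
    unfolding dichotomy_def
  proof (intro allI impI)
    fix f :: "3 cpoly" and g :: "nat \<Rightarrow> (3 option + 3 option) monom cpoly" and D
    assume f: "irreducible f" "total_degree f \<le> D" "1 \<le> D"
    have "\<forall>z\<in>?T. \<exists>C. total_degree C \<le> k z * D \<and> (\<forall>p. poly_eval C p = coeff (Q (fst z) (senv f g p 0)) (snd z))"
      using k f by blast
    from bchoice[OF this] obtain C where C: "\<And>z. z \<in> ?T \<Longrightarrow> total_degree (C z) \<le> k z * D"
      "\<And>z p. z \<in> ?T \<Longrightarrow> poly_eval (C z) p = coeff (Q (fst z) (senv f g p 0)) (snd z)" by blast
    \<comment> \<open>Coefficients divisible by \<open>f\<close> vanish on the whole surface; only
      the others have to be kept nonzero by \<open>u\<close>.\<close>
    let ?U = "{z\<in>?T. \<not> f dvd C z}"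
    define u where "u = (\<Prod>z\<in>?U. C z)"
    have nd: "\<not> f dvd u" unfolding u_def by (rule not_dvd_prod[OF f(1)]) (use finT in auto)
    have "total_degree u \<le> (\<Sum>z\<in>?U. k z * D)"
      unfolding u_def by (rule order_trans[OF total_degree_prod_le], rule sum_mono) (use C(1) in auto)
    also have "\<dots> \<le> (\<Sum>z\<in>?T. k z * D)" using finT by (intro sum_mono2) auto
    finally have deg: "total_degree u \<le> (\<Sum>z\<in>?T. k z) * D" by (simp add: sum_distrib_right)
    define \<N> where "\<N> = fst ` ?U"
    have \<N>: "\<N> \<subseteq> \<P>" "finite \<N>" using finT *(1) by (auto simp: \<N>_def intro: finite_subset)
    \<comment> \<open>\<open>\<N>\<close> holds the polynomials in \<open>x\<close> with a
      coefficient not divisible by \<open>f\<close>. Off the roots of their product, the polynomials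
      vanishing at a point of the surface are exactly those in \<open>\<P> - \<N>\<close>.\<close>
    define R where "R p = (\<Prod>P\<in>\<N>. Q P (senv f g p 0))" for p
    have Q0: "Q P (senv f g p 0) \<noteq> 0" if P: "P \<in> \<N>" and p: "poly_eval u p \<noteq> 0" for P p
    proof -
      obtain j where j: "(P, j) \<in> ?U" using P by (auto simp: \<N>_def)
      have "poly_eval (C (P, j)) p \<noteq> 0" using p j finT by (auto simp: u_def)
      then show ?thesis using C(2)[of "(P, j)" p] j by auto
    qed
    have Q1: "Q P (senv f g p 0) = 0" if P: "P \<in> \<P> - \<N>" and p: "poly_eval f p = 0" for P p
    proof (rule poly_eqI)
      fix j
      show "coeff (Q P (senv f g p 0)) j = coeff 0 j"
      proof (cases "j < b P")
        case True
        then have z: "(P, j) \<in> ?T" using P by auto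
        then have "f dvd C (P, j)" using P by (force simp: \<N>_def)
        then obtain h where "C (P, j) = f * h" by (rule dvdE)
        then show ?thesis using C(2)[OF z, of p] p by simp
      next
        case False
        then show ?thesis using PFP_zero[OF Q(1)] P by simp
      qed
    qed
    have Pe: "P (senv f g p x) = poly (Q P (senv f g p 0)) x" if "P \<in> \<P>" for P p x
      using Q(2)[OF that, of "senv f g p 0" x] by (simp only: senv_upd)
    have R0: "R p \<noteq> 0" if "poly_eval u p \<noteq> 0" for p using Q0[OF _ that] \<N>(2) by (simp add: R_def)
    have gen: "\<Phi> (senv f g p x) \<longleftrightarrow> \<P> - \<N> \<in> B" if p: "poly_eval f p = 0" and x: "poly (R p) x \<noteq> 0" for p x
    proof -
      have "P (senv f g p x) = 0 \<longleftrightarrow> P \<notin> \<N>" if "P \<in> \<P>" for P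
        using Q1[of P p] that p x \<N> by (auto simp: Pe[OF that] R_def poly_prod)
      then have "{P\<in>\<P>. P (senv f g p x) = 0} = \<P> - \<N>" by auto
      then show ?thesis by (simp add: *(3))
    qed
    have alt: "alternative (\<Sum>P\<in>\<P>. b P) \<Phi> f g u"
    proof (cases "\<P> - \<N> \<in> B")
      case True
      have "infinite {x. \<Phi> (senv f g p x)}" if "poly_eval f p = 0" "poly_eval u p \<noteq> 0" for p
      proof
        assume "finite {x. \<Phi> (senv f g p x)}"
        moreover have "finite {x. poly (R p) x = 0}" by (rule poly_roots_finite[OF R0[OF that(2)]])
        ultimately have "finite ({x. \<Phi> (senv f g p x)} \<union> {x. poly (R p) x = 0})" by simp
        moreover have "{x. \<Phi> (senv f g p x)} \<union> {x. poly (R p) x = 0} = UNIV" using gen[OF that(1)] True by auto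
        ultimately show False using infinite_UNIV_char_0[where 'a = complex] by simp
      qed
      then show ?thesis unfolding alternative_def by blast
    next
      case False
      have "\<exists>n. pfun n (\<lambda>p. poly (R p) x)" for x
      proof -
        have "pfun (\<Sum>z\<in>?T. k z * D) (\<lambda>p. poly (Q P (senv f g p 0)) x)" if P: "P \<in> \<N>" for P
        proof -
          have PP: "P \<in> \<P>" using P \<N>(1) by blast
          have "poly (Q P (senv f g p 0)) x = (\<Sum>j<b P. coeff (Q P (senv f g p 0)) j * x ^ j)" for p
            by (rule poly_truncated[OF PFP_zero[OF Q(1)[OF PP]]])
          also have "\<dots> p = (\<Sum>j<b P. poly_eval (C (P, j)) p * x ^ j)" for p
            using C(2) PP by (intro sum.cong refl) auto
          finally have "(\<lambda>p. poly (Q P (senv f g p 0)) x) = (\<lambda>p. \<Sum>j<b P. poly_eval (C (P, j)) p * x ^ j)" by (rule ext)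
          moreover have "pfun (\<Sum>z\<in>?T. k z * D) (\<lambda>p. \<Sum>j<b P. poly_eval (C (P, j)) p * x ^ j)"
          proof (rule pfun_sum)
            fix j assume "j \<in> {..<b P}"
            then have z: "(P, j) \<in> ?T" using PP by auto
            have "total_degree (C (P, j)) \<le> (\<Sum>z\<in>?T. k z * D)"
              using C(1)[OF z] member_le_sum[OF z, of "\<lambda>z. k z * D"] finT by fastforce
            from pfun_mult[OF pfun_poly_eval[OF this] pfun_const[of 0 "x ^ j"]]
            show "pfun (\<Sum>z\<in>?T. k z * D) (\<lambda>p. poly_eval (C (P, j)) p * x ^ j)" by simp
          qed
          ultimately show ?thesis by simp
        qed
        then have "pfun (\<Sum>P\<in>\<N>. \<Sum>z\<in>?T. k z * D) (\<lambda>p. \<Prod>P\<in>\<N>. poly (Q P (senv f g p 0)) x)" by (rule pfun_prod)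
        then show ?thesis by (auto simp: R_def poly_prod)
      qed
      moreover have "degree (R p) \<le> (\<Sum>P\<in>\<P>. b P)" for p
      proof -
        have "degree (R p) \<le> (\<Sum>P\<in>\<N>. degree (Q P (senv f g p 0)))"
          using degree_prod_sum_le[OF \<N>(2), of "\<lambda>P. Q P (senv f g p 0)"] by (simp add: R_def comp_def)
        also have "\<dots> \<le> (\<Sum>P\<in>\<N>. b P)"
          by (intro sum_mono degree_le) (use PFP_zero[OF Q(1)] \<N>(1) in auto)
        also have "\<dots> \<le> (\<Sum>P\<in>\<P>. b P)" using *(1) \<N>(1) by (intro sum_mono2) auto
        finally show ?thesis .
      qed
      ultimately show ?thesis unfolding alternative_def using R0 gen False by blast
    qed
    show "\<exists>u. \<not> f dvd u \<and> total_degree u \<le> (\<Sum>z\<in>?T. k z) * D \<and> alternative (\<Sum>P\<in>\<P>. b P) \<Phi> f g u"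
      using nd deg alt by (intro exI[of _ u] conjI)
  qed
  then show ?thesis by blast
qed

subsection \<open>Counting curves through their Chow forms\<close>

lemma unit_constant:
  fixes U :: "'i cpoly"
  assumes "U dvd 1"
  shows "\<exists>c. c \<noteq> 0 \<and> (\<forall>x. poly_eval U x = c)"
proof -
  obtain W where W: "1 = U * W" using assms by (rule dvdE)
  have nz: "poly_eval U x \<noteq> 0" for x
  proof
    assume "poly_eval U x = 0"
    then have "poly_eval (U * W) x = 0" by simp
    then show False by (simp flip: W)
  qed
  have "poly_eval U x = poly_eval U (\<lambda>_. 0)" for x
  proof -
    obtain q where q: "\<And>t. poly q t = poly_eval U (\<lambda>i. 0 + t * x i)"
      using pfun_on_line[OF pfun_poly_eval[OF order_refl], of U "\<lambda>_. 0" x] by blast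
    have "constant (poly q)"
      using fundamental_theorem_of_algebra[of q] nz q by metis
    then have "poly q 1 = poly q 0" by (auto simp: constant_def)
    then show ?thesis by (simp add: q)
  qed
  then show ?thesis using nz by blast
qed

lemma chow_form_unique:
  assumes curve: "irreducible_curve \<gamma>" and F: "chow_form \<gamma> F" "chow_form \<gamma> F'"
  obtains c where "c \<noteq> 0" "F' = Cst c * F"
proof -
  note 1 = chow_form_ideal[OF curve F(1)] and 2 = chow_form_ideal[OF curve F(2)]
  have "F dvd F'" using chow_ideal_principal(1)[OF curve 1] 2(2) by blast
  then obtain U where U: "F' = F * U" by (rule dvdE)
  then have "U dvd 1" using irreducibleD[OF 2(1) U] irreducible_not_unit[OF 1(1)] by blast
  then obtain c where c: "c \<noteq> 0" "\<And>x. poly_eval U x = c" using unit_constant by blast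
  have "U = Cst c" using poly_eval_eq_0_8[of "U - Cst c"] c(2) by simp
  then show ?thesis using that[OF c(1)] U by (simp add: mult.commute)
qed

lemma lookup_Cst_mult: "Poly_Mapping.lookup (Cst c * F) m = c * Poly_Mapping.lookup F m"
  using lookup_single_mult_add[of 0 c F m] by (simp add: Cst_def)

lemma chow_form_ratio:
  assumes "irreducible_curve \<gamma>" "chow_form \<gamma> F" "chow_form \<gamma> F'"
  shows "Poly_Mapping.lookup F i * Poly_Mapping.lookup F' m = Poly_Mapping.lookup F' i * Poly_Mapping.lookup F m"
    "Poly_Mapping.lookup F m = 0 \<longleftrightarrow> Poly_Mapping.lookup F' m = 0"
proof -
  obtain c where "c \<noteq> 0" "F' = Cst c * F" by (rule chow_form_unique[OF assms])
  then show "Poly_Mapping.lookup F i * Poly_Mapping.lookup F' m = Poly_Mapping.lookup F' i * Poly_Mapping.lookup F m"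
    "Poly_Mapping.lookup F m = 0 \<longleftrightarrow> Poly_Mapping.lookup F' m = 0"
    by (simp_all add: lookup_Cst_mult)
qed

lemma curve_eqI_ratio:
  assumes \<gamma>: "irreducible_curve \<gamma>" "chow_form \<gamma> F" and \<gamma>': "irreducible_curve \<gamma>'" "chow_form \<gamma>' F'"
    and nz: "Poly_Mapping.lookup F m \<noteq> 0" "Poly_Mapping.lookup F' m \<noteq> 0"
    and eq: "\<And>i. Poly_Mapping.lookup F i * Poly_Mapping.lookup F' m = Poly_Mapping.lookup F' i * Poly_Mapping.lookup F m"
  shows "\<gamma> = \<gamma>'"
proof -
  have "Cst (Poly_Mapping.lookup F' m) * F = Cst (Poly_Mapping.lookup F m) * F'"
  proof (rule poly_mapping_eqI)
    fix k
    show "Poly_Mapping.lookup (Cst (Poly_Mapping.lookup F' m) * F) k = Poly_Mapping.lookup (Cst (Poly_Mapping.lookup F m) * F') k"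
      unfolding lookup_Cst_mult using eq[of k] by (simp only: mult.commute)
  qed
  then have "poly_eval (Cst (Poly_Mapping.lookup F' m) * F) x = poly_eval (Cst (Poly_Mapping.lookup F m) * F') x" for x
    by simp
  then have "poly_eval F x = 0 \<longleftrightarrow> poly_eval F' x = 0" for x using nz by (metis mult_eq_0_iff poly_eval_Cst poly_eval_mult)
  then have "through F p \<longleftrightarrow> through F' p" for p by (simp add: through_def)
  then show ?thesis using through_iff_mem[OF \<gamma>] through_iff_mem[OF \<gamma>'] by blast
qed

text \<open>A curve is coded by a nonvanishing Chow coordinate \<open>m\<close> together with the
  ratios of all coordinates to it: \<open>card I\<close> choices of \<open>m\<close> and at most
  \<open>N\<close> values for each ratio.\<close>

lemma card_curves_le:
  assumes I: "finite I" and R: "\<And>m i. m \<in> I \<Longrightarrow> i \<in> I \<Longrightarrow> finite (R m i) \<and> card (R m i) \<le> N"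
    and \<Gamma>: "\<And>\<gamma>. \<gamma> \<in> \<Gamma> \<Longrightarrow> irreducible_curve \<gamma> \<and> (\<exists>F. chow_form \<gamma> F \<and> Poly_Mapping.keys F \<subseteq> I \<and>
      (\<forall>m\<in>I. \<forall>i\<in>I. Poly_Mapping.lookup F m \<noteq> 0 \<longrightarrow> Poly_Mapping.lookup F i / Poly_Mapping.lookup F m \<in> R m i))"
  shows "finite \<Gamma>" "card \<Gamma> \<le> card I * N ^ card I"
proof -
  have "\<forall>\<gamma>\<in>\<Gamma>. \<exists>F. chow_form \<gamma> F \<and> Poly_Mapping.keys F \<subseteq> I \<and>
      (\<forall>m\<in>I. \<forall>i\<in>I. Poly_Mapping.lookup F m \<noteq> 0 \<longrightarrow> Poly_Mapping.lookup F i / Poly_Mapping.lookup F m \<in> R m i)"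
    using \<Gamma> by blast
  from bchoice[OF this] obtain F where F: "\<And>\<gamma>. \<gamma> \<in> \<Gamma> \<Longrightarrow> chow_form \<gamma> (F \<gamma>)"
    "\<And>\<gamma>. \<gamma> \<in> \<Gamma> \<Longrightarrow> Poly_Mapping.keys (F \<gamma>) \<subseteq> I"
    "\<And>\<gamma> m i. \<gamma> \<in> \<Gamma> \<Longrightarrow> m \<in> I \<Longrightarrow> i \<in> I \<Longrightarrow> Poly_Mapping.lookup (F \<gamma>) m \<noteq> 0 \<Longrightarrow>
      Poly_Mapping.lookup (F \<gamma>) i / Poly_Mapping.lookup (F \<gamma>) m \<in> R m i" by blast
  let ?l = "\<lambda>\<gamma>. Poly_Mapping.lookup (F \<gamma>)"
  have "\<forall>\<gamma>\<in>\<Gamma>. \<exists>m\<in>I. ?l \<gamma> m \<noteq> 0"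
  proof
    fix \<gamma> assume \<gamma>: "\<gamma> \<in> \<Gamma>"
    have "F \<gamma> \<noteq> 0" using F(1)[OF \<gamma>] by (auto simp: chow_form_def irreducible_def)
    then obtain m where "?l \<gamma> m \<noteq> 0" using poly_mapping_eqI[of "F \<gamma>" 0] by auto
    then show "\<exists>m\<in>I. ?l \<gamma> m \<noteq> 0" using F(2)[OF \<gamma>] by (auto simp: in_keys_iff)
  qed
  from bchoice[OF this[unfolded Bex_def]] obtain m where m: "\<And>\<gamma>. \<gamma> \<in> \<Gamma> \<Longrightarrow> m \<gamma> \<in> I" "\<And>\<gamma>. \<gamma> \<in> \<Gamma> \<Longrightarrow> ?l \<gamma> (m \<gamma>) \<noteq> 0" by blast
  define code where "code \<gamma> = (m \<gamma>, restrict (\<lambda>i. ?l \<gamma> i / ?l \<gamma> (m \<gamma>)) I)" for \<gamma>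
  let ?T = "SIGMA m:I. PiE I (R m)"
  have sub: "code ` \<Gamma> \<subseteq> ?T" using m F(3) by (auto simp: code_def)
  have finT: "finite ?T" using I R by (intro finite_SigmaI finite_PiE) auto
  have inj: "inj_on code \<Gamma>"
  proof (rule inj_onI)
    fix \<gamma> \<gamma>' assume \<gamma>: "\<gamma> \<in> \<Gamma>" "\<gamma>' \<in> \<Gamma>" "code \<gamma> = code \<gamma>'"
    then have mm: "m \<gamma>' = m \<gamma>" by (simp add: code_def)
    have "?l \<gamma> i * ?l \<gamma>' (m \<gamma>) = ?l \<gamma>' i * ?l \<gamma> (m \<gamma>)" for i
    proof (cases "i \<in> I")
      case True
      then have "?l \<gamma> i / ?l \<gamma> (m \<gamma>) = ?l \<gamma>' i / ?l \<gamma>' (m \<gamma>)"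
        using \<gamma>(3) mm by (auto simp: code_def dest: fun_cong[of _ _ i])
      then show ?thesis using m(2)[OF \<gamma>(1)] m(2)[OF \<gamma>(2)] by (simp add: mm field_simps)
    next
      case False
      then have "?l \<gamma> i = 0" "?l \<gamma>' i = 0" using F(2)[OF \<gamma>(1)] F(2)[OF \<gamma>(2)] by (auto simp: in_keys_iff)
      then show ?thesis by simp
    qed
    then show "\<gamma> = \<gamma>'"
      using \<Gamma>[OF \<gamma>(1)] \<Gamma>[OF \<gamma>(2)] m(2)[OF \<gamma>(1)] m(2)[OF \<gamma>(2)]
      by (intro curve_eqI_ratio[OF _ F(1)[OF \<gamma>(1)] _ F(1)[OF \<gamma>(2)], of "m \<gamma>"]) (simp_all add: mm)
  qed
  show fin: "finite \<Gamma>" using finite_subset[OF sub finT] inj finite_imageD by blast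
  have "card \<Gamma> = card (code ` \<Gamma>)" using inj by (simp add: card_image)
  also have "\<dots> \<le> card ?T" by (rule card_mono[OF finT sub])
  also have "\<dots> = (\<Sum>m\<in>I. \<Prod>i\<in>I. card (R m i))" using I R by (subst card_SigmaI) (auto simp: card_PiE intro!: finite_PiE)
  also have "\<dots> \<le> (\<Sum>m\<in>I. \<Prod>i\<in>I. N)" by (intro sum_mono prod_mono) (use R in auto)
  also have "\<dots> = card I * N ^ card I" by simp
  finally show "card \<Gamma> \<le> card I * N ^ card I" .
qed

text \<open>In a representation of least complexity at most \<open>c\<close> polynomials are
  nonconstant, since each of these contributes a positive degree. Constant ones do not influence the
  pattern, so padding by 0 describes the family by exactly \<open>c\<close> polynomials.\<close>

lemma constructible_family_rep:
  assumes "constructible_family E c C"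
  obtains g :: "nat \<Rightarrow> (3 option + 3 option) monom cpoly" and B where "B \<subseteq> Pow {..<c}"
    "\<And>j. Poly_Mapping.keys (g j) \<subseteq> monoms_le (chow_index E) c"
    "\<And>x. x \<in> chow_points C \<longleftrightarrow> (\<forall>i. i \<notin> chow_index E \<longrightarrow> x i = 0) \<and> {j. j < c \<and> poly_eval (g j) x \<noteq> 0} \<in> B"
proof -
  let ?I = "chow_index E"
  have "\<exists>n fs B. constructible_rep ?I (chow_points C) fs B \<and> n = (\<Sum>f\<leftarrow>fs. total_degree f)"
    using assms by (auto simp: constructible_family_def constructible_def)
  then have "\<exists>fs B. constructible_rep ?I (chow_points C) fs B \<and> constructible_complexity ?I (chow_points C) = (\<Sum>f\<leftarrow>fs. total_degree f)"
    unfolding constructible_complexity_def by (rule LeastI_ex)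
  then obtain fs B0 where fs: "constructible_rep ?I (chow_points C) fs B0" "(\<Sum>f\<leftarrow>fs. total_degree f) \<le> c"
    using assms by (auto simp: constructible_family_def)
  have vars: "\<And>f. f \<in> set fs \<Longrightarrow> poly_vars f \<subseteq> ?I"
    and Y: "chow_points C = {x. (\<forall>i. i \<notin> ?I \<longrightarrow> x i = 0) \<and> map (\<lambda>f. of_bool (poly_eval f x \<noteq> 0)) fs \<in> B0}"
    using fs(1) by (auto simp: constructible_rep_def)
  define ns where "ns = filter (\<lambda>f. total_degree f \<noteq> 0) fs"
  have "length (filter (\<lambda>f. total_degree f \<noteq> 0) l) \<le> (\<Sum>f\<leftarrow>l. total_degree f)" for l :: "(3 option + 3 option) monom cpoly list"
    by (induction l) auto
  then have len: "length ns \<le> c" using fs(2) order_trans unfolding ns_def by blast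
  define g where "g j = (if j < length ns then ns ! j else 0)" for j
  let ?S = "\<lambda>x. {j. j < c \<and> poly_eval (g j) x \<noteq> 0}"
  have det: "poly_eval f x \<noteq> 0 \<longleftrightarrow> poly_eval f x' \<noteq> 0" if "f \<in> set fs" "?S x = ?S x'" for f x x'
  proof (cases "total_degree f = 0")
    case True
    have "Poly_Mapping.keys m = {}" if "m \<in> Poly_Mapping.keys f" for m
    proof -
      have "monom_degree m = 0" using monom_degree_le_total_degree[OF that] True by simp
      then have "m = 0" by (intro poly_mapping_eqI) (simp add: monom_degree_def in_keys_iff)
      then show ?thesis by simp
    qed
    then have "poly_vars f = {}" by (auto simp: poly_vars_def)
    then show ?thesis using poly_eval_cong[of f x x'] by simp
  next
    case False
    then have "f \<in> set ns" using that(1) by (simp add: ns_def)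
    then obtain j where j: "j < length ns" "g j = f" by (auto simp: in_set_conv_nth g_def)
    show ?thesis using arg_cong[OF that(2), of "\<lambda>S. j \<in> S"] j len by simp
  qed
  \<comment> \<open>The patterns realized by members of the family; the pattern set
    \<open>B0\<close> refers to the original list of polynomials and cannot be kept.\<close>
  define B where "B = {?S x | x. x \<in> chow_points C}"
  show ?thesis
  proof (rule that)
    show "B \<subseteq> Pow {..<c}" by (auto simp: B_def)
    show "Poly_Mapping.keys (g j) \<subseteq> monoms_le ?I c" for j
    proof (cases "j < length ns")
      case True
      then have f: "g j \<in> set fs" using nth_mem[OF True] by (auto simp: g_def ns_def)
      then have "total_degree (g j) \<le> c"
        using fs(2) member_le_sum_list[of "total_degree (g j)" "map total_degree fs"] by auto
      then have "monom_degree \<mu> \<le> c" if "\<mu> \<in> Poly_Mapping.keys (g j)" for \<mu>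
        using monom_degree_le_total_degree[OF that] by linarith
      moreover have "Poly_Mapping.keys \<mu> \<subseteq> ?I" if "\<mu> \<in> Poly_Mapping.keys (g j)" for \<mu>
        using vars[OF f] that unfolding poly_vars_def by blast
      ultimately show ?thesis unfolding monoms_le_def by blast
    qed (simp add: g_def)
    fix x
    show "x \<in> chow_points C \<longleftrightarrow> (\<forall>i. i \<notin> ?I \<longrightarrow> x i = 0) \<and> ?S x \<in> B"
    proof
      assume "x \<in> chow_points C"
      then show "(\<forall>i. i \<notin> ?I \<longrightarrow> x i = 0) \<and> ?S x \<in> B" using Y by (auto simp: B_def)
    next
      assume *: "(\<forall>i. i \<notin> ?I \<longrightarrow> x i = 0) \<and> ?S x \<in> B"
      then obtain x' where x': "x' \<in> chow_points C" "?S x = ?S x'" by (auto simp: B_def)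
      have eq: "map (\<lambda>f. of_bool (poly_eval f x \<noteq> 0)) fs = map (\<lambda>f. of_bool (poly_eval f x' \<noteq> 0) :: nat) fs"
        using det[OF _ x'(2)] by (intro map_cong refl) simp
      have "map (\<lambda>f. of_bool (poly_eval f x' \<noteq> 0)) fs \<in> B0" using x'(1) unfolding Y by blast
      then have "map (\<lambda>f. of_bool (poly_eval f x \<noteq> 0)) fs \<in> B0" unfolding eq .
      then show "x \<in> chow_points C" using * unfolding Y by blast
    qed
  qed
qed

lemma chow_points_iff: "Poly_Mapping.lookup F \<in> chow_points C \<longleftrightarrow> (\<exists>\<gamma>\<in>C. chow_form \<gamma> F)"
  by (auto simp: chow_points_def lookup_inject)

lemma constructible_family_curve:
  assumes "constructible_family E c C" "\<gamma> \<in> C"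
  shows "irreducible_curve \<gamma>" "\<exists>F. chow_form \<gamma> F"
proof -
  show "irreducible_curve \<gamma>" using assms by (auto simp: constructible_family_def curves3_def)
  then show "\<exists>F. chow_form \<gamma> F"
    using assms chow_form_exists by (auto simp: constructible_family_def curves3_def)
qed

text \<open>The degree bound for the Chow form is read off the ambient affine space in which the
  family is constructible.\<close>

lemma constructible_family_keys:
  assumes "constructible_family E c C" "\<gamma> \<in> C" "chow_form \<gamma> F"
  shows "Poly_Mapping.keys F \<subseteq> chow_index E"
proof -
  have "Poly_Mapping.lookup F \<in> chow_points C" using assms(2,3) chow_points_iff by blast
  moreover have "constructible (chow_index E) (chow_points C)" using assms(1) by (simp add: constructible_family_def)
  ultimately show ?thesis by (auto simp: constructible_def constructible_rep_def in_keys_iff)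
qed

section \<open>Constants uniform over all families of bounded complexity\<close>

lemma dichotomy_mono:
  assumes "dichotomy K N \<Phi>" "K \<le> K'" "N \<le> N'"
  shows "dichotomy K' N' \<Phi>"
proof -
  have "alternative N' \<Phi> f g u" if "alternative N \<Phi> f g u" for f g u
    using that assms(3) unfolding alternative_def by (meson order_trans)
  moreover have "K * D \<le> K' * D" for D using assms(2) by simp
  ultimately show ?thesis using assms(1) unfolding dichotomy_def by (meson order_trans)
qed

definition ratio_dichotomy :: "nat \<Rightarrow> nat \<Rightarrow> nat \<Rightarrow> nat \<Rightarrow> nat \<Rightarrow> nat set set \<Rightarrow>
    (3 option + 3 option) monom \<Rightarrow> (3 option + 3 option) monom \<Rightarrow> bool" where
  "ratio_dichotomy E c r K N B m i \<longleftrightarrow> (\<exists>\<Phi>. dichotomy K N \<Phi> \<and>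
    (\<forall>f g p x. (\<forall>j<c. Poly_Mapping.keys (g j) \<subseteq> monoms_le (chow_index E) c) \<longrightarrow>
      (\<Phi> (senv f g p x) \<longleftrightarrow> (\<exists>F\<in>admissible E c B g r f p. Poly_Mapping.lookup F m \<noteq> 0 \<and>
        x * Poly_Mapping.lookup F m = Poly_Mapping.lookup F i))))"

text \<open>For given \<open>E\<close>, \<open>c\<close> and \<open>r\<close> there are finitely
  many choices of a pattern set and two coordinates, so the sums of the individual constants serve
  for all of them.\<close>

lemma ratio_dichotomy_uniform:
  "\<exists>K N. \<forall>B\<subseteq>Pow {..<c}. \<forall>m\<in>chow_index E. \<forall>i\<in>chow_index E. ratio_dichotomy E c r K N B m i"
proof -
  let ?J = "Pow (Pow {..<c}) \<times> chow_index E \<times> chow_index E"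
  have "\<forall>z\<in>?J. \<exists>KN. ratio_dichotomy E c r (fst KN) (snd KN) (fst z) (fst (snd z)) (snd (snd z))"
  proof
    fix z assume z: "z \<in> ?J"
    obtain B m i where zz: "z = (B, m, i)" by (rule prod_cases3)
    then have "B \<subseteq> Pow {..<c}" "m \<in> chow_index E" "i \<in> chow_index E" using z by auto
    then obtain \<Phi> where \<Phi>: "\<Phi> \<in> CP"
      "\<And>f g p x e. site f g p x e \<Longrightarrow> (\<And>j. j < c \<Longrightarrow> Poly_Mapping.keys (g j) \<subseteq> monoms_le (chow_index E) c) \<Longrightarrow>
        \<Phi> e \<longleftrightarrow> (\<exists>F\<in>admissible E c B g r f p. Poly_Mapping.lookup F m \<noteq> 0 \<and>
          x * Poly_Mapping.lookup F m = Poly_Mapping.lookup F i)"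
      by (rule admissible_definable) blast
    obtain K N where KN: "dichotomy K N \<Phi>" using CP_dichotomy[OF \<Phi>(1)] by blast
    have "ratio_dichotomy E c r K N B m i"
      unfolding ratio_dichotomy_def using KN \<Phi>(2)[OF site_senv] by blast
    then show "\<exists>KN. ratio_dichotomy E c r (fst KN) (snd KN) (fst z) (fst (snd z)) (snd (snd z))"
      by (intro exI[of _ "(K, N)"]) (simp add: zz)
  qed
  from bchoice[OF this] obtain h where h: "\<And>z. z \<in> ?J \<Longrightarrow>
    ratio_dichotomy E c r (fst (h z)) (snd (h z)) (fst z) (fst (snd z)) (snd (snd z))" by blast
  have fin: "finite ?J" by (simp add: finite_chow_index)
  have "ratio_dichotomy E c r (\<Sum>z\<in>?J. fst (h z)) (\<Sum>z\<in>?J. snd (h z)) B m i"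
    if "B \<subseteq> Pow {..<c}" "m \<in> chow_index E" "i \<in> chow_index E" for B m i
  proof -
    have z: "(B, m, i) \<in> ?J" using that by auto
    have "fst (h (B, m, i)) \<le> (\<Sum>z\<in>?J. fst (h z))" "snd (h (B, m, i)) \<le> (\<Sum>z\<in>?J. snd (h z))"
      using member_le_sum[OF z, of "\<lambda>z. fst (h z)"] member_le_sum[OF z, of "\<lambda>z. snd (h z)"] fin by auto
    note le = this
    have "ratio_dichotomy E c r (fst (h (B, m, i))) (snd (h (B, m, i))) B m i" using h[OF z] by simp
    then show ?thesis unfolding ratio_dichotomy_def using dichotomy_mono[OF _ le] by blast
  qed
  then show ?thesis by blast
qed

text \<open>If some ratio of Chow coordinates takes infinitely many values at generic points, the
  curves behind them are contained in the surface, by \<open>trap\<close>. Otherwise, at each point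
  off the zeros of \<open>u\<close>, every ratio is confined to the roots of a polynomial of degree
  at most \<open>N\<close>, which bounds the number of osculating and of contained curves
  together.\<close>

lemma surface_alternative:
  assumes KN: "\<forall>B\<subseteq>Pow {..<c}. \<forall>m\<in>chow_index E. \<forall>i\<in>chow_index E. ratio_dichotomy E c r K N B m i"
    and trap: "\<And>f. irreducible f \<Longrightarrow> \<exists>b. \<not> f dvd b \<and> (\<forall>e p. poly_eval f p = 0 \<longrightarrow> poly_eval b p \<noteq> 0 \<longrightarrow>
      (\<forall>k\<le>r. poly_eval (tower E k e f) p = 0) \<longrightarrow> (\<forall>k. poly_eval (tower E k e f) p = 0))"
    and f: "irreducible f" "total_degree f = D" "1 \<le> D" and C: "constructible_family E c C"
  shows "infinitely_ruled (zero_set f) C \<or> (\<exists>u. \<not> f dvd u \<and> total_degree u \<le> (card (chow_index E))\<^sup>2 * K * D \<and>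
    (\<forall>p. poly_eval f p = 0 \<longrightarrow> poly_eval u p \<noteq> 0 \<longrightarrow>
      finite {\<gamma>\<in>C. p \<in> \<gamma> \<and> (nonsingular_point \<gamma> p \<and> osculates \<gamma> f r p \<or> \<gamma> \<subseteq> zero_set f)} \<and>
      card {\<gamma>\<in>C. p \<in> \<gamma> \<and> (nonsingular_point \<gamma> p \<and> osculates \<gamma> f r p \<or> \<gamma> \<subseteq> zero_set f)}
        \<le> card (chow_index E) * N ^ card (chow_index E)))"
proof -
  let ?I = "chow_index E"
  obtain g B where gB: "B \<subseteq> Pow {..<c}" "\<And>j. Poly_Mapping.keys (g j) \<subseteq> monoms_le ?I c"
    "\<And>x. x \<in> chow_points C \<longleftrightarrow> (\<forall>i. i \<notin> ?I \<longrightarrow> x i = 0) \<and> {j. j < c \<and> poly_eval (g j) x \<noteq> 0} \<in> B"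
    by (rule constructible_family_rep[OF C]) blast
  note curve = constructible_family_curve(1)[OF C] and ex_form = constructible_family_curve(2)[OF C]
    and keys = constructible_family_keys[OF C]
  have adm: "F \<in> admissible E c B g r f p \<longleftrightarrow> (\<exists>\<gamma>\<in>C. chow_form \<gamma> F) \<and> through F p \<and> osculating E r f F p" for F p
    using gB(3)[of "Poly_Mapping.lookup F"] unfolding chow_points_iff admissible_def
    by (auto simp: in_keys_iff subset_iff)
  have "\<forall>z\<in>?I \<times> ?I. \<exists>\<Phi>. dichotomy K N \<Phi> \<and> (\<forall>p x. \<Phi> (senv f g p x) \<longleftrightarrow>
    (\<exists>F\<in>admissible E c B g r f p. Poly_Mapping.lookup F (fst z) \<noteq> 0 \<and>
      x * Poly_Mapping.lookup F (fst z) = Poly_Mapping.lookup F (snd z)))"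
  proof
    fix z assume z: "z \<in> ?I \<times> ?I"
    then have "ratio_dichotomy E c r K N B (fst z) (snd z)" using KN gB(1) by auto
    then show "\<exists>\<Phi>. dichotomy K N \<Phi> \<and> (\<forall>p x. \<Phi> (senv f g p x) \<longleftrightarrow>
      (\<exists>F\<in>admissible E c B g r f p. Poly_Mapping.lookup F (fst z) \<noteq> 0 \<and>
        x * Poly_Mapping.lookup F (fst z) = Poly_Mapping.lookup F (snd z)))"
      using gB(2) unfolding ratio_dichotomy_def by blast
  qed
  from bchoice[OF this] obtain \<Phi> where \<Phi>0: "\<forall>z\<in>?I \<times> ?I. dichotomy K N (\<Phi> z) \<and> (\<forall>p x. \<Phi> z (senv f g p x) \<longleftrightarrow>
    (\<exists>F\<in>admissible E c B g r f p. Poly_Mapping.lookup F (fst z) \<noteq> 0 \<and>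
      x * Poly_Mapping.lookup F (fst z) = Poly_Mapping.lookup F (snd z)))" ..
  have \<Phi>: "dichotomy K N (\<Phi> z)" "\<Phi> z (senv f g p x) \<longleftrightarrow>
      (\<exists>F\<in>admissible E c B g r f p. Poly_Mapping.lookup F (fst z) \<noteq> 0 \<and>
        x * Poly_Mapping.lookup F (fst z) = Poly_Mapping.lookup F (snd z))" if "z \<in> ?I \<times> ?I" for z p x
    using bspec[OF \<Phi>0 that] by simp_all
  have ff: "total_degree f \<le> D" using f(2) by simp
  have "\<forall>z\<in>?I \<times> ?I. \<exists>u. \<not> f dvd u \<and> total_degree u \<le> K * D \<and>
      alternative N (\<Phi> z) f g u"
    using \<Phi>(1) f(1,3) ff unfolding dichotomy_def by blast
  from bchoice[OF this] obtain v where v: "\<forall>z\<in>?I \<times> ?I. \<not> f dvd v z \<and> total_degree (v z) \<le> K * D \<and>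
      alternative N (\<Phi> z) f g (v z)" ..
  show ?thesis
  proof (cases "\<exists>z\<in>?I \<times> ?I. \<forall>p. poly_eval f p = 0 \<longrightarrow> poly_eval (v z) p \<noteq> 0 \<longrightarrow> infinite {x. \<Phi> z (senv f g p x)}")
    case True
    then obtain z where z: "z \<in> ?I \<times> ?I"
      "\<And>p. poly_eval f p = 0 \<Longrightarrow> poly_eval (v z) p \<noteq> 0 \<Longrightarrow> infinite {x. \<Phi> z (senv f g p x)}" by blast
    obtain b where b: "\<not> f dvd b" "\<And>e p. poly_eval f p = 0 \<Longrightarrow> poly_eval b p \<noteq> 0 \<Longrightarrow>
      \<forall>k\<le>r. poly_eval (tower E k e f) p = 0 \<Longrightarrow> \<forall>k. poly_eval (tower E k e f) p = 0"
      using trap[OF f(1)] by blast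
    \<comment> \<open>The exceptional points: those where the ratio may take finitely many values,
      and those where contact of order \<open>r\<close> need not be infinite.\<close>
    let ?W = "zero_set f \<inter> zero_set (v z * b)"
    have "zariski_closed ?W" unfolding zariski_closed_def by (intro exI[of _ "{f, v z * b}"]) auto
    moreover have "?W \<subset> zero_set f"
    proof -
      have "\<not> f dvd v z * b" using irreducible_dvd_mult_3[OF f(1)] b(1) v z(1) by blast
      then have "\<not> zero_set f \<subseteq> zero_set (v z * b)" using hypersurface_nullstellensatz[OF f(1)] by blast
      then show ?thesis by blast
    qed
    moreover have "infinite {\<gamma>\<in>C. p \<in> \<gamma> \<and> \<gamma> \<subseteq> zero_set f}" if p: "p \<in> zero_set f - ?W" for p
    proof -
      have fp: "poly_eval f p = 0" "poly_eval (v z) p \<noteq> 0" "poly_eval b p \<noteq> 0"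
        using p by (auto simp: zero_set_def)
      let ?X = "{x. \<Phi> z (senv f g p x)}"
      have "\<forall>x\<in>?X. \<exists>G. fst G \<in> {\<gamma>\<in>C. p \<in> \<gamma> \<and> \<gamma> \<subseteq> zero_set f} \<and> chow_form (fst G) (snd G) \<and>
        Poly_Mapping.lookup (snd G) (fst z) \<noteq> 0 \<and> x * Poly_Mapping.lookup (snd G) (fst z) = Poly_Mapping.lookup (snd G) (snd z)"
      proof
        fix x assume "x \<in> ?X"
        then obtain F where F: "F \<in> admissible E c B g r f p" "Poly_Mapping.lookup F (fst z) \<noteq> 0"
          "x * Poly_Mapping.lookup F (fst z) = Poly_Mapping.lookup F (snd z)" using \<Phi>(2)[OF z(1)] by blast
        then obtain \<gamma> where \<gamma>: "\<gamma> \<in> C" "chow_form \<gamma> F" "through F p" "osculating E r f F p" unfolding adm by blast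
        have p\<gamma>: "p \<in> \<gamma>" using through_iff_mem[OF curve[OF \<gamma>(1)] \<gamma>(2)] \<gamma>(3) by blast
        obtain e where e: "represents E F e" "transversal F p (dir 0 e) (dir 1 e) (dir 2 e)"
          "\<forall>k\<le>r. poly_eval (tower E k e f) p = 0" using \<gamma>(4) unfolding osculating_def by blast
        have "\<gamma> \<subseteq> zero_set f"
          by (rule tower_contained[OF curve[OF \<gamma>(1)] \<gamma>(2) e(1) p\<gamma> e(2) b(2)[OF fp(1,3) e(3)]])
        then show "\<exists>G. fst G \<in> {\<gamma>\<in>C. p \<in> \<gamma> \<and> \<gamma> \<subseteq> zero_set f} \<and> chow_form (fst G) (snd G) \<and>
          Poly_Mapping.lookup (snd G) (fst z) \<noteq> 0 \<and> x * Poly_Mapping.lookup (snd G) (fst z) = Poly_Mapping.lookup (snd G) (snd z)"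
          using \<gamma>(1,2) p\<gamma> F(2,3) by (intro exI[of _ "(\<gamma>, F)"]) simp
      qed
      from bchoice[OF this] obtain G where G: "\<And>x. x \<in> ?X \<Longrightarrow> fst (G x) \<in> {\<gamma>\<in>C. p \<in> \<gamma> \<and> \<gamma> \<subseteq> zero_set f}"
        "\<And>x. x \<in> ?X \<Longrightarrow> chow_form (fst (G x)) (snd (G x))"
        "\<And>x. x \<in> ?X \<Longrightarrow> Poly_Mapping.lookup (snd (G x)) (fst z) \<noteq> 0"
        "\<And>x. x \<in> ?X \<Longrightarrow> x * Poly_Mapping.lookup (snd (G x)) (fst z) = Poly_Mapping.lookup (snd (G x)) (snd z)" by blast
      \<comment> \<open>Chow forms of one curve are proportional, so different values of the ratio
        belong to different curves.\<close>
      have "inj_on (\<lambda>x. fst (G x)) ?X"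
      proof (rule inj_onI)
        fix x y assume x: "x \<in> ?X" and y: "y \<in> ?X" and eq: "fst (G x) = fst (G y)"
        have "irreducible_curve (fst (G x))" using G(1)[OF x] curve by blast
        from chow_form_ratio(1)[OF this G(2)[OF x], of "snd (G y)" "snd z" "fst z"] G(2)[OF y] eq
        have "x * (Poly_Mapping.lookup (snd (G x)) (fst z) * Poly_Mapping.lookup (snd (G y)) (fst z)) =
            y * (Poly_Mapping.lookup (snd (G x)) (fst z) * Poly_Mapping.lookup (snd (G y)) (fst z))"
          unfolding G(4)[OF x, symmetric] G(4)[OF y, symmetric] by (simp add: mult_ac)
        then show "x = y" using G(3)[OF x] G(3)[OF y] by simp
      qed
      moreover have "infinite ?X" by (rule z(2)[OF fp(1,2)])
      ultimately have "infinite ((\<lambda>x. fst (G x)) ` ?X)" using finite_imageD by blast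
      moreover have "(\<lambda>x. fst (G x)) ` ?X \<subseteq> {\<gamma>\<in>C. p \<in> \<gamma> \<and> \<gamma> \<subseteq> zero_set f}" using G(1) by blast
      ultimately show ?thesis using finite_subset by blast
    qed
    ultimately show ?thesis unfolding infinitely_ruled_def by blast
  next
    case False
    then have "\<forall>z\<in>?I \<times> ?I. \<exists>R. (\<forall>x. \<exists>n. pfun n (\<lambda>p. poly (R p) x)) \<and> (\<forall>p. poly_eval f p = 0 \<longrightarrow> poly_eval (v z) p \<noteq> 0 \<longrightarrow>
         R p \<noteq> 0 \<and> degree (R p) \<le> N \<and> {x. \<Phi> z (senv f g p x)} \<subseteq> {x. poly (R p) x = 0})"
      using v unfolding alternative_def by blast
    from bchoice[OF this] obtain R where R0: "\<forall>z\<in>?I \<times> ?I. (\<forall>x. \<exists>n. pfun n (\<lambda>p. poly (R z p) x)) \<and>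
      (\<forall>p. poly_eval f p = 0 \<longrightarrow> poly_eval (v z) p \<noteq> 0 \<longrightarrow>
         R z p \<noteq> 0 \<and> degree (R z p) \<le> N \<and> {x. \<Phi> z (senv f g p x)} \<subseteq> {x. poly (R z p) x = 0})" ..
    have R1: "\<exists>n. pfun n (\<lambda>p. poly (R z p) x)" if "z \<in> ?I \<times> ?I" for z x using bspec[OF R0 that] by simp
    have R2: "R z p \<noteq> 0 \<and> degree (R z p) \<le> N \<and> {x. \<Phi> z (senv f g p x)} \<subseteq> {x. poly (R z p) x = 0}"
      if "z \<in> ?I \<times> ?I" "poly_eval f p = 0" "poly_eval (v z) p \<noteq> 0" for z p using bspec[OF R0 that(1)] that(2,3) by simp
    define u where "u = (\<Prod>z\<in>?I \<times> ?I. v z)"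
    have fin: "finite (?I \<times> ?I)" by (simp add: finite_chow_index)
    have nd: "\<not> f dvd u" unfolding u_def by (rule not_dvd_prod[OF f(1) fin]) (use v in blast)
    have "total_degree u \<le> (\<Sum>z\<in>?I \<times> ?I. K * D)"
      unfolding u_def by (rule order_trans[OF total_degree_prod_le], rule sum_mono) (use v in blast)
    then have deg: "total_degree u \<le> (card ?I)\<^sup>2 * K * D" by (simp add: card_cartesian_product power2_eq_square mult_ac)
    have uv: "poly_eval (v z) p \<noteq> 0" if "poly_eval u p \<noteq> 0" "z \<in> ?I \<times> ?I" for z p
      using that fin by (auto simp: u_def)
    have root: "poly (R (m, i) p) (Poly_Mapping.lookup F i / Poly_Mapping.lookup F m) = 0"
      if p: "poly_eval f p = 0" "poly_eval u p \<noteq> 0" "p \<in> \<gamma>" and F: "\<gamma> \<in> C" "chow_form \<gamma> F" "osculating E r f F p"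
        and mi: "m \<in> ?I" "i \<in> ?I" "Poly_Mapping.lookup F m \<noteq> 0" for p \<gamma> F m i
    proof -
      have z: "(m, i) \<in> ?I \<times> ?I" using mi by simp
      have "through F p" using through_iff_mem[OF curve[OF F(1)] F(2)] p(3) by blast
      then have "F \<in> admissible E c B g r f p" using F adm by blast
      then have "\<Phi> (m, i) (senv f g p (Poly_Mapping.lookup F i / Poly_Mapping.lookup F m))"
        unfolding \<Phi>(2)[OF z] using mi(3) by (intro bexI[of _ F]) auto
      then show ?thesis using R2[OF z p(1) uv[OF p(2) z]] by blast
    qed
    have "finite \<Gamma> \<and> card \<Gamma> \<le> card ?I * N ^ card ?I"
      if p: "poly_eval f p = 0" "poly_eval u p \<noteq> 0"
        and \<Gamma>: "\<Gamma> = {\<gamma>\<in>C. p \<in> \<gamma> \<and> (nonsingular_point \<gamma> p \<and> osculates \<gamma> f r p \<or> \<gamma> \<subseteq> zero_set f)}" for p \<Gamma>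
    proof -
      have 1: "finite {x. poly (R (m, i) p) x = 0} \<and> card {x. poly (R (m, i) p) x = 0} \<le> N" if "m \<in> ?I" "i \<in> ?I" for m i
      proof -
        have z: "(m, i) \<in> ?I \<times> ?I" using that by simp
        note Rz = R2[OF z p(1) uv[OF p(2) z]]
        show ?thesis using poly_roots_finite[of "R (m, i) p"] card_poly_roots_bound[of "R (m, i) p"] Rz by auto
      qed
      have 2: "irreducible_curve \<gamma> \<and> (\<exists>F. chow_form \<gamma> F \<and> Poly_Mapping.keys F \<subseteq> ?I \<and>
        (\<forall>m\<in>?I. \<forall>i\<in>?I. Poly_Mapping.lookup F m \<noteq> 0 \<longrightarrow>
          Poly_Mapping.lookup F i / Poly_Mapping.lookup F m \<in> {x. poly (R (m, i) p) x = 0}))" if \<gamma>\<Gamma>: "\<gamma> \<in> \<Gamma>" for \<gamma>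
      proof -
        have \<gamma>: "\<gamma> \<in> C" "p \<in> \<gamma>" "nonsingular_point \<gamma> p \<and> osculates \<gamma> f r p \<or> \<gamma> \<subseteq> zero_set f"
          using \<gamma>\<Gamma> \<Gamma> by auto
        note c\<gamma> = curve[OF \<gamma>(1)]
        obtain F where F: "chow_form \<gamma> F" using ex_form[OF \<gamma>(1)] by blast
        note kF = keys[OF \<gamma>(1) F]
        have "poly (R (m, i) p) (Poly_Mapping.lookup F i / Poly_Mapping.lookup F m) = 0"
          if mi: "m \<in> ?I" "i \<in> ?I" "Poly_Mapping.lookup F m \<noteq> 0" for m i
        proof (cases "\<gamma> \<subseteq> zero_set f")
          case False
          then have "osculating E r f F p" using \<gamma>(3) flecnode_osculating[OF c\<gamma> F kF] by blast
          then show ?thesis by (rule root[OF p \<gamma>(2,1) F _ mi])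
        next
          case True
          let ?x = "Poly_Mapping.lookup F i / Poly_Mapping.lookup F m"
          show ?thesis
          proof (rule ccontr)
            assume nz: "poly (R (m, i) p) ?x \<noteq> 0"
            obtain n where n: "pfun n (\<lambda>q. poly (R (m, i) q) ?x)" using R1[of "(m, i)"] mi by auto
            have "finite {q\<in>\<gamma>. poly (R (m, i) q) ?x = 0}"
              by (rule curve_zeros_bound(1)[OF c\<gamma> F n \<gamma>(2) nz])
            moreover have "finite {q\<in>\<gamma>. poly_eval u q = 0}"
              by (rule curve_zeros_bound(1)[OF c\<gamma> F pfun_poly_eval[OF order_refl] \<gamma>(2) p(2)])
            moreover have "finite {q\<in>\<gamma>. \<not> osculating E r f F q}" by (rule contained_osculating[OF c\<gamma> F kF True])
            moreover have "\<gamma> \<subseteq> {q\<in>\<gamma>. poly (R (m, i) q) ?x = 0} \<union> ({q\<in>\<gamma>. poly_eval u q = 0} \<union> {q\<in>\<gamma>. \<not> osculating E r f F q})"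
            proof
              fix q assume q: "q \<in> \<gamma>"
              have "poly_eval f q = 0" using True q by (auto simp: zero_set_def)
              from root[OF this _ q \<gamma>(1) F _ mi]
              show "q \<in> {q\<in>\<gamma>. poly (R (m, i) q) ?x = 0} \<union> ({q\<in>\<gamma>. poly_eval u q = 0} \<union> {q\<in>\<gamma>. \<not> osculating E r f F q})"
                using q by blast
            qed
            ultimately show False using curve_infinite[OF c\<gamma>] finite_subset by blast
          qed
        qed
        then show ?thesis using c\<gamma> F kF by blast
      qed
      show ?thesis using card_curves_le[OF finite_chow_index 1 2] by blast
    qed
    then show ?thesis using nd deg by blast
  qed
qed

theorem theorem1p7:
  fixes c E :: nat
  shows "\<exists>(c1 :: real) (r :: nat) (t :: nat) (D0 :: nat). c1 > 0 \<and>
    (\<forall>(f :: 3 cpoly) (D :: nat) (C0 :: space3 set set).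
      irreducible f \<and> total_degree f = D \<and> D > D0 \<and> constructible_family E c C0 \<longrightarrow>
        (at_least (c1 * real D ^ 2)
           {\<gamma>\<in>C0. \<gamma> \<subseteq> zero_set f \<and> at_least (c1 * real D) {p\<in>\<gamma>. flecnode f t C0 r p}}
         \<longrightarrow> infinitely_ruled (zero_set f) C0) \<and>
        (\<not> infinitely_ruled (zero_set f) C0 \<longrightarrow>
         at_most (c1 * real D ^ 2)
           {\<gamma>\<in>C0. \<gamma> \<subseteq> zero_set f \<and> \<not> at_most (c1 * real D) {p\<in>\<gamma>. rich_point f t C0 p}}))"
proof -
  obtain r where trap: "\<And>f. irreducible f \<Longrightarrow> \<exists>b. \<not> f dvd b \<and> (\<forall>e p. poly_eval f p = 0 \<longrightarrow> poly_eval b p \<noteq> 0 \<longrightarrow>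
      (\<forall>k\<le>r. poly_eval (tower E k e f) p = 0) \<longrightarrow> (\<forall>k. poly_eval (tower E k e f) p = 0))"
    by (rule tower_trapped[of E]) blast
  obtain K N where KN: "\<forall>B\<subseteq>Pow {..<c}. \<forall>m\<in>chow_index E. \<forall>i\<in>chow_index E. ratio_dichotomy E c r K N B m i"
    using ratio_dichotomy_uniform by blast
  define k where "k = (card (chow_index E))\<^sup>2 * K"
  define T where "T = card (chow_index E) * N ^ card (chow_index E)"
  \<comment> \<open>The first summand bounds the zeros of \<open>u\<close> on a curve whose Chow
    form has degree at most \<open>2 * E\<close>, the second one the number of curves contained in
    both surfaces, and 1 makes both bounds strict.\<close>
  define c1 where "c1 = real ((2 * E)\<^sup>2 * k + k + 1)"
  have main: "(at_least (c1 * real D ^ 2)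
           {\<gamma>\<in>C. \<gamma> \<subseteq> zero_set f \<and> at_least (c1 * real D) {p\<in>\<gamma>. flecnode f (Suc T) C r p}}
         \<longrightarrow> infinitely_ruled (zero_set f) C) \<and>
        (\<not> infinitely_ruled (zero_set f) C \<longrightarrow>
         at_most (c1 * real D ^ 2)
           {\<gamma>\<in>C. \<gamma> \<subseteq> zero_set f \<and> \<not> at_most (c1 * real D) {p\<in>\<gamma>. rich_point f (Suc T) C p}})"
    if f: "irreducible f" "total_degree f = D" "D > 0" and C: "constructible_family E c C" for f D C
  proof (cases "infinitely_ruled (zero_set f) C")
    case False
    define \<Gamma> where "\<Gamma> p = {\<gamma>\<in>C. p \<in> \<gamma> \<and> (nonsingular_point \<gamma> p \<and> osculates \<gamma> f r p \<or> \<gamma> \<subseteq> zero_set f)}" for p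
    have "1 \<le> D" using f(3) by simp
    from surface_alternative[OF KN trap f(1,2) this C] False
    obtain u where u: "\<not> f dvd u" "total_degree u \<le> k * D"
      "\<And>p. poly_eval f p = 0 \<Longrightarrow> poly_eval u p \<noteq> 0 \<Longrightarrow> finite (\<Gamma> p) \<and> card (\<Gamma> p) \<le> T"
      unfolding k_def T_def \<Gamma>_def by blast
    \<comment> \<open>The multiplicity required is one more than the bound \<open>T\<close>, so no
      flecnode or rich point of the surface lies off the zeros of \<open>u\<close>.\<close>
    have few: "\<not> at_least (real (Suc T)) S" if S: "S \<subseteq> \<Gamma> p" and p: "poly_eval f p = 0" "poly_eval u p \<noteq> 0" for S p
    proof -
      have "finite S" "card S \<le> T" using u(3)[OF p] finite_subset[OF S] card_mono[OF _ S] by auto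
      then show ?thesis by (simp add: at_least_def)
    qed
    let ?Z = "{\<gamma>\<in>C. \<gamma> \<subseteq> zero_set f \<inter> zero_set u}"
    have Zcard: "card S \<le> D * (k * D)" if "finite S" "S \<subseteq> ?Z" for S
      by (rule bezout_curves[OF f(1,2) u(1,2) that(1)]) (use that(2) constructible_family_curve[OF C] in blast)
    have Z: "finite ?Z"
    proof (rule ccontr)
      assume "infinite ?Z"
      from infinite_arbitrarily_large[OF this, of "Suc (D * (k * D))"]
      obtain S where "finite S" "card S = Suc (D * (k * D))" "S \<subseteq> ?Z" by blast
      then show False using Zcard[of S] by simp
    qed
    have "real (card ?Z) \<le> real (D * (k * D))" using Zcard[OF Z] by (simp only: of_nat_le_iff order_refl)
    also have "\<dots> < c1 * real D ^ 2"
    proof -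
      have "0 < (real ((2 * E)\<^sup>2 * k) + 1) * real D ^ 2" using f(3) by (intro mult_pos_pos add_nonneg_pos) simp_all
      then show ?thesis by (simp add: c1_def power2_eq_square algebra_simps)
    qed
    finally have Z_less: "real (card ?Z) < c1 * real D ^ 2" .
    have sparse: "finite {p\<in>\<gamma>. P p} \<and> real (card {p\<in>\<gamma>. P p}) < c1 * real D"
      if \<gamma>: "\<gamma> \<in> C" "\<gamma> \<subseteq> zero_set f" "\<gamma> \<notin> ?Z" and P: "\<And>p. p \<in> \<gamma> \<Longrightarrow> P p \<Longrightarrow> poly_eval u p = 0" for \<gamma> P
    proof -
      obtain F where F: "chow_form \<gamma> F" using constructible_family_curve(2)[OF C \<gamma>(1)] by blast
      have "total_degree F \<le> 2 * E"
        using constructible_family_keys[OF C \<gamma>(1) F] by (intro total_degree_leI) (auto simp: chow_index_def)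
      then have dF: "(total_degree F)\<^sup>2 * (k * D) \<le> (2 * E)\<^sup>2 * (k * D)" by (intro mult_le_mono1 power_mono) auto
      obtain q where q: "q \<in> \<gamma>" "poly_eval u q \<noteq> 0" using \<gamma> by (auto simp: zero_set_def)
      note zb = curve_zeros_bound[OF constructible_family_curve(1)[OF C \<gamma>(1)] F pfun_poly_eval[OF u(2)] q]
      have sub: "{p\<in>\<gamma>. P p} \<subseteq> {p\<in>\<gamma>. poly_eval u p = 0}" using P by blast
      have "card {p\<in>\<gamma>. P p} \<le> (2 * E)\<^sup>2 * (k * D)"
        using card_mono[OF zb(1) sub] zb(2) dF by linarith
      then have "real (card {p\<in>\<gamma>. P p}) \<le> real ((2 * E)\<^sup>2 * (k * D))" by (simp only: of_nat_le_iff)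
      also have "\<dots> < c1 * real D" using f(3) by (simp add: c1_def algebra_simps add_pos_nonneg)
      finally show ?thesis using finite_subset[OF sub zb(1)] by blast
    qed
    have "{\<gamma>\<in>C. \<gamma> \<subseteq> zero_set f \<and> at_least (c1 * real D) {p\<in>\<gamma>. flecnode f (Suc T) C r p}} \<subseteq> ?Z" (is "?A \<subseteq> _")
    proof (rule subsetI, rule ccontr)
      fix \<gamma> assume \<gamma>: "\<gamma> \<in> ?A" "\<gamma> \<notin> ?Z"
      have "poly_eval u p = 0" if "flecnode f (Suc T) C r p" for p
      proof (rule ccontr)
        assume "poly_eval u p \<noteq> 0"
        moreover have "{\<gamma>\<in>C. p \<in> \<gamma> \<and> nonsingular_point \<gamma> p \<and> osculates \<gamma> f r p} \<subseteq> \<Gamma> p" by (auto simp: \<Gamma>_def)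
        ultimately show False using few[of _ p] that unfolding flecnode_def zero_set_def by blast
      qed
      then have "finite {p\<in>\<gamma>. flecnode f (Suc T) C r p} \<and> real (card {p\<in>\<gamma>. flecnode f (Suc T) C r p}) < c1 * real D"
        using \<gamma> by (intro sparse) auto
      then show False using \<gamma>(1) by (simp add: at_least_def)
    qed
    then have A: "finite ?A" "card ?A \<le> card ?Z" using Z by (auto intro: finite_subset card_mono)
    have "{\<gamma>\<in>C. \<gamma> \<subseteq> zero_set f \<and> \<not> at_most (c1 * real D) {p\<in>\<gamma>. rich_point f (Suc T) C p}} \<subseteq> ?Z" (is "?B \<subseteq> _")
    proof (rule subsetI, rule ccontr)
      fix \<gamma> assume \<gamma>: "\<gamma> \<in> ?B" "\<gamma> \<notin> ?Z"
      have "poly_eval u p = 0" if "p \<in> \<gamma>" "rich_point f (Suc T) C p" for p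
      proof (rule ccontr)
        assume "poly_eval u p \<noteq> 0"
        moreover have "{\<gamma>\<in>C. p \<in> \<gamma> \<and> \<gamma> \<subseteq> zero_set f} \<subseteq> \<Gamma> p" by (auto simp: \<Gamma>_def)
        moreover have "poly_eval f p = 0" using \<gamma>(1) that(1) by (auto simp: zero_set_def)
        ultimately show False using few[of _ p] that(2) unfolding rich_point_def by blast
      qed
      then have "finite {p\<in>\<gamma>. rich_point f (Suc T) C p} \<and> real (card {p\<in>\<gamma>. rich_point f (Suc T) C p}) < c1 * real D"
        using \<gamma> by (intro sparse) auto
      then show False using \<gamma>(1) by (simp add: at_most_def)
    qed
    then have B: "finite ?B" "card ?B \<le> card ?Z" using Z by (auto intro: finite_subset card_mono)
    have "\<not> at_least (c1 * real D ^ 2) ?A"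
      using A Z_less by (auto simp: at_least_def)
    moreover have "at_most (c1 * real D ^ 2) ?B" using B Z_less by (auto simp: at_most_def)
    ultimately show ?thesis by blast
  qed simp
  have "c1 > 0" by (simp only: c1_def of_nat_0_less_iff)
  show ?thesis
    by (intro exI[of _ c1] exI[of _ r] exI[of _ "Suc T"] exI[of _ 0] conjI[OF \<open>c1 > 0\<close>] allI impI, elim conjE, rule main)
qed


end
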